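(* Let $\alpha>0$, $\alpha\ne\frac13$. Suppose that the rescaled flow $\overline{\Gamma}_\tau$ of a closed convex ancient $\alpha$-curve shortening flow converges smoothly to the unit circle as $\tau\to-\infty$, and let $1+v(\cdot,\tau)$ be the support function of $\overline{\Gamma}_\tau$. Then there exist $C>0$ and $T\ll-1$ such that for all $\tau\le T$ $$\|P_-v\|_{L^2(\mathbb{S}^1)}+\|P_*v\|_{L^2(\mathbb{S}^1)}\le C\|v\|_{C^4(\mathbb{S}^1)}\|P_+v\|_{L^2(\mathbb{S}^1)}$$ and $$\|v(\cdot,\tau)\|_{C^4(\mathbb{S}^1)}\le Ce^{-\lambda_I\tau},$$ where $\lambda_I$ is the greatest negative eigenvalue of the operator $\mathcal{L}=\alpha\partial_\theta^2+\alpha+1$ on $\mathbb{S}^1$.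
   Context: For $\alpha>0$, an $\alpha$-curve shortening flow is a family of complete convex embedded curves $\Gamma_t\subset\mathbb{R}^2$ whose position vector satisfies $\partial_t\mathbf{X}=\kappa^\alpha\mathbf{N}$, where $\kappa$ is the curvature and $\mathbf N$ the inward pointing unit normal; it is ancient if it exists for $t\in(-\infty,T)$ for some $T\in\mathbb{R}\cup\{+\infty\}$. Its rescaled flow is $\overline{\Gamma}_\tau=(1+\alpha)^{-\frac1{1+\alpha}}(-t)^{-\frac{1}{1+\alpha}}\Gamma_t$, $\tau=-\frac1{1+\alpha}\log(-t)$. The support function of $\Gamma=\partial\Omega$ is $u(\theta)=\max_{z\in\overline\Omega}\langle(\cos\theta,\sin\theta),z\rangle$. The function $v$ solves $v_\tau=-(1+v_{\theta\theta}+v)^{-\alpha}+1+v$. Sign convention: $\lambda$ is an eigenvalue of $\mathcal{L}$ with eigenfunction $\varphi\ne0$ if $\mathcal{L}\varphi+\lambda\varphi=0$. Thus the eigenvalues are $\alpha(l^2-1)-1$, $l=0,1,2,\dots$, with eigenspaces spanned by $\cos l\theta,\sin l\theta$. $P_+$, $P_*$, $P_-$ denote the $L^2(\mathbb{S}^1)$-orthogonal projections onto the closed span of the eigenfunctions with $\lambda<0$, $\lambda=0$, $\lambda>0$, respectively. *)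

theory Defs
  imports "HOL-Analysis.Analysis"
begin

(* The plane R^2 is the type complex, whose inner product is the Euclidean one.  The circle S^1
   is R / (2 pi Z): functions on S^1 are 2 pi-periodic functions on the real line, and functions
   in L^2(S^1) are represented by their values on [0, 2 pi]. *)

definition periodic_2pi :: "(real \<Rightarrow> 'a) \<Rightarrow> bool" where
  "periodic_2pi f \<longleftrightarrow> (\<forall>\<theta>. f (\<theta> + 2 * pi) = f \<theta>)"

primrec Ck_on :: "nat \<Rightarrow> 'a::real_normed_vector set \<Rightarrow> ('a \<Rightarrow> 'b::real_normed_vector) \<Rightarrow> bool" where
  "Ck_on 0 S f \<longleftrightarrow> continuous_on S f"
| "Ck_on (Suc k) S f \<longleftrightarrow>
     (\<forall>x\<in>S. f differentiable (at x)) \<and> (\<forall>w. Ck_on k S (\<lambda>x. frechet_derivative f (at x) w))"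

definition smooth_on :: "'a::real_normed_vector set \<Rightarrow> ('a \<Rightarrow> 'b::real_normed_vector) \<Rightarrow> bool" where
  "smooth_on S f \<longleftrightarrow> (\<forall>k. Ck_on k S f)"

definition nth_deriv :: "nat \<Rightarrow> (real \<Rightarrow> 'a::real_normed_vector) \<Rightarrow> real \<Rightarrow> 'a" where
  "nth_deriv k f = ((\<lambda>g s. vector_derivative g (at s)) ^^ k) f"

(* Meaningful for periodic functions of class C^k, whose derivatives are bounded; the supremum
   is a junk value otherwise. *)
definition Ck_norm :: "nat \<Rightarrow> (real \<Rightarrow> 'a::real_normed_vector) \<Rightarrow> real" where
  "Ck_norm k f = (\<Sum>j\<le>k. SUP s. norm (nth_deriv j f s))"

(* N is normal at the point Y s to the closed curve parametrised by Y. *)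
definition inward_unit_normal :: "(real \<Rightarrow> complex) \<Rightarrow> real \<Rightarrow> complex \<Rightarrow> bool" where
  "inward_unit_normal Y s N \<longleftrightarrow>
     norm N = 1 \<and> N \<bullet> nth_deriv 1 Y s = 0 \<and>
     (\<forall>\<^sub>F \<epsilon> in at_right 0. Y s + \<epsilon> *\<^sub>R N \<in> inside (range Y))"

(* Curvature with respect to the unit normal N; independent of the orientation of Y, and
   nonnegative for a convex curve if N points inwards. *)
definition curvature_wrt :: "(real \<Rightarrow> complex) \<Rightarrow> real \<Rightarrow> complex \<Rightarrow> real" where
  "curvature_wrt Y s N = (nth_deriv 2 Y s \<bullet> N) / (norm (nth_deriv 1 Y s))\<^sup>2"

definition closed_convex_embedding :: "(real \<Rightarrow> complex) \<Rightarrow> bool" where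
  "closed_convex_embedding Y \<longleftrightarrow>
     periodic_2pi Y \<and> inj_on Y {0..<2 * pi} \<and> (\<forall>s. nth_deriv 1 Y s \<noteq> 0) \<and>
     convex (inside (range Y))"

(* X s t is the position vector at time t. *)
definition closed_ancient_alpha_csf :: "real \<Rightarrow> ereal \<Rightarrow> (real \<Rightarrow> complex set) \<Rightarrow> bool" where
  "closed_ancient_alpha_csf \<alpha> T \<Gamma> \<longleftrightarrow> T \<noteq> -\<infinity> \<and>
     (\<exists>X. smooth_on {p. ereal (snd p) < T} (\<lambda>p. X (fst p) (snd p)) \<and>
        (\<forall>t. ereal t < T \<longrightarrow>
           closed_convex_embedding (\<lambda>s. X s t) \<and> \<Gamma> t = range (\<lambda>s. X s t) \<and>
           (\<forall>s. \<exists>N. inward_unit_normal (\<lambda>s. X s t) s N \<and>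
              ((\<lambda>t'. X s t') has_vector_derivative
                 (curvature_wrt (\<lambda>s. X s t) s N powr \<alpha>) *\<^sub>R N) (at t))))"

(* The time t < 0 with \<tau> = - ln (- t) / (1 + \<alpha>). *)
definition unscaled_time :: "real \<Rightarrow> real \<Rightarrow> real" where
  "unscaled_time \<alpha> \<tau> = - exp (- (1 + \<alpha>) * \<tau>)"

definition rescaled_flow :: "real \<Rightarrow> (real \<Rightarrow> complex set) \<Rightarrow> real \<Rightarrow> complex set" where
  "rescaled_flow \<alpha> \<Gamma> \<tau> =
     (let t = unscaled_time \<alpha> \<tau> in
      (\<lambda>z. ((1 + \<alpha>) powr (- 1 / (1 + \<alpha>)) * (- t) powr (- 1 / (1 + \<alpha>))) *\<^sub>R z) ` \<Gamma> t)"

(* Smooth convergence of curves: suitable parametrisations converge, with all their derivatives,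
   uniformly to the standard parametrisation of the unit circle. *)
definition converges_smoothly_to_unit_circle :: "(real \<Rightarrow> complex set) \<Rightarrow> bool" where
  "converges_smoothly_to_unit_circle G \<longleftrightarrow>
     (\<exists>Y. (\<forall>\<^sub>F \<tau> in at_bot. smooth_on UNIV (Y \<tau>) \<and> periodic_2pi (Y \<tau>) \<and> range (Y \<tau>) = G \<tau>) \<and>
          (\<forall>k. ((\<lambda>\<tau>. Ck_norm k (\<lambda>s. Y \<tau> s - cis s)) \<longlongrightarrow> 0) at_bot))"

(* For a Jordan curve \<Gamma> the open region \<Omega> with boundary \<Gamma> is inside \<Gamma>; the supremum is
   attained because the closure of \<Omega> is compact. *)
definition support_function :: "complex set \<Rightarrow> real \<Rightarrow> real" where
  "support_function \<Gamma> \<theta> = (SUP z\<in>closure (inside \<Gamma>). Complex (cos \<theta>) (sin \<theta>) \<bullet> z)"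

definition lin_op :: "real \<Rightarrow> (real \<Rightarrow> real) \<Rightarrow> real \<Rightarrow> real" where
  "lin_op \<alpha> \<phi> \<theta> = \<alpha> * nth_deriv 2 \<phi> \<theta> + (\<alpha> + 1) * \<phi> \<theta>"

(* Note the sign: the eigenvalue equation is L \<phi> + \<mu> \<phi> = 0. *)
definition eigenfunction :: "real \<Rightarrow> real \<Rightarrow> (real \<Rightarrow> real) \<Rightarrow> bool" where
  "eigenfunction \<alpha> \<mu> \<phi> \<longleftrightarrow>
     smooth_on UNIV \<phi> \<and> periodic_2pi \<phi> \<and> (\<exists>\<theta>. \<phi> \<theta> \<noteq> 0) \<and>
     (\<forall>\<theta>. lin_op \<alpha> \<phi> \<theta> + \<mu> * \<phi> \<theta> = 0)"

definition eigenvalue :: "real \<Rightarrow> real \<Rightarrow> bool" where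
  "eigenvalue \<alpha> \<mu> \<longleftrightarrow> (\<exists>\<phi>. eigenfunction \<alpha> \<mu> \<phi>)"

definition lambda_I :: "real \<Rightarrow> real" where
  "lambda_I \<alpha> = (GREATEST \<mu>. eigenvalue \<alpha> \<mu> \<and> \<mu> < 0)"

definition L2_circle :: "(real \<Rightarrow> real) set" where
  "L2_circle = {f. set_borel_measurable lborel {0..2 * pi} f \<and>
                   set_integrable lborel {0..2 * pi} (\<lambda>\<theta>. (f \<theta>)\<^sup>2)}"

definition L2_inner :: "(real \<Rightarrow> real) \<Rightarrow> (real \<Rightarrow> real) \<Rightarrow> real" where
  "L2_inner f g = (LINT \<theta>:{0..2 * pi}|lborel. f \<theta> * g \<theta>)"

definition L2_norm :: "(real \<Rightarrow> real) \<Rightarrow> real" where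
  "L2_norm f = sqrt (L2_inner f f)"

definition fun_span :: "(real \<Rightarrow> real) set \<Rightarrow> (real \<Rightarrow> real) set" where
  "fun_span E = {(\<lambda>\<theta>. \<Sum>\<phi>\<in>F. c \<phi> * \<phi> \<theta>) | F c. finite F \<and> F \<subseteq> E}"

definition L2_closed_span :: "(real \<Rightarrow> real) set \<Rightarrow> (real \<Rightarrow> real) set" where
  "L2_closed_span E =
     {g \<in> L2_circle. \<forall>\<epsilon>>0. \<exists>h\<in>fun_span E. L2_norm (\<lambda>\<theta>. g \<theta> - h \<theta>) < \<epsilon>}"

(* The choice is only between representatives that agree almost everywhere on [0, 2 pi]. *)
definition L2_proj :: "(real \<Rightarrow> real) set \<Rightarrow> (real \<Rightarrow> real) \<Rightarrow> real \<Rightarrow> real" where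
  "L2_proj E f = (SOME g. g \<in> L2_closed_span E \<and>
     (\<forall>h\<in>L2_closed_span E. L2_inner (\<lambda>\<theta>. f \<theta> - g \<theta>) h = 0))"

(* P_plus is the projection for the NEGATIVE eigenvalues (the modes unstable forwards in time). *)
definition P_plus :: "real \<Rightarrow> (real \<Rightarrow> real) \<Rightarrow> real \<Rightarrow> real" where
  "P_plus \<alpha> = L2_proj {\<phi>. \<exists>\<mu><0. eigenfunction \<alpha> \<mu> \<phi>}"

definition P_star :: "real \<Rightarrow> (real \<Rightarrow> real) \<Rightarrow> real \<Rightarrow> real" where
  "P_star \<alpha> = L2_proj {\<phi>. eigenfunction \<alpha> 0 \<phi>}"

definition P_minus :: "real \<Rightarrow> (real \<Rightarrow> real) \<Rightarrow> real \<Rightarrow> real" where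
  "P_minus \<alpha> = L2_proj {\<phi>. \<exists>\<mu>>0. eigenfunction \<alpha> \<mu> \<phi>}"

end

theory Submission
  imports Defs
begin

text \<open>Linearising at the circle gives \<open>v' = L v + E\<close> with \<open>E\<close> quadratic in \<open>w = v + v''\<close>. Smooth convergence
  bounds all derivatives of \<open>v\<close>, so by interpolation \<open>w\<close> is controlled by a power of \<open>\<parallel>v\<parallel>\<close> slightly below one.
  Write \<open>X\<close>, \<open>Y\<close>, \<open>Z\<close> for the norms of the unstable, neutral and stable parts of \<open>v\<close>.

  Without neutral modes \<open>X\<^sup>2 - Z\<^sup>2\<close> is nondecreasing and tends to \<open>0\<close> at \<open>-\<infinity>\<close>, whence \<open>Z \<le> X\<close>. Neutral modes occur
  only for \<open>\<alpha> = 1 / (l\<^sup>2 - 1)\<close>, with \<open>l \<ge> 3\<close> as \<open>\<alpha> \<noteq> 1 / 3\<close>. Then, for \<open>u = 1 + v\<close> and \<open>p = l\<^sup>2 - 2\<close>, the scale-invariant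
  entropy \<open>(\<integral>u (u + u''))\<^sup>p (\<integral>u\<^sup>-\<^sup>p)\<^sup>2\<close> is monotone by Chebyshev's inequality, and is at least its value at the circle. In its
  fourth order expansion the square of the neutral energy has a coefficient proportional to \<open>- (p\<^sup>2 - 4)\<close>, which is
  negative except in the affine case \<open>l = 2\<close>; so the neutral part is slaved to the unstable one, and integrating the
  equations of the modes gives \<open>\<parallel>v\<parallel> \<le> C X\<close> again.

  Once \<open>\<parallel>v\<parallel> \<le> C X\<close>, the unstable part decays like \<open>exp (- \<lambda>\<^sub>I \<tau>)\<close> at \<open>-\<infinity>\<close>, and Duhamel's formula for each remaining mode,
  with quadratic forcing, makes \<open>Y\<close> and \<open>Z\<close> quadratic in \<open>X\<close>.

  The equation for \<open>v\<close> comes from parametrising the curves near the circle by the normal angle and differentiating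
  the support function, a maximum, in time (Danskin's theorem).\<close>

section \<open>Periodic functions\<close>

text \<open>The nonlinearity contains second derivatives of v, so an L2 estimate does not close by
  itself. In place of parabolic smoothing, smooth convergence bounds 26 derivatives of v uniformly
  in time, and interpolation against these bounds costs a small power only: w is of order |v|^(3/4),
  and its square is still superlinear. With neutral modes the entropy alone yields Y^2 <= C X, so
  the square of the neutral part may be as large as X and is no perturbation. The way out is that
  the square of a mode of frequency l has frequencies 0 and 2 l only: it feeds neither the neutral
  modes nor the unstable modes 0 < |k| < l, and its effect on the mean is absorbed by a weighted
  energy. The exception l = 2 has a geometric reason. There p = 2, and the entropy is, up to a
  constant, the square of the area of the convex body times the area of its polar body. This is
  invariant under linear maps, so centred ellipses have the same entropy as the circle and no fourth
  order term can control the neutral part.\<close>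

lemma nth_deriv_0 [simp]: "nth_deriv 0 f = f"
  by (simp add: nth_deriv_def)

lemma nth_deriv_Suc_at: "nth_deriv (Suc k) f x = vector_derivative (nth_deriv k f) (at x)"
  by (simp add: nth_deriv_def)

lemma nth_deriv_Suc: "nth_deriv (Suc k) f = nth_deriv k (nth_deriv 1 f)"
  by (simp add: nth_deriv_def funpow_Suc_right del: funpow.simps(2))

lemma nth_deriv_eqI:
  fixes f g :: "real \<Rightarrow> real"
  assumes "\<And>x. (f has_real_derivative g x) (at x)"
  shows "nth_deriv (Suc j) f = nth_deriv j g"
proof -
  have "nth_deriv 1 f = g"
    by (rule ext) (simp only: One_nat_def nth_deriv_Suc_at nth_deriv_0
        vector_derivative_at[OF assms[unfolded has_real_derivative_iff_has_vector_derivative]])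
  then show ?thesis by (simp only: nth_deriv_Suc[of j])
qed

text \<open>C^n functions on the circle, with derivatives named by \<open>nth_deriv\<close>.
  Inductions peel off the innermost derivative through \<open>CP_deriv\<close> and
  \<open>CP_SucI\<close>, so integration by parts and Fourier coefficients can refer to
  \<open>nth_deriv\<close> directly.\<close>

definition CP :: "nat \<Rightarrow> (real \<Rightarrow> real) \<Rightarrow> bool" where
  "CP n f \<longleftrightarrow> periodic_2pi f \<and>
     (\<forall>j<n. \<forall>x. (nth_deriv j f has_real_derivative nth_deriv (Suc j) f x) (at x)) \<and>
     continuous_on UNIV (nth_deriv n f)"

lemma CP_periodic: "CP n f \<Longrightarrow> periodic_2pi f"
  by (simp add: CP_def)

lemma CP_D: "CP n f \<Longrightarrow> j < n \<Longrightarrow> (nth_deriv j f has_real_derivative nth_deriv (Suc j) f x) (at x)"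
  by (simp add: CP_def)

lemma CP_D0: "CP n f \<Longrightarrow> 0 < n \<Longrightarrow> (f has_real_derivative nth_deriv 1 f x) (at x)"
  using CP_D[of n f 0 x] by simp

lemma CP_contj: "CP n f \<Longrightarrow> j \<le> n \<Longrightarrow> continuous_on UNIV (nth_deriv j f)"
proof (cases "j = n")
  case False
  assume "CP n f" "j \<le> n"
  then have "isCont (nth_deriv j f) x" for x using CP_D[of n f j x] False by (simp add: DERIV_isCont)
  then show ?thesis by (simp add: continuous_at_imp_continuous_on)
qed (simp add: CP_def)

lemma CP_cont: "CP n f \<Longrightarrow> continuous_on UNIV f"
  using CP_contj[of n f 0] by simp

lemma CP_mono: "CP n f \<Longrightarrow> m \<le> n \<Longrightarrow> CP m f"
  unfolding CP_def[of m] using CP_contj[of n f m] CP_periodic[of n f] CP_D[of n f] by simp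

lemma periodic_deriv:
  fixes f g :: "real \<Rightarrow> real"
  assumes "periodic_2pi f" "\<And>x. (f has_real_derivative g x) (at x)"
  shows "periodic_2pi g"
  unfolding periodic_2pi_def
proof
  fix x
  have "((\<lambda>x. f (x + 2 * pi)) has_real_derivative g (x + 2 * pi)) (at x)"
    using assms(2)[of "x + 2 * pi"] by (simp add: DERIV_shift)
  then have "(f has_real_derivative g (x + 2 * pi)) (at x)"
    using assms(1) by (simp add: periodic_2pi_def)
  then show "g (x + 2 * pi) = g x"
    using assms(2) DERIV_unique by blast
qed

lemma CP_deriv: assumes "CP (Suc n) f" shows "CP n (nth_deriv 1 f)"
proof -
  have "periodic_2pi (nth_deriv 1 f)"
    by (rule periodic_deriv[OF CP_periodic[OF assms] CP_D0[OF assms]]) simp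
  then show ?thesis
    using assms by (simp add: CP_def nth_deriv_Suc[symmetric] del: One_nat_def)
qed

lemma CP_nth: "CP (j + n) f \<Longrightarrow> CP n (nth_deriv j f)"
proof (induction j arbitrary: f)
  case (Suc j)
  then show ?case using CP_deriv[of "j + n" f] by (simp add: nth_deriv_Suc[of j] del: One_nat_def)
qed simp

lemma CP_nth': "CP m f \<Longrightarrow> j + n \<le> m \<Longrightarrow> CP n (nth_deriv j f)"
  using CP_mono CP_nth by blast

lemma nth_deriv_add: "nth_deriv (i + j) f = nth_deriv i (nth_deriv j f)"
  by (simp add: nth_deriv_def funpow_add)

lemma CP_0I: "periodic_2pi f \<Longrightarrow> continuous_on UNIV f \<Longrightarrow> CP 0 f"
  by (simp add: CP_def)

lemma CP_SucI:
  assumes "periodic_2pi f" "\<And>x. (f has_real_derivative g x) (at x)" "CP n g"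
  shows "CP (Suc n) f"
  unfolding CP_def
proof (intro conjI allI impI)
  fix j x assume "j < Suc n"
  then show "(nth_deriv j f has_real_derivative nth_deriv (Suc j) f x) (at x)"
  proof (cases j)
    case 0
    then show ?thesis using assms(2) nth_deriv_eqI[OF assms(2), of 0] by simp
  next
    case (Suc i)
    then show ?thesis
      using assms(3) \<open>j < Suc n\<close> CP_D[of n g i x] nth_deriv_eqI[OF assms(2)] by simp
  qed
qed (use assms nth_deriv_eqI[OF assms(2), of n] in \<open>auto simp: CP_def\<close>)

lemma CP_lin_aux:
  assumes "CP n f" "CP n g"
  shows "CP n (\<lambda>x. a * f x + b * g x) \<and>
    (\<forall>j\<le>n. nth_deriv j (\<lambda>x. a * f x + b * g x) = (\<lambda>x. a * nth_deriv j f x + b * nth_deriv j g x))"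
  using assms
proof (induction n arbitrary: f g)
  case 0
  then show ?case
    by (auto intro!: CP_0I continuous_intros simp: CP_def periodic_2pi_def)
next
  case (Suc n)
  have d: "((\<lambda>x. a * f x + b * g x) has_real_derivative a * nth_deriv 1 f x + b * nth_deriv 1 g x) (at x)" for x
    using CP_D0[OF Suc.prems(1), of x] CP_D0[OF Suc.prems(2), of x]
    by (auto intro!: derivative_eq_intros)
  have p: "periodic_2pi (\<lambda>x. a * f x + b * g x)"
    using Suc.prems by (auto simp: CP_def periodic_2pi_def)
  note IH = Suc.IH[OF CP_deriv[OF Suc.prems(1)] CP_deriv[OF Suc.prems(2)]]
  have "nth_deriv j (\<lambda>x. a * f x + b * g x) = (\<lambda>x. a * nth_deriv j f x + b * nth_deriv j g x)"
    if "j \<le> Suc n" for j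
  proof (cases j)
    case (Suc i)
    then show ?thesis
      using nth_deriv_eqI[of "\<lambda>x. a * f x + b * g x", OF d, of i] IH that
      by (simp add: nth_deriv_Suc[of i])
  qed simp
  then show ?case using CP_SucI[OF p d] IH by blast
qed

lemma CP_lin: "CP n f \<Longrightarrow> CP n g \<Longrightarrow> CP n (\<lambda>x. a * f x + b * g x)"
  using CP_lin_aux by blast

lemma nth_deriv_lin: "CP n f \<Longrightarrow> CP n g \<Longrightarrow> j \<le> n \<Longrightarrow>
   nth_deriv j (\<lambda>x. a * f x + b * g x) = (\<lambda>x. a * nth_deriv j f x + b * nth_deriv j g x)"
  using CP_lin_aux by blast

lemma CP_const: "CP n (\<lambda>x. c)"
proof (induction n arbitrary: c)
  case 0 then show ?case by (auto intro!: CP_0I simp: periodic_2pi_def)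
next
  case (Suc n)
  show ?case
  proof (rule CP_SucI)
    show "periodic_2pi (\<lambda>x. c)" by (simp add: periodic_2pi_def)
    show "((\<lambda>x. c) has_real_derivative 0) (at x)" for x by (rule DERIV_const)
    show "CP n (\<lambda>x. 0)" by (rule Suc.IH)
  qed
qed

lemma CP_add: "CP n f \<Longrightarrow> CP n g \<Longrightarrow> CP n (\<lambda>x. f x + g x)"
  using CP_lin[of n f g 1 1] by simp

lemma CP_diff: "CP n f \<Longrightarrow> CP n g \<Longrightarrow> CP n (\<lambda>x. f x - g x)"
  using CP_lin[of n f g 1 "-1"] by simp

lemma CP_cmult: "CP n f \<Longrightarrow> CP n (\<lambda>x. c * f x)"
  using CP_lin[of n f f c 0] by simp

lemma nth_deriv_diff: "CP n f \<Longrightarrow> CP n g \<Longrightarrow> j \<le> n \<Longrightarrow>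
   nth_deriv j (\<lambda>x. f x - g x) = (\<lambda>x. nth_deriv j f x - nth_deriv j g x)"
  using nth_deriv_lin[of n f g j 1 "-1"] by simp

lemma nth_deriv_plus: "CP n f \<Longrightarrow> CP n g \<Longrightarrow> j \<le> n \<Longrightarrow>
   nth_deriv j (\<lambda>x. f x + g x) = (\<lambda>x. nth_deriv j f x + nth_deriv j g x)"
  using nth_deriv_lin[of n f g j 1 "1"] by simp

lemma nth_deriv_cmult: "CP n f \<Longrightarrow> j \<le> n \<Longrightarrow>
   nth_deriv j (\<lambda>x. c * f x) = (\<lambda>x. c * nth_deriv j f x)"
  using nth_deriv_lin[of n f f j c 0] by simp

lemma CP_sum: "finite F \<Longrightarrow> (\<And>k. k \<in> F \<Longrightarrow> CP n (f k)) \<Longrightarrow> CP n (\<lambda>x. \<Sum>k\<in>F. f k x)"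
proof (induction F rule: finite_induct)
  case empty
  show ?case by (simp add: CP_const)
next
  case (insert k F)
  then have "CP n (f k)" "CP n (\<lambda>x. \<Sum>k\<in>F. f k x)" by blast+
  from CP_add[OF this] insert.hyps show ?case by simp
qed

lemma nth_deriv_sum: "finite F \<Longrightarrow> (\<And>k. k \<in> F \<Longrightarrow> CP n (f k)) \<Longrightarrow> j \<le> n \<Longrightarrow>
   nth_deriv j (\<lambda>x. \<Sum>k\<in>F. f k x) = (\<lambda>x. \<Sum>k\<in>F. nth_deriv j (f k) x)"
proof (induction F rule: finite_induct)
  case empty
  then show ?case using nth_deriv_cmult[of n "\<lambda>x. 0" j 0] CP_const by simp
next
  case (insert k F)
  then show ?case using nth_deriv_plus[of n "f k" "\<lambda>x. \<Sum>k\<in>F. f k x" j] CP_sum[of F n f] by simp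
qed

lemma CP_mult: "CP n f \<Longrightarrow> CP n g \<Longrightarrow> CP n (\<lambda>x. f x * g x)"
proof (induction n arbitrary: f g)
  case 0
  then show ?case
    by (auto intro!: CP_0I continuous_intros simp: CP_def periodic_2pi_def)
next
  case (Suc n)
  have p: "periodic_2pi (\<lambda>x. f x * g x)"
    using Suc.prems by (auto simp: CP_def periodic_2pi_def)
  have d: "((\<lambda>x. f x * g x) has_real_derivative nth_deriv 1 f x * g x + nth_deriv 1 g x * f x) (at x)" for x
    using CP_D0[OF Suc.prems(1), of x] CP_D0[OF Suc.prems(2), of x]
    by (auto intro!: derivative_eq_intros)
  show ?case
    by (rule CP_SucI[OF p d]) (use Suc CP_mono[of "Suc n" _ n] CP_deriv[of n] in \<open>auto intro!: CP_add\<close>)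
qed

section \<open>Integrals over the circle and the pairing of continuous functions\<close>

definition ip :: "(real \<Rightarrow> real) \<Rightarrow> (real \<Rightarrow> real) \<Rightarrow> real" where
  "ip f g = integral {0..2 * pi} (\<lambda>x. f x * g x)"

text \<open>\<open>circ\<close> and \<open>ip\<close> are gauge integrals, which suit the
  fundamental theorem of calculus; for continuous functions \<open>L2_inner_ip\<close> identifies
  \<open>ip\<close> with the Lebesgue pairing of the statement.\<close>

definition circ :: "(real \<Rightarrow> real) \<Rightarrow> real" where
  "circ f = integral {0..2 * pi} f"

abbreviation "cont \<equiv> continuous_on (UNIV :: real set)"

lemma cont_int: "cont (f :: real \<Rightarrow> real) \<Longrightarrow> f integrable_on {0..2 * pi}"
  by (rule integrable_continuous_interval) (rule continuous_on_subset, auto)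

lemma circ_add: "cont f \<Longrightarrow> cont g \<Longrightarrow> circ (\<lambda>x. f x + g x) = circ f + circ g"
  unfolding circ_def by (intro integral_add cont_int)

lemma circ_diff: "cont f \<Longrightarrow> cont g \<Longrightarrow> circ (\<lambda>x. f x - g x) = circ f - circ g"
  unfolding circ_def by (intro integral_diff cont_int)

lemma circ_cmult: "circ (\<lambda>x. c * f x) = c * circ f"
  unfolding circ_def by simp

lemma circ_minus: "circ (\<lambda>x. - f x) = - circ f"
  unfolding circ_def by simp

lemma circ_const: "circ (\<lambda>x. c) = 2 * pi * c"
  unfolding circ_def by simp

lemma circ_mono: "cont f \<Longrightarrow> cont g \<Longrightarrow> (\<And>x. f x \<le> g x) \<Longrightarrow> circ f \<le> circ g"
  unfolding circ_def by (intro integral_le cont_int)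

lemma circ_nonneg: "cont f \<Longrightarrow> (\<And>x. 0 \<le> f x) \<Longrightarrow> 0 \<le> circ f"
  using circ_mono[of "\<lambda>x. 0" f] circ_const[of 0] by simp

lemma circ_bound: "cont f \<Longrightarrow> (\<And>x. \<bar>f x\<bar> \<le> B) \<Longrightarrow> \<bar>circ f\<bar> \<le> 2 * pi * B"
proof -
  assume a: "cont f" "\<And>x. \<bar>f x\<bar> \<le> B"
  have "f x \<le> B" "- B \<le> f x" for x using a(2)[of x] by auto
  then show ?thesis
    using circ_mono[of f "\<lambda>x. B"] circ_mono[of "\<lambda>x. - B" f] a(1) by (auto simp: circ_const circ_minus abs_le_iff)
qed

lemma circ_sum: "finite F \<Longrightarrow> (\<And>k. k \<in> F \<Longrightarrow> cont (f k)) \<Longrightarrow> circ (\<lambda>x. \<Sum>k\<in>F. f k x) = (\<Sum>k\<in>F. circ (f k))"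
  unfolding circ_def by (intro integral_sum cont_int)

lemma ip_circ: "ip f g = circ (\<lambda>x. f x * g x)"
  by (simp add: ip_def circ_def)

lemma ip_commute: "ip f g = ip g f"
  by (simp add: ip_def mult.commute)

lemma ip_add: "cont f \<Longrightarrow> cont g \<Longrightarrow> cont h \<Longrightarrow> ip (\<lambda>x. f x + g x) h = ip f h + ip g h"
  unfolding ip_circ ring_distribs by (rule circ_add) (simp_all add: continuous_on_mult)

lemma ip_diff: "cont f \<Longrightarrow> cont g \<Longrightarrow> cont h \<Longrightarrow> ip (\<lambda>x. f x - g x) h = ip f h - ip g h"
  unfolding ip_circ left_diff_distrib by (rule circ_diff) (simp_all add: continuous_on_mult)

lemma ip_cmult: "ip (\<lambda>x. c * f x) h = c * ip f h"
  unfolding ip_circ using circ_cmult[of c] by (simp add: mult.assoc)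

lemma ip_add2: "cont f \<Longrightarrow> cont g \<Longrightarrow> cont h \<Longrightarrow> ip h (\<lambda>x. f x + g x) = ip h f + ip h g"
  using ip_add[of f g h] by (simp add: ip_commute[of h])

lemma ip_diff2: "cont f \<Longrightarrow> cont g \<Longrightarrow> cont h \<Longrightarrow> ip h (\<lambda>x. f x - g x) = ip h f - ip h g"
  using ip_diff[of f g h] by (simp add: ip_commute[of h])

lemma ip_cmult2: "ip h (\<lambda>x. c * f x) = c * ip h f"
  using ip_cmult ip_commute by metis

lemma ip_sum: "finite F \<Longrightarrow> (\<And>k. k \<in> F \<Longrightarrow> cont (f k)) \<Longrightarrow> cont h \<Longrightarrow> 
   ip (\<lambda>x. \<Sum>k\<in>F. f k x) h = (\<Sum>k\<in>F. ip (f k) h)"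
  unfolding ip_circ sum_distrib_right by (intro circ_sum continuous_intros)

lemma ip_sum2: "finite F \<Longrightarrow> (\<And>k. k \<in> F \<Longrightarrow> cont (f k)) \<Longrightarrow> cont h \<Longrightarrow> 
   ip h (\<lambda>x. \<Sum>k\<in>F. f k x) = (\<Sum>k\<in>F. ip h (f k))"
  using ip_sum[of F f h] by (simp add: ip_commute[of h])

lemma ip_pos: "cont f \<Longrightarrow> 0 \<le> ip f f"
  unfolding ip_circ by (intro circ_nonneg continuous_intros) auto

lemma ip_square_diff: 
  assumes "cont f" "cont g"
  shows "ip (\<lambda>x. f x - g x) (\<lambda>x. f x - g x) = ip f f - 2 * ip f g + ip g g"
proof -
  have c: "cont (\<lambda>x. f x - g x)" using assms by (intro continuous_intros)
  show ?thesis
    using assms c by (simp add: ip_diff ip_diff2 ip_commute[of g f])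
qed

lemma ip_cauchy:
  assumes f: "cont f" and g: "cont g"
  shows "(ip f g)\<^sup>2 \<le> ip f f * ip g g"
proof -
  have q: "0 \<le> ip f f - 2 * t * ip f g + t\<^sup>2 * ip g g" for t
    using ip_pos[of "\<lambda>x. f x - t * g x"] ip_square_diff[of f "\<lambda>x. t * g x"] f g
    by (simp add: ip_cmult ip_cmult2 continuous_intros power2_eq_square)
  show ?thesis
  proof (cases "ip g g = 0")
    case True
    have "ip f g = 0"
    proof (rule ccontr)
      assume a: "ip f g \<noteq> 0"
      \<comment> \<open>Here the form is affine in t, and this t makes it equal to -1.\<close>
      show False using q[of "(ip f f + 1) / (2 * ip f g)"] a True by (simp add: field_simps)
    qed
    then show ?thesis using True by simp
  next
    case False
    then have p: "ip g g > 0" using ip_pos[OF g] by simp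
    have "0 \<le> (ip f f - 2 * (ip f g / ip g g) * ip f g + (ip f g / ip g g)\<^sup>2 * ip g g) * ip g g"
      using q[of "ip f g / ip g g"] p by (intro mult_nonneg_nonneg) auto
    also have "\<dots> = ip f f * ip g g - (ip f g)\<^sup>2"
      using False by (simp add: field_simps power2_eq_square)
    finally show ?thesis by simp
  qed
qed

definition nrm :: "(real \<Rightarrow> real) \<Rightarrow> real" where "nrm f = sqrt (ip f f)"

lemma nrm_nonneg: "cont f \<Longrightarrow> 0 \<le> nrm f"
  by (simp add: nrm_def ip_pos)

lemma nrm_sq: "cont f \<Longrightarrow> (nrm f)\<^sup>2 = ip f f"
  by (simp add: nrm_def ip_pos)

lemma ip_le_nrm: "cont f \<Longrightarrow> cont g \<Longrightarrow> \<bar>ip f g\<bar> \<le> nrm f * nrm g"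
  using ip_cauchy[of f g] ip_pos[of f] ip_pos[of g]
  by (metis nrm_def real_sqrt_abs real_sqrt_le_mono real_sqrt_mult)

text \<open>The factor 3 stands for sqrt (2 pi), since 2 pi <= 9.\<close>

lemma nrm_bound: "cont f \<Longrightarrow> (\<And>x. \<bar>f x\<bar> \<le> B) \<Longrightarrow> nrm f \<le> 3 * B"
proof -
  assume a: "cont f" "\<And>x. \<bar>f x\<bar> \<le> B"
  then have B: "0 \<le> B" using abs_ge_zero order_trans by blast
  have "ip f f \<le> 2 * pi * (B\<^sup>2)"
    unfolding ip_circ using a
    by (subst circ_const[symmetric], intro circ_mono continuous_intros)
       (auto simp: power2_eq_square[symmetric] abs_le_square_iff B intro!: abs_le_square_iff[THEN iffD1])
  also have "\<dots> \<le> 9 * B\<^sup>2" using pi_less_4 by (intro mult_right_mono) auto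
  also have "\<dots> = (3 * B)\<^sup>2" by (simp add: power_mult_distrib)
  finally show ?thesis unfolding nrm_def using B by (intro real_le_lsqrt) auto
qed

lemma circ_deriv:
  assumes "periodic_2pi f" "\<And>x. (f has_real_derivative g x) (at x)"
  shows "circ g = 0"
proof -
  have "(g has_integral (f (2 * pi) - f 0)) {0..2 * pi}"
    by (intro fundamental_theorem_of_calculus)
       (auto intro!: DERIV_subset[OF assms(2), THEN has_real_derivative_iff_has_vector_derivative[THEN iffD1]])
  moreover have "f (2 * pi) = f 0" using assms(1) by (metis add_0 periodic_2pi_def)
  ultimately show ?thesis by (auto simp: circ_def)
qed

lemma ip_parts:
  assumes "CP 1 f" "CP 1 g"
  shows "ip (nth_deriv 1 f) g = - ip f (nth_deriv 1 g)"
proof -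
  have "circ (\<lambda>x. nth_deriv 1 f x * g x + f x * nth_deriv 1 g x) = 0"
    by (rule circ_deriv[of "\<lambda>x. f x * g x"])
       (use assms CP_D0[of 1] in \<open>auto simp: CP_def periodic_2pi_def intro!: derivative_eq_intros\<close>)
  moreover have "cont f" "cont g" "cont (nth_deriv 1 f)" "cont (nth_deriv 1 g)"
    using assms CP_cont CP_contj[of 1 _ 1] by auto
  ultimately show ?thesis
    unfolding ip_circ by (subst (asm) circ_add) (auto intro!: continuous_intros)
qed

lemma ip_parts_n:
  assumes "CP n f" "CP n g"
  shows "ip (nth_deriv n f) g = (- 1) ^ n * ip f (nth_deriv n g)"
  using assms
proof (induction n arbitrary: f g)
  case (Suc n)
  have "ip (nth_deriv (Suc n) f) g = (- 1) ^ n * ip (nth_deriv 1 f) (nth_deriv n g)"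
    unfolding nth_deriv_Suc
    by (rule Suc.IH) (use Suc.prems CP_deriv CP_mono in auto)
  also have "ip (nth_deriv 1 f) (nth_deriv n g) = - ip f (nth_deriv (Suc n) g)"
    using ip_parts[of f "nth_deriv n g"] Suc.prems CP_mono[of "Suc n" f 1] CP_nth[of n 1 g]
    by (simp add: nth_deriv_add[of 1 n g, simplified])
  finally show ?case by simp
qed simp

section \<open>Interpolation and Sobolev inequalities\<close>

lemma interp:
  assumes "CP (2 * n) f"
  shows "(nrm (nth_deriv n f))\<^sup>2 \<le> nrm f * nrm (nth_deriv (2 * n) f)"
proof -
  have c: "cont f" "cont (nth_deriv n f)" "cont (nth_deriv (2 * n) f)"
    using assms CP_cont CP_contj[of "2 * n" f] by auto
  have "ip (nth_deriv n f) (nth_deriv n f) = (- 1) ^ n * ip f (nth_deriv n (nth_deriv n f))"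
    by (rule ip_parts_n) (use assms CP_mono[of "2 * n" f n] CP_nth[of n n f] in \<open>auto simp: mult_2\<close>)
  also have "nth_deriv n (nth_deriv n f) = nth_deriv (2 * n) f"
    by (simp add: mult_2 nth_deriv_add)
  finally have "\<bar>ip (nth_deriv n f) (nth_deriv n f)\<bar> = \<bar>ip f (nth_deriv (2 * n) f)\<bar>"
    by (simp add: abs_mult)
  then show ?thesis
    using ip_le_nrm[of f "nth_deriv (2 * n) f"] c nrm_sq[of "nth_deriv n f"] ip_pos[of "nth_deriv n f"] by auto
qed

text \<open>\<open>interp\<close> nested in itself: a bound on the derivative of order 4 n turns
  into control of order n by the power 3 / 4 of the L2 norm. A single application would give the
  power 1 / 2, too weak for a quadratic term to be superlinear.\<close>

lemma interp4:
  assumes "CP (4 * n) f"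
  shows "(nrm (nth_deriv n f)) ^ 4 \<le> (nrm f) ^ 3 * nrm (nth_deriv (4 * n) f)"
proof -
  have c: "cont f" "cont (nth_deriv n f)" "cont (nth_deriv (2 * n) f)" "cont (nth_deriv (4 * n) f)"
    using assms CP_cont CP_contj[of "4 * n" f] by auto
  have 1: "(nrm (nth_deriv n f))\<^sup>2 \<le> nrm f * nrm (nth_deriv (2 * n) f)"
    using interp CP_mono assms by (metis mult_le_mono1 numeral_le_iff semiring_norm(69,71,68,72))
  have 2: "(nrm (nth_deriv (2 * n) f))\<^sup>2 \<le> nrm f * nrm (nth_deriv (4 * n) f)"
    using interp[of "2 * n" f] assms by simp
  have "((nrm (nth_deriv n f))\<^sup>2)\<^sup>2 \<le> (nrm f * nrm (nth_deriv (2 * n) f))\<^sup>2"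
    by (rule power_mono[OF 1]) simp
  also have "\<dots> \<le> (nrm f)\<^sup>2 * (nrm f * nrm (nth_deriv (4 * n) f))"
    unfolding power_mult_distrib using 2 by (intro mult_left_mono) auto
  finally show ?thesis by (simp add: power_mult[symmetric] power2_eq_square power3_eq_cube power4_eq_xxxx mult.assoc)
qed

lemma periodic_int:
  assumes "periodic_2pi f"
  shows "f (x + 2 * pi * of_int k) = f x"
proof -
  have n: "f (x + 2 * pi * of_nat m) = f x" for m x
  proof (induction m)
    case (Suc m)
    have "f (x + 2 * pi * of_nat (Suc m)) = f ((x + 2 * pi * of_nat m) + 2 * pi)"
      by (simp add: algebra_simps)
    then show ?case using Suc assms by (metis periodic_2pi_def)
  qed simp
  show ?thesis
  proof (cases "k \<ge> 0")
    case True
    then show ?thesis using n[of x "nat k"] by simp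
  next
    case False
    then show ?thesis using n[of "x + 2 * pi * of_int k" "nat (- k)"] by simp
  qed
qed

lemma periodic_reduce:
  assumes "periodic_2pi f"
  obtains y where "y \<in> {0..<2 * pi}" "f y = f x" "\<exists>k. y = x + 2 * pi * of_int k"
proof -
  define k where "k = \<lfloor>x / (2 * pi)\<rfloor>"
  have "of_int k \<le> x / (2 * pi)" "x / (2 * pi) < of_int k + 1"
    by (auto simp: k_def)
  then have "x + 2 * pi * of_int (- k) \<in> {0..<2 * pi}"
    by (auto simp: field_simps)
  then show ?thesis using that[of "x + 2 * pi * of_int (- k)"] periodic_int[OF assms] by blast
qed

text \<open>Since 2 pi > 1, somewhere f^2 is at most its integral; from there f^2 changes by at most
  the integral of 2 |f f'|, which is at most that of f^2 + f'^2.\<close>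

lemma sobolev:
  assumes "CP 1 f"
  shows "(f x)\<^sup>2 \<le> 2 * (nrm f)\<^sup>2 + (nrm (nth_deriv 1 f))\<^sup>2"
proof -
  let ?f' = "nth_deriv 1 f"
  have c: "cont f" "cont ?f'" using assms CP_cont CP_contj[of 1 f 1] by auto
  obtain z where z: "z \<in> {0..<2 * pi}" "f z = f x" using periodic_reduce[of f x] assms by (auto simp: CP_def)
  have "\<exists>y\<in>{0..2 * pi}. (f y)\<^sup>2 \<le> ip f f"
  proof (rule ccontr)
    assume n: "\<not> (\<exists>y\<in>{0..2 * pi}. (f y)\<^sup>2 \<le> ip f f)"
    then have "\<And>y. y \<in> {0..2 * pi} \<Longrightarrow> ip f f \<le> (f y)\<^sup>2" by force
    moreover have 1: "ip f f < (f 0)\<^sup>2" using n by force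
    ultimately have "integral {0..2 * pi} (\<lambda>y. ip f f) \<le> ip f f"
      unfolding ip_def[of f f] power2_eq_square[symmetric]
      by (intro integral_le cont_int continuous_intros c) (auto simp: ip_def power2_eq_square)
    then have "2 * pi * ip f f \<le> ip f f" by simp
    moreover have "ip f f \<ge> 0" "2 * pi > 1" using ip_pos c pi_gt3 by auto
    ultimately have "ip f f = 0" 
      by (metis less_le_not_le mult_le_cancel_right2 order_antisym_conv)
    have "circ (\<lambda>x. (f x)\<^sup>2) = 0" using \<open>ip f f = 0\<close> by (simp add: ip_circ power2_eq_square)
    moreover have "continuous_on {0..2 * pi} (\<lambda>x. (f x)\<^sup>2)"
      using c(1) by (auto intro!: continuous_on_power intro: continuous_on_subset)
    ultimately have "(f 0)\<^sup>2 = 0"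
      using c \<open>ip f f = 0\<close> integral_eq_0_iff[of 0 "2 * pi" "\<lambda>x. (f x)\<^sup>2"]
      by (auto simp: circ_def intro!: continuous_intros intro: continuous_on_subset)
    then show False using 1 \<open>ip f f = 0\<close> by simp
  qed
  then obtain y where y: "y \<in> {0..2 * pi}" "(f y)\<^sup>2 \<le> ip f f" by blast
  have key: "\<bar>(f b)\<^sup>2 - (f a)\<^sup>2\<bar> \<le> ip f f + ip ?f' ?f'" if "0 \<le> a" "a \<le> b" "b \<le> 2 * pi" for a b
  proof -
    have hi: "((\<lambda>x. 2 * f x * ?f' x) has_integral ((f b)\<^sup>2 - (f a)\<^sup>2)) {a..b}"
      using that CP_D0[OF assms]
      by (intro fundamental_theorem_of_calculus)
        (auto intro!: derivative_eq_intros simp: has_real_derivative_iff_has_vector_derivative[symmetric] intro: DERIV_subset)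
    have "\<bar>integral {a..b} (\<lambda>x. 2 * f x * ?f' x)\<bar> \<le> integral {a..b} (\<lambda>x. f x * f x + ?f' x * ?f' x)"
    proof -
      have "norm (integral {a..b} (\<lambda>x. 2 * f x * ?f' x)) \<le> integral {a..b} (\<lambda>x. f x * f x + ?f' x * ?f' x)"
      proof (rule integral_norm_bound_integral)
        fix x
        have "0 \<le> (\<bar>f x\<bar> - \<bar>?f' x\<bar>)\<^sup>2" by simp
        then show "norm (2 * f x * ?f' x) \<le> f x * f x + ?f' x * ?f' x"
          unfolding power2_diff power2_abs by (simp add: abs_mult power2_eq_square)
      qed (use c in \<open>auto intro!: integrable_continuous_interval continuous_intros intro: continuous_on_subset\<close>)
      then show ?thesis by simp
    qed
    also have "\<dots> \<le> integral {0..2 * pi} (\<lambda>x. f x * f x + ?f' x * ?f' x)"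
      using that c by (intro integral_subset_le) 
        (auto intro!: integrable_continuous_interval continuous_intros intro: continuous_on_subset)
    also have "\<dots> = ip f f + ip ?f' ?f'"
      unfolding ip_def by (intro integral_add cont_int continuous_intros c)
    finally show ?thesis using hi by (simp add: integral_unique)
  qed
  have "\<bar>(f z)\<^sup>2 - (f y)\<^sup>2\<bar> \<le> ip f f + ip ?f' ?f'"
    using key[of y z] key[of z y] y z by (cases "y \<le> z") (auto simp: abs_minus_commute)
  then show ?thesis using y z c by (simp add: nrm_sq del: One_nat_def)
qed

section \<open>Fourier series\<close>

text \<open>Orthonormal real Fourier basis indexed by all integers: cosines at k > 0, sines at k <
  0. With this indexing differentiation is one rule, \<open>eb k\<close> to - k
  \<open>eb (- k)\<close>, for every sign of k.\<close>

definition eb :: "int \<Rightarrow> real \<Rightarrow> real" where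
  "eb k x = (if k = 0 then 1 / sqrt (2 * pi) else if k > 0 then cos (of_int k * x) / sqrt pi
             else sin (of_int (- k) * x) / sqrt pi)"

lemma eb_deriv: "(eb k has_real_derivative - of_int k * eb (- k) x) (at x)"
proof -
  consider "k = 0" | "k > 0" | "k < 0" by linarith
  then show ?thesis
  proof cases
    case 1
    then have "eb k = (\<lambda>x. 1 / sqrt (2 * pi))" by (simp add: eb_def fun_eq_iff)
    then show ?thesis using 1 by simp
  next
    case 2
    define c where "c = 1 / sqrt pi"
    have "eb k = (\<lambda>x. c * cos (of_int k * x))" "eb (- k) = (\<lambda>x. c * sin (of_int k * x))"
      using 2 by (simp_all add: eb_def fun_eq_iff c_def)
    then show ?thesis by (auto intro!: derivative_eq_intros)
  next
    case 3
    define c where "c = 1 / sqrt pi"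
    have "eb k = (\<lambda>x. c * sin (of_int (- k) * x))" "eb (- k) = (\<lambda>x. c * cos (of_int (- k) * x))"
      using 3 by (simp_all add: eb_def fun_eq_iff c_def)
    then show ?thesis by (auto intro!: derivative_eq_intros)
  qed
qed

lemma eb_periodic: "periodic_2pi (eb k)"
proof -
  have pc: "periodic_2pi (cos :: real \<Rightarrow> real)" and ps: "periodic_2pi (sin :: real \<Rightarrow> real)"
    by (simp_all add: periodic_2pi_def)
  have 1: "cos (of_int k * (x + 2 * pi)) = cos (of_int k * x)" for x
    using periodic_int[OF pc, of "of_int k * x" k] by (simp add: algebra_simps)
  have 2: "sin (of_int (- k) * (x + 2 * pi)) = sin (of_int (- k) * x)" for x
    using periodic_int[OF ps, of "of_int (- k) * x" "- k"] by (simp add: algebra_simps)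
  show ?thesis unfolding periodic_2pi_def eb_def using 1 2 by presburger
qed

lemma CP_eb: "CP n (eb k)"
proof (induction n arbitrary: k)
  case 0
  show ?case by (rule CP_0I[OF eb_periodic])
      (auto intro!: continuous_at_imp_continuous_on intro: DERIV_isCont[OF eb_deriv])
next
  case (Suc n)
  show ?case by (rule CP_SucI[OF eb_periodic eb_deriv CP_cmult[OF Suc.IH]])
qed

lemma cont_eb: "cont (eb k)"
  using CP_cont[OF CP_eb[of 0]] .

lemma eb_1: "nth_deriv 1 (eb k) = (\<lambda>x. - of_int k * eb (- k) x)"
  using nth_deriv_eqI[OF eb_deriv, of 0 k] by simp

lemma eb_2: "nth_deriv 2 (eb k) = (\<lambda>x. - (of_int k)\<^sup>2 * eb k x)"
proof -
  have "nth_deriv 2 (eb k) = nth_deriv 1 (nth_deriv 1 (eb k))"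
    using nth_deriv_Suc[of 1 "eb k"] by (simp add: numeral_2_eq_2)
  also have "\<dots> = (\<lambda>x. - of_int k * nth_deriv 1 (eb (- k)) x)"
    unfolding eb_1[of k] by (rule nth_deriv_cmult[OF CP_eb[of 1]]) simp
  finally show ?thesis by (simp add: eb_1 power2_eq_square fun_eq_iff del: One_nat_def)
qed

lemma eb_abs: "\<bar>eb k x\<bar> \<le> 1"
proof -
  have "1 \<le> sqrt pi" "1 \<le> sqrt (2 * pi)" using pi_gt3 by auto
  moreover from this have "\<bar>cos y\<bar> \<le> sqrt pi" "\<bar>sin y\<bar> \<le> sqrt pi" for y :: real
    using order_trans[OF abs_cos_le_one] order_trans[OF abs_sin_le_one] by blast+
  ultimately show ?thesis by (auto simp: eb_def divide_simps)
qed

lemma eb_sq: "k \<noteq> 0 \<Longrightarrow> (eb k x)\<^sup>2 + (eb (- k) x)\<^sup>2 = 1 / pi"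
  using sin_cos_squared_add[of "of_int k * x"] sin_cos_squared_add[of "of_int (- k) * x"]
  by (auto simp: eb_def power_divide add_divide_distrib[symmetric] add.commute)

text \<open>Integrating by parts twice separates modes with different k^2; the pair k, - k shares
  its eigenvalue and is separated by the exact derivative of \<open>(eb k)\<close> squared.\<close>

lemma ip_eb_ne:
  assumes "j \<noteq> k" shows "ip (eb j) (eb k) = 0"
proof (cases "j = - k")
  case True
  then have k: "k \<noteq> 0" using assms by auto
  have "circ (\<lambda>x. - of_int k * eb (- k) x * (2 * eb k x)) = 0"
    by (rule circ_deriv[of "\<lambda>x. (eb k x)\<^sup>2"])
      (use eb_periodic[of k] in \<open>auto simp: periodic_2pi_def intro!: derivative_eq_intros eb_deriv\<close>)
  then have "circ (\<lambda>x. (- 2 * of_int k) * (eb (- k) x * eb k x)) = 0" by (simp add: algebra_simps)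
  then show ?thesis unfolding circ_cmult using k True by (simp add: ip_circ)
next
  case False
  have "ip (nth_deriv 2 (eb j)) (eb k) = ip (eb j) (nth_deriv 2 (eb k))"
    using ip_parts_n[OF CP_eb[of 2 j] CP_eb[of 2 k]] by simp
  then have "(of_int j)\<^sup>2 * ip (eb j) (eb k) = (of_int k)\<^sup>2 * ip (eb j) (eb k)"
    unfolding eb_2 ip_cmult ip_cmult2 by simp
  moreover have "(of_int j)\<^sup>2 \<noteq> ((of_int k)\<^sup>2 :: real)"
    using assms False by (auto simp: power2_eq_iff simp flip: of_int_minus)
  ultimately show ?thesis by simp
qed

text \<open>The exact derivative of \<open>eb k x * eb (- k) x\<close> shows that both functions
  have the same norm, and by \<open>eb_sq\<close> the two squared norms add up to 2.\<close>

lemma ip_eb_same: "ip (eb k) (eb k) = 1"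
proof (cases "k = 0")
  case True
  have "eb 0 = (\<lambda>x. 1 / sqrt (2 * pi))" by (simp add: eb_def fun_eq_iff)
  then show ?thesis using True by (simp add: ip_def)
next
  case False
  have "circ (\<lambda>x. of_int k * (eb k x)\<^sup>2 - of_int k * (eb (- k) x)\<^sup>2) = 0"
    by (rule circ_deriv[of "\<lambda>x. eb k x * eb (- k) x"])
      (use eb_periodic[of k] eb_periodic[of "- k"] eb_deriv[of "- k"]
        in \<open>auto simp: periodic_2pi_def power2_eq_square intro!: derivative_eq_intros eb_deriv\<close>)
  then have "of_int k * ip (eb k) (eb k) - of_int k * ip (eb (- k)) (eb (- k)) = 0"
    by (subst (asm) circ_diff) (auto simp: ip_circ circ_cmult power2_eq_square intro!: continuous_on_mult cont_eb)
  then have 1: "ip (eb k) (eb k) = ip (eb (- k)) (eb (- k))" using False by simp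
  have "circ (\<lambda>x. (eb k x)\<^sup>2 + (eb (- k) x)\<^sup>2) = 2"
    unfolding eb_sq[OF False] by (simp add: circ_const)
  then have "ip (eb k) (eb k) + ip (eb (- k)) (eb (- k)) = 2"
    by (subst (asm) circ_add) (auto simp: ip_circ power2_eq_square intro!: continuous_on_mult cont_eb)
  then show ?thesis using 1 by simp
qed

lemma ip_eb: "ip (eb j) (eb k) = (if j = k then 1 else 0)"
  by (simp add: ip_eb_ne ip_eb_same)

definition fc :: "(real \<Rightarrow> real) \<Rightarrow> int \<Rightarrow> real" where "fc f k = ip f (eb k)"

definition four :: "int set \<Rightarrow> (real \<Rightarrow> real) \<Rightarrow> real \<Rightarrow> real" where
  "four F f x = (\<Sum>k\<in>F. fc f k * eb k x)"

lemma CP_four: "finite F \<Longrightarrow> CP n (four F f)"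
  unfolding four_def by (intro CP_sum CP_cmult CP_eb)

lemma cont_four: "finite F \<Longrightarrow> cont (four F f)"
  using CP_cont[OF CP_four[of F 0]] .

lemma ip_four: "finite F \<Longrightarrow> cont g \<Longrightarrow> ip (four F f) g = (\<Sum>k\<in>F. fc f k * fc g k)"
  unfolding four_def
  by (subst ip_sum) (auto simp: ip_cmult fc_def ip_commute[of g] intro!: continuous_on_mult cont_eb)

lemma fc_four: "finite F \<Longrightarrow> fc (four F f) k = (if k \<in> F then fc f k else 0)"
  unfolding fc_def[of "four F f"] ip_four[OF _ cont_eb] by (simp add: fc_def[of "eb _"] ip_eb if_distrib sum.delta cong: if_cong)

lemma fc_add: "cont f \<Longrightarrow> cont g \<Longrightarrow> fc (\<lambda>x. f x + g x) k = fc f k + fc g k"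
  unfolding fc_def by (intro ip_add cont_eb)

lemma fc_diff: "cont f \<Longrightarrow> cont g \<Longrightarrow> fc (\<lambda>x. f x - g x) k = fc f k - fc g k"
  unfolding fc_def by (intro ip_diff cont_eb)

lemma fc_cmult: "fc (\<lambda>x. c * f x) k = c * fc f k"
  unfolding fc_def by (rule ip_cmult)

lemma ip_minus_four:
  assumes "finite F" "cont f"
  shows "ip (\<lambda>x. f x - four F f x) (\<lambda>x. f x - four F f x) = ip f f - (\<Sum>k\<in>F. (fc f k)\<^sup>2)"
proof -
  have c: "cont (four F f)" using assms(1) by (rule cont_four)
  have 1: "ip (four F f) (four F f) = (\<Sum>k\<in>F. (fc f k)\<^sup>2)"
    unfolding ip_four[OF assms(1) c] using assms(1)
    by (intro sum.cong) (simp_all add: fc_four power2_eq_square)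
  have "ip f (four F f) = (\<Sum>k\<in>F. (fc f k)\<^sup>2)"
    unfolding ip_commute[of f "four F f"] ip_four[OF assms] by (simp add: power2_eq_square)
  then show ?thesis unfolding ip_square_diff[OF assms(2) c] 1 by simp
qed

lemma bessel: "finite F \<Longrightarrow> cont f \<Longrightarrow> (\<Sum>k\<in>F. (fc f k)\<^sup>2) \<le> ip f f"
  using ip_minus_four[of F f] ip_pos[of "\<lambda>x. f x - four F f x"] cont_four[of F f]
  by (simp add: continuous_on_diff)

lemma fc_le_nrm: "cont f \<Longrightarrow> \<bar>fc f k\<bar> \<le> nrm f"
  using ip_le_nrm[of f "eb k"] cont_eb by (simp add: fc_def nrm_def[of "eb k"] ip_eb_same)

lemma fc_deriv: "CP 1 f \<Longrightarrow> fc (nth_deriv 1 f) k = of_int k * fc f (- k)"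
  using ip_parts[OF _ CP_eb, of f k] ip_cmult2[of f "- of_int k" "eb (- k)"]
  by (simp add: fc_def eb_1 del: One_nat_def)

lemma fc_deriv2: assumes "CP 2 f" shows "fc (nth_deriv 2 f) k = - (of_int k)\<^sup>2 * fc f k"
  unfolding fc_def by (subst ip_parts_n[OF assms CP_eb]) (simp only: eb_2 ip_cmult2, simp)

text \<open>Each derivative swaps the indices k and - k and may change the sign. Squaring hides the
  sign, and \<open>sum_sym\<close> later undoes the swap on symmetric index ranges.\<close>

lemma fc_nth: "CP n f \<Longrightarrow> (fc (nth_deriv n f) k)\<^sup>2 = (of_int k ^ n * fc f ((-1) ^ n * k))\<^sup>2"
proof (induction n arbitrary: f)
  case (Suc n)
  have "(fc (nth_deriv (Suc n) f) k)\<^sup>2 = (of_int k ^ n * fc (nth_deriv 1 f) ((-1) ^ n * k))\<^sup>2"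
    unfolding nth_deriv_Suc using Suc.IH[OF CP_deriv[OF Suc.prems]] .
  also have "fc (nth_deriv 1 f) ((-1) ^ n * k) = of_int ((-1) ^ n * k) * fc f (- ((-1) ^ n * k))"
    by (rule fc_deriv) (rule CP_mono[OF Suc.prems], simp)
  finally show ?case by (simp add: power_mult_distrib power_mult[symmetric] mult_ac)
qed simp

section \<open>Density of trigonometric polynomials, Parseval and Poincare inequalities\<close>

inductive trigp :: "(real \<Rightarrow> real) \<Rightarrow> bool" where
  tcos: "trigp (\<lambda>x. c * cos (of_int k * x))"
| tsin: "trigp (\<lambda>x. c * sin (of_int k * x))"
| tadd: "trigp f \<Longrightarrow> trigp g \<Longrightarrow> trigp (\<lambda>x. f x + g x)"

text \<open>The product-to-sum formulas make the class contain every polynomial in cos and sin, as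
  Stone-Weierstrass asks; admitting all integer frequencies avoids a case split on the sign of k -
  j.\<close>

lemma trigp_mult:
  assumes "trigp f" "trigp g" shows "trigp (\<lambda>x. f x * g x)"
  using assms(1)
proof (induction rule: trigp.induct)
  case (tcos c k)
  from assms(2) show ?case
  proof (induction rule: trigp.induct)
    case (tcos d j)
    have "(\<lambda>x. c * cos (of_int k * x) * (d * cos (of_int j * x))) =
      (\<lambda>x. c * d / 2 * cos (of_int (k - j) * x) + c * d / 2 * cos (of_int (k + j) * x))"
      by (simp add: fun_eq_iff cos_add cos_diff algebra_simps)
    then show ?case by (simp only:) (intro trigp.intros)
  next
    case (tsin d j)
    have "(\<lambda>x. c * cos (of_int k * x) * (d * sin (of_int j * x))) =
      (\<lambda>x. c * d / 2 * sin (of_int (j + k) * x) + c * d / 2 * sin (of_int (j - k) * x))"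
      by (simp add: fun_eq_iff sin_add sin_diff algebra_simps)
    then show ?case by (simp only:) (intro trigp.intros)
  qed (auto simp: ring_distribs intro: trigp.intros)
next
  case (tsin c k)
  from assms(2) show ?case
  proof (induction rule: trigp.induct)
    case (tcos d j)
    have "(\<lambda>x. c * sin (of_int k * x) * (d * cos (of_int j * x))) =
      (\<lambda>x. c * d / 2 * sin (of_int (k + j) * x) + c * d / 2 * sin (of_int (k - j) * x))"
      by (simp add: fun_eq_iff sin_add sin_diff algebra_simps)
    then show ?case by (simp only:) (intro trigp.intros)
  next
    case (tsin d j)
    have "(\<lambda>x. c * sin (of_int k * x) * (d * sin (of_int j * x))) =
      (\<lambda>x. c * d / 2 * cos (of_int (k - j) * x) + (- c * d / 2) * cos (of_int (k + j) * x))"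
      by (simp add: fun_eq_iff cos_add cos_diff algebra_simps)
    then show ?case by (simp only:) (intro trigp.intros)
  qed (auto simp: ring_distribs intro: trigp.intros)
qed (auto simp: ring_distribs intro: trigp.intros)

lemma trigp_const: "trigp (\<lambda>x. c)"
  using tcos[of c 0] by simp

lemma trigp_real_poly:
  assumes "real_polynomial_function (p :: complex \<Rightarrow> real)"
  shows "trigp (\<lambda>x. p (cis x))"
  using assms
proof (induction p rule: real_polynomial_function.induct)
  case (linear f)
  have "f (cis x) = f 1 * cos (of_int 1 * x) + f \<i> * sin (of_int 1 * x)" for x
  proof -
    interpret bounded_linear f by fact
    have "cis x = cos x *\<^sub>R 1 + sin x *\<^sub>R \<i>" by (simp add: complex_eq_iff)
    then show ?thesis by (simp only: add scaleR) simp
  qed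
  then show ?case by (simp only:) (intro trigp.intros)
next
  case (const c)
  show ?case by (rule trigp_const)
next
  case (add f g)
  then show ?case by (auto intro: tadd)
next
  case (mult f g)
  then show ?case by (auto intro: trigp_mult)
qed

lemma trigp_cont: "trigp f \<Longrightarrow> cont f"
  by (induction rule: trigp.induct) (auto intro!: continuous_intros)

text \<open>Completeness uses orthogonality only, so a cut-off frequency is recorded in place of the
  Fourier coefficients of T.\<close>

lemma trigp_eb: "trigp T \<Longrightarrow> \<exists>N. \<forall>g. cont g \<longrightarrow> (\<forall>k. \<bar>k\<bar> \<le> N \<longrightarrow> ip g (eb k) = 0) \<longrightarrow> ip g T = 0"
proof (induction rule: trigp.induct)
  case (tcos c k)
  have "(\<lambda>x. c * cos (of_int k * x)) =
     (\<lambda>x. (if k = 0 then c * sqrt (2 * pi) else c * sqrt pi) * eb \<bar>k\<bar> x)"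
    by (cases "k \<ge> 0") (auto simp: eb_def fun_eq_iff real_sqrt_mult)
  then show ?case by (intro exI[of _ "\<bar>k\<bar>"]) (simp only: ip_cmult2, simp)
next
  case (tsin c k)
  have "(\<lambda>x. c * sin (of_int k * x)) = (\<lambda>x. (sgn (of_int k) * c * sqrt pi) * eb (- \<bar>k\<bar>) x)"
    by (cases "k \<ge> 0"; cases "k = 0") (auto simp: eb_def fun_eq_iff)
  then show ?case by (intro exI[of _ "\<bar>k\<bar>"]) (simp only: ip_cmult2, simp)
next
  case (tadd f g)
  then obtain N M where
    "\<forall>g. cont g \<longrightarrow> (\<forall>k. \<bar>k\<bar> \<le> N \<longrightarrow> ip g (eb k) = 0) \<longrightarrow> ip g f = 0"
    "\<forall>h. cont h \<longrightarrow> (\<forall>k. \<bar>k\<bar> \<le> M \<longrightarrow> ip h (eb k) = 0) \<longrightarrow> ip h g = 0" by blast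
  then show ?case
    using trigp_cont[OF tadd.hyps(1)] trigp_cont[OF tadd.hyps(2)]
    by (intro exI[of _ "max N M"]) (auto simp: ip_add2)
qed

lemma trig_dense:
  assumes "periodic_2pi f" "cont f" "\<epsilon> > 0"
  obtains T where "trigp T" "\<And>x. \<bar>f x - T x\<bar> < \<epsilon>"
proof -
  define F where "F z = f (Arg z)" for z
  have F: "F (cis x) = f x" for x
  proof -
    have "cis (Arg (cis x)) = cis x" using cis_Arg[of "cis x"] by (simp add: sgn_div_norm)
    then obtain k :: int where "x = Arg (cis x) + 2 * pi * of_int k"
      by (metis cis_cnj cis_conv_exp complex_exp_exists of_real_eq_iff sin_cos_eq_iff cis.sel)
    then show ?thesis unfolding F_def using periodic_int[OF assms(1), of "Arg (cis x)" k] by simp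
  qed
  \<comment> \<open>\<open>Arg\<close> jumps at the negative axis, so continuity is read off from
    preimages of closed sets: they are images under \<open>cis\<close> of compact subsets of the
    interval.\<close>
  have cF: "continuous_on (sphere 0 1) F"
    unfolding continuous_on_closed_vimage[OF closed_sphere]
  proof (intro allI impI)
    fix B :: "real set" assume B: "closed B"
    have "F -` B \<inter> sphere 0 1 = cis ` ({0..2 * pi} \<inter> f -` B)"
    proof (intro subset_antisym subsetI)
      fix z assume z: "z \<in> F -` B \<inter> sphere 0 1"
      then have "z \<noteq> 0" by auto
      then have "z = cis (Arg z)" using cis_Arg[of z] z by (simp add: sgn_div_norm)
      obtain y k where y: "y \<in> {0..<2 * pi}" "f y = f (Arg z)" "y = Arg z + 2 * pi * of_int k"
        using periodic_reduce[OF assms(1)] by metis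
      have "cis y = cis (Arg z)"
        unfolding y(3) cis_mult[symmetric] using cis_multiple_2pi[of "of_int k"] by simp
      then show "z \<in> cis ` ({0..2 * pi} \<inter> f -` B)"
        using y z \<open>z = cis (Arg z)\<close> by (intro image_eqI[of _ _ y]) (auto simp: F_def)
    qed (auto simp: F)
    moreover have "compact ({0..2 * pi} \<inter> f -` B)"
      using B assms(2) by (intro compact_Int_closed closed_vimage) (auto simp: )
    ultimately show "closed (F -` B \<inter> sphere 0 1)"
      by (auto intro!: compact_imp_closed compact_continuous_image continuous_intros)
  qed
  obtain p where p: "real_polynomial_function p" "\<And>z. z \<in> sphere 0 1 \<Longrightarrow> \<bar>F z - p z\<bar> < \<epsilon>"
    using Stone_Weierstrass_real_polynomial_function[OF compact_sphere cF assms(3)] by blast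
  show ?thesis
    using that[OF trigp_real_poly[OF p(1)]] p(2)[of "cis _"] by (simp add: F)
qed

text \<open>Best approximation: the remainder g is orthogonal to its partial sum and to the
  approximant T, so |g|^2 = <g, f - T>, and |g| is at most the norm of f - T.\<close>

lemma four_complete:
  assumes "periodic_2pi f" "cont f" "\<epsilon> > 0"
  obtains N where "\<And>n. n \<ge> N \<Longrightarrow> nrm (\<lambda>x. f x - four {-n..n} f x) < \<epsilon>"
proof -
  obtain T where T: "trigp T" "\<And>x. \<bar>f x - T x\<bar> < \<epsilon> / 4"
    using trig_dense[OF assms(1,2), of "\<epsilon> / 4"] assms(3) by auto
  obtain N where N: "\<And>g. cont g \<Longrightarrow> (\<And>k. \<bar>k\<bar> \<le> N \<Longrightarrow> ip g (eb k) = 0) \<Longrightarrow> ip g T = 0"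
    using trigp_eb[OF T(1)] by blast
  show ?thesis
  proof (rule that[of N])
    fix n assume n: "n \<ge> N"
    let ?S = "four {-n..n} f" and ?g = "\<lambda>x. f x - four {-n..n} f x"
    have c: "cont ?S" "cont ?g" "cont T" "cont (\<lambda>x. f x - T x)"
      using assms(2) trigp_cont[OF T(1)] by (simp_all add: continuous_on_diff cont_four)
    have z: "ip ?g (eb k) = 0" if "\<bar>k\<bar> \<le> n" for k
      using fc_diff[of f ?S k] fc_four[of "{-n..n}" f k] c assms(2) that by (auto simp: fc_def)
    have 1: "ip ?g T = 0" by (rule N) (use z n c in auto)
    have "ip ?g ?S = (\<Sum>k\<in>{-n..n}. fc f k * fc ?g k)"
      using ip_four[of "{-n..n}" ?g f] c by (simp add: ip_commute)
    also have "\<dots> = 0" using z by (intro sum.neutral) (auto simp: fc_def)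
    finally have "ip ?g ?g = ip ?g (\<lambda>x. f x - T x)"
      using 1 c assms(2) ip_diff2[of f ?S ?g] ip_diff2[of f T ?g] by simp
    also have "\<dots> \<le> nrm ?g * nrm (\<lambda>x. f x - T x)" using ip_le_nrm[OF c(2,4)] by simp
    also have "\<dots> \<le> nrm ?g * (3 * (\<epsilon> / 4))"
      using nrm_bound[OF c(4), of "\<epsilon> / 4"] T(2) nrm_nonneg[OF c(2)]
      by (intro mult_left_mono) (auto intro: less_imp_le)
    finally have "(nrm ?g)\<^sup>2 \<le> nrm ?g * (3 * (\<epsilon> / 4))" using nrm_sq[OF c(2)] by simp
    then have "nrm ?g \<le> 3 * (\<epsilon> / 4)" using nrm_nonneg[OF c(2)] assms(3)
      by (cases "nrm ?g = 0") (auto simp: power2_eq_square)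
    then show "nrm ?g < \<epsilon>" using assms(3) by simp
  qed
qed

lemma parseval_le:
  assumes "periodic_2pi f" "cont f" "\<And>n. (\<Sum>k\<in>{-n..n}. (fc f k)\<^sup>2) \<le> B"
  shows "ip f f \<le> B"
proof (rule field_le_epsilon)
  fix e :: real assume e: "e > 0"
  obtain N where "nrm (\<lambda>x. f x - four {-N..N} f x) < sqrt e"
    using four_complete[OF assms(1,2), of "sqrt e"] e by (metis order_refl real_sqrt_gt_zero)
  then have "ip (\<lambda>x. f x - four {-N..N} f x) (\<lambda>x. f x - four {-N..N} f x) < e"
    by (simp add: nrm_def)
  then show "ip f f \<le> B + e" using ip_minus_four[of "{-N..N}" f] assms(3)[of N] assms(2) by simp
qed

lemma sum_sym: "(\<Sum>k\<in>{-n..n}. h ((-1) ^ j * k)) = (\<Sum>k\<in>{-n..n::int}. (h k :: real))"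
proof (cases "even j")
  case False
  have "(\<Sum>k\<in>{-n..n}. h (- k)) = (\<Sum>k\<in>{-n..n}. h k)"
    by (rule sum.reindex_bij_witness[of _ uminus uminus]) auto
  then show ?thesis using False by simp
qed simp

lemma nth_parseval_le:
  assumes "CP j f" "\<And>n. (\<Sum>k\<in>{-n..n}. (of_int k ^ j * fc f k)\<^sup>2) \<le> B"
  shows "ip (nth_deriv j f) (nth_deriv j f) \<le> B"
proof (rule parseval_le)
  show "periodic_2pi (nth_deriv j f)" using CP_periodic[OF CP_nth[of j 0 f]] assms by simp
  show "cont (nth_deriv j f)" using CP_contj[OF assms(1)] by simp
  fix n
  have "(\<Sum>k\<in>{-n..n}. (fc (nth_deriv j f) k)\<^sup>2) = (\<Sum>k\<in>{-n..n}. (\<lambda>k. (of_int k ^ j * fc f k)\<^sup>2) ((-1) ^ j * k))"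
    unfolding fc_nth[OF assms(1)] by (intro sum.cong) (auto simp: power_mult_distrib power_mult[symmetric])
  also have "\<dots> = (\<Sum>k\<in>{-n..n}. (of_int k ^ j * fc f k)\<^sup>2)"
    by (rule sum_sym[of "\<lambda>k. (of_int k ^ j * fc f k)\<^sup>2" j n])
  also have "\<dots> \<le> B" by (rule assms(2))
  finally show "(\<Sum>k\<in>{-n..n}. (fc (nth_deriv j f) k)\<^sup>2) \<le> B" .
qed

lemma nth_bessel:
  assumes "CP j f"
  shows "(\<Sum>k\<in>{-n..n}. (of_int k ^ j * fc f k)\<^sup>2) \<le> ip (nth_deriv j f) (nth_deriv j f)"
proof -
  have "(\<Sum>k\<in>{-n..n}. (of_int k ^ j * fc f k)\<^sup>2) = (\<Sum>k\<in>{-n..n}. (\<lambda>k. (of_int k ^ j * fc f k)\<^sup>2) ((-1) ^ j * k))"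
    by (rule sum_sym[of "\<lambda>k. (of_int k ^ j * fc f k)\<^sup>2" j n, symmetric])
  also have "\<dots> = (\<Sum>k\<in>{-n..n}. (fc (nth_deriv j f) k)\<^sup>2)"
    unfolding fc_nth[OF assms(1)] by (intro sum.cong) (auto simp: power_mult_distrib power_mult[symmetric])
  also have "\<dots> \<le> ip (nth_deriv j f) (nth_deriv j f)"
    using bessel CP_contj[OF assms(1)] by auto
  finally show ?thesis .
qed

text \<open>Poincare inequality, by comparing the Fourier sums of f and f' term by term.\<close>

lemma coercive:
  assumes "CP 1 f" "0 \<le> m" "\<And>k. fc f k \<noteq> 0 \<Longrightarrow> m \<le> \<bar>k\<bar>"
  shows "(of_int m)\<^sup>2 * ip f f \<le> ip (nth_deriv 1 f) (nth_deriv 1 f)"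
proof (cases "m = 0")
  case True
  then show ?thesis using ip_pos CP_contj[OF assms(1), of 1] by simp
next
  case False
  have "ip f f \<le> ip (nth_deriv 1 f) (nth_deriv 1 f) / (of_int m)\<^sup>2"
  proof (rule parseval_le)
    fix n
    have "(of_int m)\<^sup>2 * (\<Sum>k\<in>{-n..n}. (fc f k)\<^sup>2) \<le> (\<Sum>k\<in>{-n..n}. (of_int k ^ 1 * fc f k)\<^sup>2)"
      unfolding sum_distrib_left
    proof (rule sum_mono)
      fix k
      show "(of_int m)\<^sup>2 * (fc f k)\<^sup>2 \<le> (of_int k ^ 1 * fc f k)\<^sup>2"
      proof (cases "fc f k = 0")
        case False
        then have "\<bar>m\<bar> \<le> \<bar>k\<bar>" using assms(2,3) by auto
        then have "(of_int m)\<^sup>2 \<le> (of_int k :: real)\<^sup>2" by (metis abs_le_square_iff of_int_abs of_int_le_iff)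
        then show ?thesis by (simp add: power_mult_distrib mult_right_mono)
      qed simp
    qed
    also have "\<dots> \<le> ip (nth_deriv 1 f) (nth_deriv 1 f)" by (rule nth_bessel[OF assms(1)])
    finally show "(\<Sum>k\<in>{-n..n}. (fc f k)\<^sup>2) \<le> ip (nth_deriv 1 f) (nth_deriv 1 f) / (of_int m)\<^sup>2"
      using False by (simp add: field_simps)
  qed (use assms CP_cont CP_periodic in auto)
  then show ?thesis using False by (simp add: field_simps)
qed

section \<open>Uniformly bounded families\<close>

text \<open>Boundedness in C^n, uniform in an index that will be the rescaled time. The derivative
  is existentially quantified, so each closure rule supplies its own formula for it;
  \<open>fam_nth_bound\<close> recovers bounds on \<open>nth_deriv\<close>.\<close>

primrec fam :: "nat \<Rightarrow> 'i set \<Rightarrow> ('i \<Rightarrow> real \<Rightarrow> real) \<Rightarrow> bool" where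
  "fam 0 I f \<longleftrightarrow> (\<forall>i\<in>I. cont (f i)) \<and> (\<exists>B. \<forall>i\<in>I. \<forall>x. \<bar>f i x\<bar> \<le> B)"
| "fam (Suc n) I f \<longleftrightarrow> (\<exists>B. \<forall>i\<in>I. \<forall>x. \<bar>f i x\<bar> \<le> B) \<and>
     (\<exists>f'. fam n I f' \<and> (\<forall>i\<in>I. \<forall>x. (f i has_real_derivative f' i x) (at x)))"

lemma fam_bounded: "fam n I f \<Longrightarrow> \<exists>B. \<forall>i\<in>I. \<forall>x. \<bar>f i x\<bar> \<le> B"
  by (cases n) auto

lemma fam_bound: assumes "fam n I f" obtains B where "B > 0" "\<And>i x. i \<in> I \<Longrightarrow> \<bar>f i x\<bar> \<le> B"
proof -
  obtain B where "\<forall>i\<in>I. \<forall>x. \<bar>f i x\<bar> \<le> B" using fam_bounded[OF assms] by blast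
  then show ?thesis by (intro that[of "max B 1"]) (auto simp: le_max_iff_disj)
qed

lemma fam_cont: assumes "fam n I f" "i \<in> I" shows "cont (f i)"
proof (cases n)
  case (Suc m)
  then obtain f' where "\<forall>i\<in>I. \<forall>x. (f i has_real_derivative f' i x) (at x)" using assms by auto
  then show ?thesis using assms(2)
    by (meson DERIV_isCont continuous_at_imp_continuous_on)
qed (use assms in auto)

lemma fam_Suc: "fam (Suc n) I f \<Longrightarrow> fam n I f"
proof (induction n arbitrary: f)
  case 0
  then show ?case using fam_cont[OF 0] fam_bounded[OF 0] by auto
next
  case (Suc n)
  then show ?case by (subst fam.simps(2)) (use Suc in \<open>auto simp del: fam.simps simp: fam.simps(2)[of "Suc n"]\<close>)
qed

lemma fam_mono: assumes "fam n I f" "m \<le> n" shows "fam m I f"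
  using assms(2,1) by (induction rule: dec_induct) (use fam_Suc in blast)+

lemma fam_subset: "fam n I f \<Longrightarrow> J \<subseteq> I \<Longrightarrow> fam n J f"
proof (induction n arbitrary: f)
  case (Suc n)
  then obtain B f' where "\<forall>i\<in>I. \<forall>x. \<bar>f i x\<bar> \<le> B" "fam n I f'"
    "\<forall>i\<in>I. \<forall>x. (f i has_real_derivative f' i x) (at x)" by auto
  then show ?case using Suc.IH[of f'] Suc.prems(2) by auto blast+
qed (simp, blast)

lemma fam_SucI:
  assumes "fam n I f" "fam n I f'" "\<And>i x. i \<in> I \<Longrightarrow> (f i has_real_derivative f' i x) (at x)"
  shows "fam (Suc n) I f"
  using assms fam_bounded[OF assms(1)] by auto

lemma fam_SucE:
  assumes "fam (Suc n) I f"
  obtains f' where "fam n I f'" "\<And>i x. i \<in> I \<Longrightarrow> (f i has_real_derivative f' i x) (at x)"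
  using assms by auto

lemma fam_cong: assumes "fam n I f" "\<And>i. i \<in> I \<Longrightarrow> f i = g i" shows "fam n I g"
  using assms by (cases n) auto

lemma fam_const: "(\<And>i. i \<in> I \<Longrightarrow> \<bar>c i\<bar> \<le> B) \<Longrightarrow> fam n I (\<lambda>i x. c i)"
proof (induction n arbitrary: c B)
  case (Suc n)
  show ?case
    by (rule fam_SucI[where f' = "\<lambda>i x. 0"]) (use Suc.IH[of c] Suc.IH[of "\<lambda>i. 0" 0] Suc.prems in auto)
qed auto

lemma fam_const': "fam n I (\<lambda>i x. c)"
  by (rule fam_const[of I _ "\<bar>c\<bar>"]) simp

lemma fam_add: "fam n I f \<Longrightarrow> fam n I g \<Longrightarrow> fam n I (\<lambda>i x. f i x + g i x)"
proof (induction n arbitrary: f g)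
  case 0
  obtain B C where "\<And>i x. i \<in> I \<Longrightarrow> \<bar>f i x\<bar> \<le> B" "\<And>i x. i \<in> I \<Longrightarrow> \<bar>g i x\<bar> \<le> C"
    using fam_bound[OF 0(1)] fam_bound[OF 0(2)] by metis
  then have "\<And>i x. i \<in> I \<Longrightarrow> \<bar>f i x + g i x\<bar> \<le> B + C"
    by (meson abs_triangle_ineq add_mono order_trans)
  then show ?case using 0 by (auto intro!: continuous_on_add)
next
  case (Suc n)
  obtain f' where f: "fam n I f'" "\<And>i x. i \<in> I \<Longrightarrow> (f i has_real_derivative f' i x) (at x)"
    using fam_SucE[OF Suc.prems(1)] by metis
  obtain g' where g: "fam n I g'" "\<And>i x. i \<in> I \<Longrightarrow> (g i has_real_derivative g' i x) (at x)"
    using fam_SucE[OF Suc.prems(2)] by metis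
  show ?case
    by (rule fam_SucI[OF Suc.IH[OF fam_Suc[OF Suc.prems(1)] fam_Suc[OF Suc.prems(2)]] Suc.IH[OF f(1) g(1)]])
      (use f g in \<open>auto intro!: DERIV_add\<close>)
qed

lemma fam_mult: "fam n I f \<Longrightarrow> fam n I g \<Longrightarrow> fam n I (\<lambda>i x. f i x * g i x)"
proof (induction n arbitrary: f g)
  case 0
  obtain B C where BC: "B > 0" "\<And>i x. i \<in> I \<Longrightarrow> \<bar>f i x\<bar> \<le> B" "\<And>i x. i \<in> I \<Longrightarrow> \<bar>g i x\<bar> \<le> C"
    using fam_bound[OF 0(1)] fam_bound[OF 0(2)] by metis
  then have "\<And>i x. i \<in> I \<Longrightarrow> \<bar>f i x * g i x\<bar> \<le> B * C"
    unfolding abs_mult by (intro mult_mono) auto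
  then show ?case using 0 by (auto intro!: continuous_on_mult)
next
  case (Suc n)
  obtain f' where f: "fam n I f'" "\<And>i x. i \<in> I \<Longrightarrow> (f i has_real_derivative f' i x) (at x)"
    using fam_SucE[OF Suc.prems(1)] by metis
  obtain g' where g: "fam n I g'" "\<And>i x. i \<in> I \<Longrightarrow> (g i has_real_derivative g' i x) (at x)"
    using fam_SucE[OF Suc.prems(2)] by metis
  note fg = fam_Suc[OF Suc.prems(1)] fam_Suc[OF Suc.prems(2)]
  show ?case
    by (rule fam_SucI[OF Suc.IH[OF fg] fam_add[OF Suc.IH[OF f(1) fg(2)] Suc.IH[OF g(1) fg(1)]]])
      (use f g in \<open>auto intro!: DERIV_mult\<close>)
qed

lemma fam_cmult: "fam n I f \<Longrightarrow> fam n I (\<lambda>i x. c * f i x)"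
  using fam_mult[OF fam_const'[of n I c]] by simp

lemma fam_minus: "fam n I f \<Longrightarrow> fam n I (\<lambda>i x. - f i x)"
  using fam_cmult[of n I f "-1"] by simp

lemma fam_diff: "fam n I f \<Longrightarrow> fam n I g \<Longrightarrow> fam n I (\<lambda>i x. f i x - g i x)"
  using fam_add[OF _ fam_minus, of n I f g] by simp

lemma fam_cos_sin: "fam n I (\<lambda>i x. a * cos x + b * sin x)"
proof (induction n arbitrary: a b)
  case 0
  have "\<bar>a * cos x + b * sin x\<bar> \<le> \<bar>a\<bar> + \<bar>b\<bar>" for x
    by (intro order_trans[OF abs_triangle_ineq] add_mono) (auto simp: abs_mult mult_left_le)
  then show ?case by (auto intro!: continuous_intros)
next
  case (Suc n)
  show ?case
    by (rule fam_SucI[OF Suc.IH[of a b] Suc.IH[of b "- a"]]) (auto intro!: derivative_eq_intros)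
qed

lemma fam_cos: "fam n I (\<lambda>i x. cos x)" and fam_sin: "fam n I (\<lambda>i x. sin x)"
  using fam_cos_sin[of n I 1 0] fam_cos_sin[of n I 0 1] by auto

lemma powr_bound:
  fixes c B y a :: real
  assumes "0 < c" "c \<le> y" "y \<le> B" shows "\<bar>y powr a\<bar> \<le> c powr a + B powr a"
proof (cases "a \<ge> 0")
  case True
  then have "y powr a \<le> B powr a" using assms by (intro powr_mono2) auto
  then show ?thesis by (simp add: add_increasing)
next
  case False
  then have "y powr a \<le> c powr a" using assms by (intro powr_mono2') auto
  then show ?thesis by (simp add: add_increasing2)
qed

text \<open>Differentiation lowers the exponent, hence the induction over arbitrary a; the uniform
  lower bound c keeps negative powers bounded.\<close>

lemma fam_powr:
  assumes "fam n I f" "c > 0" "\<And>i x. i \<in> I \<Longrightarrow> c \<le> f i x"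
  shows "fam n I (\<lambda>i x. f i x powr a)"
  using assms
proof (induction n arbitrary: a)
  case 0
  obtain B where B: "\<And>i x. i \<in> I \<Longrightarrow> \<bar>f i x\<bar> \<le> B" using fam_bound[OF 0(1)] by metis
  have "\<bar>f i x powr a\<bar> \<le> c powr a + B powr a" if "i \<in> I" for i x
    by (rule powr_bound[OF 0(2) 0(3)[OF that]]) (use B[OF that, of x] in auto)
  moreover have "cont (\<lambda>x. f i x powr a)" if i: "i \<in> I" for i
  proof -
    have "f i x \<noteq> 0" for x using 0(2) 0(3)[OF i, of x] by linarith
    then show ?thesis using 0(1) i by (intro continuous_on_powr) auto
  qed
  ultimately show ?case by auto
next
  case (Suc n)
  obtain f' where f: "fam n I f'" "\<And>i x. i \<in> I \<Longrightarrow> (f i has_real_derivative f' i x) (at x)"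
    using fam_SucE[OF Suc.prems(1)] by metis
  note IH = Suc.IH[OF fam_Suc[OF Suc.prems(1)] Suc.prems(2,3)]
  show ?case
  proof (rule fam_SucI[OF IH fam_mult[OF fam_cmult[OF IH[of "a - 1"], of a] f(1)]])
    fix i x assume i: "i \<in> I"
    have "0 < f i x" using Suc.prems(2) Suc.prems(3)[OF i, of x] by linarith
    then show "((\<lambda>x. f i x powr a) has_real_derivative a * f i x powr (a - 1) * f' i x) (at x)"
      using f(2)[OF i, of x] by (auto intro!: derivative_eq_intros simp: field_simps powr_diff)
  qed
qed

text \<open>The inner function solves \<sigma>' = \<Phi>(\<sigma>), so the derivative of the
  composite is F' \<Phi> composed with \<sigma> again. In this form \<sigma> may be unbounded, as
  the inverse of the normal angle is.\<close>

lemma fam_compose: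
  assumes "fam n I F" "fam n I \<Phi>"
    "\<And>i x. i \<in> I \<Longrightarrow> (\<sigma> i has_real_derivative \<Phi> i (\<sigma> i x)) (at x)"
  shows "fam n I (\<lambda>i x. F i (\<sigma> i x))"
  using assms
proof (induction n arbitrary: F)
  case 0
  have "cont (\<lambda>x. F i (\<sigma> i x))" if i: "i \<in> I" for i
  proof -
    have "cont (\<sigma> i)" using 0(3)[OF i] by (meson DERIV_isCont continuous_at_imp_continuous_on)
    then show ?thesis using 0(1) i by (auto intro: continuous_on_compose2)
  qed
  moreover obtain B where "\<And>i x. i \<in> I \<Longrightarrow> \<bar>F i x\<bar> \<le> B" using fam_bound[OF 0(1)] by metis
  ultimately show ?case by auto
next
  case (Suc n)
  obtain F' where F: "fam n I F'" "\<And>i x. i \<in> I \<Longrightarrow> (F i has_real_derivative F' i x) (at x)"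
    using fam_SucE[OF Suc.prems(1)] by metis
  note p = fam_Suc[OF Suc.prems(2)]
  show ?case
    by (rule fam_SucI[OF Suc.IH[OF fam_Suc[OF Suc.prems(1)] p Suc.prems(3)]
          Suc.IH[OF fam_mult[OF F(1) p] p Suc.prems(3)]])
      (use DERIV_chain2[OF F(2) Suc.prems(3)] in auto)
qed

lemma fam_nth: "fam (j + n) I f \<Longrightarrow> fam n I (\<lambda>i. nth_deriv j (f i))"
proof (induction j arbitrary: f)
  case (Suc j)
  obtain f' where f: "fam (j + n) I f'" "\<And>i x. i \<in> I \<Longrightarrow> (f i has_real_derivative f' i x) (at x)"
    using fam_SucE Suc.prems by (metis add_Suc)
  show ?case
    by (rule fam_cong[OF Suc.IH[OF f(1)]]) (use nth_deriv_eqI[OF f(2)] in auto)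
qed simp

lemma fam_nth': "fam m I f \<Longrightarrow> j + n \<le> m \<Longrightarrow> fam n I (\<lambda>i. nth_deriv j (f i))"
  using fam_mono fam_nth by blast

lemma fam_CP: "fam n I f \<Longrightarrow> i \<in> I \<Longrightarrow> periodic_2pi (f i) \<Longrightarrow> CP n (f i)"
proof (induction n arbitrary: f)
  case 0
  then show ?case by (auto intro: CP_0I)
next
  case (Suc n)
  obtain f' where f: "fam n I f'" "\<And>i x. i \<in> I \<Longrightarrow> (f i has_real_derivative f' i x) (at x)"
    using fam_SucE[OF Suc.prems(1)] by metis
  have "periodic_2pi (f' i)" using periodic_deriv[OF Suc.prems(3) f(2)] Suc.prems(2) by blast
  then show ?case using CP_SucI[OF Suc.prems(3) f(2)] Suc.IH[OF f(1)] Suc.prems(2) by blast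
qed

lemma fam_nth_bound:
  assumes "fam n I f"
  obtains B where "B > 0" "\<And>i j x. i \<in> I \<Longrightarrow> j \<le> n \<Longrightarrow> \<bar>nth_deriv j (f i) x\<bar> \<le> B"
proof -
  have "\<exists>B>0. \<forall>i\<in>I. \<forall>x. \<bar>nth_deriv j (f i) x\<bar> \<le> B" if "j \<le> n" for j
    using fam_bound[OF fam_nth'[OF assms, of j 0]] that by (metis add.right_neutral)
  then obtain b where b: "\<And>j i x. j \<le> n \<Longrightarrow> i \<in> I \<Longrightarrow> \<bar>nth_deriv j (f i) x\<bar> \<le> b j" "\<And>j. j \<le> n \<Longrightarrow> b j > 0"
    by metis
  show ?thesis
  proof (rule that[of "\<Sum>j\<le>n. b j"])
    show "(\<Sum>j\<le>n. b j) > 0" using b(2) by (intro sum_pos) auto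
    fix i j x assume ij: "i \<in> I" "j \<le> n"
    have "b j \<le> (\<Sum>j\<le>n. b j)" using b(2) ij(2) by (intro member_le_sum) (auto intro: less_imp_le)
    then show "\<bar>nth_deriv j (f i) x\<bar> \<le> (\<Sum>j\<le>n. b j)" using b(1)[OF ij(2,1), of x] by linarith
  qed
qed

section \<open>Binomial expansion and differentiation under the integral\<close>

lemma powr_taylor:
  fixes a :: real
  obtains C where "C > 0" 
    "\<And>w. \<bar>w\<bar> \<le> 1 / 2 \<Longrightarrow> \<bar>(1 + w) powr a - (\<Sum>m<n. (a gchoose m) * w ^ m)\<bar> \<le> C * \<bar>w\<bar> ^ n"
proof (cases "n = 0")
  case True
  have "\<bar>(1 + w) powr a\<bar> \<le> (1 / 2) powr a + 2 powr a" if "\<bar>w\<bar> \<le> 1 / 2" for w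
    by (rule powr_bound) (use that in auto)
  then show ?thesis using True by (intro that[of "(1 / 2) powr a + 2 powr a"]) (auto simp: add_pos_pos)
next
  case False
  \<comment> \<open>\<open>D m\<close> is the m-th derivative of (1 + t)^a. \<open>K\<close> bounds
    \<open>D n\<close> for 1 / 2 <= 1 + t <= 2; the added 1 keeps it positive when the product
    vanishes.\<close>
  define D where "D m t = (\<Prod>i<m. a - of_nat i) * (1 + t) powr (a - of_nat m)" for m and t :: real
  define K where "K = \<bar>\<Prod>i<n. a - of_nat i\<bar> * ((1 / 2) powr (a - of_nat n) + 2 powr (a - of_nat n)) + 1"
  have K: "K > 0" unfolding K_def by (intro add_nonneg_pos mult_nonneg_nonneg add_nonneg_nonneg) auto
  have dD: "(D m has_real_derivative D (Suc m) t) (at t)" if "- 1 / 2 \<le> t" for m t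
    unfolding D_def using that
    by (auto intro!: derivative_eq_intros simp: powr_diff[symmetric] powr_one_gt_zero_iff algebra_simps powr_mult_base
        simp flip: powr_add)
  show ?thesis
  proof (rule that[OF K])
    fix w :: real assume w: "\<bar>w\<bar> \<le> 1 / 2"
    show "\<bar>(1 + w) powr a - (\<Sum>m<n. (a gchoose m) * w ^ m)\<bar> \<le> K * \<bar>w\<bar> ^ n"
    proof (cases "w = 0")
      case True
      have "(\<Sum>m<n. (a gchoose m) * w ^ m) = (\<Sum>m<n. if m = 0 then 1 else 0)"
        using True by (intro sum.cong) auto
      then show ?thesis using True False K by simp
    next
      case wn: False
      obtain t where t: "if w < 0 then w < t \<and> t < 0 else 0 < t \<and> t < w"
        "D 0 w = (\<Sum>m<n. D m 0 / fact m * (w - 0) ^ m) + D n t / fact n * (w - 0) ^ n"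
      proof -
        have "- 1 / 2 \<le> w" "w \<le> 1 / 2" using w by (auto simp: abs_le_iff)
        then have "\<exists>t. (if w < 0 then w < t \<and> t < 0 else 0 < t \<and> t < w) \<and>
            D 0 w = (\<Sum>m<n. D m 0 / fact m * (w - 0) ^ m) + D n t / fact n * (w - 0) ^ n"
          using dD False wn by (intro Taylor[of n D "D 0" "-1/2" "1/2"]) auto
        then show ?thesis using that by blast
      qed
      have tb: "1 / 2 \<le> 1 + t" "1 + t \<le> 2" using t(1) w by (auto split: if_splits)
      have "D m 0 / fact m = a gchoose m" for m
        by (simp add: D_def gbinomial_prod_rev atLeast0LessThan)
      then have e: "(1 + w) powr a - (\<Sum>m<n. (a gchoose m) * w ^ m) = D n t / fact n * w ^ n"
        using t(2) by (simp add: D_def)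
      have "\<bar>D n t\<bar> \<le> K"
        unfolding D_def K_def abs_mult using powr_bound[OF _ tb, of "a - of_nat n"]
        by (simp add: add_increasing2 mult_left_mono)
      moreover have "\<bar>D n t / fact n\<bar> \<le> \<bar>D n t\<bar>"
        using mult_right_mono[OF fact_ge_1[of n], of "\<bar>D n t\<bar>"] by (simp add: field_simps)
      ultimately show ?thesis unfolding e abs_mult power_abs by (intro mult_right_mono) auto
    qed
  qed
qed

lemma circ_limit:
  assumes "\<And>n. cont (f n)" "cont g" "\<And>n x. \<bar>f n x\<bar> \<le> B" "\<And>x. (\<lambda>n. f n x) \<longlonglongrightarrow> g x"
  shows "(\<lambda>n. circ (f n)) \<longlonglongrightarrow> circ g"
  unfolding circ_def
  by (rule dominated_convergence(2)[where h = "\<lambda>x. B"]) (use assms in \<open>auto intro!: cont_int\<close>)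

lemma diff_quotient_bound:
  fixes F G :: "real \<Rightarrow> real"
  assumes "\<And>s. s < b \<Longrightarrow> (F has_real_derivative G s) (at s)" "\<And>s. s < b \<Longrightarrow> \<bar>G s\<bar> \<le> B" "s < b" "t < b"
  shows "\<bar>F s - F t\<bar> \<le> B * \<bar>s - t\<bar>"
proof -
  have "norm (F s - F t) \<le> B * norm (s - t)"
    by (rule field_differentiable_bound[of "{..<b}" F G]) (use assms in \<open>auto intro: DERIV_subset\<close>)
  then show ?thesis by simp
qed

text \<open>Dominated convergence for the difference quotients, which the mean value inequality
  bounds by B. It speaks of sequences, hence the sequential form of the limit; dropping N terms
  brings the sequence into the half-line s < b.\<close>

lemma circ_has_derivative:
  assumes F: "\<And>s x. s < b \<Longrightarrow> ((\<lambda>s. F s x) has_real_derivative G s x) (at s)"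
    and c: "\<And>s. s < b \<Longrightarrow> cont (F s)" "\<And>s. s < b \<Longrightarrow> cont (G s)"
    and B: "\<And>s x. s < b \<Longrightarrow> \<bar>G s x\<bar> \<le> B" and t: "t < b"
  shows "((\<lambda>s. circ (F s)) has_real_derivative circ (G t)) (at t)"
  unfolding has_field_derivative_iff
proof (subst tendsto_at_iff_sequentially, intro allI impI)
  fix X :: "nat \<Rightarrow> real" assume X: "\<forall>i. X i \<in> UNIV - {t}" "X \<longlonglongrightarrow> t"
  obtain N where N: "\<And>n. n \<ge> N \<Longrightarrow> X n < b"
    using order_tendstoD(2)[OF X(2) t] by (auto simp: eventually_sequentially)
  define Y where "Y n = X (n + N)" for n
  have Y: "Y n < b" "Y n \<noteq> t" for n using N X(1) by (auto simp: Y_def)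
  have Yl: "Y \<longlonglongrightarrow> t" unfolding Y_def using X(2) by (rule LIMSEQ_ignore_initial_segment)
  have "(\<lambda>n. circ (\<lambda>x. (F (Y n) x - F t x) / (Y n - t))) \<longlonglongrightarrow> circ (G t)"
  proof (rule circ_limit[where B = B])
    fix n
    show "cont (\<lambda>x. (F (Y n) x - F t x) / (Y n - t))" 
      using c(1)[OF Y(1)] c(1)[OF t] Y by (intro continuous_on_divide continuous_on_diff) auto
    show "\<bar>(F (Y n) x - F t x) / (Y n - t)\<bar> \<le> B" for x
      using diff_quotient_bound[of b "\<lambda>s. F s x" "\<lambda>s. G s x" B "Y n" t] F B Y t
      by (simp add: field_simps abs_divide)
  next
    fix x
    have "filterlim Y (at t) sequentially" using Yl Y by (auto simp: filterlim_at)
    then show "(\<lambda>n. (F (Y n) x - F t x) / (Y n - t)) \<longlonglongrightarrow> G t x"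
      using F[OF t, of x] unfolding has_field_derivative_iff by (rule filterlim_compose[rotated])
  qed (rule c(2)[OF t])
  moreover have "circ (\<lambda>x. (F (Y n) x - F t x) / (Y n - t)) = (circ (F (Y n)) - circ (F t)) / (Y n - t)" for n
    using circ_cmult[of "1 / (Y n - t)" "\<lambda>x. F (Y n) x - F t x"] circ_diff[OF c(1)[OF Y(1)] c(1)[OF t], of n] by simp
  ultimately have "(\<lambda>n. (circ (F (X (n + N))) - circ (F t)) / (X (n + N) - t)) \<longlonglongrightarrow> circ (G t)"
    by (simp add: Y_def)
  then have "(\<lambda>n. (circ (F (X n)) - circ (F t)) / (X n - t)) \<longlonglongrightarrow> circ (G t)"
    by (rule LIMSEQ_offset)
  then show "((\<lambda>y. (circ (F y) - circ (F t)) / (y - t)) \<circ> X) \<longlonglongrightarrow> circ (G t)"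
    by (simp add: o_def)
qed

section \<open>Growth, interpolation and coercivity\<close>

text \<open>Each sign of k contributes at most 2, by comparison with the telescoping sum of 1 / (k -
  1) - 1 / k.\<close>

lemma sum_inverse_squares: "(\<Sum>k\<in>{-n..n} - {0::int}. 1 / (of_int k)\<^sup>2) \<le> (4::real)"
proof -
  define m where "m = nat n"
  have 1: "(\<Sum>k=1..m. 1 / (real k)\<^sup>2) \<le> 2 - 1 / real m" for m
  proof (induction m)
    case (Suc m)
    show ?case
    proof (cases "m = 0")
      case False
      have "1 / (real (Suc m))\<^sup>2 \<le> 1 / real m - 1 / real (Suc m)"
        using False by (simp add: divide_simps power2_eq_square)
      then show ?thesis using Suc by simp
    qed simp
  qed simp
  have s: "{-n..n} - {0} = int ` {1..m} \<union> (\<lambda>k. - int k) ` {1..m}"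
  proof (intro subset_antisym subsetI)
    fix k assume "k \<in> {-n..n} - {0}"
    then show "k \<in> int ` {1..m} \<union> (\<lambda>k. - int k) ` {1..m}"
      by (cases "k > 0") (auto simp: m_def image_iff intro!: bexI[of _ "nat \<bar>k\<bar>"])
  qed (auto simp: m_def)
  have "(\<Sum>k\<in>{-n..n} - {0::int}. 1 / (of_int k)\<^sup>2) = 
    (\<Sum>k\<in>int ` {1..m}. 1 / (of_int k)\<^sup>2) + (\<Sum>k\<in>(\<lambda>k. - int k) ` {1..m}. 1 / (of_int k :: real)\<^sup>2)"
    unfolding s by (rule sum.union_disjoint) auto
  also have "\<dots> = (\<Sum>k=1..m. 1 / (real k)\<^sup>2) + (\<Sum>k=1..m. 1 / (real k)\<^sup>2)"
    by (simp add: sum.reindex inj_on_def)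
  also have "\<dots> \<le> 4" using 1[of m] by (smt (verit) divide_nonneg_nonneg of_nat_0_le_iff)
  finally show ?thesis .
qed

text \<open>Monotonicity of y exp (- \<mu> s). It is read backwards in time: the present value
  controls the whole past, with exponential decay if \<mu> > 0.\<close>

lemma growth:
  fixes y y' :: "real \<Rightarrow> real"
  assumes "\<And>s. s < b \<Longrightarrow> (y has_real_derivative y' s) (at s)" "\<And>s. s < b \<Longrightarrow> \<mu> * y s \<le> y' s"
    "s \<le> t" "t < b"
  shows "y s \<le> y t * exp (\<mu> * (s - t))"
proof -
  have "y s * exp (- \<mu> * s) \<le> y t * exp (- \<mu> * t)"
  proof (rule DERIV_nonneg_imp_nondecreasing[OF assms(3)])
    fix x assume x: "s \<le> x" "x \<le> t"
    show "\<exists>z. ((\<lambda>s. y s * exp (- \<mu> * s)) has_real_derivative z) (at x) \<and> 0 \<le> z"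
    proof (intro exI conjI)
      show "((\<lambda>s. y s * exp (- \<mu> * s)) has_real_derivative (y' x - \<mu> * y x) * exp (- \<mu> * x)) (at x)"
        using assms(1)[of x] assms(4) x by (auto intro!: derivative_eq_intros simp: algebra_simps)
      show "0 \<le> (y' x - \<mu> * y x) * exp (- \<mu> * x)" using assms(2)[of x] assms(4) x by simp
    qed
  qed
  then have "y s * exp (- \<mu> * s) * exp (\<mu> * s) \<le> y t * exp (- \<mu> * t) * exp (\<mu> * s)"
    by (rule mult_right_mono) simp
  then show ?thesis by (simp add: mult.assoc exp_add[symmetric] algebra_simps)
qed

text \<open>For an ancient solution the limit at - infinity plays the part of an initial
  value.\<close>

lemma nonneg_of_nondecreasing:
  fixes y y' :: "real \<Rightarrow> real"
  assumes "\<And>s. s < b \<Longrightarrow> (y has_real_derivative y' s) (at s)" "\<And>s. s < b \<Longrightarrow> 0 \<le> y' s"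
    "(y \<longlongrightarrow> l) at_bot" "t < b"
  shows "l \<le> y t"
proof -
  have "\<forall>\<^sub>F s in at_bot. y s \<le> y t"
    using eventually_le_at_bot[of t]
  proof eventually_elim
    case (elim s)
    then show ?case using growth[of b y y' 0 s t] assms by auto
  qed
  from tendsto_upperbound[OF assms(3) this] show ?thesis by simp
qed

text \<open>Duhamel's formula from - infinity, as a comparison: A exp (\<beta> (s - t)) solves the
  equation with the extremal forcing, and its excess over c, weighted by exp (\<nu> (s - t)), is
  nondecreasing and starts from 0. The case \<nu> = 0 is included for neutral modes.\<close>

lemma ode_decay_upper:
  fixes c f :: "real \<Rightarrow> real"
  assumes c: "\<And>s. s < b \<Longrightarrow> (c has_real_derivative - \<nu> * c s + f s) (at s)"
    and f: "\<And>s. s \<le> t \<Longrightarrow> f s \<le> F * exp (\<beta> * (s - t))"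
    and l: "(c \<longlongrightarrow> 0) at_bot" "0 \<le> \<nu>" "0 < \<beta>" and t: "t < b" "0 \<le> F"
  shows "c t \<le> F / (\<nu> + \<beta>)"
proof -
  define A where "A = F / (\<nu> + \<beta>)"
  define g where "g s = (A * exp (\<beta> * (s - t)) - c s) * exp (\<nu> * (s - t))" for s
  have p: "F = A * (\<nu> + \<beta>)" using l by (simp add: A_def)
  have "0 \<le> g s0" if "s0 < t" for s0
  proof (rule nonneg_of_nondecreasing[OF _ _ _ that])
    fix s assume s: "s < t"
    show "(g has_real_derivative (F * exp (\<beta> * (s - t)) - f s) * exp (\<nu> * (s - t))) (at s)"
      unfolding g_def using s t(1) c[of s]
      by (auto intro!: derivative_eq_intros simp: algebra_simps p)
    show "0 \<le> (F * exp (\<beta> * (s - t)) - f s) * exp (\<nu> * (s - t))"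
      using f[of s] s by simp
  next
    have b1: "LIM s at_bot. \<beta> * (s - t) :> at_bot"
      unfolding filterlim_at_bot eventually_at_bot_linorder
    proof
      fix Z
      have "\<beta> * (n - t) \<le> Z" if "n \<le> Z / \<beta> + t" for n
        using that l(3) by (simp add: field_simps)
      then show "\<exists>N. \<forall>n\<le>N. \<beta> * (n - t) \<le> Z" by blast
    qed
    have e: "((\<lambda>s. exp (\<beta> * (s - t))) \<longlongrightarrow> 0) at_bot" using exp_at_bot b1 by (rule filterlim_compose)
    have k: "((\<lambda>s. A * exp (\<beta> * (s - t)) - c s) \<longlongrightarrow> 0) at_bot"
      using tendsto_diff[OF tendsto_mult[OF tendsto_const e, of A] l(1)] by simp
    show "(g \<longlongrightarrow> 0) at_bot"
    proof (rule Lim_null_comparison[OF _ tendsto_rabs_zero[OF k]])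
      show "\<forall>\<^sub>F s in at_bot. norm (g s) \<le> \<bar>A * exp (\<beta> * (s - t)) - c s\<bar>"
        using eventually_le_at_bot[of t]
      proof eventually_elim
        case (elim s)
        have "exp (\<nu> * (s - t)) \<le> 1" using elim l(2) by (simp add: mult_nonneg_nonpos)
        then show ?case by (simp add: g_def abs_mult mult_left_le)
      qed
    qed
  qed
  \<comment> \<open>The forcing is bounded up to time t only, so the comparison gives g >= 0
    strictly before t; the value at t follows by continuity from the left.\<close>
  moreover have "(g \<longlongrightarrow> g t) (at_left t)"
  proof -
    have "isCont c t" using c[OF t(1)] by (rule DERIV_isCont)
    then have "isCont g t" unfolding g_def by (intro continuous_intros) auto
    then show ?thesis by (auto simp: isCont_def intro: filterlim_at_split[THEN iffD1, THEN conjunct1])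
  qed
  ultimately have "0 \<le> g t"
    by (intro tendsto_lowerbound[of g "g t" "at_left t"]) (auto simp: eventually_at_filter)
  then show ?thesis by (simp add: g_def A_def)
qed

lemma ode_decay:
  fixes c f :: "real \<Rightarrow> real"
  assumes c: "\<And>s. s < b \<Longrightarrow> (c has_real_derivative - \<nu> * c s + f s) (at s)"
    and f: "\<And>s. s \<le> t \<Longrightarrow> \<bar>f s\<bar> \<le> F * exp (\<beta> * (s - t))"
    and l: "(c \<longlongrightarrow> 0) at_bot" "0 \<le> \<nu>" "0 < \<beta>" and t: "t < b"
  shows "\<bar>c t\<bar> \<le> F / (\<nu> + \<beta>)"
proof -
  have F: "0 \<le> F" using order_trans[OF abs_ge_zero f[of t]] by simp
  have "c t \<le> F / (\<nu> + \<beta>)"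
    by (rule ode_decay_upper[OF c _ l t F]) (use f in \<open>auto simp: abs_le_iff\<close>)
  moreover have "- c t \<le> F / (\<nu> + \<beta>)"
  proof (rule ode_decay_upper[where b = b and c = "\<lambda>s. - c s" and f = "\<lambda>s. - f s"])
    fix s assume "s < b"
    then show "((\<lambda>s. - c s) has_real_derivative - \<nu> * - c s + - f s) (at s)"
      using DERIV_minus[OF c] by simp
  next
    show "((\<lambda>s. - c s) \<longlongrightarrow> 0) at_bot" using tendsto_minus[OF l(1)] by simp
    show "- f s \<le> F * exp (\<beta> * (s - t))" if "s \<le> t" for s using f[OF that] by linarith
  qed (use l t F in auto)
  ultimately show ?thesis by linarith
qed

text \<open>The crude rate \<mu> makes the relative error, of order y^(1/4), decay like exp (\<mu> s
  / 4), which is integrable at - infinity; hence the full rate 2 \<mu> holds up to a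
  constant.\<close>

lemma growth_sharp:
  fixes y y' :: "real \<Rightarrow> real"
  assumes y: "\<And>s. s < b \<Longrightarrow> (y has_real_derivative y' s) (at s)" "\<And>s. s < b \<Longrightarrow> 0 \<le> y s"
    and y': "\<And>s. s < b \<Longrightarrow> 2 * \<mu> * y s - C * y s powr (5 / 4) \<le> y' s"
    and K: "\<And>s. s < b \<Longrightarrow> y s \<le> K * exp (\<mu> * s)" "0 < K" "0 < \<mu>" "0 \<le> C"
    and t: "t < b" "s \<le> t"
  shows "y s \<le> (y t * exp (- 2 * \<mu> * t) * exp (4 * C * K powr (1 / 4) / \<mu> * exp (\<mu> * t / 4))) * exp (2 * \<mu> * s)"
proof -
  \<comment> \<open>Chosen so that q exp (\<mu> s / 4) has the derivative C K^(1/4) exp (\<mu> s /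
    4), the bound on the relative error.\<close>
  define q where "q = 4 * C * K powr (1 / 4) / \<mu>"
  define g where "g s = y s * exp (q * exp (\<mu> * s / 4) - 2 * \<mu> * s)" for s
  have "g s \<le> g t"
  proof (rule DERIV_nonneg_imp_nondecreasing[OF t(2)])
    fix x assume x: "s \<le> x" "x \<le> t"
    then have xb: "x < b" using t by simp
    show "\<exists>z. (g has_real_derivative z) (at x) \<and> 0 \<le> z"
    proof (intro exI conjI)
      show "(g has_real_derivative (y' x - 2 * \<mu> * y x + q * \<mu> / 4 * exp (\<mu> * x / 4) * y x) * exp (q * exp (\<mu> * x / 4) - 2 * \<mu> * x)) (at x)"
        unfolding g_def using y(1)[OF xb] by (auto intro!: derivative_eq_intros simp: algebra_simps)
      have "C * y x powr (5 / 4) = C * (y x powr (1 / 4) * y x)"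
        using y(2)[OF xb] powr_add[of "y x" "1 / 4" 1] by (cases "y x = 0") auto
      also have "y x powr (1 / 4) \<le> (K * exp (\<mu> * x)) powr (1 / 4)"
        using K(1)[OF xb] y(2)[OF xb] by (intro powr_mono2) auto
      also have "\<dots> = K powr (1 / 4) * exp (\<mu> * x / 4)"
        using K(2) by (simp add: powr_mult powr_def[of "exp _"])
      finally have "C * y x powr (5 / 4) \<le> C * (K powr (1 / 4) * exp (\<mu> * x / 4) * y x)"
        using K(4) y(2)[OF xb] by (simp add: mult_left_mono mult_right_mono)
      also have "\<dots> = q * \<mu> / 4 * exp (\<mu> * x / 4) * y x" using K(3) by (simp add: q_def)
      finally show "0 \<le> (y' x - 2 * \<mu> * y x + q * \<mu> / 4 * exp (\<mu> * x / 4) * y x) * exp (q * exp (\<mu> * x / 4) - 2 * \<mu> * x)"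
        using y'[OF xb] by simp
    qed
  qed
  have q: "q \<ge> 0" using K by (simp add: q_def)
  have "y s * exp (- 2 * \<mu> * s) \<le> g s"
    unfolding g_def using y(2)[of s] t q by (intro mult_left_mono) auto
  with \<open>g s \<le> g t\<close> have "y s * exp (- 2 * \<mu> * s) * exp (2 * \<mu> * s) \<le> g t * exp (2 * \<mu> * s)"
    by (intro mult_right_mono) auto
  then have "y s \<le> g t * exp (2 * \<mu> * s)" by (simp add: mult.assoc flip: exp_add)
  then show ?thesis by (simp add: g_def q_def exp_diff exp_minus field_simps)
qed

text \<open>By \<open>sobolev\<close> the sup norm of a derivative of order at most 2 costs one more
  derivative in L2, and \<open>interp4\<close> asks for four times that order: 12 = 4 * 3. The
  constant satisfies K^4 = 3 B, the L2 bound of a function bounded by B.\<close>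

lemma sup_interp:
  fixes B :: real assumes "B > 0"
  obtains C where "C > 0"
    "\<And>f j x. CP 12 f \<Longrightarrow> (\<And>j x. j \<le> 12 \<Longrightarrow> \<bar>nth_deriv j f x\<bar> \<le> B) \<Longrightarrow> j \<le> 2 \<Longrightarrow>
       \<bar>nth_deriv j f x\<bar> \<le> C * nrm f powr (3 / 4)"
proof -
  define K where "K = (3 * B) powr (1 / 4)"
  have K: "K > 0" using assms by (simp add: K_def)
  have K4: "K ^ 4 = 3 * B" using assms by (simp add: K_def powr_power)
  show ?thesis
  proof (rule that[of "2 * K"])
    fix f j x
    assume f: "CP 12 f" "\<And>j x. j \<le> 12 \<Longrightarrow> \<bar>nth_deriv j f x\<bar> \<le> B" and j: "j \<le> (2::nat)"
    let ?m = "nrm f powr (3 / 4)"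
    have m4: "?m ^ 4 = nrm f ^ 3" using nrm_nonneg[OF CP_cont[OF f(1)]]
      by (cases "nrm f = 0") (auto simp: powr_power powr_numeral)
    have n: "nrm (nth_deriv i f) \<le> K * ?m" if i: "i \<le> 3" for i
    proof -
      have "nrm (nth_deriv i f) ^ 4 \<le> nrm f ^ 3 * nrm (nth_deriv (4 * i) f)"
        by (rule interp4) (use CP_mono[OF f(1)] i in auto)
      also have "\<dots> \<le> nrm f ^ 3 * (3 * B)"
        using nrm_bound[of "nth_deriv (4 * i) f" B] CP_contj[OF f(1), of "4 * i"] f(2)[of "4 * i"] i
          nrm_nonneg[OF CP_cont[OF f(1)]] by (intro mult_left_mono) auto
      also have "\<dots> = (K * ?m) ^ 4" by (simp add: power_mult_distrib K4 m4)
      finally have "nrm (nth_deriv i f) ^ 4 \<le> (K * ?m) ^ 4" .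
      moreover have "0 \<le> nrm (nth_deriv i f)" using nrm_nonneg CP_contj[OF f(1)] i by simp
      ultimately show ?thesis using K power_mono_iff[of "nrm (nth_deriv i f)" "K * ?m" 4] by simp
    qed
    have "(nth_deriv j f x)\<^sup>2 \<le> 2 * (nrm (nth_deriv j f))\<^sup>2 + (nrm (nth_deriv (Suc j) f))\<^sup>2"
      using sobolev[of "nth_deriv j f" x] CP_nth'[OF f(1), of j 1] j by (simp add: nth_deriv_add[of 1 j f, simplified])
    also have "\<dots> \<le> 2 * (K * ?m)\<^sup>2 + (K * ?m)\<^sup>2"
      using n[of j] n[of "Suc j"] j nrm_nonneg[OF CP_contj[OF f(1)], of j] nrm_nonneg[OF CP_contj[OF f(1)], of "Suc j"]
      by (intro add_mono mult_left_mono power_mono) auto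
    also have "\<dots> \<le> (2 * K * ?m)\<^sup>2" by (simp add: power_mult_distrib)
    finally show "\<bar>nth_deriv j f x\<bar> \<le> 2 * K * ?m"
      using K by (simp add: abs_le_square_iff[symmetric])
  qed (use K in simp)
qed

lemma deriv_four:
  assumes "CP 1 f" "finite P" "\<And>k. k \<in> P \<Longrightarrow> - k \<in> P"
  shows "nth_deriv 1 (four P f) = four P (nth_deriv 1 f)"
proof
  fix x
  have "nth_deriv 1 (four P f) x = (\<Sum>k\<in>P. nth_deriv 1 (\<lambda>x. fc f k * eb k x) x)"
    using nth_deriv_sum[OF assms(2), of 1 "\<lambda>k x. fc f k * eb k x" 1] CP_cmult[OF CP_eb]
    by (simp add: four_def[abs_def])
  also have "\<dots> = (\<Sum>k\<in>P. fc f k * (- of_int k * eb (- k) x))"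
    using nth_deriv_cmult[OF CP_eb[of 1]] eb_1 by (intro sum.cong) (auto simp: fun_eq_iff)
  also have "\<dots> = (\<Sum>k\<in>P. fc f (- k) * (of_int k * eb k x))"
    by (rule sum.reindex_bij_witness[of _ uminus uminus]) (use assms in auto)
  also have "\<dots> = four P (nth_deriv 1 f) x"
    unfolding four_def fc_deriv[OF assms(1)] by (intro sum.cong) (auto simp: mult_ac)
  finally show "nth_deriv 1 (four P f) x = four P (nth_deriv 1 f) x" .
qed

text \<open>Poincare inequality for the part of f with |k| >= m. Both energies of that part are
  written as totals minus finitely many modes, so no infinite sum appears.\<close>

lemma coercive_high:
  assumes f: "CP 1 f" and m: "0 \<le> m"
  shows "(of_int m)\<^sup>2 * (ip f f - (\<Sum>k\<in>{k. \<bar>k\<bar> < m}. (fc f k)\<^sup>2))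
     \<le> ip (nth_deriv 1 f) (nth_deriv 1 f) - (\<Sum>k\<in>{k. \<bar>k\<bar> < m}. (of_int k * fc f k)\<^sup>2)"
proof -
  let ?P = "{k. \<bar>k\<bar> < m}"
  have P: "?P = {- m <..< m}" by auto
  have fin: "finite ?P" unfolding P by simp
  let ?z = "\<lambda>x. f x - four ?P f x"
  note c = CP_cont[OF f] cont_four[OF fin] CP_contj[OF f order_refl]
  have z: "CP 1 ?z" using f CP_four[OF fin] by (rule CP_diff)
  have "nth_deriv 1 ?z = (\<lambda>x. nth_deriv 1 f x - four ?P (nth_deriv 1 f) x)"
    using nth_deriv_diff[OF f CP_four[OF fin], of 1 f] deriv_four[OF f fin] by (simp del: One_nat_def)
  moreover have "(\<Sum>k\<in>?P. (fc (nth_deriv 1 f) k)\<^sup>2) = (\<Sum>k\<in>?P. (of_int k * fc f k)\<^sup>2)"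
    unfolding fc_deriv[OF f]
    by (rule sum.reindex_bij_witness[of _ uminus uminus]) (auto simp: power_mult_distrib)
  ultimately have 1: "ip (nth_deriv 1 ?z) (nth_deriv 1 ?z) =
     ip (nth_deriv 1 f) (nth_deriv 1 f) - (\<Sum>k\<in>?P. (of_int k * fc f k)\<^sup>2)"
    using ip_minus_four[OF fin c(3)] by (simp del: One_nat_def)
  have "fc ?z k = (if k \<in> ?P then 0 else fc f k)" for k
    using fc_diff[OF c(1,2)] fc_four[OF fin] by simp
  then have "(of_int m)\<^sup>2 * ip ?z ?z \<le> ip (nth_deriv 1 ?z) (nth_deriv 1 ?z)"
    by (intro coercive[OF z m]) (auto split: if_splits)
  then show ?thesis unfolding 1 ip_minus_four[OF fin c(1)] .
qed

section \<open>The evolution equation of the support function\<close>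

text \<open>The eigenvalue shared by \<open>eb k\<close> and \<open>eb (- k)\<close>; the integer
  index matches \<open>eb\<close>, so each nonzero |k| occurs twice in sums over modes.\<close>

definition lam :: "real \<Rightarrow> int \<Rightarrow> real" where "lam \<alpha> k = \<alpha> * ((of_int k)\<^sup>2 - 1) - 1"

lemma lam_0: "lam \<alpha> 0 = - \<alpha> - 1"
  by (simp add: lam_def)

lemma lam_uminus: "lam \<alpha> (- k) = lam \<alpha> k"
  by (simp add: lam_def)

lemma lam_less: "\<alpha> > 0 \<Longrightarrow> \<bar>j\<bar> < \<bar>k\<bar> \<Longrightarrow> lam \<alpha> j < lam \<alpha> k"
proof -
  assume a: "\<alpha> > 0" "\<bar>j\<bar> < \<bar>k\<bar>"
  then have "\<bar>of_int j\<bar> < \<bar>of_int k :: real\<bar>" by linarith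
  then have "(of_int j)\<^sup>2 < (of_int k :: real)\<^sup>2"
    using power_strict_mono[of "\<bar>of_int j\<bar>" "\<bar>of_int k :: real\<bar>" 2] by simp
  then show ?thesis using a(1) by (simp add: lam_def)
qed

lemma finite_lam: assumes "\<alpha> > 0" shows "finite {k. lam \<alpha> k \<le> c}"
proof -
  define N where "N = \<lceil>(c + 1) / \<alpha> + 1\<rceil> + 1"
  have "{k. lam \<alpha> k \<le> c} \<subseteq> {- N..N}"
  proof
    fix k assume "k \<in> {k. lam \<alpha> k \<le> c}"
    then have "(of_int k)\<^sup>2 \<le> (c + 1) / \<alpha> + 1" using assms by (simp add: lam_def field_simps)
    then have "of_int (k\<^sup>2) \<le> (of_int N :: real)"
      unfolding N_def of_int_add of_int_power using le_of_int_ceiling[of "(c + 1) / \<alpha> + 1"] by linarith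
    then have "k\<^sup>2 \<le> N" by (simp only: of_int_le_iff)
    moreover have "\<bar>k\<bar> \<le> k\<^sup>2"
      using mult_left_mono[of 1 "\<bar>k\<bar>" "\<bar>k\<bar>"] by (cases "k = 0") (auto simp: power2_eq_square abs_mult[symmetric])
    ultimately show "k \<in> {- N..N}" by auto
  qed
  then show ?thesis using finite_subset by blast
qed

text \<open>What the geometry hands over: bounded spatial derivatives, the pointwise equation in
  time and decay in L2. The bound 1 / 2 keeps the radius of curvature away from 0. Of the 26
  derivatives \<open>w\<close> loses two; the remaining 24 = 4 * 6 let Fourier coefficients be
  weighted by the sixth power of k.\<close>

locale pde =
  fixes \<alpha> :: real and v :: "real \<Rightarrow> real \<Rightarrow> real" and \<tau>0 :: real
  assumes apos: "\<alpha> > 0"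
    and fam_v: "fam 26 {..\<tau>0} v"
    and per: "\<And>\<tau>. \<tau> \<le> \<tau>0 \<Longrightarrow> periodic_2pi (v \<tau>)"
    and w_half: "\<And>\<tau> x. \<tau> \<le> \<tau>0 \<Longrightarrow> \<bar>v \<tau> x + nth_deriv 2 (v \<tau>) x\<bar> \<le> 1 / 2"
    and evol: "\<And>\<tau> x. \<tau> < \<tau>0 \<Longrightarrow>
      ((\<lambda>s. v s x) has_real_derivative
         1 + v \<tau> x - (1 + (v \<tau> x + nth_deriv 2 (v \<tau>) x)) powr - \<alpha>) (at \<tau>)"
    and lim: "((\<lambda>\<tau>. nrm (v \<tau>)) \<longlongrightarrow> 0) at_bot"
begin

text \<open>As 1 + v is a support function, 1 + w is the radius of curvature. \<open>E\<close> is
  what the linear operator misses in the equation, and \<open>R\<close> is the whole right-hand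
  side.\<close>

definition w :: "real \<Rightarrow> real \<Rightarrow> real" where "w \<tau> x = v \<tau> x + nth_deriv 2 (v \<tau>) x"
definition E :: "real \<Rightarrow> real \<Rightarrow> real" where "E \<tau> x = 1 - \<alpha> * w \<tau> x - (1 + w \<tau> x) powr - \<alpha>"
definition R :: "real \<Rightarrow> real \<Rightarrow> real" where "R \<tau> x = (\<alpha> * nth_deriv 2 (v \<tau>) x + (\<alpha> + 1) * v \<tau> x) + E \<tau> x"

lemma wh: "\<tau> \<le> \<tau>0 \<Longrightarrow> \<bar>w \<tau> x\<bar> \<le> 1 / 2"
  using w_half by (simp add: w_def)

lemma CPv: "\<tau> \<le> \<tau>0 \<Longrightarrow> CP 26 (v \<tau>)"
  using fam_CP[OF fam_v] per by simp

lemma CPv': "\<tau> \<le> \<tau>0 \<Longrightarrow> n \<le> 26 \<Longrightarrow> CP n (v \<tau>)"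
  using CP_mono[OF CPv] .

lemma cont_v: "\<tau> \<le> \<tau>0 \<Longrightarrow> cont (v \<tau>)"
  using CP_cont[OF CPv] .

lemma cont_vj: "\<tau> \<le> \<tau>0 \<Longrightarrow> j \<le> 26 \<Longrightarrow> cont (nth_deriv j (v \<tau>))"
  using CP_contj[OF CPv] .

lemma fam_w: "fam 24 {..\<tau>0} w"
  unfolding w_def[abs_def] by (intro fam_add fam_nth'[OF fam_v] fam_mono[OF fam_v]) auto

lemma fam_E: "fam 24 {..\<tau>0} E"
  unfolding E_def[abs_def]
proof (intro fam_diff fam_const' fam_cmult fam_w fam_powr[of _ _ _ "1/2"] fam_add)
  show "1 / 2 \<le> 1 + w i x" if "i \<in> {..\<tau>0}" for i x using wh[of i x] that by (auto simp: abs_le_iff)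
qed simp

lemma per_w: "\<tau> \<le> \<tau>0 \<Longrightarrow> periodic_2pi (w \<tau>)"
  using per[of \<tau>] CP_periodic[OF CP_nth'[OF CPv, of \<tau> 2 0]] by (simp add: w_def periodic_2pi_def)

lemma CP_w: "\<tau> \<le> \<tau>0 \<Longrightarrow> CP 24 (w \<tau>)"
  using fam_CP[OF fam_w] per_w by simp

lemma CP_E: "\<tau> \<le> \<tau>0 \<Longrightarrow> CP 24 (E \<tau>)"
  using fam_CP[OF fam_E, of \<tau>] per_w[of \<tau>] by (simp add: periodic_2pi_def E_def)

lemma cont_w: "\<tau> \<le> \<tau>0 \<Longrightarrow> cont (w \<tau>)" and cont_E: "\<tau> \<le> \<tau>0 \<Longrightarrow> cont (E \<tau>)"
  using CP_cont[OF CP_w] CP_cont[OF CP_E] by auto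

lemma cont_R: "\<tau> \<le> \<tau>0 \<Longrightarrow> cont (R \<tau>)"
  unfolding R_def[abs_def] by (intro continuous_on_add continuous_on_mult continuous_on_const cont_E cont_v cont_vj) auto

lemma evolR: "\<tau> < \<tau>0 \<Longrightarrow> ((\<lambda>s. v s x) has_real_derivative R \<tau> x) (at \<tau>)"
  using evol[of \<tau> x] by (simp add: R_def E_def w_def algebra_simps)

lemma bound_v: obtains B where "B > 0" "\<And>\<tau> j x. \<tau> \<le> \<tau>0 \<Longrightarrow> j \<le> 26 \<Longrightarrow> \<bar>nth_deriv j (v \<tau>) x\<bar> \<le> B"
  using fam_nth_bound[OF fam_v] by (metis atMost_iff)

lemma bound_R: obtains B where "B > 0" "\<And>\<tau> x. \<tau> \<le> \<tau>0 \<Longrightarrow> \<bar>R \<tau> x\<bar> \<le> B"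
proof -
  have "fam 0 {..\<tau>0} R"
    unfolding R_def[abs_def] by (intro fam_add fam_cmult fam_nth'[OF fam_v] fam_mono[OF fam_v] fam_mono[OF fam_E]) auto
  from fam_bound[OF this] show ?thesis using that by (metis atMost_iff)
qed

lemma fc_R: assumes "\<tau> \<le> \<tau>0" shows "fc (R \<tau>) k = - lam \<alpha> k * fc (v \<tau>) k + fc (E \<tau>) k"
proof -
  have "fc (R \<tau>) k = \<alpha> * fc (nth_deriv 2 (v \<tau>)) k + (\<alpha> + 1) * fc (v \<tau>) k + fc (E \<tau>) k"
    unfolding R_def[abs_def] using cont_E[OF assms] cont_v[OF assms] cont_vj[OF assms, of 2]
    by (simp add: fc_add fc_cmult continuous_on_add continuous_on_mult)
  then show ?thesis using fc_deriv2[OF CPv'[OF assms, of 2]] by (simp add: lam_def algebra_simps)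
qed

lemma fc_has_derivative:
  assumes "\<tau> < \<tau>0"
  shows "((\<lambda>s. fc (v s) k) has_real_derivative - lam \<alpha> k * fc (v \<tau>) k + fc (E \<tau>) k) (at \<tau>)"
proof -
  obtain B where "B > 0" and B: "\<And>\<tau> x. \<tau> \<le> \<tau>0 \<Longrightarrow> \<bar>R \<tau> x\<bar> \<le> B" using bound_R by blast
  have "((\<lambda>s. circ (\<lambda>x. v s x * eb k x)) has_real_derivative circ (\<lambda>x. R \<tau> x * eb k x)) (at \<tau>)"
  proof (rule circ_has_derivative[where b = \<tau>0 and B = B])
    show "\<bar>R s x * eb k x\<bar> \<le> B" if "s < \<tau>0" for s x
      using mult_mono[OF B[of s x] eb_abs[of k x]] that order_trans[OF abs_ge_zero B[of s x]] by (simp add: abs_mult)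
  qed (use assms evolR cont_v cont_R cont_eb in \<open>auto intro!: derivative_eq_intros continuous_on_mult\<close>)
  then show ?thesis using fc_R[of \<tau> k] assms by (simp add: fc_def ip_circ)
qed

lemma energy_has_derivative:
  assumes "\<tau> < \<tau>0"
  shows "((\<lambda>s. ip (v s) (v s)) has_real_derivative 2 * ip (v \<tau>) (R \<tau>)) (at \<tau>)"
proof -
  obtain B where B: "B > 0" "\<And>\<tau> x. \<tau> \<le> \<tau>0 \<Longrightarrow> \<bar>R \<tau> x\<bar> \<le> B" using bound_R by blast
  obtain D where D: "D > 0" "\<And>\<tau> j x. \<tau> \<le> \<tau>0 \<Longrightarrow> j \<le> 26 \<Longrightarrow> \<bar>nth_deriv j (v \<tau>) x\<bar> \<le> D" using bound_v by blast
  have "((\<lambda>s. circ (\<lambda>x. v s x * v s x)) has_real_derivative circ (\<lambda>x. 2 * (v \<tau> x * R \<tau> x))) (at \<tau>)"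
  proof (rule circ_has_derivative[where b = \<tau>0 and B = "2 * (D * B)"])
    show "\<bar>2 * (v s x * R s x)\<bar> \<le> 2 * (D * B)" if "s < \<tau>0" for s x
      using mult_mono[OF D(2)[of s 0 x] B(2)[of s x]] that D(1) by (simp add: abs_mult)
  qed (use assms evolR cont_v cont_R in \<open>auto intro!: derivative_eq_intros continuous_on_mult\<close>)
  then show ?thesis by (simp add: ip_circ circ_cmult)
qed

lemma w_small: obtains C where "C > 0" "\<And>\<tau> x. \<tau> \<le> \<tau>0 \<Longrightarrow> \<bar>w \<tau> x\<bar> \<le> C * nrm (v \<tau>) powr (3 / 4)"
proof -
  obtain B where B: "B > 0" "\<And>\<tau> j x. \<tau> \<le> \<tau>0 \<Longrightarrow> j \<le> 26 \<Longrightarrow> \<bar>nth_deriv j (v \<tau>) x\<bar> \<le> B" using bound_v by blast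
  obtain C where C: "C > 0" "\<And>f j x. CP 12 f \<Longrightarrow> (\<And>j x. j \<le> 12 \<Longrightarrow> \<bar>nth_deriv j f x\<bar> \<le> B) \<Longrightarrow> j \<le> 2 \<Longrightarrow>
       \<bar>nth_deriv j f x\<bar> \<le> C * nrm f powr (3 / 4)" using sup_interp[OF B(1)] by blast
  show ?thesis
  proof (rule that[of "2 * C"])
    fix \<tau> x assume t: "\<tau> \<le> \<tau>0"
    have "\<bar>nth_deriv j (v \<tau>) x\<bar> \<le> C * nrm (v \<tau>) powr (3 / 4)" if "j \<le> 2" for j
      by (rule C(2)[OF CPv'[OF t]]) (use B(2)[OF t] that in auto)
    from this[of 0] this[of 2] show "\<bar>w \<tau> x\<bar> \<le> 2 * C * nrm (v \<tau>) powr (3 / 4)"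
      unfolding w_def by simp
  qed (use C in simp)
qed

lemma E_quadratic: obtains C where "C > 0" "\<And>\<tau> x. \<tau> \<le> \<tau>0 \<Longrightarrow> \<bar>E \<tau> x\<bar> \<le> C * (w \<tau> x)\<^sup>2"
proof -
  obtain C where C: "C > 0" "\<And>w. \<bar>w\<bar> \<le> 1 / 2 \<Longrightarrow> \<bar>(1 + w) powr - \<alpha> - (\<Sum>m<2. (- \<alpha> gchoose m) * w ^ m)\<bar> \<le> C * \<bar>w\<bar> ^ 2"
    using powr_taylor[of "- \<alpha>" 2] by blast
  show ?thesis
  proof (rule that[OF C(1)])
    fix \<tau> x assume t: "\<tau> \<le> \<tau>0"
    show "\<bar>E \<tau> x\<bar> \<le> C * (w \<tau> x)\<^sup>2"
      using C(2)[OF wh[OF t, of x]] by (simp add: E_def numeral_2_eq_2 abs_minus_commute algebra_simps)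
  qed
qed

text \<open>Keeps the quadratic term explicit: with neutral modes it is too large to count as an
  error, and its Fourier support is what matters.\<close>

lemma E_cubic: obtains C where "C > 0"
  "\<And>\<tau> x. \<tau> \<le> \<tau>0 \<Longrightarrow> \<bar>E \<tau> x + \<alpha> * (\<alpha> + 1) / 2 * (w \<tau> x)\<^sup>2\<bar> \<le> C * \<bar>w \<tau> x\<bar> ^ 3"
proof -
  obtain C where C: "C > 0" "\<And>w. \<bar>w\<bar> \<le> 1 / 2 \<Longrightarrow> \<bar>(1 + w) powr - \<alpha> - (\<Sum>m<3. (- \<alpha> gchoose m) * w ^ m)\<bar> \<le> C * \<bar>w\<bar> ^ 3"
    using powr_taylor[of "- \<alpha>" 3] by blast
  have g: "- \<alpha> gchoose 2 = \<alpha> * (\<alpha> + 1) / 2"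
    by (simp add: gbinomial_prod_rev numeral_2_eq_2 fact_2[unfolded numeral_2_eq_2] algebra_simps)
  have s: "(\<Sum>m<3. (- \<alpha> gchoose m) * y ^ m) = 1 - \<alpha> * y + \<alpha> * (\<alpha> + 1) / 2 * y\<^sup>2" for y
    using g by (simp add: numeral_3_eq_3 numeral_2_eq_2)
  show ?thesis
  proof (rule that[OF C(1)])
    fix \<tau> x assume t: "\<tau> \<le> \<tau>0"
    have "\<bar>E \<tau> x + \<alpha> * (\<alpha> + 1) / 2 * (w \<tau> x)\<^sup>2\<bar> = \<bar>(1 + w \<tau> x) powr - \<alpha> - (1 - \<alpha> * w \<tau> x + \<alpha> * (\<alpha> + 1) / 2 * (w \<tau> x)\<^sup>2)\<bar>"
      by (simp add: E_def)
    then show "\<bar>E \<tau> x + \<alpha> * (\<alpha> + 1) / 2 * (w \<tau> x)\<^sup>2\<bar> \<le> C * \<bar>w \<tau> x\<bar> ^ 3"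
      using C(2)[OF wh[OF t, of x]] unfolding s by simp
  qed
qed

text \<open>Two factors w, each of order |v|^(3/4), give the power 3 / 2 > 1: superlinear although
  \<open>w\<close> contains second derivatives.\<close>

lemma nrm_E: obtains C where "C > 0" "\<And>\<tau>. \<tau> \<le> \<tau>0 \<Longrightarrow> nrm (E \<tau>) \<le> C * nrm (v \<tau>) powr (3 / 2)"
proof -
  obtain C where C: "C > 0" "\<And>\<tau> x. \<tau> \<le> \<tau>0 \<Longrightarrow> \<bar>w \<tau> x\<bar> \<le> C * nrm (v \<tau>) powr (3 / 4)" using w_small by blast
  obtain K where K: "K > 0" "\<And>\<tau> x. \<tau> \<le> \<tau>0 \<Longrightarrow> \<bar>E \<tau> x\<bar> \<le> K * (w \<tau> x)\<^sup>2" using E_quadratic by blast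
  show ?thesis
  proof (rule that[of "3 * (K * C\<^sup>2)"])
    fix \<tau> assume t: "\<tau> \<le> \<tau>0"
    have "nrm (E \<tau>) \<le> 3 * (K * (C * nrm (v \<tau>) powr (3 / 4))\<^sup>2)"
    proof (rule nrm_bound[OF cont_E[OF t]])
      fix x
      have "(w \<tau> x)\<^sup>2 \<le> (C * nrm (v \<tau>) powr (3 / 4))\<^sup>2"
        using C(2)[OF t, of x] by (metis abs_ge_zero power2_abs power_mono)
      then show "\<bar>E \<tau> x\<bar> \<le> K * (C * nrm (v \<tau>) powr (3 / 4))\<^sup>2"
        using K(2)[OF t, of x] K(1) by (meson mult_left_mono less_imp_le order_trans)
    qed
    also have "\<dots> = 3 * (K * C\<^sup>2) * nrm (v \<tau>) powr (3 / 2)"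
      by (simp add: power_mult_distrib power2_eq_square[of "_ powr _"] flip: powr_add)
    finally show "nrm (E \<tau>) \<le> 3 * (K * C\<^sup>2) * nrm (v \<tau>) powr (3 / 2)" .
  qed (use C K in simp)
qed

section \<open>Energy and growth of the unstable modes\<close>

definition P :: "int set" where "P = {k. lam \<alpha> k < 0}"
definition x2 :: "real \<Rightarrow> real" where "x2 \<tau> = (\<Sum>k\<in>P. (fc (v \<tau>) k)\<^sup>2)"

lemma finite_P: "finite P"
  unfolding P_def by (rule finite_subset[OF _ finite_lam[OF apos, of 0]]) auto

lemma zero_in_P: "0 \<in> P"
  using apos by (simp add: P_def lam_0)

lemma x2_nonneg: "0 \<le> x2 \<tau>"
  unfolding x2_def by (intro sum_nonneg) auto

lemma x2_le: "\<tau> \<le> \<tau>0 \<Longrightarrow> x2 \<tau> \<le> (nrm (v \<tau>))\<^sup>2"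
  unfolding x2_def using bessel[OF finite_P cont_v] nrm_sq[OF cont_v] by simp

text \<open>The slowest growth rate among the unstable modes, equal to minus
  \<open>lambda_I \<alpha>\<close> by \<open>lambda_I_eq\<close>; the gap that the error terms have
  to beat.\<close>

definition \<mu> :: real where "\<mu> = Min ((\<lambda>k. - lam \<alpha> k) ` P)"

lemma mu_pos: "\<mu> > 0"
  unfolding \<mu>_def using finite_P zero_in_P by (subst Min_gr_iff) (auto simp: P_def)

lemma mu_le: "k \<in> P \<Longrightarrow> \<mu> \<le> - lam \<alpha> k"
  unfolding \<mu>_def using finite_P by (intro Min_le) auto

lemma abs_fc_P: "k \<in> P \<Longrightarrow> \<bar>fc (v \<tau>) k\<bar> \<le> sqrt (x2 \<tau>)"
proof -
  assume "k \<in> P"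
  then have "(fc (v \<tau>) k)\<^sup>2 \<le> x2 \<tau>"
    unfolding x2_def using finite_P by (intro member_le_sum) auto
  then show ?thesis by (intro real_le_rsqrt) simp
qed

lemma x2_has_derivative:
  assumes "\<tau> < \<tau>0"
  shows "(x2 has_real_derivative (\<Sum>k\<in>P. 2 * fc (v \<tau>) k * (- lam \<alpha> k * fc (v \<tau>) k + fc (E \<tau>) k))) (at \<tau>)"
  unfolding x2_def[abs_def] power2_eq_square
  by (rule DERIV_cong[OF DERIV_sum[OF DERIV_mult[OF fc_has_derivative fc_has_derivative]]])
    (use assms in \<open>auto simp: algebra_simps intro!: sum.cong\<close>)

lemma sum_P_E: assumes "\<tau> \<le> \<tau>0" shows "\<bar>\<Sum>k\<in>P. fc (v \<tau>) k * fc (E \<tau>) k\<bar> \<le> sqrt (x2 \<tau>) * nrm (E \<tau>)"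
proof -
  have c: "cont (four P (v \<tau>))" using finite_P by (rule cont_four)
  have "ip (four P (v \<tau>)) (four P (v \<tau>)) = x2 \<tau>"
    unfolding ip_four[OF finite_P c] x2_def using finite_P
    by (intro sum.cong) (simp_all add: fc_four power2_eq_square)
  then show ?thesis
    using ip_le_nrm[OF c cont_E[OF assms]] ip_four[OF finite_P cont_E[OF assms], of "v \<tau>"]
    by (simp add: nrm_def[of "four P (v \<tau>)"])
qed

lemma x2_deriv_lower:
  assumes "\<tau> \<le> \<tau>0"
  shows "2 * \<mu> * x2 \<tau> - 2 * (sqrt (x2 \<tau>) * nrm (E \<tau>)) \<le>
    (\<Sum>k\<in>P. 2 * fc (v \<tau>) k * (- lam \<alpha> k * fc (v \<tau>) k + fc (E \<tau>) k))"
proof -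
  have "2 * \<mu> * x2 \<tau> \<le> (\<Sum>k\<in>P. 2 * ((- lam \<alpha> k) * (fc (v \<tau>) k)\<^sup>2))"
    unfolding x2_def sum_distrib_left
  proof (rule sum_mono)
    fix k assume "k \<in> P"
    from mult_right_mono[OF mu_le[OF this], of "(fc (v \<tau>) k)\<^sup>2"]
    show "2 * \<mu> * (fc (v \<tau>) k)\<^sup>2 \<le> 2 * ((- lam \<alpha> k) * (fc (v \<tau>) k)\<^sup>2)" by simp
  qed
  moreover have "(\<Sum>k\<in>P. 2 * fc (v \<tau>) k * (- lam \<alpha> k * fc (v \<tau>) k + fc (E \<tau>) k)) =
     (\<Sum>k\<in>P. 2 * ((- lam \<alpha> k) * (fc (v \<tau>) k)\<^sup>2)) + 2 * (\<Sum>k\<in>P. fc (v \<tau>) k * fc (E \<tau>) k)"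
    unfolding sum_distrib_left sum.distrib[symmetric] by (intro sum.cong) (auto simp: algebra_simps power2_eq_square)
  ultimately show ?thesis using sum_P_E[OF assms] by (auto simp: abs_le_iff)
qed

end

section \<open>Dominance of the unstable modes\<close>

context pde begin

text \<open>\<open>lam\<close> increases with |k|, so the unstable modes form a symmetric interval,
  ending before the first m where \<open>lam\<close> is nonnegative.\<close>

lemma P_interval: obtains m where "0 < m" "P = {k. \<bar>k\<bar> < m}" "0 \<le> lam \<alpha> m"
proof (rule that[of "Max P + 1"])
  have "P \<noteq> {}" using zero_in_P by blast
  then have M: "Max P \<in> P" "0 \<le> Max P"
    using Max_in[OF finite_P] Max_ge[OF finite_P zero_in_P] by auto
  then show "0 < Max P + 1" by simp
  show "P = {k. \<bar>k\<bar> < Max P + 1}"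
  proof (intro subset_antisym subsetI)
    fix k assume k: "k \<in> P"
    then have "\<bar>k\<bar> \<in> P" using lam_uminus[of \<alpha> k] by (auto simp: P_def abs_if)
    then show "k \<in> {k. \<bar>k\<bar> < Max P + 1}" using Max_ge[OF finite_P, of "\<bar>k\<bar>"] by simp
  next
    fix k assume "k \<in> {k. \<bar>k\<bar> < Max P + 1}"
    then have "\<bar>k\<bar> < \<bar>Max P\<bar> \<or> \<bar>k\<bar> = Max P" using M by auto
    then show "k \<in> P"
    proof
      assume "\<bar>k\<bar> < \<bar>Max P\<bar>"
      then show ?thesis using lam_less[OF apos] M(1) unfolding P_def by (metis (mono_tags) less_trans mem_Collect_eq)
    next
      assume "\<bar>k\<bar> = Max P"
      then have "lam \<alpha> k = lam \<alpha> (Max P)" using lam_uminus[of \<alpha> k] by (auto simp: abs_if split: if_splits)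
      then show ?thesis using M(1) unfolding P_def by simp
    qed
  qed
  show "0 \<le> lam \<alpha> (Max P + 1)"
  proof (rule ccontr)
    assume "\<not> 0 \<le> lam \<alpha> (Max P + 1)"
    then have "Max P + 1 \<in> P" by (simp add: P_def)
    then show False using Max_ge[OF finite_P] by force
  qed
qed

lemma ip_v_R:
  assumes "\<tau> \<le> \<tau>0"
  shows "ip (v \<tau>) (R \<tau>) = - \<alpha> * ip (nth_deriv 1 (v \<tau>)) (nth_deriv 1 (v \<tau>)) + (\<alpha> + 1) * ip (v \<tau>) (v \<tau>) + ip (v \<tau>) (E \<tau>)"
proof -
  have "ip (nth_deriv 1 (v \<tau>)) (nth_deriv 1 (v \<tau>)) = - ip (v \<tau>) (nth_deriv 2 (v \<tau>))"
    using ip_parts[OF CPv'[OF assms] CP_nth'[OF CPv[OF assms], of 1 1]]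
    by (simp add: nth_deriv_add[of 1 1 "v \<tau>", simplified] numeral_2_eq_2)
  then show ?thesis
    unfolding R_def[abs_def] using cont_v[OF assms] cont_E[OF assms] cont_vj[OF assms, of 2]
    by (simp add: ip_add2 ip_cmult2 continuous_on_add continuous_on_mult)
qed

lemma x2_lim: "(x2 \<longlongrightarrow> 0) at_bot"
proof (rule Lim_null_comparison)
  show "\<forall>\<^sub>F \<tau> in at_bot. norm (x2 \<tau>) \<le> (nrm (v \<tau>))\<^sup>2"
    using eventually_le_at_bot[of \<tau>0] by eventually_elim (use x2_le x2_nonneg in auto)
  show "((\<lambda>\<tau>. (nrm (v \<tau>))\<^sup>2) \<longlongrightarrow> 0) at_bot" using tendsto_power[OF lim, of 2] by simp
qed

text \<open>The functional 2 x2 - |v|^2 is X^2 - Z^2. The linear part makes its derivative at least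
  2 b |v|^2, with b the smaller of the gaps on the two sides of 0, while the error is at most 6 |v|
  |E|, of order |v|^(5/2).\<close>

lemma nonneutral_unstable_dominance:
  assumes nz: "\<And>k. lam \<alpha> k \<noteq> 0"
  obtains \<tau>1 where "\<tau>1 < \<tau>0" "\<And>\<tau>. \<tau> \<le> \<tau>1 \<Longrightarrow> (nrm (v \<tau>))\<^sup>2 \<le> 2 * x2 \<tau>"
proof -
  obtain m where m: "0 < m" "P = {k. \<bar>k\<bar> < m}" "0 < lam \<alpha> m"
    using P_interval nz by (metis order_le_less)
  obtain C where C: "C > 0" "\<And>\<tau>. \<tau> \<le> \<tau>0 \<Longrightarrow> nrm (E \<tau>) \<le> C * nrm (v \<tau>) powr (3 / 2)" using nrm_E by blast
  \<comment> \<open>The smaller of the two gaps. The threshold (b / (3 C))^2 below amounts to 3 C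
    sqrt |v| <= b, which makes the error at most the gain.\<close>
  define b where "b = min \<mu> (lam \<alpha> m)"
  have b: "b > 0" "b \<le> \<mu>" "b \<le> lam \<alpha> m" using mu_pos m(3) by (auto simp: b_def)
  have "\<forall>\<^sub>F \<tau> in at_bot. nrm (v \<tau>) < (b / (3 * C))\<^sup>2"
    using order_tendstoD(2)[OF lim] b(1) C(1) by simp
  then obtain t1 where t1: "\<And>\<tau>. \<tau> \<le> t1 \<Longrightarrow> nrm (v \<tau>) < (b / (3 * C))\<^sup>2"
    by (auto simp: eventually_at_bot_linorder)
  define t where "t = min t1 \<tau>0"
  define S' where "S' \<tau> = 2 * (\<Sum>k\<in>P. 2 * fc (v \<tau>) k * (- lam \<alpha> k * fc (v \<tau>) k + fc (E \<tau>) k)) - 2 * ip (v \<tau>) (R \<tau>)" for \<tau>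
  have "0 \<le> 2 * x2 \<tau> - ip (v \<tau>) (v \<tau>)" if "\<tau> < t" for \<tau>
  proof (rule nonneg_of_nondecreasing[where b = t and y = "\<lambda>\<tau>. 2 * x2 \<tau> - ip (v \<tau>) (v \<tau>)" and y' = S'])
    fix s assume s: "s < t"
    then have s0: "s < \<tau>0" "s \<le> \<tau>0" "s \<le> t1" by (auto simp: t_def)
    show "((\<lambda>\<tau>. 2 * x2 \<tau> - ip (v \<tau>) (v \<tau>)) has_real_derivative S' s) (at s)"
      unfolding S'_def
      by (intro DERIV_diff DERIV_cmult x2_has_derivative[OF s0(1)] energy_has_derivative[OF s0(1)])
    let ?M = "nrm (v s)" and ?V = "ip (nth_deriv 1 (v s)) (nth_deriv 1 (v s))"
    have M: "0 \<le> ?M" "?M\<^sup>2 = ip (v s) (v s)" using nrm_nonneg nrm_sq cont_v s0 by auto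
    define N1 where "N1 = (\<Sum>k\<in>P. - lam \<alpha> k * (fc (v s) k)\<^sup>2)"
    define e1 where "e1 = (\<Sum>k\<in>P. fc (v s) k * fc (E s) k)"
    have N1: "\<mu> * x2 s \<le> N1"
      unfolding N1_def x2_def sum_distrib_left using mu_le by (intro sum_mono mult_right_mono) auto
    have xM: "sqrt (x2 s) \<le> ?M" using x2_le[OF s0(2)] M(1) by (intro real_le_lsqrt x2_nonneg)
    have En: "0 \<le> nrm (E s)" using nrm_nonneg cont_E s0 by auto
    have e1: "\<bar>e1\<bar> \<le> ?M * nrm (E s)"
      unfolding e1_def using sum_P_E[OF s0(2)] mult_right_mono[OF xM En] by linarith
    have e2: "\<bar>ip (v s) (E s)\<bar> \<le> ?M * nrm (E s)" using ip_le_nrm cont_v cont_E s0 by auto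
    have d: "(\<Sum>k\<in>P. 2 * fc (v s) k * (- lam \<alpha> k * fc (v s) k + fc (E s) k)) = 2 * N1 + 2 * e1"
      unfolding N1_def e1_def sum_distrib_left sum.distrib[symmetric]
      by (intro sum.cong) (auto simp: algebra_simps power2_eq_square)
    have "(of_int m)\<^sup>2 * (?M\<^sup>2 - x2 s) \<le> ?V - (\<Sum>k\<in>P. (of_int k * fc (v s) k)\<^sup>2)"
      using coercive_high[OF CPv'[OF s0(2)], where m = m] m(1) unfolding M(2) x2_def m(2) by simp
    then have "\<alpha> * ((of_int m)\<^sup>2 * (?M\<^sup>2 - x2 s)) \<le> \<alpha> * (?V - (\<Sum>k\<in>P. (of_int k * fc (v s) k)\<^sup>2))"
      using apos by (intro mult_left_mono) auto
    moreover have "N1 = (\<alpha> + 1) * x2 s - \<alpha> * (\<Sum>k\<in>P. (of_int k * fc (v s) k)\<^sup>2)"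
      unfolding N1_def x2_def sum_distrib_left sum_subtractf[symmetric]
      by (intro sum.cong) (auto simp: lam_def algebra_simps power2_eq_square)
    ultimately have "- \<alpha> * ?V + (\<alpha> + 1) * ?M\<^sup>2 \<le> N1 - lam \<alpha> m * (?M\<^sup>2 - x2 s)"
      by (simp add: lam_def algebra_simps)
    then have "2 * N1 + 2 * (lam \<alpha> m * (?M\<^sup>2 - x2 s)) - 6 * (?M * nrm (E s)) \<le> S' s"
      unfolding S'_def d ip_v_R[OF s0(2)] M(2)[symmetric] using e1 e2 by (auto simp: abs_le_iff)
    moreover have "b * x2 s \<le> N1" using N1 mult_right_mono[OF b(2) x2_nonneg[of s]] by linarith
    moreover have "b * (?M\<^sup>2 - x2 s) \<le> lam \<alpha> m * (?M\<^sup>2 - x2 s)"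
      using x2_le[OF s0(2)] b(3) by (intro mult_right_mono) auto
    ultimately have 1: "2 * (b * ?M\<^sup>2) - 6 * (?M * nrm (E s)) \<le> S' s" by (simp add: algebra_simps)
    have "sqrt ?M \<le> b / (3 * C)" using t1[OF s0(3)] b(1) C(1) by (intro real_le_lsqrt M(1)) auto
    then have "3 * C * sqrt ?M \<le> b" using C(1) by (simp add: field_simps)
    then have "(3 * C * sqrt ?M) * ?M\<^sup>2 \<le> b * ?M\<^sup>2" by (rule mult_right_mono) simp
    moreover have "?M * nrm (E s) \<le> ?M * (C * (sqrt ?M * ?M))"
    proof (rule mult_left_mono[OF _ M(1)])
      have "?M powr (3 / 2) = sqrt ?M * ?M"
        using powr_add[of ?M "1 / 2" 1] M(1) by (cases "?M = 0") (auto simp: powr_half_sqrt)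
      then show "nrm (E s) \<le> C * (sqrt ?M * ?M)" using C(2)[OF s0(2)] by simp
    qed
    ultimately show "0 \<le> S' s" using 1 by (simp add: power2_eq_square algebra_simps)
  next
    have "((\<lambda>\<tau>. 2 * x2 \<tau> - (nrm (v \<tau>))\<^sup>2) \<longlongrightarrow> 2 * 0 - 0\<^sup>2) at_bot"
      by (intro tendsto_intros x2_lim lim)
    then have "((\<lambda>\<tau>. 2 * x2 \<tau> - (nrm (v \<tau>))\<^sup>2) \<longlongrightarrow> 0) at_bot" by simp
    then show "((\<lambda>\<tau>. 2 * x2 \<tau> - ip (v \<tau>) (v \<tau>)) \<longlongrightarrow> 0) at_bot"
    proof (rule Lim_transform_eventually)
      show "\<forall>\<^sub>F \<tau> in at_bot. 2 * x2 \<tau> - (nrm (v \<tau>))\<^sup>2 = 2 * x2 \<tau> - ip (v \<tau>) (v \<tau>)"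
        using eventually_le_at_bot[of \<tau>0] by eventually_elim (simp add: nrm_sq cont_v)
    qed
  qed (rule that)
  note nn = this
  show ?thesis
  proof (rule that[of "t - 1"])
    show "t - 1 < \<tau>0" by (simp add: t_def)
    fix \<tau> assume "\<tau> \<le> t - 1"
    then have "\<tau> < t" "\<tau> \<le> \<tau>0" by (auto simp: t_def)
    then show "(nrm (v \<tau>))\<^sup>2 \<le> 2 * x2 \<tau>" using nn[of \<tau>] by (simp add: nrm_sq cont_v)
  qed
qed

text \<open>Dividing a forcing by lam k + \<mu> must gain a factor 1 / |k|, so that the coefficients
  become square summable. For large k the quadratic growth of \<open>lam\<close> gives this; where
  \<alpha> k^2 < 2 (\<alpha> + 1), the summand \<mu> does.\<close>

lemma lam_gap: obtains c where "c > 0" "\<And>k. k \<notin> P \<Longrightarrow> c * of_int \<bar>k\<bar> \<le> lam \<alpha> k + \<mu>"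
proof (rule that[of "min (\<alpha> / 2) (\<mu> * \<alpha> / (2 * (\<alpha> + 1)))"])
  let ?c = "min (\<alpha> / 2) (\<mu> * \<alpha> / (2 * (\<alpha> + 1)))"
  show "?c > 0" using apos mu_pos by simp
  fix k assume k: "k \<notin> P"
  have "\<bar>k\<bar> \<le> k\<^sup>2"
    using mult_left_mono[of 1 "\<bar>k\<bar>" "\<bar>k\<bar>"] by (cases "k = 0") (auto simp: power2_eq_square abs_mult[symmetric])
  then have k2: "of_int \<bar>k\<bar> \<le> (of_int k :: real)\<^sup>2" by (metis of_int_le_iff of_int_power)
  show "?c * of_int \<bar>k\<bar> \<le> lam \<alpha> k + \<mu>"
  proof (cases "\<alpha> * (of_int k)\<^sup>2 \<ge> 2 * (\<alpha> + 1)")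
    case True
    have "?c * of_int \<bar>k\<bar> \<le> \<alpha> / 2 * (of_int k)\<^sup>2" using k2 apos by (intro mult_mono[OF min.cobounded1]) auto
    then show ?thesis using True mu_pos by (simp add: lam_def algebra_simps)
  next
    case False
    have "?c * of_int \<bar>k\<bar> \<le> \<mu> * \<alpha> / (2 * (\<alpha> + 1)) * (of_int k)\<^sup>2" using k2 apos mu_pos by (intro mult_mono[OF min.cobounded2]) auto
    also have "\<dots> = \<mu> / (2 * (\<alpha> + 1)) * (\<alpha> * (of_int k)\<^sup>2)" by simp
    also have "\<dots> \<le> \<mu> / (2 * (\<alpha> + 1)) * (2 * (\<alpha> + 1))" using False apos mu_pos by (intro mult_left_mono) auto
    also have "\<dots> = \<mu>" using apos by simp
    finally show ?thesis using k by (simp add: P_def)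
  qed
qed

lemma fc_lim: "((\<lambda>s. fc (v s) k) \<longlongrightarrow> 0) at_bot"
proof (rule Lim_null_comparison[OF _ lim])
  show "\<forall>\<^sub>F s in at_bot. norm (fc (v s) k) \<le> nrm (v s)"
    using eventually_le_at_bot[of \<tau>0] by eventually_elim (simp add: fc_le_nrm cont_v)
qed

text \<open>A bootstrap. Superlinear forcing gives the growth rate of X and, by Duhamel in each
  weighted mode, C^4 bounds linear in X; these make \<open>E\<close> quadratic in X, and Duhamel
  again makes the other modes quadratic. Since \<open>x2\<close> is X^2, an amplitude is superlinear
  when its power of \<open>x2\<close> exceeds 1 / 2, an energy when it exceeds 1.\<close>

lemma mode_bounds_of_unstable_dominance:
  assumes C0: "C0 > 0" "\<tau>1 < \<tau>0" "\<And>\<tau>. \<tau> \<le> \<tau>1 \<Longrightarrow> nrm (v \<tau>) \<le> C0 * sqrt (x2 \<tau>)"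
  obtains C \<tau>2 where "C > 0" "\<tau>2 < \<tau>0"
    "\<And>\<tau> j x. \<tau> \<le> \<tau>2 \<Longrightarrow> j \<le> 4 \<Longrightarrow> \<bar>nth_deriv j (v \<tau>) x\<bar> \<le> C * sqrt (x2 \<tau>)"
    "\<And>\<tau> k. \<tau> \<le> \<tau>2 \<Longrightarrow> k \<notin> P \<Longrightarrow> of_int \<bar>k\<bar> * \<bar>fc (v \<tau>) k\<bar> \<le> C * x2 \<tau>"
    "\<And>\<tau>. \<tau> \<le> \<tau>2 \<Longrightarrow> sqrt (x2 \<tau>) \<le> C * exp (\<mu> * \<tau>)"
proof -
  obtain CE where CE: "CE > 0" "\<And>\<tau>. \<tau> \<le> \<tau>0 \<Longrightarrow> nrm (E \<tau>) \<le> CE * nrm (v \<tau>) powr (3 / 2)" using nrm_E by blast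
  define C1 where "C1 = CE * C0 powr (3 / 2)"
  have C1: "C1 > 0" using CE C0 by (simp add: C1_def)
  have nE: "nrm (E s) \<le> C1 * x2 s powr (3 / 4)" if "s \<le> \<tau>1" for s
  proof -
    have "nrm (E s) \<le> CE * nrm (v s) powr (3 / 2)" using CE(2) that C0(2) by simp
    also have "\<dots> \<le> CE * (C0 * sqrt (x2 s)) powr (3 / 2)"
      using CE(1) C0(3)[OF that] that C0(2) nrm_nonneg[OF cont_v] by (intro mult_left_mono powr_mono2) auto
    also have "\<dots> = C1 * x2 s powr (3 / 4)"
      using C0(1) x2_nonneg[of s] by (simp add: C1_def powr_mult powr_half_sqrt[symmetric] powr_powr)
    finally show ?thesis .
  qed
  \<comment> \<open>Below this threshold 2 C1 x2^(1/4) <= \<mu>, so half of the rate 2 \<mu>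
    survives; the bound by 1 lets powers of \<open>x2\<close> be compared.\<close>
  define \<delta> where "\<delta> = min 1 ((\<mu> / (2 * C1)) ^ 4)"
  have "\<delta> > 0" using mu_pos C1 by (simp add: \<delta>_def)
  then have "\<forall>\<^sub>F \<tau> in at_bot. x2 \<tau> < \<delta>" using order_tendstoD(2)[OF x2_lim] by simp
  then obtain t1 where t1: "\<And>\<tau>. \<tau> \<le> t1 \<Longrightarrow> x2 \<tau> < \<delta>" by (auto simp: eventually_at_bot_linorder)
  define b where "b = min t1 \<tau>1"
  have b: "s < \<tau>0" "s \<le> \<tau>0" "s \<le> \<tau>1" "x2 s < \<delta>" if "s < b" for s
    using that t1[of s] C0(2) by (auto simp: b_def)
  have x1: "x2 s \<le> 1" if "s < b" for s using b(4)[OF that] by (simp add: \<delta>_def)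
  define d where "d \<tau> = (\<Sum>k\<in>P. 2 * fc (v \<tau>) k * (- lam \<alpha> k * fc (v \<tau>) k + fc (E \<tau>) k))" for \<tau>
  have dx: "(x2 has_real_derivative d s) (at s)" if "s < b" for s
    unfolding d_def by (rule x2_has_derivative[OF b(1)[OF that]])
  have d1: "2 * \<mu> * x2 s - 2 * C1 * x2 s powr (5 / 4) \<le> d s" if s: "s < b" for s
  proof -
    have "sqrt (x2 s) * nrm (E s) \<le> sqrt (x2 s) * (C1 * x2 s powr (3 / 4))"
      using nE[OF b(3)[OF s]] x2_nonneg by (intro mult_left_mono) auto
    also have "\<dots> = C1 * x2 s powr (5 / 4)"
      using x2_nonneg[of s] by (simp add: powr_half_sqrt[symmetric] flip: powr_add)
    finally show ?thesis using x2_deriv_lower[OF b(2)[OF s]] unfolding d_def by simp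
  qed
  have d2: "\<mu> * x2 s \<le> d s" if s: "s < b" for s
  proof -
    have "x2 s powr (1 / 4) \<le> ((\<mu> / (2 * C1)) ^ 4) powr (1 / 4)"
      using b(4)[OF s] x2_nonneg by (intro powr_mono2) (auto simp: \<delta>_def)
    also have "\<dots> = \<mu> / (2 * C1)"
      using mu_pos C1 powr_powr[of "\<mu> / (2 * C1)" 4 "1 / 4"] by (simp add: powr_numeral)
    finally have "2 * C1 * x2 s powr (1 / 4) \<le> \<mu>" using C1 by (simp add: field_simps)
    then have "2 * C1 * x2 s powr (1 / 4) * x2 s \<le> \<mu> * x2 s" by (rule mult_right_mono) (rule x2_nonneg)
    moreover have "x2 s powr (5 / 4) = x2 s powr (1 / 4) * x2 s"
      using x2_nonneg[of s] powr_add[of "x2 s" "1 / 4" 1] by (cases "x2 s = 0") auto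
    ultimately show ?thesis using d1[OF s] by simp
  qed
  have gr: "x2 s \<le> x2 t * exp (\<mu> * (s - t))" if "s \<le> t" "t < b" for s t
    by (rule growth[OF dx d2 that])
  \<comment> \<open>\<open>b - 1\<close>, and \<open>b - 2\<close> below, are reference times
    strictly inside the half-line where the estimates hold. The crude rate \<mu> recorded here is
    the input that \<open>growth_sharp\<close> improves to 2 \<mu>.\<close>
  define K where "K = x2 (b - 1) * exp (- \<mu> * (b - 1)) + 1"
  have K: "K > 0" unfolding K_def using x2_nonneg by (intro add_nonneg_pos mult_nonneg_nonneg) auto
  have xK: "x2 s \<le> K * exp (\<mu> * s)" if "s < b - 1" for s
  proof -
    have "exp (\<mu> * (s - (b - 1))) = exp (- \<mu> * (b - 1)) * exp (\<mu> * s)"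
      by (simp add: exp_add[symmetric] algebra_simps)
    then have "x2 s \<le> x2 (b - 1) * exp (- \<mu> * (b - 1)) * exp (\<mu> * s)"
      using gr[of s "b - 1"] that by (simp add: mult.assoc)
    also have "\<dots> \<le> K * exp (\<mu> * s)" by (simp add: K_def algebra_simps)
    finally show ?thesis .
  qed
  define K2 where "K2 = x2 (b - 2) * exp (- 2 * \<mu> * (b - 2)) * exp (4 * (2 * C1) * K powr (1 / 4) / \<mu> * exp (\<mu> * (b - 2) / 4))"
  have sharp: "x2 s \<le> K2 * exp (2 * \<mu> * s)" if "s \<le> b - 2" for s
    unfolding K2_def
    by (rule growth_sharp[where b = "b - 1" and y' = d]) (use dx x2_nonneg d1 xK K mu_pos C1 that in auto)
  have K2: "K2 \<ge> 0" using x2_nonneg by (simp add: K2_def)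
  have sq: "sqrt (x2 s) \<le> sqrt K2 * exp (\<mu> * s)" if "s \<le> b - 2" for s
  proof -
    have "sqrt (x2 s) \<le> sqrt (K2 * exp (2 * \<mu> * s))" using sharp[OF that] by simp
    also have "\<dots> = sqrt K2 * exp (\<mu> * s)"
      by (simp add: real_sqrt_mult exp_double[of "\<mu> * s"] mult.assoc)
    finally show ?thesis .
  qed
  obtain BE where BE: "BE > 0" "\<And>s j x. s \<in> {..\<tau>0} \<Longrightarrow> j \<le> 24 \<Longrightarrow> \<bar>nth_deriv j (E s) x\<bar> \<le> BE"
    using fam_nth_bound[OF fam_E] by blast
  define C2 where "C2 = (3 * BE * C1 ^ 3) powr (1 / 4)"
  have C2: "C2 > 0" "C2 ^ 4 = 3 * BE * C1 ^ 3" using BE C1 by (simp_all add: C2_def powr_power)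
  \<comment> \<open>Interpolation mode by mode: (|k|^6 f)^4 = (|k|^24 f) f^3, where 24 derivatives
    of \<open>E\<close> are bounded and f is at most C1 x2^(3/4). The resulting power 9 / 16 = 3 / 4
    * 3 / 4 still exceeds 1 / 2.\<close>
  have fE: "of_int \<bar>k\<bar> ^ 6 * \<bar>fc (E s) k\<bar> \<le> C2 * x2 s powr (9 / 16)" if s: "s < b" for s k
  proof -
    let ?f = "\<bar>fc (E s) k\<bar>" and ?k = "of_int \<bar>k\<bar> :: real"
    have a: "?f \<le> C1 * x2 s powr (3 / 4)"
      using fc_le_nrm[OF cont_E[OF b(2)[OF s]], of k] nE[OF b(3)[OF s]] by linarith
    have "(of_int k ^ 24 * fc (E s) k)\<^sup>2 = (fc (nth_deriv 24 (E s)) k)\<^sup>2"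
      using fc_nth[OF CP_E[OF b(2)[OF s]], of k] by simp
    then have "\<bar>of_int k ^ 24 * fc (E s) k\<bar> = \<bar>fc (nth_deriv 24 (E s)) k\<bar>" by (simp add: power2_eq_iff abs_eq_iff)
    also have "\<dots> \<le> nrm (nth_deriv 24 (E s))" using fc_le_nrm CP_contj[OF CP_E[OF b(2)[OF s]]] by blast
    also have "\<dots> \<le> 3 * BE"
      using CP_contj[OF CP_E[OF b(2)[OF s]]] BE(2)[of s 24] b(2)[OF s] by (intro nrm_bound) auto
    finally have c: "?k ^ 24 * ?f \<le> 3 * BE" by (simp add: abs_mult power_abs)
    have "(a ^ 6 * f) ^ 4 = (a ^ 24 * f) * f ^ 3" for a f :: real by algebra
    then have "(?k ^ 6 * ?f) ^ 4 = (?k ^ 24 * ?f) * ?f ^ 3" .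
    also have "\<dots> \<le> (3 * BE) * (C1 * x2 s powr (3 / 4)) ^ 3"
      by (rule mult_mono[OF c power_mono[OF a]]) (use BE in auto)
    also have "\<dots> = (C2 * x2 s powr (9 / 16)) ^ 4"
    proof -
      have "(x2 s powr (3 / 4)) ^ 3 = (x2 s powr (9 / 16)) ^ 4"
        by (cases "x2 s = 0") (auto simp: powr_power)
      then show ?thesis by (simp add: power_mult_distrib C2(2))
    qed
    finally show ?thesis using C2(1) power_mono_iff[of "?k ^ 6 * ?f" "C2 * x2 s powr (9 / 16)" 4] by simp
  qed
  define C3 where "C3 = C2 / (9 / 16 * \<mu>) + (\<Sum>k\<in>P. of_int \<bar>k\<bar> ^ 6)"
  have C3: "C3 > 0" unfolding C3_def using C2 mu_pos by (intro add_pos_nonneg sum_nonneg) auto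
  \<comment> \<open>Unstable modes carry finitely many weights and are at most X. For the others
    Duhamel's formula applies to the weighted mode, the bound on its forcing growing at rate 9 / 16
    \<mu> by \<open>gr\<close>.\<close>
  have fv: "of_int \<bar>k\<bar> ^ 6 * \<bar>fc (v t) k\<bar> \<le> C3 * sqrt (x2 t)" if t: "t < b" for t k
  proof (cases "k \<in> P")
    case True
    have "of_int \<bar>k\<bar> ^ 6 \<le> (\<Sum>k\<in>P. of_int \<bar>k\<bar> ^ 6 :: real)"
      using finite_P True by (intro member_le_sum) auto
    also have "\<dots> \<le> C3" unfolding C3_def using C2 mu_pos by simp
    finally show ?thesis using abs_fc_P[OF True, of t] C3 by (intro mult_mono) auto
  next
    case False
    let ?k = "of_int \<bar>k\<bar> ^ 6 :: real"
    have "\<bar>?k * fc (v t) k\<bar> \<le> C2 * x2 t powr (9 / 16) / (lam \<alpha> k + 9 / 16 * \<mu>)"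
    proof (rule ode_decay[where c = "\<lambda>s. ?k * fc (v s) k" and f = "\<lambda>s. ?k * fc (E s) k" and b = b])
      fix s assume "s < b"
      from DERIV_cmult[OF fc_has_derivative[OF b(1)[OF this], of k], of ?k]
      show "((\<lambda>s. ?k * fc (v s) k) has_real_derivative - lam \<alpha> k * (?k * fc (v s) k) + ?k * fc (E s) k) (at s)"
        by (simp add: algebra_simps)
    next
      fix s assume s: "s \<le> t"
      then have "x2 s powr (9 / 16) \<le> (x2 t * exp (\<mu> * (s - t))) powr (9 / 16)"
        using gr[OF s t] x2_nonneg by (intro powr_mono2) auto
      also have "\<dots> = x2 t powr (9 / 16) * exp (9 / 16 * \<mu> * (s - t))"
        using x2_nonneg by (simp add: powr_mult powr_def[of "exp _"])
      finally have "C2 * x2 s powr (9 / 16) \<le> C2 * x2 t powr (9 / 16) * exp (9 / 16 * \<mu> * (s - t))"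
        using C2 by simp
      then show "\<bar>?k * fc (E s) k\<bar> \<le> C2 * x2 t powr (9 / 16) * exp (9 / 16 * \<mu> * (s - t))"
        using fE[of s k] s t by (simp add: abs_mult)
    next
      show "((\<lambda>s. ?k * fc (v s) k) \<longlongrightarrow> 0) at_bot" using tendsto_mult[OF tendsto_const fc_lim, of ?k] by simp
    qed (use False mu_pos t in \<open>auto simp: P_def\<close>)
    also have "\<dots> \<le> C2 * x2 t powr (9 / 16) / (9 / 16 * \<mu>)"
      using C2 mu_pos False by (intro divide_left_mono mult_pos_pos) (auto simp: P_def add_nonneg_pos)
    also have "\<dots> = C2 / (9 / 16 * \<mu>) * x2 t powr (9 / 16)" by simp
    also have "\<dots> \<le> C3 * sqrt (x2 t)"
    proof (rule mult_mono)
      show "C2 / (9 / 16 * \<mu>) \<le> C3" unfolding C3_def by (simp add: sum_nonneg)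
      show "x2 t powr (9 / 16) \<le> sqrt (x2 t)"
        using x1[OF t] x2_nonneg[of t] powr_mono'[of "1 / 2" "9 / 16" "x2 t"] by (simp add: powr_half_sqrt)
    qed (use C3 in auto)
    finally show ?thesis by (simp add: abs_mult)
  qed
  define C5 where "C5 = sqrt (1 + 4 * C3\<^sup>2)"
  have C5: "C5 \<ge> 1" by (simp add: C5_def)
  \<comment> \<open>The weight of order 6 pays for five derivatives and for one factor 1 / |k|,
    which makes the sum of squares converge.\<close>
  have nD: "nrm (nth_deriv j (v t)) \<le> C5 * sqrt (x2 t)" if t: "t < b" and j: "j \<le> 5" for t j
  proof -
    have "ip (nth_deriv j (v t)) (nth_deriv j (v t)) \<le> (1 + 4 * C3\<^sup>2) * x2 t"
    proof (rule nth_parseval_le)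
      show "CP j (v t)" using CPv' b(2)[OF t] j by simp
      fix n
      have "(fc (v t) 0)\<^sup>2 \<le> x2 t"
        using abs_le_square_iff[of "fc (v t) 0" "sqrt (x2 t)"] abs_fc_P[OF zero_in_P, of t] x2_nonneg[of t] by simp
      then have z: "(of_int 0 ^ j * fc (v t) 0)\<^sup>2 \<le> x2 t" using x2_nonneg[of t] by (cases j) auto
      have nz: "(of_int k ^ j * fc (v t) k)\<^sup>2 \<le> C3\<^sup>2 * x2 t * (1 / (of_int k)\<^sup>2)" if "k \<noteq> 0" for k
      proof -
        let ?k = "of_int \<bar>k\<bar> :: real"
        have k1: "1 \<le> ?k" using that by linarith
        have "?k ^ j * \<bar>fc (v t) k\<bar> \<le> ?k ^ 5 * \<bar>fc (v t) k\<bar>"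
          using k1 j by (intro mult_right_mono power_increasing) auto
        also have "\<dots> = ?k ^ 6 * \<bar>fc (v t) k\<bar> / ?k" using k1 by (simp add: field_simps numeral_eq_Suc)
        also have "\<dots> \<le> C3 * sqrt (x2 t) / ?k" using fv[OF t, of k] k1 by (intro divide_right_mono) auto
        finally have "(?k ^ j * \<bar>fc (v t) k\<bar>)\<^sup>2 \<le> (C3 * sqrt (x2 t) / ?k)\<^sup>2" using k1 by (intro power_mono) auto
        moreover have "(?k ^ j * \<bar>fc (v t) k\<bar>)\<^sup>2 = (of_int k ^ j * fc (v t) k)\<^sup>2"
          by (metis abs_mult of_int_abs power2_abs power_abs)
        moreover have "(C3 * sqrt (x2 t) / ?k)\<^sup>2 = C3\<^sup>2 * x2 t * (1 / (of_int k)\<^sup>2)"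
          using x2_nonneg[of t] by (simp add: power_mult_distrib power_divide)
        ultimately show ?thesis by simp
      qed
      have "(\<Sum>k\<in>{-n..n}. (of_int k ^ j * fc (v t) k)\<^sup>2) \<le>
         (\<Sum>k\<in>insert 0 ({-n..n} - {0}). (of_int k ^ j * fc (v t) k)\<^sup>2)"
        by (intro sum_mono2) auto
      also have "\<dots> = (of_int 0 ^ j * fc (v t) 0)\<^sup>2 + (\<Sum>k\<in>{-n..n} - {0}. (of_int k ^ j * fc (v t) k)\<^sup>2)"
        by (subst sum.insert) auto
      also have "\<dots> \<le> x2 t + (\<Sum>k\<in>{-n..n} - {0}. C3\<^sup>2 * x2 t * (1 / (of_int k)\<^sup>2))"
        using z nz by (intro add_mono sum_mono) auto
      also have "\<dots> \<le> x2 t + C3\<^sup>2 * x2 t * 4"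
        unfolding sum_distrib_left[symmetric] using x2_nonneg sum_inverse_squares[of n]
        by (intro add_left_mono mult_left_mono) auto
      finally show "(\<Sum>k\<in>{-n..n}. (of_int k ^ j * fc (v t) k)\<^sup>2) \<le> (1 + 4 * C3\<^sup>2) * x2 t"
        by (simp add: algebra_simps)
    qed
    then show ?thesis unfolding nrm_def C5_def by (simp add: real_sqrt_mult[symmetric])
  qed
  have pt: "\<bar>nth_deriv j (v t) x\<bar> \<le> 2 * C5 * sqrt (x2 t)" if t: "t < b" and j: "j \<le> 4" for t j x
  proof -
    note t0 = b(2)[OF t]
    have "(nth_deriv j (v t) x)\<^sup>2 \<le> 2 * (nrm (nth_deriv j (v t)))\<^sup>2 + (nrm (nth_deriv (Suc j) (v t)))\<^sup>2"
      using sobolev[of "nth_deriv j (v t)" x] CP_nth'[OF CPv[OF t0], of j 1] j by (simp add: nth_deriv_add[of 1 j "v t", simplified])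
    also have "\<dots> \<le> 2 * (C5 * sqrt (x2 t))\<^sup>2 + (C5 * sqrt (x2 t))\<^sup>2"
      using nD[OF t, of j] nD[OF t, of "Suc j"] j nrm_nonneg[OF cont_vj[OF t0]]
      by (intro add_mono mult_left_mono power_mono) auto
    also have "\<dots> \<le> (2 * C5 * sqrt (x2 t))\<^sup>2" using x2_nonneg[of t] by (simp add: power_mult_distrib mult_right_mono)
    finally show ?thesis using C5 x2_nonneg[of t] by (simp add: abs_le_square_iff[symmetric])
  qed
  obtain KE where KE: "KE > 0" "\<And>\<tau> x. \<tau> \<le> \<tau>0 \<Longrightarrow> \<bar>E \<tau> x\<bar> \<le> KE * (w \<tau> x)\<^sup>2" using E_quadratic by blast
  define C6 where "C6 = 3 * (KE * (4 * C5)\<^sup>2)"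
  have C6: "C6 > 0" using KE C5 by (simp add: C6_def)
  \<comment> \<open>With the C^2 norm linear in X, the error is quadratic and the loss by
    interpolation is gone.\<close>
  have nE2: "nrm (E t) \<le> C6 * x2 t" if t: "t < b" for t
  proof -
    have "nrm (E t) \<le> 3 * (KE * (4 * C5)\<^sup>2 * x2 t)"
    proof (rule nrm_bound[OF cont_E[OF b(2)[OF t]]])
      fix x
      have "\<bar>w t x\<bar> \<le> 4 * C5 * sqrt (x2 t)"
        using pt[OF t, of 0 x] pt[OF t, of 2 x] unfolding w_def by simp
      then have "(w t x)\<^sup>2 \<le> (4 * C5 * sqrt (x2 t))\<^sup>2" by (metis abs_ge_zero power2_abs power_mono)
      also have "\<dots> = (4 * C5)\<^sup>2 * x2 t" using x2_nonneg by (simp add: power_mult_distrib)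
      finally have "KE * (w t x)\<^sup>2 \<le> KE * ((4 * C5)\<^sup>2 * x2 t)" using KE by (intro mult_left_mono) auto
      then show "\<bar>E t x\<bar> \<le> KE * (4 * C5)\<^sup>2 * x2 t" using KE(2)[OF b(2)[OF t], of x] by simp
    qed
    then show ?thesis by (simp add: C6_def)
  qed
  obtain c where c: "c > 0" "\<And>k. k \<notin> P \<Longrightarrow> c * of_int \<bar>k\<bar> \<le> lam \<alpha> k + \<mu>" using lam_gap by blast
  \<comment> \<open>Duhamel with the quadratic forcing, whose bound grows at rate \<mu>;
    \<open>lam_gap\<close> turns the denominator into the factor |k|.\<close>
  have fv2: "of_int \<bar>k\<bar> * \<bar>fc (v t) k\<bar> \<le> C6 / c * x2 t" if t: "t < b" and k: "k \<notin> P" for t k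
  proof -
    have l: "0 \<le> lam \<alpha> k" using k by (simp add: P_def)
    have "\<bar>fc (v t) k\<bar> \<le> C6 * x2 t / (lam \<alpha> k + \<mu>)"
    proof (rule ode_decay[where c = "\<lambda>s. fc (v s) k" and f = "\<lambda>s. fc (E s) k" and b = b])
      show "((\<lambda>s. fc (v s) k) has_real_derivative - lam \<alpha> k * fc (v s) k + fc (E s) k) (at s)" if "s < b" for s
        by (rule fc_has_derivative[OF b(1)[OF that]])
      fix s assume s: "s \<le> t"
      have "\<bar>fc (E s) k\<bar> \<le> C6 * x2 s"
        using fc_le_nrm[OF cont_E, of s k] nE2[of s] b(2)[of s] s t by fastforce
      also have "\<dots> \<le> C6 * (x2 t * exp (\<mu> * (s - t)))" using gr[OF s t] C6 by simp
      finally show "\<bar>fc (E s) k\<bar> \<le> C6 * x2 t * exp (\<mu> * (s - t))" by simp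
    qed (use fc_lim l mu_pos t in auto)
    then have "\<bar>fc (v t) k\<bar> * (lam \<alpha> k + \<mu>) \<le> C6 * x2 t"
      using l mu_pos by (simp add: field_simps)
    moreover have "\<bar>fc (v t) k\<bar> * (c * of_int \<bar>k\<bar>) \<le> \<bar>fc (v t) k\<bar> * (lam \<alpha> k + \<mu>)"
      by (rule mult_left_mono[OF c(2)[OF k]]) simp
    ultimately show ?thesis using c(1) by (simp add: field_simps)
  qed
  define C where "C = 2 * C5 + C6 / c + sqrt K2"
  have C: "C > 0" "2 * C5 \<le> C" "C6 / c \<le> C" "sqrt K2 \<le> C"
    using C5 C6 c(1) K2 unfolding C_def by (auto intro!: add_pos_nonneg)
  show ?thesis
  proof (rule that[of C "b - 2"])
    show "b - 2 < \<tau>0" using C0(2) by (simp add: b_def)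
    show "\<bar>nth_deriv j (v \<tau>) x\<bar> \<le> C * sqrt (x2 \<tau>)" if "\<tau> \<le> b - 2" "j \<le> 4" for \<tau> j x
      using pt[of \<tau> j x] that mult_right_mono[OF C(2), of "sqrt (x2 \<tau>)"] x2_nonneg[of \<tau>] by auto
    show "of_int \<bar>k\<bar> * \<bar>fc (v \<tau>) k\<bar> \<le> C * x2 \<tau>" if "\<tau> \<le> b - 2" "k \<notin> P" for \<tau> k
      using fv2[of \<tau> k] that mult_right_mono[OF C(3), of "x2 \<tau>"] x2_nonneg[of \<tau>] by auto
    show "sqrt (x2 \<tau>) \<le> C * exp (\<mu> * \<tau>)" if "\<tau> \<le> b - 2" for \<tau>
      by (rule order_trans[OF sq[OF that] mult_right_mono[OF C(4)]]) simp
  qed (use C in auto)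
qed

end

section \<open>The entropy near the circle\<close>

definition av :: "(real \<Rightarrow> real) \<Rightarrow> real" where "av f = circ f / (2 * pi)"

lemma av_add: "cont f \<Longrightarrow> cont g \<Longrightarrow> av (\<lambda>x. f x + g x) = av f + av g"
  by (simp add: av_def circ_add add_divide_distrib)

lemma av_diff: "cont f \<Longrightarrow> cont g \<Longrightarrow> av (\<lambda>x. f x - g x) = av f - av g"
  by (simp add: av_def circ_diff diff_divide_distrib)

lemma av_cmult: "av (\<lambda>x. c * f x) = c * av f"
  by (simp add: av_def circ_cmult)

lemma av_const: "av (\<lambda>x. c) = c"
  by (simp add: av_def circ_const)

lemma av_mono: "cont f \<Longrightarrow> cont g \<Longrightarrow> (\<And>x. f x \<le> g x) \<Longrightarrow> av f \<le> av g"
  by (simp add: av_def circ_mono divide_right_mono)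

lemma av_abs_le: "cont f \<Longrightarrow> cont g \<Longrightarrow> (\<And>x. \<bar>f x\<bar> \<le> g x) \<Longrightarrow> \<bar>av f\<bar> \<le> av g"
  using av_mono[of f g] av_mono[of "\<lambda>x. - f x" g] av_cmult[of "-1" f] continuous_on_minus[of UNIV f]
  by (simp add: abs_le_iff)

text \<open>The derivative t^3 / (1 + t) of the difference has the sign of t, so the difference is
  smallest at 0. An upper bound is what counts, because the entropy is known to be bounded
  below.\<close>

lemma ln_upper_cubic:
  fixes x :: real assumes "\<bar>x\<bar> \<le> 1 / 2"
  shows "ln (1 + x) \<le> x - x\<^sup>2 / 2 + \<bar>x\<bar> ^ 3"
proof -
  define g where "g x = x - x\<^sup>2 / 2 + x ^ 3 / 3 - ln (1 + x)" for x :: real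
  have d: "(g has_real_derivative t ^ 3 / (1 + t)) (at t)" if "- 1 / 2 \<le> t" for t
    unfolding g_def using that
    by (auto intro!: derivative_eq_intros simp: field_simps power2_eq_square power3_eq_cube)
  have "g 0 \<le> g x"
  proof (cases "x \<ge> 0")
    case True
    show ?thesis
    proof (rule DERIV_nonneg_imp_nondecreasing[OF True])
      fix t :: real assume t: "0 \<le> t" "t \<le> x"
      then have "0 \<le> t ^ 3 / (1 + t)" by simp
      then show "\<exists>y. (g has_real_derivative y) (at t) \<and> 0 \<le> y" using d[of t] t by auto
    qed
  next
    case False
    show ?thesis
    proof (rule DERIV_nonpos_imp_nonincreasing[of x 0])
      fix t assume t: "x \<le> t" "t \<le> 0"
      then have "- 1 / 2 \<le> t" using assms by (auto simp: abs_le_iff)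
      moreover from this t have "t ^ 3 / (1 + t) \<le> 0" by (intro divide_nonpos_pos) (auto simp: power_le_zero_eq)
      ultimately show "\<exists>y. (g has_real_derivative y) (at t) \<and> y \<le> 0" using d by blast
    qed (use False in simp)
  qed
  moreover have "x ^ 3 / 3 \<le> \<bar>x\<bar> ^ 3" using abs_ge_self[of "x ^ 3"] zero_le_power[OF abs_ge_zero[of x], of 3] unfolding power_abs by linarith
  ultimately show ?thesis by (simp add: g_def)
qed

section \<open>A single Fourier mode, its moments and its second harmonic\<close>

locale mode =
  fixes l :: int and a b :: real
  assumes l: "l > 0"
begin

text \<open>A function of frequency l and its derivative \<open>n1\<close>; \<open>N\<close> is the
  mean of n^2, and \<open>m2\<close> the rest of n^2, a pure mode of frequency 2 l.\<close>

definition n :: "real \<Rightarrow> real" where "n x = a * eb l x + b * eb (- l) x"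
definition n1 :: "real \<Rightarrow> real" where "n1 x = of_int l * (b * eb l x - a * eb (- l) x)"
definition N :: real where "N = (a\<^sup>2 + b\<^sup>2) / (2 * pi)"
definition m2 :: "real \<Rightarrow> real" where "m2 x = (n x)\<^sup>2 - N"

lemma N_nonneg: "N \<ge> 0"
  by (simp add: N_def)

lemma n_deriv: "(n has_real_derivative n1 x) (at x)"
  unfolding n_def[abs_def] n1_def
  by (auto intro!: derivative_eq_intros eb_deriv eb_deriv[of "- l", simplified] simp: algebra_simps)

lemma n1_deriv: "(n1 has_real_derivative - (of_int l)\<^sup>2 * n x) (at x)"
  unfolding n_def n1_def[abs_def]
  by (auto intro!: derivative_eq_intros eb_deriv eb_deriv[of "- l", simplified] simp: algebra_simps power2_eq_square)

lemma CP_n: "CP j n" and CP_n1: "CP j n1"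
  unfolding n_def[abs_def] n1_def[abs_def] by (intro CP_cmult CP_add CP_diff CP_eb)+

lemma cont_n: "cont n" and cont_n1: "cont n1"
  using CP_cont CP_n CP_n1 by blast+

text \<open>Conservation of energy of a harmonic oscillator. It turns the exact derivatives of n^j
  n' into relations between the moments of n, from which the third and fourth moments are read
  off.\<close>

lemma pyth: "(n1 x)\<^sup>2 = (of_int l)\<^sup>2 * (2 * N - (n x)\<^sup>2)"
proof -
  have "(n x)\<^sup>2 + (b * eb l x - a * eb (- l) x)\<^sup>2 = (a\<^sup>2 + b\<^sup>2) * ((eb l x)\<^sup>2 + (eb (- l) x)\<^sup>2)"
    unfolding n_def by (simp add: power2_eq_square algebra_simps)
  also have "\<dots> = (a\<^sup>2 + b\<^sup>2) * (1 / pi)" using eb_sq[of l x] l by simp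
  also have "\<dots> = 2 * N" by (simp add: N_def field_simps)
  finally have "(b * eb l x - a * eb (- l) x)\<^sup>2 = 2 * N - (n x)\<^sup>2" by simp
  then show ?thesis unfolding n1_def power_mult_distrib by simp
qed

lemma n_sq_le: "(n x)\<^sup>2 \<le> 2 * N"
  using pyth[of x] l zero_le_power2[of "n1 x"] by (simp add: zero_le_mult_iff)

lemma CP_m2: "CP j m2"
  unfolding m2_def[abs_def] power2_eq_square by (intro CP_diff CP_mult CP_n CP_const)

lemma cont_m2: "cont m2"
  using CP_cont CP_m2 by blast

lemma m2_deriv: "(m2 has_real_derivative 2 * n x * n1 x) (at x)"
  unfolding m2_def[abs_def] using n_deriv by (auto intro!: derivative_eq_intros)

lemma m2_deriv2: "((\<lambda>x. 2 * n x * n1 x) has_real_derivative - (2 * of_int l)\<^sup>2 * m2 x) (at x)"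
proof -
  have "((\<lambda>x. 2 * n x * n1 x) has_real_derivative 2 * (n1 x)\<^sup>2 - 2 * (of_int l)\<^sup>2 * (n x)\<^sup>2) (at x)"
    using n_deriv n1_deriv by (auto intro!: derivative_eq_intros simp: power2_eq_square algebra_simps)
  then show ?thesis unfolding pyth m2_def by (simp add: power_mult_distrib algebra_simps)
qed

lemma m2_nth2: "nth_deriv 2 m2 = (\<lambda>x. - (2 * of_int l)\<^sup>2 * m2 x)"
  using nth_deriv_eqI[OF m2_deriv, of 1] nth_deriv_eqI[OF m2_deriv2, of 0] by (simp add: numeral_2_eq_2)

text \<open>\<open>m2\<close> is an eigenfunction of the second derivative with eigenvalue - (2
  l)^2.\<close>

lemma fc_m2: "\<bar>k\<bar> \<noteq> 2 * l \<Longrightarrow> fc m2 k = 0"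
proof -
  assume k: "\<bar>k\<bar> \<noteq> 2 * l"
  have "- (2 * of_int l)\<^sup>2 * fc m2 k = - (of_int k)\<^sup>2 * fc m2 k"
    using fc_deriv2[OF CP_m2, of k] unfolding m2_nth2 fc_cmult .
  moreover have "(2 * of_int l)\<^sup>2 \<noteq> (of_int k :: real)\<^sup>2"
  proof
    assume "(2 * of_int l)\<^sup>2 = (of_int k :: real)\<^sup>2"
    then have "of_int (2 * l) = (of_int k :: real) \<or> of_int (2 * l) = (of_int (- k) :: real)"
      using power2_eq_iff[of "2 * of_int l :: real" "of_int k"] by simp
    then show False using k l by (simp only: of_int_eq_iff) auto
  qed
  ultimately show ?thesis by simp
qed

lemma per_n: "periodic_2pi n" "periodic_2pi n1"
  using CP_periodic[OF CP_n[of 0]] CP_periodic[OF CP_n1[of 0]] by auto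

lemma circ_m2: "circ m2 = 0"
proof -
  have "circ (\<lambda>x. - (2 * of_int l)\<^sup>2 * m2 x) = 0"
    by (rule circ_deriv[OF _ m2_deriv2]) (use per_n in \<open>simp add: periodic_2pi_def\<close>)
  then show ?thesis unfolding circ_cmult using l by simp
qed

lemma av_n2: "av (\<lambda>x. (n x)\<^sup>2) = N"
proof -
  have "av (\<lambda>x. m2 x + N) = N"
    using av_add[OF cont_m2 continuous_on_const[of _ N]] circ_m2 av_const[of N] by (simp add: av_def)
  then show ?thesis by (simp add: m2_def)
qed

lemma circ_n: "circ n = 0"
proof -
  have "circ (\<lambda>x. - (of_int l)\<^sup>2 * n x) = 0" by (rule circ_deriv[OF per_n(2) n1_deriv])
  then show ?thesis unfolding circ_cmult using l by simp
qed

lemma av_n3: "av (\<lambda>x. (n x) ^ 3) = 0"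
proof -
  have "circ (\<lambda>x. (of_int l)\<^sup>2 * (4 * N * n x - 3 * (n x) ^ 3)) = 0"
  proof (rule circ_deriv[of "\<lambda>x. (n x)\<^sup>2 * n1 x"])
    fix x
    have "((\<lambda>x. (n x)\<^sup>2 * n1 x) has_real_derivative 2 * n x * (n1 x)\<^sup>2 - (of_int l)\<^sup>2 * (n x) ^ 3) (at x)"
      using n_deriv n1_deriv by (auto intro!: derivative_eq_intros simp: power2_eq_square power3_eq_cube algebra_simps)
    then show "((\<lambda>x. (n x)\<^sup>2 * n1 x) has_real_derivative (of_int l)\<^sup>2 * (4 * N * n x - 3 * (n x) ^ 3)) (at x)"
      unfolding pyth by (simp add: power2_eq_square power3_eq_cube algebra_simps)
  qed (use per_n in \<open>simp add: periodic_2pi_def\<close>)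
  then have "circ (\<lambda>x. 4 * N * n x - 3 * (n x) ^ 3) = 0" unfolding circ_cmult using l by simp
  then have "4 * N * circ n - 3 * circ (\<lambda>x. (n x) ^ 3) = 0"
    by (subst (asm) circ_diff) (auto intro!: continuous_on_mult continuous_on_power cont_n simp: circ_cmult)
  then show ?thesis by (simp add: circ_n av_def)
qed

lemma av_n4: "av (\<lambda>x. (n x) ^ 4) = 3 / 2 * N\<^sup>2"
proof -
  have "circ (\<lambda>x. (of_int l)\<^sup>2 * (6 * N * (n x)\<^sup>2 - 4 * (n x) ^ 4)) = 0"
  proof (rule circ_deriv[of "\<lambda>x. (n x) ^ 3 * n1 x"])
    fix x
    have "((\<lambda>x. (n x) ^ 3 * n1 x) has_real_derivative 3 * (n x)\<^sup>2 * (n1 x)\<^sup>2 - (of_int l)\<^sup>2 * (n x) ^ 4) (at x)"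
      using n_deriv n1_deriv
      by (auto intro!: derivative_eq_intros simp: power2_eq_square power3_eq_cube power4_eq_xxxx algebra_simps)
    then show "((\<lambda>x. (n x) ^ 3 * n1 x) has_real_derivative (of_int l)\<^sup>2 * (6 * N * (n x)\<^sup>2 - 4 * (n x) ^ 4)) (at x)"
      unfolding pyth by (simp add: power2_eq_square power4_eq_xxxx algebra_simps)
  qed (use per_n in \<open>simp add: periodic_2pi_def\<close>)
  then have "av (\<lambda>x. 6 * N * (n x)\<^sup>2 - 4 * (n x) ^ 4) = 0" unfolding circ_cmult using l by (simp add: av_def)
  then have "6 * N * av (\<lambda>x. (n x)\<^sup>2) - 4 * av (\<lambda>x. (n x) ^ 4) = 0"
    by (subst (asm) av_diff) (auto intro!: continuous_on_mult continuous_on_power cont_n simp: av_cmult)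
  then show ?thesis unfolding av_n2 by (simp add: power2_eq_square)
qed

lemma av_m2_sq: "av (\<lambda>x. (m2 x)\<^sup>2) = N\<^sup>2 / 2"
proof -
  have "(\<lambda>x. (m2 x)\<^sup>2) = (\<lambda>x. (n x) ^ 4 - 2 * N * m2 x - N\<^sup>2)"
    by (simp add: m2_def fun_eq_iff power2_eq_square power4_eq_xxxx algebra_simps)
  then have "av (\<lambda>x. (m2 x)\<^sup>2) = av (\<lambda>x. (n x) ^ 4) - 2 * N * av m2 - N\<^sup>2"
    using av_const[of "N\<^sup>2"]
    by (simp add: av_diff av_cmult continuous_on_diff continuous_on_mult continuous_on_power cont_n cont_m2)
  then show ?thesis using circ_m2 by (simp add: av_n4 av_def[of m2])
qed

end

lemma av_ip: "av (\<lambda>x. f x * g x) = ip f g / (2 * pi)"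
  by (simp add: av_def ip_circ)

lemma three_split:
  assumes f: "cont f" and FG: "finite F" "finite G" "F \<inter> G = {}"
  defines "z \<equiv> (\<lambda>x. f x - four F f x - four G f x)"
  shows "cont z" "fc z k = (if k \<in> F \<union> G then 0 else fc f k)"
    "ip f f = (\<Sum>k\<in>F. (fc f k)\<^sup>2) + (\<Sum>k\<in>G. (fc f k)\<^sup>2) + ip z z"
proof -
  have z: "z = (\<lambda>x. f x - four (F \<union> G) f x)"
    unfolding z_def four_def using FG by (simp add: sum.union_disjoint fun_eq_iff)
  have fin: "finite (F \<union> G)" using FG by simp
  show "cont z" unfolding z using f cont_four[OF fin] by (rule continuous_on_diff)
  show "fc z k = (if k \<in> F \<union> G then 0 else fc f k)"
    unfolding z using fc_diff[OF f cont_four[OF fin]] fc_four[OF fin] by simp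
  show "ip f f = (\<Sum>k\<in>F. (fc f k)\<^sup>2) + (\<Sum>k\<in>G. (fc f k)\<^sup>2) + ip z z"
    unfolding z ip_minus_four[OF fin f] using FG by (simp add: sum.union_disjoint)
qed

lemma ip_square_lin:
  assumes "cont f" "cont h"
  shows "ip (\<lambda>x. 1 * f x + c * h x) (\<lambda>x. 1 * f x + c * h x) = ip f f + 2 * c * ip f h + c\<^sup>2 * ip h h"
proof -
  have ch: "cont (\<lambda>x. c * h x)" using assms(2) by (intro continuous_on_mult continuous_on_const)
  have cs: "cont (\<lambda>x. f x + c * h x)" using assms(1) ch by (rule continuous_on_add)
  show ?thesis
    using ip_add[OF assms(1) ch cs] ip_add2[OF assms(1) ch assms(1)] ip_add2[OF assms(1) ch assms(2)]
    by (simp add: ip_cmult ip_cmult2 ip_commute[of h f] power2_eq_square algebra_simps)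
qed

lemma coercive_gap:
  assumes "CP 1 g" "0 < l" "\<And>k. \<bar>k\<bar> \<le> l \<Longrightarrow> fc g k = 0"
  shows "(of_int l + 1)\<^sup>2 * ip g g \<le> ip (nth_deriv 1 g) (nth_deriv 1 g)"
proof -
  have "l + 1 \<le> \<bar>k\<bar>" if "fc g k \<noteq> 0" for k using assms(3)[of k] that by force
  then show ?thesis using coercive[OF assms(1), of "l + 1"] assms(2) by simp
qed

text \<open>The quadratic form $l^2 \langle g^2\rangle - \langle g'^2\rangle$ absorbs the cubic interaction of the
  mode $l$ with its second harmonic, after completing the square.\<close>

lemma complete_square:
  fixes l :: int and a b p \<delta> :: real
  assumes l: "l \<ge> 3" and p: "p = (of_int l)\<^sup>2 - 2" and z: "CP 2 z" "\<And>k. \<bar>k\<bar> \<le> l \<Longrightarrow> fc z k = 0"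
    and \<delta>: "0 \<le> \<delta>" "\<delta> \<le> 1 - (of_int l)\<^sup>2 / (of_int l + 1)\<^sup>2"
  shows "(p + 2) * ip z z - ip (nth_deriv 1 z) (nth_deriv 1 z) - (p + 1) * (p + 2) * ip z (mode.m2 l a b)
    \<le> 2 * pi * ((p + 1)\<^sup>2 * (p + 2) / 24 * (mode.N a b)\<^sup>2 + \<delta> * (p + 1)\<^sup>2 * (p + 2) / 18 * (mode.N a b)\<^sup>2) - \<delta> / 2 * ip (nth_deriv 1 z) (nth_deriv 1 z)"
proof -
  interpret mode l a b using l by unfold_locales simp
  \<comment> \<open>At frequency 2 l the form contributes (p + 2) (1 - 4) = - 3 (p + 2) per unit of
    z^2; completing the square with the cross term (p + 1) (p + 2) z m2 gives the shift (p + 1) /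
    6.\<close>
  define \<kappa> where "\<kappa> = (p + 1) / 6"
  define g where "g = (\<lambda>x. 1 * z x + \<kappa> * mode.m2 l a b x)"
  have CPg: "CP 2 g" unfolding g_def by (rule CP_lin[OF z(1) CP_m2])
  have g1: "nth_deriv 1 g = (\<lambda>x. 1 * nth_deriv 1 z x + \<kappa> * nth_deriv 1 (mode.m2 l a b) x)"
    unfolding g_def by (rule nth_deriv_lin[OF z(1) CP_m2]) simp
  let ?m = "mode.m2 l a b" and ?z' = "nth_deriv 1 z" and ?m' = "nth_deriv 1 (mode.m2 l a b)"
  have c: "cont z" "cont ?m" "cont ?z'" "cont ?m'"
    using CP_cont[OF z(1)] cont_m2 CP_contj[OF z(1), of 1] CP_contj[OF CP_m2[of 1], of 1] by auto
  have fcg: "fc g k = 0" if "\<bar>k\<bar> \<le> l" for k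
  proof -
    have "\<bar>k\<bar> \<noteq> 2 * l" using that l by auto
    then show ?thesis
      unfolding g_def using fc_add[of "\<lambda>x. 1 * z x" "\<lambda>x. \<kappa> * ?m x" k] c z(2)[OF that] fc_m2[of k] fc_cmult[of \<kappa> ?m k]
      by (simp add: continuous_on_mult)
  qed
  have co: "(of_int l + 1)\<^sup>2 * ip g g \<le> ip (nth_deriv 1 g) (nth_deriv 1 g)"
    by (rule coercive_gap[OF CP_mono[OF CPg] _ fcg]) (use l in auto)
  have sq: "ip (\<lambda>x. 1 * f x + \<kappa> * h x) (\<lambda>x. 1 * f x + \<kappa> * h x) = ip f f + 2 * \<kappa> * ip f h + \<kappa>\<^sup>2 * ip h h"
    if "cont f" "cont h" for f h
    by (rule ip_square_lin[OF that])
  have gg: "ip g g = ip z z + 2 * \<kappa> * ip z ?m + \<kappa>\<^sup>2 * ip ?m ?m"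
    unfolding g_def by (rule sq[OF c(1,2)])
  have g1g1: "ip (nth_deriv 1 g) (nth_deriv 1 g) = ip ?z' ?z' + 2 * \<kappa> * ip ?z' ?m' + \<kappa>\<^sup>2 * ip ?m' ?m'"
    unfolding g1 by (rule sq[OF c(3,4)])
  have par: "ip (nth_deriv 1 f) ?m' = (2 * of_int l)\<^sup>2 * ip f ?m" if "CP 2 f" for f
  proof -
    have "nth_deriv 1 ?m' = nth_deriv 2 ?m" by (simp add: nth_deriv_add[of 1 1 "?m", simplified] numeral_2_eq_2)
    then show ?thesis
      using ip_parts[OF CP_mono[OF that] CP_nth[of 1 1 ?m]] CP_m2[of 2] unfolding m2_nth2
      by (simp only: ip_cmult2) (simp add: numeral_2_eq_2)
  qed
  have mm: "ip ?m ?m = 2 * pi * (N\<^sup>2 / 2)" using av_m2_sq by (simp add: av_ip power2_eq_square field_simps)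
  have l2: "(2 * of_int l)\<^sup>2 = 4 * (p + 2)" using p by (simp add: power_mult_distrib)
  have z'm': "ip ?z' ?m' = 4 * (p + 2) * ip z ?m" using par[OF z(1)] l2 by simp
  have m'm': "ip ?m' ?m' = 4 * (p + 2) * (2 * pi * (N\<^sup>2 / 2))" using par[OF CP_m2] l2 mm by simp
  have nn: "0 \<le> ip g g" "0 \<le> ip (nth_deriv 1 g) (nth_deriv 1 g)"
    using ip_pos CP_cont[OF CPg] CP_contj[OF CPg, of 1] by auto
  let ?G = "ip (nth_deriv 1 g) (nth_deriv 1 g)"
  \<comment> \<open>All modes of g lie beyond l, so the form is at most - \<delta> |g'|^2; this
    reserve is what later leaves a negative multiple of |z'|^2.\<close>
  have "(p + 2) * ip g g \<le> (1 - \<delta>) * ?G"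
  proof -
    have L: "(of_int l + 1)\<^sup>2 > (0::real)" using l by simp
    have "(p + 2) * ip g g = (of_int l)\<^sup>2 / (of_int l + 1)\<^sup>2 * ((of_int l + 1)\<^sup>2 * ip g g)" using L p by simp
    also have "\<dots> \<le> (of_int l)\<^sup>2 / (of_int l + 1)\<^sup>2 * ?G" using co by (intro mult_left_mono) auto
    also have "\<dots> \<le> (1 - \<delta>) * ?G" using \<delta> nn by (intro mult_right_mono) auto
    finally show ?thesis .
  qed
  then have 1: "(p + 2) * ip g g - ?G \<le> - \<delta> * ?G" by (simp add: algebra_simps)
  have "ip ?z' ?z' \<le> 2 * ?G + 2 * (\<kappa>\<^sup>2 * ip ?m' ?m')"
  proof -
    have "0 \<le> ip (\<lambda>x. 1 * ?z' x + (2 * \<kappa>) * ?m' x) (\<lambda>x. 1 * ?z' x + (2 * \<kappa>) * ?m' x)"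
      by (intro ip_pos continuous_on_add continuous_on_mult continuous_on_const c)
    also have "\<dots> = ip ?z' ?z' + 4 * \<kappa> * ip ?z' ?m' + 4 * (\<kappa>\<^sup>2 * ip ?m' ?m')"
      unfolding ip_square_lin[OF c(3,4)] by (simp add: power2_eq_square)
    finally show ?thesis unfolding g1g1 by simp
  qed
  then have "\<delta> / 2 * ip ?z' ?z' \<le> \<delta> / 2 * (2 * ?G + 2 * (\<kappa>\<^sup>2 * ip ?m' ?m'))"
    using \<delta>(1) by (intro mult_left_mono) auto
  then have 2: "- \<delta> * ?G \<le> - \<delta> / 2 * ip ?z' ?z' + \<delta> * (\<kappa>\<^sup>2 * ip ?m' ?m')" by (simp add: algebra_simps)
  have "(p + 2) * ip z z - ip ?z' ?z' - (p + 1) * (p + 2) * ip z ?m =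
    (p + 2) * ip g g - ?G + 2 * pi * ((p + 1)\<^sup>2 * (p + 2) / 24 * N\<^sup>2)"
    unfolding gg g1g1 mm z'm' m'm' \<kappa>_def by (simp add: field_simps power2_eq_square)
  also have "\<dots> \<le> 2 * pi * ((p + 1)\<^sup>2 * (p + 2) / 24 * N\<^sup>2) + (- \<delta> / 2 * ip ?z' ?z' + \<delta> * (\<kappa>\<^sup>2 * ip ?m' ?m'))"
    using 1 2 by linarith
  also have "\<delta> * (\<kappa>\<^sup>2 * ip ?m' ?m') = 2 * pi * (\<delta> * (p + 1)\<^sup>2 * (p + 2) / 18 * N\<^sup>2)"
    unfolding m'm' \<kappa>_def by (simp add: field_simps power2_eq_square)
  finally show ?thesis by (simp add: algebra_simps)
qed

section \<open>Scalar inequalities for the fourth order expansion\<close>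

lemma abs_cube_le: "\<bar>x\<bar> \<le> e \<Longrightarrow> \<bar>x\<bar> ^ 3 \<le> e * (x::real)\<^sup>2"
  using mult_right_mono[of "\<bar>x\<bar>" e "x\<^sup>2"] by (simp add: power3_eq_cube power2_eq_square abs_mult[symmetric] mult.assoc)

text \<open>\<open>A\<close> is the relative change of the mean of u (u + u''). Since R <= D, - A is
  at least (p + 1) N, so - A^2 / 2 contributes its full N^2 term; the cubic term is at most a
  multiple of \<epsilon> (N^2 + D).\<close>

lemma quartic_upper:
  fixes A N D R p \<epsilon> :: real
  assumes A: "A = - (p + 1) * N + R - D" "R \<le> D" "0 \<le> R" "0 \<le> N"
    and e: "0 < \<epsilon>" "N \<le> \<epsilon>" "D \<le> \<epsilon>" "(p + 2) * \<epsilon> \<le> 1 / 2" "\<epsilon> \<le> 1" and p: "0 < p"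
  shows "\<bar>A\<bar> \<le> 1 / 2"
    "A - A\<^sup>2 / 2 + \<bar>A\<bar> ^ 3 \<le> A - (p + 1)\<^sup>2 / 2 * N\<^sup>2 + \<epsilon> * ((p + 2) * (2 * (p + 1)\<^sup>2 + 2)) * (N\<^sup>2 + D)"
proof -
  have n: "0 \<le> (p + 1) * N" "0 \<le> D" using A p by auto
  have A1: "A = - ((p + 1) * N) + R - D" using A(1) by (simp add: algebra_simps)
  have aA: "\<bar>A\<bar> \<le> (p + 1) * N + D" using A(2,3) n unfolding A1 abs_le_iff by linarith
  also have "\<dots> \<le> (p + 1) * \<epsilon> + \<epsilon>" using e p by (intro add_mono mult_left_mono) auto
  finally have aE: "\<bar>A\<bar> \<le> (p + 2) * \<epsilon>" by (simp add: algebra_simps)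
  then show "\<bar>A\<bar> \<le> 1 / 2" using e by linarith
  have "((p + 1) * N)\<^sup>2 \<le> (- A)\<^sup>2" using A(2) n unfolding A1 by (intro power_mono) auto
  then have 1: "(p + 1)\<^sup>2 * N\<^sup>2 \<le> A\<^sup>2" by (simp add: power_mult_distrib)
  have "A\<^sup>2 \<le> ((p + 1) * N + D)\<^sup>2" using aA by (metis abs_ge_zero power2_abs power_mono)
  also have "\<dots> \<le> 2 * ((p + 1) * N)\<^sup>2 + 2 * D\<^sup>2"
    using zero_le_power2[of "(p + 1) * N - D"] by (simp add: power2_eq_square algebra_simps)
  also have "\<dots> \<le> 2 * ((p + 1)\<^sup>2 * N\<^sup>2) + 2 * D"
  proof -
    have "D\<^sup>2 \<le> D" using n e by (simp add: power2_eq_square mult_left_le)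
    then show ?thesis by (simp add: power_mult_distrib)
  qed
  also have "\<dots> \<le> (2 * (p + 1)\<^sup>2 + 2) * (N\<^sup>2 + D)" using n by (simp add: algebra_simps)
  finally have 2: "A\<^sup>2 \<le> (2 * (p + 1)\<^sup>2 + 2) * (N\<^sup>2 + D)" .
  have "\<bar>A\<bar> ^ 3 \<le> (p + 2) * \<epsilon> * A\<^sup>2" by (rule abs_cube_le[OF aE])
  also have "\<dots> \<le> (p + 2) * \<epsilon> * ((2 * (p + 1)\<^sup>2 + 2) * (N\<^sup>2 + D))" using 2 e p by (intro mult_left_mono) auto
  finally show "A - A\<^sup>2 / 2 + \<bar>A\<bar> ^ 3 \<le> A - (p + 1)\<^sup>2 / 2 * N\<^sup>2 + \<epsilon> * ((p + 2) * (2 * (p + 1)\<^sup>2 + 2)) * (N\<^sup>2 + D)"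
    using 1 by (simp add: algebra_simps)
qed

text \<open>\<open>B\<close> is the relative change of the mean of u^(- p), close to b times the
  mean U of the squared perturbation. As U >= N, the square of B supplies b^2 N^2 up to errors of
  order \<epsilon> (N^2 + D).\<close>

lemma quartic_upper_B:
  fixes B U N R D b C \<epsilon> :: real
  assumes B: "\<bar>B - b * U\<bar> \<le> C * \<epsilon> * U" "U = N + R" "0 \<le> N" "0 \<le> R" "R \<le> D" "0 < b" "0 < C"
    and e: "0 < \<epsilon>" "U \<le> \<epsilon>" "\<epsilon> \<le> 1" "C * \<epsilon> \<le> b" "(b + C) * \<epsilon> \<le> 1 / 2"
  shows "\<bar>B\<bar> \<le> 1 / 2"
    "B - B\<^sup>2 / 2 + \<bar>B\<bar> ^ 3 \<le> B - b\<^sup>2 / 2 * N\<^sup>2 + \<epsilon> * (b * C + 2 * (b + C) ^ 3) * (N\<^sup>2 + D)"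
proof -
  have U: "0 \<le> U" using B by simp
  have "0 \<le> b * U" using B U by simp
  then have "\<bar>B\<bar> \<le> b * U + C * \<epsilon> * U" using B(1) unfolding abs_le_iff by linarith
  also have "\<dots> \<le> b * U + C * 1 * U" using e U B by (intro add_left_mono mult_right_mono mult_left_mono) auto
  finally have aU: "\<bar>B\<bar> \<le> (b + C) * U" by (simp add: algebra_simps)
  also have "\<dots> \<le> (b + C) * \<epsilon>" using e B by (intro mult_left_mono) auto
  finally have aE: "\<bar>B\<bar> \<le> (b + C) * \<epsilon>" .
  then show "\<bar>B\<bar> \<le> 1 / 2" using e by linarith
  have lo: "(b - C * \<epsilon>) * N \<le> B"
  proof -
    have "(b - C * \<epsilon>) * N \<le> (b - C * \<epsilon>) * U" using e B by (intro mult_left_mono) auto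
    also have "\<dots> \<le> B" using B(1) by (simp add: abs_le_iff algebra_simps)
    finally show ?thesis .
  qed
  moreover have "0 \<le> (b - C * \<epsilon>) * N" using e B by simp
  ultimately have "((b - C * \<epsilon>) * N)\<^sup>2 \<le> B\<^sup>2" by (intro power_mono) auto
  moreover have "b\<^sup>2 * N\<^sup>2 - 2 * (b * (C * \<epsilon>)) * N\<^sup>2 \<le> ((b - C * \<epsilon>) * N)\<^sup>2"
    using zero_le_power2[of "C * \<epsilon> * N"] by (simp add: power2_eq_square algebra_simps)
  ultimately have 1: "b\<^sup>2 * N\<^sup>2 - 2 * (b * (C * \<epsilon>)) * N\<^sup>2 \<le> B\<^sup>2" by linarith
  have "B\<^sup>2 \<le> ((b + C) * U)\<^sup>2" using aU by (metis abs_ge_zero power2_abs power_mono)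
  also have "\<dots> \<le> (b + C)\<^sup>2 * (2 * (N\<^sup>2 + D))"
  proof -
    have "U\<^sup>2 \<le> 2 * N\<^sup>2 + 2 * R\<^sup>2" unfolding B(2) using zero_le_power2[of "N - R"] by (simp add: power2_eq_square algebra_simps)
    moreover have "R\<^sup>2 \<le> R" using B e by (simp add: power2_eq_square mult_left_le)
    ultimately have "U\<^sup>2 \<le> 2 * (N\<^sup>2 + D)" using B(5) by simp
    then show ?thesis unfolding power_mult_distrib by (intro mult_left_mono) auto
  qed
  finally have 2: "B\<^sup>2 \<le> (b + C)\<^sup>2 * (2 * (N\<^sup>2 + D))" .
  have "\<bar>B\<bar> ^ 3 \<le> (b + C) * \<epsilon> * B\<^sup>2" by (rule abs_cube_le[OF aE])
  also have "\<dots> \<le> (b + C) * \<epsilon> * ((b + C)\<^sup>2 * (2 * (N\<^sup>2 + D)))" using 2 e B by (intro mult_left_mono) auto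
  also have "\<dots> = \<epsilon> * (2 * (b + C) ^ 3) * (N\<^sup>2 + D)" by (simp add: power2_eq_square power3_eq_cube)
  finally have 3: "\<bar>B\<bar> ^ 3 \<le> \<epsilon> * (2 * (b + C) ^ 3) * (N\<^sup>2 + D)" .
  have 4: "b * (C * \<epsilon>) * N\<^sup>2 \<le> \<epsilon> * (b * C) * (N\<^sup>2 + D)" using B e by (simp add: algebra_simps)
  show "B - B\<^sup>2 / 2 + \<bar>B\<bar> ^ 3 \<le> B - b\<^sup>2 / 2 * N\<^sup>2 + \<epsilon> * (b * C + 2 * (b + C) ^ 3) * (N\<^sup>2 + D)"
    using 1 3 4 by (simp add: algebra_simps)
qed

lemma circ_eq_fc0: "circ f = sqrt (2 * pi) * fc f 0"
proof -
  have "fc f 0 = circ (\<lambda>x. (1 / sqrt (2 * pi)) * f x)" by (simp add: fc_def ip_circ eb_def)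
  then show ?thesis unfolding circ_cmult by simp
qed

lemma av_bound: "cont f \<Longrightarrow> (\<And>x. f x \<le> B) \<Longrightarrow> av f \<le> B"
  using av_mono[of f "\<lambda>x. B"] by (simp add: av_const)

text \<open>Main terms of the fourth order expansion of the entropy around the circle; the coefficient of
  \<open>N\<^sup>2\<close> adds up to \<open>- p (p + 1) (p\<^sup>2 - 4) / 12\<close>.\<close>

lemma quartic_combine:
  fixes p b c3 c4 N R D S Rz Z X X0 \<delta> \<epsilon> K1 K2 C5 A B T3 T4 T5 \<A> \<B> :: real
  assumes p: "7 \<le> p" and b: "b = p * (p + 1) / 2" and c3: "c3 = p * (p + 1) * (p + 2) / 6"
    and c4: "c4 = p * (p + 1) * (p + 2) * (p + 3) / 24" and C5: "0 < C5"
    and pos: "0 \<le> N" "0 \<le> R" "R \<le> D" "0 < \<epsilon>" "R = X0 + Rz" "D = X + Z"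
    and A: "A = - (p + 1) * N + R - D" "\<A> \<le> A - (p + 1)\<^sup>2 / 2 * N\<^sup>2 + \<epsilon> * K1 * (N\<^sup>2 + D)"
    and B: "B \<le> b * (N + R) - c3 * T3 + c4 * T4 + C5 * T5"
      "\<B> \<le> B - b\<^sup>2 / 2 * N\<^sup>2 + \<epsilon> * K2 * (N\<^sup>2 + D)"
    and T: "\<bar>T3 - 3 * S\<bar> \<le> 9 * \<epsilon> * R" "T4 \<le> 3 / 2 * N\<^sup>2 + \<epsilon> * (6 * N\<^sup>2 + 61 * R)" "T5 \<le> \<epsilon> * (12 * N\<^sup>2 + 72 * R)"
    and sq: "(p + 2) * Rz - Z - (p + 1) * (p + 2) * S
      \<le> (p + 1)\<^sup>2 * (p + 2) / 24 * N\<^sup>2 + \<delta> * (p + 1)\<^sup>2 * (p + 2) / 18 * N\<^sup>2 - \<delta> / 2 * Z"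
    and d: "0 \<le> \<delta>" "\<delta> \<le> 3 * (p - 2) / (4 * (p + 1))"
    and ent: "0 \<le> p * \<A> + 2 * \<B>"
  shows "0 \<le> p * (p + 2) * X0 - p * X - p * \<delta> / 2 * Z - p * (p + 1) * (p\<^sup>2 - 4) / 24 * N\<^sup>2
    + \<epsilon> * (p * K1 + 2 * K2 + 18 * c3 + 122 * c4 + 144 * C5) * (N\<^sup>2 + (X + Z))"
proof -
  have c: "0 \<le> c3" "0 \<le> c4" using p by (auto simp: c3 c4)
  let ?Q = "N\<^sup>2 + D"
  have RQ: "R \<le> ?Q" "0 \<le> ?Q" using pos by (auto intro: add_increasing)
  have "p * \<A> \<le> p * (A - (p + 1)\<^sup>2 / 2 * N\<^sup>2 + \<epsilon> * K1 * ?Q)" using A(2) p by (intro mult_left_mono) auto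
  then have a: "p * \<A> \<le> p * A - p * (p + 1)\<^sup>2 / 2 * N\<^sup>2 + \<epsilon> * (p * K1) * ?Q" by (simp add: algebra_simps)
  have "- T3 \<le> - 3 * S + 9 * \<epsilon> * R" using T(1) by (simp add: abs_le_iff)
  also have "9 * \<epsilon> * R \<le> 9 * \<epsilon> * ?Q" using RQ pos by (intro mult_left_mono) auto
  finally have "c3 * (- T3) \<le> c3 * (- 3 * S + 9 * \<epsilon> * ?Q)" using c by (intro mult_left_mono) auto
  then have t3: "- (c3 * T3) \<le> - 3 * c3 * S + \<epsilon> * (9 * c3) * ?Q" by (simp add: algebra_simps)
  have "T4 \<le> 3 / 2 * N\<^sup>2 + \<epsilon> * (61 * ?Q)"
  proof -
    have "6 * N\<^sup>2 \<le> 61 * N\<^sup>2" "61 * R \<le> 61 * D" using pos(3) by simp_all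
    then have "6 * N\<^sup>2 + 61 * R \<le> 61 * ?Q" unfolding distrib_left by (rule add_mono)
    from mult_left_mono[OF this, of \<epsilon>] show ?thesis using T(2) pos(4) by linarith
  qed
  then have "c4 * T4 \<le> c4 * (3 / 2 * N\<^sup>2 + \<epsilon> * (61 * ?Q))" using c by (intro mult_left_mono) auto
  then have t4: "c4 * T4 \<le> 3 / 2 * c4 * N\<^sup>2 + \<epsilon> * (61 * c4) * ?Q" by (simp add: algebra_simps)
  have "T5 \<le> \<epsilon> * (72 * ?Q)"
  proof -
    have "12 * N\<^sup>2 \<le> 72 * N\<^sup>2" "72 * R \<le> 72 * D" using pos(3) by simp_all
    then have "12 * N\<^sup>2 + 72 * R \<le> 72 * ?Q" unfolding distrib_left by (rule add_mono)
    from mult_left_mono[OF this, of \<epsilon>] show ?thesis using T(3) pos(4) by linarith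
  qed
  then have "C5 * T5 \<le> C5 * (\<epsilon> * (72 * ?Q))" using C5 by (intro mult_left_mono) auto
  then have t5: "C5 * T5 \<le> \<epsilon> * (72 * C5) * ?Q" by (simp add: algebra_simps)
  have "2 * \<B> \<le> 2 * b * (N + R) - 6 * c3 * S + 3 * c4 * N\<^sup>2 - b\<^sup>2 * N\<^sup>2
     + \<epsilon> * (2 * K2 + 18 * c3 + 122 * c4 + 144 * C5) * ?Q"
    using B t3 t4 t5 by (simp add: algebra_simps)
  with a ent have 1: "0 \<le> p * A + 2 * b * (N + R) - 6 * c3 * S + (3 * c4 - b\<^sup>2 - p * (p + 1)\<^sup>2 / 2) * N\<^sup>2
     + \<epsilon> * (p * K1 + 2 * K2 + 18 * c3 + 122 * c4 + 144 * C5) * ?Q"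
    by (simp add: algebra_simps)
  \<comment> \<open>The terms linear in N cancel because 2 b = p (p + 1): the mode l lies in the
    kernel of the second variation of the entropy.\<close>
  have e1: "p * A + 2 * b * (N + R) - 6 * c3 * S = p * ((p + 2) * X0 - X) + p * ((p + 2) * Rz - Z - (p + 1) * (p + 2) * S)"
    unfolding A(1) b c3 pos(5,6) by (simp add: field_simps)
  have e2: "p * ((p + 2) * Rz - Z - (p + 1) * (p + 2) * S) \<le> p * ((p + 1)\<^sup>2 * (p + 2) / 24 * N\<^sup>2 + \<delta> * (p + 1)\<^sup>2 * (p + 2) / 18 * N\<^sup>2 - \<delta> / 2 * Z)"
    using sq p by (intro mult_left_mono) auto
  \<comment> \<open>At the upper bound imposed on \<delta> the reserve costs exactly half of the N^2
    coefficient, leaving - p (p + 1) (p^2 - 4) / 24.\<close>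
  have "\<delta> * (p * (p + 1)\<^sup>2 * (p + 2) / 18) \<le> 3 * (p - 2) / (4 * (p + 1)) * (p * (p + 1)\<^sup>2 * (p + 2) / 18)"
    using d p by (intro mult_right_mono) auto
  also have "\<dots> = p * (p + 1) * (p\<^sup>2 - 4) / 24"
    using p by (simp add: field_simps power2_eq_square)
  finally have dd: "p * (\<delta> * (p + 1)\<^sup>2 * (p + 2) / 18) \<le> p * (p + 1) * (p\<^sup>2 - 4) / 24" by (simp add: algebra_simps)
  have e3: "3 * c4 - b\<^sup>2 - p * (p + 1)\<^sup>2 / 2 + p * ((p + 1)\<^sup>2 * (p + 2) / 24) = - (p * (p + 1) * (p\<^sup>2 - 4) / 12)"
    unfolding c4 b by (simp add: field_simps power2_eq_square)
  have "(3 * c4 - b\<^sup>2 - p * (p + 1)\<^sup>2 / 2 + p * ((p + 1)\<^sup>2 * (p + 2) / 24) + p * (\<delta> * (p + 1)\<^sup>2 * (p + 2) / 18)) * N\<^sup>2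
     \<le> (- (p * (p + 1) * (p\<^sup>2 - 4) / 24)) * N\<^sup>2"
  proof (rule mult_right_mono)
    have "- (x / 12) + y \<le> - (x / 24)" if "y \<le> x / 24" for x y :: real using that by simp
    from this[OF dd] show "3 * c4 - b\<^sup>2 - p * (p + 1)\<^sup>2 / 2 + p * ((p + 1)\<^sup>2 * (p + 2) / 24) + p * (\<delta> * (p + 1)\<^sup>2 * (p + 2) / 18)
      \<le> - (p * (p + 1) * (p\<^sup>2 - 4) / 24)" unfolding e3 .
  qed simp
  then show ?thesis using 1 e1 e2 unfolding pos(6) by (simp add: algebra_simps)
qed

text \<open>On mean-free functions the second variation of the entropy is positive for 0 < |k| < l,
  negative for |k| > l and zero at l, where the fourth order coefficient is negative as p > 2. An
  entropy not below that of the circle therefore has to be paid for by the modes below l.\<close>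

lemma static_neutral:
  assumes l3: "(l::int) \<ge> 3" and p: "p = (of_int l)\<^sup>2 - (2::real)"
  obtains \<epsilon> C where "\<epsilon> > 0" "C > 0"
    "\<And>f. CP 2 f \<Longrightarrow> fc f 0 = 0 \<Longrightarrow> (\<And>x. \<bar>f x\<bar> \<le> \<epsilon>) \<Longrightarrow> (\<And>x. \<bar>nth_deriv 1 f x\<bar> \<le> \<epsilon>) \<Longrightarrow>
       0 \<le> p * ln (1 + (ip f f - ip (nth_deriv 1 f) (nth_deriv 1 f)) / (2 * pi)) + 2 * ln (av (\<lambda>x. (1 + f x) powr - p)) \<Longrightarrow>
       ((fc f l)\<^sup>2 + (fc f (- l))\<^sup>2)\<^sup>2 + (ip f f - ((fc f l)\<^sup>2 + (fc f (- l))\<^sup>2) - (\<Sum>k\<in>{k. 0 < \<bar>k\<bar> \<and> \<bar>k\<bar> < l}. (fc f k)\<^sup>2))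
         \<le> C * (\<Sum>k\<in>{k. 0 < \<bar>k\<bar> \<and> \<bar>k\<bar> < l}. (fc f k)\<^sup>2)"
proof -
  note l = l3
  have "(3::real)\<^sup>2 \<le> (of_int l)\<^sup>2" using l by (intro power_mono) auto
  then have p7: "7 \<le> p" using p by simp
  define b where "b = p * (p + 1) / 2"
  define c3 where "c3 = p * (p + 1) * (p + 2) / 6"
  define c4 where "c4 = p * (p + 1) * (p + 2) * (p + 3) / 24"
  have bc: "0 < b" "0 < c3" "0 < c4" using p7 by (auto simp: b_def c3_def c4_def)
  have g2: "- p gchoose 2 = b"
    by (simp add: gbinomial_prod_rev numeral_2_eq_2 fact_numeral b_def algebra_simps)
  have g3: "- p gchoose 3 = - c3"
    by (simp add: gbinomial_prod_rev eval_nat_numeral fact_numeral c3_def field_simps)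
  have g4: "- p gchoose 4 = c4"
    by (simp add: gbinomial_prod_rev eval_nat_numeral fact_numeral c4_def field_simps)
  obtain C3 where C3: "C3 > 0" "\<And>w. \<bar>w\<bar> \<le> 1 / 2 \<Longrightarrow> \<bar>(1 + w) powr - p - (\<Sum>m<3. (- p gchoose m) * w ^ m)\<bar> \<le> C3 * \<bar>w\<bar> ^ 3"
    using powr_taylor[of "- p" 3] by blast
  have s3: "(\<Sum>m<3. (- p gchoose m) * w ^ m) = 1 - p * w + b * w\<^sup>2" for w
    using g2 by (simp add: numeral_3_eq_3 numeral_2_eq_2)
  obtain C5 where C5: "C5 > 0" "\<And>w. \<bar>w\<bar> \<le> 1 / 2 \<Longrightarrow> \<bar>(1 + w) powr - p - (\<Sum>m<5. (- p gchoose m) * w ^ m)\<bar> \<le> C5 * \<bar>w\<bar> ^ 5"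
    using powr_taylor[of "- p" 5] by blast
  have s5: "(\<Sum>m<5. (- p gchoose m) * w ^ m) = 1 - p * w + b * w\<^sup>2 - c3 * w ^ 3 + c4 * w ^ 4" for w
  proof -
    have "(\<Sum>m<5. (- p gchoose m) * w ^ m) = (\<Sum>m<3. (- p gchoose m) * w ^ m) + (- p gchoose 3) * w ^ 3 + (- p gchoose 4) * w ^ 4"
      by (simp add: lessThan_nat_numeral eval_nat_numeral)
    then show ?thesis unfolding s3 g3 g4 by simp
  qed
  define K1 where "K1 = (p + 2) * (2 * (p + 1)\<^sup>2 + 2)"
  define K2 where "K2 = b * C3 + 2 * (b + C3) ^ 3"
  define K where "K = p * K1 + 2 * K2 + 18 * c3 + 122 * c4 + 144 * C5"
  have K: "K > 0" unfolding K_def K1_def K2_def using p7 bc C3 C5 by (intro add_nonneg_pos add_nonneg_nonneg) auto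
  define \<delta> where "\<delta> = min (1 - (of_int l)\<^sup>2 / (of_int l + 1)\<^sup>2) (3 * (p - 2) / (4 * (p + 1)))"
  have \<delta>: "0 < \<delta>" "\<delta> \<le> 1 - (of_int l)\<^sup>2 / (of_int l + 1)\<^sup>2" "\<delta> \<le> 3 * (p - 2) / (4 * (p + 1))"
  proof -
    have "(of_int l)\<^sup>2 < (of_int l + 1 :: real)\<^sup>2" using l by (intro power_strict_mono) auto
    moreover have "0 < (of_int l + 1 :: real)\<^sup>2" using l by simp
    ultimately have "(of_int l)\<^sup>2 / (of_int l + 1 :: real)\<^sup>2 < 1" by (simp only: divide_less_eq_1_pos)
    then show "0 < \<delta>" unfolding \<delta>_def using p7 by simp
  qed (auto simp: \<delta>_def)
  \<comment> \<open>The smaller of the coefficients of Z and N^2 in \<open>quartic_combine\<close>;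
    with \<epsilon> K <= c1 / 2 below, the error takes away at most half of it.\<close>
  define c1 where "c1 = min (p * \<delta> / 2) (p * (p + 1) * (p\<^sup>2 - 4) / 24)"
  have "4 < p\<^sup>2" using p7 power_strict_mono[of 2 p 2] by simp
  then have c1: "0 < c1" "c1 \<le> p * \<delta> / 2" "c1 \<le> p * (p + 1) * (p\<^sup>2 - 4) / 24"
    using p7 \<delta> by (auto simp: c1_def)
  \<comment> \<open>The reciprocal of \<epsilon>: a sum of positive terms, one for each smallness
    condition in \<open>e\<close>.\<close>
  define M where "M = 2 + 2 * (p + 2) + C3 / b + 2 * (b + C3) + 2 * (K / c1)"
  have Mpos: "0 < p + 2" "0 < C3 / b" "0 < b + C3" "0 < K / c1" using p7 C3 bc K c1 by auto
  define \<epsilon> where "\<epsilon> = 1 / M"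
  have M: "M > 0" unfolding M_def using Mpos by simp
  have eM: "t * \<epsilon> \<le> 1" if "t \<le> M" for t using that M by (simp add: \<epsilon>_def)
  have e: "0 < \<epsilon>" "\<epsilon> \<le> 1 / 2" "(p + 2) * \<epsilon> \<le> 1 / 2" "C3 * \<epsilon> \<le> b" "(b + C3) * \<epsilon> \<le> 1 / 2" "\<epsilon> * K \<le> c1 / 2"
  proof -
    show "0 < \<epsilon>" using M by (simp add: \<epsilon>_def)
    have le: "2 \<le> M" "2 * (p + 2) \<le> M" "C3 / b \<le> M" "2 * (b + C3) \<le> M" "2 * (K / c1) \<le> M"
    proof -
      have "2 \<le> 2 + 2 * x + y + 2 * z + 2 * u" "2 * x \<le> 2 + 2 * x + y + 2 * z + 2 * u" "y \<le> 2 + 2 * x + y + 2 * z + 2 * u"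
        "2 * z \<le> 2 + 2 * x + y + 2 * z + 2 * u" "2 * u \<le> 2 + 2 * x + y + 2 * z + 2 * u"
        if "0 < x" "0 < y" "0 < z" "0 < u" for x y z u :: real using that by simp_all
      from this[OF Mpos] show "2 \<le> M" "2 * (p + 2) \<le> M" "C3 / b \<le> M" "2 * (b + C3) \<le> M" "2 * (K / c1) \<le> M"
        unfolding M_def .
    qed
    show "\<epsilon> \<le> 1 / 2" using eM[OF le(1)] by simp
    show "(p + 2) * \<epsilon> \<le> 1 / 2" using eM[OF le(2)] by (simp add: algebra_simps)
    have "C3 / b * \<epsilon> \<le> 1" by (rule eM[OF le(3)])
    then show "C3 * \<epsilon> \<le> b" using bc by (simp add: field_simps)
    show "(b + C3) * \<epsilon> \<le> 1 / 2" using eM[OF le(4)] by (simp add: algebra_simps)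
    have "2 * (K / c1) * \<epsilon> \<le> 1" by (rule eM[OF le(5)])
    then show "\<epsilon> * K \<le> c1 / 2" using c1 by (simp add: field_simps)
  qed
  have ee: "\<epsilon>\<^sup>2 \<le> \<epsilon>" "\<epsilon> \<le> 1" using e by (auto simp: power2_eq_square mult_left_le)
  define C' where "C' = 2 / c1 * (p * (p + 2) + c1 / 2 * (p + 2))"
  have C': "C' > 0" unfolding C'_def using p7 c1 by (intro mult_pos_pos add_pos_pos) auto
  show ?thesis
  proof (rule that[OF e(1), of "2 * pi * C'"])
    show "2 * pi * C' > 0" using C' by simp
    fix f assume f: "CP 2 f" "fc f 0 = 0" "\<And>x. \<bar>f x\<bar> \<le> \<epsilon>" "\<And>x. \<bar>nth_deriv 1 f x\<bar> \<le> \<epsilon>"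
      and H: "0 \<le> p * ln (1 + (ip f f - ip (nth_deriv 1 f) (nth_deriv 1 f)) / (2 * pi)) + 2 * ln (av (\<lambda>x. (1 + f x) powr - p))"
    define F where "F = {k::int. 0 < \<bar>k\<bar> \<and> \<bar>k\<bar> < l}"
    define G where "G = {l, - l}"
    have "F \<subseteq> {- l..l}" by (auto simp: F_def)
    then have fin: "finite F" "finite G" "F \<inter> G = {}"
      using l finite_subset[of F "{- l..l}"] by (auto simp: F_def G_def)
    have Fs: "- k \<in> F" if "k \<in> F" for k using that by (auto simp: F_def)
    have Gs: "- k \<in> G" if "k \<in> G" for k using that by (auto simp: G_def)
    let ?f' = "nth_deriv 1 f"
    have f1: "CP 1 f" using CP_mono[OF f(1)] by simp
    have c: "cont f" "cont ?f'" using CP_cont[OF f(1)] CP_contj[OF f(1), of 1] by auto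
    define z where "z = (\<lambda>x. f x - four F f x - four G f x)"
    interpret mode l "fc f l" "fc f (- l)" using l by unfold_locales simp
    have nG: "four G f = n" using l by (auto simp: four_def n_def G_def fun_eq_iff)
    have z2: "CP 2 z" unfolding z_def by (intro CP_diff f(1) CP_four fin)
    have z': "nth_deriv 1 z = (\<lambda>x. ?f' x - four F ?f' x - four G ?f' x)"
      unfolding z_def
      using nth_deriv_diff[OF CP_diff[OF f1 CP_four[OF fin(1)]] CP_four[OF fin(2)], of 1 f f]
        nth_deriv_diff[OF f1 CP_four[OF fin(1)], of 1 f] deriv_four[OF f1 fin(1) Fs] deriv_four[OF f1 fin(2) Gs]
      by (simp del: One_nat_def)
    note sp = three_split[OF c(1) fin, folded z_def] and sp' = three_split[OF c(2) fin, folded z']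
    have sG: "(\<Sum>k\<in>G. h k) = h l + h (- l)" for h :: "int \<Rightarrow> real" using l by (simp add: G_def)
    \<comment> \<open>Energies divided by 2 pi: \<open>X0\<close> and \<open>X\<close> for the
      unstable modes and their derivative, \<open>Rz\<close> and \<open>Z\<close> for the stable
      part and its derivative.\<close>
    define X0 where "X0 = (\<Sum>k\<in>F. (fc f k)\<^sup>2) / (2 * pi)"
    define X where "X = (\<Sum>k\<in>F. (of_int k * fc f k)\<^sup>2) / (2 * pi)"
    define Rz where "Rz = ip z z / (2 * pi)"
    define Z where "Z = ip (nth_deriv 1 z) (nth_deriv 1 z) / (2 * pi)"
    define R where "R = X0 + Rz"
    define D where "D = X + Z"
    have ff: "ip f f / (2 * pi) = N + R"
      unfolding sp(3) R_def X0_def Rz_def N_def sG by (simp add: field_simps)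
    have sx: "(\<Sum>k\<in>F. (fc ?f' k)\<^sup>2) = (\<Sum>k\<in>F. (of_int k * fc f k)\<^sup>2)"
      unfolding fc_deriv[OF f1]
      by (rule sum.reindex_bij_witness[of _ uminus uminus]) (use Fs in \<open>auto simp: power_mult_distrib\<close>)
    have ff': "ip ?f' ?f' / (2 * pi) = (p + 2) * N + D"
      unfolding sp'(3) D_def X_def Z_def N_def sG sx using fc_deriv[OF f1] p
      by (simp add: field_simps power_mult_distrib)
    have fcz: "fc z k = 0" if "\<bar>k\<bar> \<le> l" for k
      unfolding sp(2) using that f(2) by (auto simp: F_def G_def)
    have X0X: "0 \<le> X0" "X0 \<le> X" "X \<le> (p + 2) * X0"
    proof -
      show "0 \<le> X0" by (simp add: X0_def sum_nonneg)
      have k: "1 \<le> (of_int k :: real)\<^sup>2" "(of_int k :: real)\<^sup>2 \<le> (of_int l)\<^sup>2" if "k \<in> F" for k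
      proof -
        have "1 \<le> \<bar>of_int k :: real\<bar>" "\<bar>of_int k :: real\<bar> \<le> \<bar>of_int l\<bar>" using that by (auto simp: F_def)
        then show "1 \<le> (of_int k :: real)\<^sup>2" "(of_int k :: real)\<^sup>2 \<le> (of_int l)\<^sup>2"
          using abs_le_square_iff[of 1 "of_int k :: real"] abs_le_square_iff[of "of_int k :: real" "of_int l"] by auto
      qed
      have "(\<Sum>k\<in>F. (fc f k)\<^sup>2) \<le> (\<Sum>k\<in>F. (of_int k * fc f k)\<^sup>2)"
      proof (rule sum_mono)
        fix i assume "i \<in> F"
        from mult_right_mono[OF k(1)[OF this], of "(fc f i)\<^sup>2"]
        show "(fc f i)\<^sup>2 \<le> (of_int i * fc f i)\<^sup>2" by (simp add: power_mult_distrib)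
      qed
      then show "X0 \<le> X" by (simp add: X0_def X_def divide_right_mono)
      have "(\<Sum>k\<in>F. (of_int k * fc f k)\<^sup>2) \<le> (\<Sum>k\<in>F. (of_int l)\<^sup>2 * (fc f k)\<^sup>2)"
      proof (rule sum_mono)
        fix i assume "i \<in> F"
        from mult_right_mono[OF k(2)[OF this], of "(fc f i)\<^sup>2"]
        show "(of_int i * fc f i)\<^sup>2 \<le> (of_int l)\<^sup>2 * (fc f i)\<^sup>2" by (simp add: power_mult_distrib)
      qed
      then show "X \<le> (p + 2) * X0" using p by (simp add: X0_def X_def sum_distrib_left[symmetric] divide_right_mono)
    qed
    have Rz: "0 \<le> Rz" unfolding Rz_def using ip_pos[OF sp(1)] by simp
    have RzZ: "Rz \<le> Z"
    proof -
      have "1 * ip z z \<le> (of_int l + 1)\<^sup>2 * ip z z"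
        using l ip_pos[OF sp(1)] by (intro mult_right_mono) (auto intro!: one_le_power)
      also have "\<dots> \<le> ip (nth_deriv 1 z) (nth_deriv 1 z)"
        by (rule coercive_gap[OF CP_mono[OF z2]]) (use l fcz in auto)
      finally show ?thesis by (simp add: Rz_def Z_def divide_right_mono)
    qed
    have pos: "0 \<le> N" "0 \<le> R" "R \<le> D" using N_nonneg X0X Rz RzZ by (auto simp: R_def D_def)
    have sqb: "y\<^sup>2 \<le> \<epsilon>\<^sup>2" if "\<bar>y\<bar> \<le> \<epsilon>" for y using that e by (metis abs_ge_zero power2_abs power_mono)
    have U: "N + R \<le> \<epsilon>\<^sup>2"
      unfolding ff[symmetric] av_ip[symmetric] power2_eq_square[symmetric]
      by (rule av_bound) (use sqb[OF f(3)] c in \<open>auto intro!: continuous_on_power\<close>)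
    have D': "(p + 2) * N + D \<le> \<epsilon>\<^sup>2"
      unfolding ff'[symmetric] av_ip[symmetric] power2_eq_square[symmetric]
      by (rule av_bound) (use sqb[OF f(4)] c in \<open>auto intro!: continuous_on_power\<close>)
    have small: "N \<le> \<epsilon>" "D \<le> \<epsilon>" "N + R \<le> \<epsilon>" "N \<le> \<epsilon>\<^sup>2"
    proof -
      have "0 \<le> (p + 2) * N" using p7 pos(1) by (intro mult_nonneg_nonneg) auto
      then show "D \<le> \<epsilon>" using D' ee(1) by linarith
    qed (use U ee pos in linarith)+
    define A where "A = (ip f f - ip ?f' ?f') / (2 * pi)"
    have A: "A = - (p + 1) * N + R - D"
      unfolding A_def diff_divide_distrib ff ff' by (simp add: algebra_simps)
    note qA = quartic_upper[OF A pos(3,2,1) e(1) small(1,2) e(3) ee(2)]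
    define r where "r x = f x - n x" for x
    have cr: "cont r" unfolding r_def[abs_def] using c(1) cont_n by (rule continuous_on_diff)
    have rr: "av (\<lambda>x. (r x)\<^sup>2) = R"
    proof -
      have "ip r r = ip f f - ((fc f l)\<^sup>2 + (fc f (- l))\<^sup>2)"
        using ip_minus_four[OF fin(2) c(1)] unfolding nG sG r_def[abs_def] .
      then show ?thesis using ff by (simp add: power2_eq_square[of "r _"] av_ip N_def field_simps)
    qed
    have nb: "\<bar>n x\<bar> \<le> 2 * \<epsilon>" for x
    proof -
      have "(n x)\<^sup>2 \<le> 4 * \<epsilon>\<^sup>2" using n_sq_le[of x] small(4) zero_le_power2[of \<epsilon>] by linarith
      then have "(n x)\<^sup>2 \<le> (2 * \<epsilon>)\<^sup>2" by (simp add: power_mult_distrib)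
      then show ?thesis using e(1) abs_le_square_iff[of "n x" "2 * \<epsilon>"] by simp
    qed
    have rb: "\<bar>r x\<bar> \<le> 3 * \<epsilon>" for x using f(3)[of x] nb[of x] unfolding r_def by linarith
    note ci = continuous_on_add continuous_on_mult continuous_on_power continuous_on_const continuous_on_diff continuous_on_rabs c cr cont_n
    define S where "S = ip z m2 / (2 * pi)"
    \<comment> \<open>Since r has mean zero, only the second harmonic of n^2 counts; and it meets
      only the stable part, because 2 l lies outside \<open>F\<close>.\<close>
    have n2r: "av (\<lambda>x. (n x)\<^sup>2 * r x) = S"
    proof -
      have r: "r = (\<lambda>x. four F f x + z x)" by (simp add: r_def[abs_def] z_def nG[symmetric])
      have "(\<lambda>x. (n x)\<^sup>2 * r x) = (\<lambda>x. r x * m2 x + N * r x)" by (simp add: m2_def algebra_simps)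
      then have "av (\<lambda>x. (n x)\<^sup>2 * r x) = ip r m2 / (2 * pi) + N * av r"
        using cont_m2 cr by (simp add: av_add av_ip[of r m2] av_cmult ci)
      moreover have "fc r 0 = 0"
        using fc_diff[OF c(1) cont_n, of 0] fc_four[OF fin(2), of f 0] f(2) nG by (auto simp: r_def[abs_def] G_def split: if_splits)
      then have "av r = 0" by (simp add: av_def circ_eq_fc0)
      moreover have "ip r m2 = ip (four F f) m2 + ip z m2"
        unfolding r by (rule ip_add[OF cont_four[OF fin(1)] sp(1) cont_m2])
      moreover have "ip (four F f) m2 = 0"
        unfolding ip_four[OF fin(1) cont_m2] using fc_m2 by (intro sum.neutral) (auto simp: F_def)
      ultimately show ?thesis by (simp add: S_def)
    qed
    \<comment> \<open>n^3 has mean zero, so the cubic term starts with 3 n^2 r.\<close>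
    have T3: "\<bar>av (\<lambda>x. (f x) ^ 3) - 3 * S\<bar> \<le> 9 * \<epsilon> * R"
    proof -
      have "av (\<lambda>x. (f x) ^ 3) = av (\<lambda>x. (n x) ^ 3 + 3 * ((n x)\<^sup>2 * r x) + (3 * n x + r x) * (r x)\<^sup>2)"
        by (rule arg_cong[of _ _ av]) (simp add: r_def fun_eq_iff power2_eq_square power3_eq_cube algebra_simps)
      also have "\<dots> = 3 * S + av (\<lambda>x. (3 * n x + r x) * (r x)\<^sup>2)"
        by (simp add: av_add av_cmult ci av_n3 n2r)
      finally have "av (\<lambda>x. (f x) ^ 3) - 3 * S = av (\<lambda>x. (3 * n x + r x) * (r x)\<^sup>2)" by simp
      also have "\<bar>\<dots>\<bar> \<le> av (\<lambda>x. 9 * \<epsilon> * (r x)\<^sup>2)"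
      proof (rule av_abs_le)
        fix x
        have "\<bar>3 * n x + r x\<bar> \<le> 9 * \<epsilon>" using nb[of x] rb[of x] by linarith
        then show "\<bar>(3 * n x + r x) * (r x)\<^sup>2\<bar> \<le> 9 * \<epsilon> * (r x)\<^sup>2" by (simp add: abs_mult mult_right_mono)
      qed (intro ci)+
      finally show ?thesis by (simp add: av_cmult rr)
    qed
    have T4: "av (\<lambda>x. (f x) ^ 4) \<le> 3 / 2 * N\<^sup>2 + \<epsilon> * (6 * N\<^sup>2 + 61 * R)"
    proof -
      have "av (\<lambda>x. (f x) ^ 4) \<le> av (\<lambda>x. (1 + 4 * \<epsilon>) * (n x) ^ 4 + 61 * \<epsilon> * (r x)\<^sup>2)"
      proof (rule av_mono)
        fix x
        \<comment> \<open>Young's inequality, after one factor n has been spent on the small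
          constant.\<close>
        have "n x * ((n x)\<^sup>2 * r x) \<le> 2 * \<epsilon> * (((n x) ^ 4 + (r x)\<^sup>2) / 2)"
        proof -
          have "\<bar>(n x)\<^sup>2 * r x\<bar> \<le> ((n x) ^ 4 + (r x)\<^sup>2) / 2"
            using zero_le_power2[of "(n x)\<^sup>2 - r x"] zero_le_power2[of "(n x)\<^sup>2 + r x"]
            by (simp add: abs_le_iff power2_sum power2_diff power_mult[symmetric])
          then have "\<bar>n x\<bar> * \<bar>(n x)\<^sup>2 * r x\<bar> \<le> 2 * \<epsilon> * (((n x) ^ 4 + (r x)\<^sup>2) / 2)"
            using nb[of x] e by (intro mult_mono) auto
          then show ?thesis using abs_ge_self[of "n x * ((n x)\<^sup>2 * r x)"] unfolding abs_mult[of "n x"] by linarith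
        qed
        moreover have "(6 * (n x)\<^sup>2 + 4 * (n x * r x) + (r x)\<^sup>2) * (r x)\<^sup>2 \<le> (57 * \<epsilon>) * (r x)\<^sup>2"
        proof (rule mult_right_mono)
          have "(n x)\<^sup>2 \<le> (2 * \<epsilon>)\<^sup>2" "(r x)\<^sup>2 \<le> (3 * \<epsilon>)\<^sup>2"
            using nb[of x] rb[of x] by (metis abs_ge_zero power2_abs power_mono)+
          moreover have "n x * r x \<le> 2 * \<epsilon> * (3 * \<epsilon>)"
            using mult_mono[OF nb[of x] rb[of x]] e(1) abs_ge_self[of "n x * r x"] unfolding abs_mult by simp
          ultimately show "6 * (n x)\<^sup>2 + 4 * (n x * r x) + (r x)\<^sup>2 \<le> 57 * \<epsilon>"
            using ee(1) by (simp add: power2_eq_square)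
        qed simp
        moreover have "(f x) ^ 4 = (n x) ^ 4 + 4 * (n x * ((n x)\<^sup>2 * r x)) + (6 * (n x)\<^sup>2 + 4 * (n x * r x) + (r x)\<^sup>2) * (r x)\<^sup>2"
          by (simp add: r_def power2_eq_square power4_eq_xxxx algebra_simps)
        ultimately show "(f x) ^ 4 \<le> (1 + 4 * \<epsilon>) * (n x) ^ 4 + 61 * \<epsilon> * (r x)\<^sup>2" by (simp add: algebra_simps)
      qed (intro ci)+
      also have "\<dots> = (1 + 4 * \<epsilon>) * (3 / 2 * N\<^sup>2) + 61 * \<epsilon> * R"
        by (simp add: av_add av_cmult ci av_n4 rr)
      also have "\<dots> = 3 / 2 * N\<^sup>2 + \<epsilon> * (6 * N\<^sup>2 + 61 * R)" by (simp add: field_simps)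
      finally show ?thesis .
    qed
    have T5: "av (\<lambda>x. \<bar>f x\<bar> ^ 5) \<le> \<epsilon> * (12 * N\<^sup>2 + 72 * R)"
    proof -
      have "av (\<lambda>x. \<bar>f x\<bar> ^ 5) \<le> av (\<lambda>x. 8 * \<epsilon> * (n x) ^ 4 + 72 * \<epsilon> * (r x)\<^sup>2)"
      proof (rule av_mono)
        fix x
        have "(f x)\<^sup>2 \<le> 2 * (n x)\<^sup>2 + 2 * (r x)\<^sup>2"
          using zero_le_power2[of "n x - r x"] by (simp add: r_def power2_eq_square algebra_simps)
        then have "((f x)\<^sup>2)\<^sup>2 \<le> (2 * (n x)\<^sup>2 + 2 * (r x)\<^sup>2)\<^sup>2" by (intro power_mono) auto
        also have "\<dots> \<le> 8 * ((n x)\<^sup>2)\<^sup>2 + 8 * ((r x)\<^sup>2)\<^sup>2"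
          using zero_le_power2[of "(n x)\<^sup>2 - (r x)\<^sup>2"] by (simp add: power2_eq_square algebra_simps)
        also have "((r x)\<^sup>2)\<^sup>2 \<le> 9 * (r x)\<^sup>2"
        proof -
          have "(r x)\<^sup>2 \<le> (3 * \<epsilon>)\<^sup>2" using rb[of x] by (metis abs_ge_zero power2_abs power_mono)
          also have "\<dots> \<le> 9" using e ee by (simp add: power_mult_distrib)
          finally show ?thesis unfolding power2_eq_square[of "(r x)\<^sup>2"] by (rule mult_right_mono) simp
        qed
        finally have "(f x) ^ 4 \<le> 8 * (n x) ^ 4 + 72 * (r x)\<^sup>2" by (simp add: power_mult[symmetric])
        then have "\<bar>f x\<bar> * (f x) ^ 4 \<le> \<epsilon> * (8 * (n x) ^ 4 + 72 * (r x)\<^sup>2)" using f(3)[of x] e by (intro mult_mono) auto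
        then show "\<bar>f x\<bar> ^ 5 \<le> 8 * \<epsilon> * (n x) ^ 4 + 72 * \<epsilon> * (r x)\<^sup>2"
          by (simp add: eval_nat_numeral algebra_simps abs_mult[symmetric])
      qed (intro ci)+
      also have "\<dots> = 8 * \<epsilon> * (3 / 2 * N\<^sup>2) + 72 * \<epsilon> * R" by (simp add: av_add av_cmult ci av_n4 rr)
      also have "\<dots> = \<epsilon> * (12 * N\<^sup>2 + 72 * R)" by (simp add: field_simps)
      finally show ?thesis .
    qed
    have f0: "av f = 0" using f(2) by (simp add: av_def circ_eq_fc0)
    have U2: "av (\<lambda>x. (f x)\<^sup>2) = N + R" using ff by (simp add: power2_eq_square av_ip)
    have fh: "\<bar>f x\<bar> \<le> 1 / 2" for x using f(3)[of x] e by linarith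
    have cp: "cont (\<lambda>x. (1 + f x) powr - p)"
    proof -
      have "1 + f x \<noteq> 0" for x using fh[of x] by auto
      then show ?thesis using c by (intro continuous_on_powr ci) auto
    qed
    define B where "B = av (\<lambda>x. (1 + f x) powr - p) - 1"
    have B1: "\<bar>B - b * (N + R)\<bar> \<le> C3 * \<epsilon> * (N + R)"
    proof -
      have "\<bar>av (\<lambda>x. (1 + f x) powr - p - (1 - p * f x + b * (f x)\<^sup>2))\<bar> \<le> av (\<lambda>x. C3 * \<epsilon> * (f x)\<^sup>2)"
      proof (rule av_abs_le)
        fix x
        have "C3 * \<bar>f x\<bar> ^ 3 \<le> C3 * (\<epsilon> * (f x)\<^sup>2)" using abs_cube_le[OF f(3)] C3 by simp
        then show "\<bar>(1 + f x) powr - p - (1 - p * f x + b * (f x)\<^sup>2)\<bar> \<le> C3 * \<epsilon> * (f x)\<^sup>2"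
          using C3(2)[OF fh[of x]] unfolding s3 by simp
      qed (intro ci cp)+
      moreover have "av (\<lambda>x. (1 + f x) powr - p - (1 - p * f x + b * (f x)\<^sup>2)) = B - b * (N + R)"
        by (simp add: av_add av_diff av_cmult ci cp f0 U2 av_const B_def)
      ultimately show ?thesis by (simp add: av_cmult U2)
    qed
    have B2: "B \<le> b * (N + R) - c3 * av (\<lambda>x. (f x) ^ 3) + c4 * av (\<lambda>x. (f x) ^ 4) + C5 * av (\<lambda>x. \<bar>f x\<bar> ^ 5)"
    proof -
      have "av (\<lambda>x. (1 + f x) powr - p) \<le> av (\<lambda>x. 1 - p * f x + b * (f x)\<^sup>2 - c3 * (f x) ^ 3 + c4 * (f x) ^ 4 + C5 * \<bar>f x\<bar> ^ 5)"
      proof (rule av_mono)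
        fix x
        show "(1 + f x) powr - p \<le> 1 - p * f x + b * (f x)\<^sup>2 - c3 * (f x) ^ 3 + c4 * (f x) ^ 4 + C5 * \<bar>f x\<bar> ^ 5"
          using C5(2)[OF fh[of x]] unfolding s5 abs_le_iff by linarith
      qed (intro ci cp)+
      also have "\<dots> = 1 + b * (N + R) - c3 * av (\<lambda>x. (f x) ^ 3) + c4 * av (\<lambda>x. (f x) ^ 4) + C5 * av (\<lambda>x. \<bar>f x\<bar> ^ 5)"
        by (simp add: av_add av_diff av_cmult ci f0 U2 av_const)
      finally show ?thesis by (simp add: B_def)
    qed
    note qB = quartic_upper_B[OF B1 refl pos(1,2,3) bc(1) C3(1) e(1) small(3) ee(2) e(4,5)]
    have sqr: "(p + 2) * Rz - Z - (p + 1) * (p + 2) * S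
      \<le> (p + 1)\<^sup>2 * (p + 2) / 24 * N\<^sup>2 + \<delta> * (p + 1)\<^sup>2 * (p + 2) / 18 * N\<^sup>2 - \<delta> / 2 * Z"
      using divide_right_mono[OF complete_square[OF l3 p z2 fcz less_imp_le[OF \<delta>(1)] \<delta>(2), of "fc f l" "fc f (- l)"], of "2 * pi"]
      unfolding Rz_def Z_def S_def by (simp add: diff_divide_distrib add_divide_distrib)
    have ent: "0 \<le> p * (A - A\<^sup>2 / 2 + \<bar>A\<bar> ^ 3) + 2 * (B - B\<^sup>2 / 2 + \<bar>B\<bar> ^ 3)"
    proof -
      have h1: "p * ln (1 + A) \<le> p * (A - A\<^sup>2 / 2 + \<bar>A\<bar> ^ 3)"
        using ln_upper_cubic[OF qA(1)] p7 by (intro mult_left_mono) auto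
      have h2: "2 * ln (1 + B) \<le> 2 * (B - B\<^sup>2 / 2 + \<bar>B\<bar> ^ 3)"
        by (rule mult_left_mono[OF ln_upper_cubic[OF qB(1)]]) simp
      have h3: "0 \<le> p * ln (1 + A) + 2 * ln (1 + B)" using H by (simp add: A_def B_def)
      show ?thesis by (rule order_trans[OF h3 add_mono[OF h1 h2]])
    qed
    have fin': "0 \<le> p * (p + 2) * X0 - p * X - p * \<delta> / 2 * Z - p * (p + 1) * (p\<^sup>2 - 4) / 24 * N\<^sup>2 + \<epsilon> * K * (N\<^sup>2 + (X + Z))"
      unfolding K_def
      by (rule quartic_combine[OF p7 b_def c3_def c4_def C5(1) pos e(1) R_def D_def A qA(2)[folded K1_def] B2 qB(2)[folded K2_def]
            T3 T4 T5 sqr less_imp_le[OF \<delta>(1)] \<delta>(3) ent]) (use p7 in simp)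
    have Z0: "0 \<le> Z" using Rz RzZ by simp
    have eK: "\<epsilon> * K * (N\<^sup>2 + (X + Z)) \<le> c1 / 2 * (N\<^sup>2 + (X + Z))"
      using e(6) X0X Z0 by (intro mult_right_mono) auto
    have cZ: "2 * (c1 / 2 * Z) \<le> p * \<delta> / 2 * Z" using mult_right_mono[OF c1(2) Z0] by simp
    have cN: "2 * (c1 / 2 * N\<^sup>2) \<le> p * (p + 1) * (p\<^sup>2 - 4) / 24 * N\<^sup>2"
      using mult_right_mono[OF c1(3), of "N\<^sup>2"] by simp
    have pX: "0 \<le> p * X" using p7 X0X by simp
    have cX: "c1 / 2 * X \<le> c1 / 2 * ((p + 2) * X0)" using c1 X0X by (intro mult_left_mono) auto
    have comb: "k * (n + z) \<le> a + y"
      if "0 \<le> a - b - c - d + e" "e \<le> k * (n + (x + z))" "2 * (k * z) \<le> c" "2 * (k * n) \<le> d" "0 \<le> b" "k * x \<le> y"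
      for a b c d e k n x y z :: real using that by (simp add: distrib_left)
    have "c1 / 2 * (N\<^sup>2 + Z) \<le> p * (p + 2) * X0 + c1 / 2 * ((p + 2) * X0)"
      by (rule comb[OF fin' eK cZ cN pX cX])
    then have le: "2 / c1 * (c1 / 2 * (N\<^sup>2 + Z)) \<le> 2 / c1 * (p * (p + 2) * X0 + c1 / 2 * ((p + 2) * X0))"
      using c1(1) by (intro mult_left_mono) auto
    have e1: "2 / c1 * (c1 / 2 * (N\<^sup>2 + Z)) = N\<^sup>2 + Z" using c1(1) by simp
    have e2: "2 / c1 * (p * (p + 2) * X0 + c1 / 2 * ((p + 2) * X0)) = C' * X0"
      unfolding C'_def by (simp only: distrib_right mult.assoc)
    have NZ: "N\<^sup>2 + Z \<le> C' * X0" using le unfolding e1 e2 .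
    have "((fc f l)\<^sup>2 + (fc f (- l))\<^sup>2)\<^sup>2 + ip z z = (2 * pi)\<^sup>2 * N\<^sup>2 + 2 * pi * Rz"
      by (simp add: N_def Rz_def power_divide)
    also have "\<dots> \<le> (2 * pi)\<^sup>2 * N\<^sup>2 + (2 * pi)\<^sup>2 * Z"
    proof -
      have "2 * pi * Rz \<le> (2 * pi)\<^sup>2 * Z"
        using RzZ Rz pi_gt3 by (intro mult_mono) (auto simp: power2_eq_square)
      then show ?thesis by simp
    qed
    also have "\<dots> \<le> (2 * pi)\<^sup>2 * (C' * X0)" using NZ by (simp add: distrib_left[symmetric])
    also have "\<dots> = 2 * pi * C' * (\<Sum>k\<in>F. (fc f k)\<^sup>2)" by (simp add: X0_def power2_eq_square)
    finally show "((fc f l)\<^sup>2 + (fc f (- l))\<^sup>2)\<^sup>2 + (ip f f - ((fc f l)\<^sup>2 + (fc f (- l))\<^sup>2) - (\<Sum>k\<in>{k. 0 < \<bar>k\<bar> \<and> \<bar>k\<bar> < l}. (fc f k)\<^sup>2))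
         \<le> 2 * pi * C' * (\<Sum>k\<in>{k. 0 < \<bar>k\<bar> \<and> \<bar>k\<bar> < l}. (fc f k)\<^sup>2)"
      using sp(3) unfolding sG F_def by simp
  qed
qed

section \<open>Monotonicity of the entropy\<close>

context pde begin

text \<open>Interpolation upgrades decay in L2 to decay in C^2.\<close>

lemma v_unif:
  assumes "e > 0"
  obtains t where "t < \<tau>0" "\<And>\<tau> j x. \<tau> \<le> t \<Longrightarrow> j \<le> 2 \<Longrightarrow> \<bar>nth_deriv j (v \<tau>) x\<bar> \<le> e"
proof -
  obtain B where B: "B > 0" "\<And>\<tau> j x. \<tau> \<le> \<tau>0 \<Longrightarrow> j \<le> 26 \<Longrightarrow> \<bar>nth_deriv j (v \<tau>) x\<bar> \<le> B" using bound_v by blast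
  obtain C where C: "C > 0" "\<And>f j x. CP 12 f \<Longrightarrow> (\<And>j x. j \<le> 12 \<Longrightarrow> \<bar>nth_deriv j f x\<bar> \<le> B) \<Longrightarrow> j \<le> 2 \<Longrightarrow>
       \<bar>nth_deriv j f x\<bar> \<le> C * nrm f powr (3 / 4)" using sup_interp[OF B(1)] by blast
  have "\<forall>\<^sub>F \<tau> in at_bot. 0 \<le> nrm (v \<tau>)"
    using eventually_le_at_bot[of \<tau>0] by eventually_elim (rule nrm_nonneg[OF cont_v])
  then have "((\<lambda>\<tau>. C * nrm (v \<tau>) powr (3 / 4)) \<longlongrightarrow> C * 0 powr (3 / 4)) at_bot"
    by (intro tendsto_mult tendsto_const tendsto_powr' lim) auto
  then have "\<forall>\<^sub>F \<tau> in at_bot. C * nrm (v \<tau>) powr (3 / 4) < e"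
    using assms by (intro order_tendstoD(2)) auto
  then obtain t where t: "\<And>\<tau>. \<tau> \<le> t \<Longrightarrow> C * nrm (v \<tau>) powr (3 / 4) < e" by (auto simp: eventually_at_bot_linorder)
  show ?thesis
  proof (rule that[of "min t (\<tau>0 - 1)"])
    fix \<tau> j x assume a: "\<tau> \<le> min t (\<tau>0 - 1)" "j \<le> (2::nat)"
    then have t0: "\<tau> \<le> \<tau>0" by simp
    have "\<bar>nth_deriv j (v \<tau>) x\<bar> \<le> C * nrm (v \<tau>) powr (3 / 4)"
      by (rule C(2)[OF CPv'[OF t0]]) (use B(2)[OF t0] a in auto)
    then show "\<bar>nth_deriv j (v \<tau>) x\<bar> \<le> e" using t[of \<tau>] a by simp
  qed simp
qed

text \<open>The difference of two time slices has bounded derivatives, and by the equation its L2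
  norm is small; interpolation makes its second derivative small as well.\<close>

lemma w_time_cont:
  assumes X: "\<And>n. X n \<le> \<tau>0 - d" "d > 0" "\<tau> \<le> \<tau>0 - d" "X \<longlonglongrightarrow> \<tau>"
  shows "(\<lambda>n. w (X n) x) \<longlonglongrightarrow> w \<tau> x"
proof -
  obtain B where B: "B > 0" "\<And>\<tau> j x. \<tau> \<le> \<tau>0 \<Longrightarrow> j \<le> 26 \<Longrightarrow> \<bar>nth_deriv j (v \<tau>) x\<bar> \<le> B" using bound_v by blast
  obtain D where D: "D > 0" "\<And>\<tau> x. \<tau> \<le> \<tau>0 \<Longrightarrow> \<bar>R \<tau> x\<bar> \<le> D" using bound_R by blast
  have B2: "2 * B > 0" using B by simp
  obtain C where C: "C > 0" "\<And>f j x. CP 12 f \<Longrightarrow> (\<And>j x. j \<le> 12 \<Longrightarrow> \<bar>nth_deriv j f x\<bar> \<le> 2 * B) \<Longrightarrow> j \<le> 2 \<Longrightarrow>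
       \<bar>nth_deriv j f x\<bar> \<le> C * nrm f powr (3 / 4)" using sup_interp[OF B2] by blast
  have t0: "X n \<le> \<tau>0" "X n < \<tau>0" "\<tau> \<le> \<tau>0" "\<tau> < \<tau>0" for n using X(1)[of n] X(2,3) by auto
  have key: "\<bar>w (X n) x - w \<tau> x\<bar> \<le> 2 * C * (3 * (D * \<bar>X n - \<tau>\<bar>)) powr (3 / 4)" for n
  proof -
    define f where "f = (\<lambda>x. v (X n) x - v \<tau> x)"
    have f: "nth_deriv j f = (\<lambda>x. nth_deriv j (v (X n)) x - nth_deriv j (v \<tau>) x)" if "j \<le> 12" for j
      unfolding f_def by (rule nth_deriv_diff[OF CPv[OF t0(1)] CPv[OF t0(3)]]) (use that in simp)
    have c: "cont f" unfolding f_def using cont_v t0 by (intro continuous_on_diff) auto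
    have "CP 12 f" unfolding f_def using CPv' t0 by (intro CP_diff) auto
    moreover have "\<bar>nth_deriv j f x\<bar> \<le> 2 * B" if "j \<le> 12" for j x
      using B(2)[OF t0(1)[of n], of j x] B(2)[OF t0(3), of j x] that f[OF that] by simp
    ultimately have 1: "\<bar>nth_deriv j f x\<bar> \<le> C * nrm f powr (3 / 4)" if "j \<le> 2" for j using C(2) that by blast
    have "nrm f \<le> 3 * (D * \<bar>X n - \<tau>\<bar>)"
    proof (rule nrm_bound[OF c])
      fix y
      show "\<bar>f y\<bar> \<le> D * \<bar>X n - \<tau>\<bar>"
        unfolding f_def by (rule diff_quotient_bound[where b = \<tau>0 and F = "\<lambda>s. v s y" and G = "\<lambda>s. R s y"])
         (use evolR D t0 in auto)
    qed
    then have "nrm f powr (3 / 4) \<le> (3 * (D * \<bar>X n - \<tau>\<bar>)) powr (3 / 4)" using nrm_nonneg[OF c] by (intro powr_mono2) auto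
    then have 2: "C * nrm f powr (3 / 4) \<le> C * (3 * (D * \<bar>X n - \<tau>\<bar>)) powr (3 / 4)" using C(1) by simp
    have "w (X n) x - w \<tau> x = nth_deriv 0 f x + nth_deriv 2 f x" unfolding w_def using f[of 2] by (simp add: f_def)
    then show ?thesis using 1[of 0] 1[of 2] 2 by simp
  qed
  have "(\<lambda>n. 2 * C * (3 * (D * \<bar>X n - \<tau>\<bar>)) powr (3 / 4)) \<longlonglongrightarrow> 2 * C * (3 * (D * \<bar>\<tau> - \<tau>\<bar>)) powr (3 / 4)"
    using D(1) by (intro tendsto_intros X(4) tendsto_powr') auto
  then have "(\<lambda>n. 2 * C * (3 * (D * \<bar>X n - \<tau>\<bar>)) powr (3 / 4)) \<longlonglongrightarrow> 0" by simp
  then have "(\<lambda>n. w (X n) x - w \<tau> x) \<longlonglongrightarrow> 0"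
    by (rule Lim_null_comparison[rotated]) (use key in auto)
  then show ?thesis by (simp add: LIM_zero_iff)
qed

lemma ip_vw_sym:
  assumes "s \<le> \<tau>0" "t \<le> \<tau>0" shows "ip (v s) (w t) = ip (w s) (v t)"
proof -
  have "ip (nth_deriv 2 (v s)) (v t) = ip (v s) (nth_deriv 2 (v t))"
    using ip_parts_n[OF CPv' CPv', OF assms(1) _ assms(2), of 2] by simp
  then show ?thesis
    unfolding w_def[abs_def] using assms cont_v cont_vj[of _ 2] by (simp add: ip_add ip_add2)
qed

text \<open>Only \<open>v\<close> has a known time derivative. By symmetry of 1 + d^2/dx^2 the
  increment of <v, w> is <v(s) - v(\<tau>), w(s) + w(\<tau>)>, so \<open>v\<close> alone is
  differentiated while continuity in time suffices for \<open>w\<close>.\<close>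

lemma ip_vw_deriv:
  assumes t: "\<tau> < \<tau>0"
  shows "((\<lambda>s. ip (v s) (w s)) has_real_derivative 2 * ip (R \<tau>) (w \<tau>)) (at \<tau>)"
  unfolding has_field_derivative_iff
proof (subst tendsto_at_iff_sequentially, intro allI impI)
  fix X :: "nat \<Rightarrow> real" assume X: "\<forall>i. X i \<in> UNIV - {\<tau>}" "X \<longlonglongrightarrow> \<tau>"
  define d where "d = (\<tau>0 - \<tau>) / 2"
  have d: "d > 0" "\<tau> \<le> \<tau>0 - d" "\<tau> < \<tau>0 - d" using t by (auto simp: d_def field_simps)
  obtain D where D: "D > 0" "\<And>\<tau> x. \<tau> \<le> \<tau>0 \<Longrightarrow> \<bar>R \<tau> x\<bar> \<le> D" using bound_R by blast
  obtain N where N: "\<And>n. n \<ge> N \<Longrightarrow> X n < \<tau>0 - d"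
    using order_tendstoD(2)[OF X(2) d(3)] by (auto simp: eventually_sequentially)
  define Y where "Y n = X (n + N)" for n
  have Y: "Y n \<le> \<tau>0 - d" "Y n \<noteq> \<tau>" "Y n \<le> \<tau>0" "Y n < \<tau>0" for n using N[of "n + N"] X(1) d by (auto simp: Y_def)
  have Yl: "Y \<longlonglongrightarrow> \<tau>" unfolding Y_def using X(2) by (rule LIMSEQ_ignore_initial_segment)
  have t': "\<tau> \<le> \<tau>0" using t by simp
  have "(\<lambda>n. circ (\<lambda>x. (v (Y n) x - v \<tau> x) / (Y n - \<tau>) * (w (Y n) x + w \<tau> x))) \<longlonglongrightarrow> circ (\<lambda>x. R \<tau> x * (w \<tau> x + w \<tau> x))"
  proof (rule circ_limit[where B = "D * 1"])
    fix n
    show "cont (\<lambda>x. (v (Y n) x - v \<tau> x) / (Y n - \<tau>) * (w (Y n) x + w \<tau> x))"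
      using cont_v cont_w Y[of n] t' by (intro continuous_on_mult continuous_on_add continuous_on_divide continuous_on_diff) auto
    fix x
    have "\<bar>v (Y n) x - v \<tau> x\<bar> \<le> D * \<bar>Y n - \<tau>\<bar>"
      by (rule diff_quotient_bound[where b = \<tau>0 and F = "\<lambda>s. v s x" and G = "\<lambda>s. R s x"])
         (use evolR D Y t in auto)
    then have "\<bar>(v (Y n) x - v \<tau> x) / (Y n - \<tau>)\<bar> \<le> D" using Y(2)[of n] by (simp add: abs_divide field_simps)
    moreover have "\<bar>w (Y n) x + w \<tau> x\<bar> \<le> 1" using wh[OF Y(3), of n x] wh[OF t', of x] by linarith
    ultimately show "\<bar>(v (Y n) x - v \<tau> x) / (Y n - \<tau>) * (w (Y n) x + w \<tau> x)\<bar> \<le> D * 1"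
      unfolding abs_mult using D(1) by (intro mult_mono) auto
  next
    show "cont (\<lambda>x. R \<tau> x * (w \<tau> x + w \<tau> x))" using cont_R cont_w t' by (intro continuous_on_mult continuous_on_add) auto
    fix x
    have "filterlim Y (at \<tau>) sequentially" using Yl Y by (auto simp: filterlim_at)
    then have "(\<lambda>n. (v (Y n) x - v \<tau> x) / (Y n - \<tau>)) \<longlonglongrightarrow> R \<tau> x"
      using evolR[OF t, of x] unfolding has_field_derivative_iff by (rule filterlim_compose[rotated])
    then show "(\<lambda>n. (v (Y n) x - v \<tau> x) / (Y n - \<tau>) * (w (Y n) x + w \<tau> x)) \<longlonglongrightarrow> R \<tau> x * (w \<tau> x + w \<tau> x)"
      by (intro tendsto_mult tendsto_add tendsto_const w_time_cont[OF Y(1) d(1,2) Yl])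
  qed
  moreover have "circ (\<lambda>x. (v (Y n) x - v \<tau> x) / (Y n - \<tau>) * (w (Y n) x + w \<tau> x)) = (ip (v (Y n)) (w (Y n)) - ip (v \<tau>) (w \<tau>)) / (Y n - \<tau>)" for n
  proof -
    have c: "cont (v (Y n))" "cont (v \<tau>)" "cont (w (Y n))" "cont (w \<tau>)" using cont_v cont_w Y(3) t' by auto
    have "ip (\<lambda>x. v (Y n) x - v \<tau> x) (\<lambda>x. w (Y n) x + w \<tau> x) = ip (v (Y n)) (w (Y n)) - ip (v \<tau>) (w \<tau>)"
      using c ip_vw_sym[OF Y(3)[of n] t'] by (simp add: ip_diff ip_add2 continuous_on_add ip_commute[of "w (Y n)" "v \<tau>"])
    then have "circ (\<lambda>x. (1 / (Y n - \<tau>)) * ((v (Y n) x - v \<tau> x) * (w (Y n) x + w \<tau> x))) = (ip (v (Y n)) (w (Y n)) - ip (v \<tau>) (w \<tau>)) / (Y n - \<tau>)"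
      unfolding circ_cmult ip_circ by simp
    then show ?thesis by simp
  qed
  moreover have "circ (\<lambda>x. R \<tau> x * (w \<tau> x + w \<tau> x)) = 2 * ip (R \<tau>) (w \<tau>)"
    unfolding ip_circ circ_cmult[symmetric] by (rule arg_cong[of _ _ circ]) (simp add: fun_eq_iff algebra_simps)
  ultimately have "(\<lambda>n. (ip (v (X (n + N))) (w (X (n + N))) - ip (v \<tau>) (w \<tau>)) / (X (n + N) - \<tau>)) \<longlonglongrightarrow> 2 * ip (R \<tau>) (w \<tau>)"
    by (simp add: Y_def)
  then have "(\<lambda>n. (ip (v (X n)) (w (X n)) - ip (v \<tau>) (w \<tau>)) / (X n - \<tau>)) \<longlonglongrightarrow> 2 * ip (R \<tau>) (w \<tau>)"
    by (rule LIMSEQ_offset)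
  then show "((\<lambda>y. (ip (v y) (w y) - ip (v \<tau>) (w \<tau>)) / (y - \<tau>)) \<circ> X) \<longlonglongrightarrow> 2 * ip (R \<tau>) (w \<tau>)"
    by (simp add: o_def)
qed

end

section \<open>The scale-invariant entropy at a neutral eigenvalue\<close>

locale neutral = pde +
  fixes l :: int
  assumes l3: "l \<ge> 3" and al: "\<alpha> = 1 / ((of_int l)\<^sup>2 - 1)"
begin

text \<open>The relation \<alpha> (p + 1) = 1 ties the exponent to the flow. \<open>A\<close> is
  twice the enclosed area; scaling u by c multiplies \<open>A\<close> by c^2 and \<open>B\<close> by
  c^(- p), so A^p B^2 is invariant.\<close>

definition p :: real where "p = (of_int l)\<^sup>2 - 2"
definition A :: "real \<Rightarrow> real" where "A s = circ (\<lambda>x. (1 + v s x) * (1 + w s x))"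
definition B :: "real \<Rightarrow> real" where "B s = circ (\<lambda>x. (1 + v s x) powr - p)"

lemma p7: "7 \<le> p"
proof -
  have "(3::real)\<^sup>2 \<le> (of_int l)\<^sup>2" using l3 by (intro power_mono) auto
  then show ?thesis by (simp add: p_def)
qed

lemma alp: "\<alpha> * (p + 1) = 1"
  using p7 by (simp add: al p_def)

lemma A_eq: "s \<le> \<tau>0 \<Longrightarrow> A s = 2 * pi + 2 * circ (v s) + ip (v s) (w s)"
proof -
  assume s: "s \<le> \<tau>0"
  have "circ (w s) = circ (v s)"
    using fc_add[OF cont_v[OF s] cont_vj[OF s, of 2], of 0] fc_deriv2[OF CPv'[OF s, of 2], of 0]
    by (simp add: circ_eq_fc0 w_def[abs_def])
  moreover have "A s = circ (\<lambda>x. 1 + (v s x + (w s x + v s x * w s x)))"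
    unfolding A_def by (rule arg_cong[of _ _ circ]) (simp add: fun_eq_iff algebra_simps)
  moreover have "\<dots> = 2 * pi + (circ (v s) + (circ (w s) + ip (v s) (w s)))"
    using cont_v[OF s] cont_w[OF s] by (simp add: circ_add circ_const ip_circ continuous_on_add continuous_on_mult)
  ultimately show ?thesis by simp
qed

lemma A_deriv: assumes "s < \<tau>0" shows "(A has_real_derivative 2 * circ (\<lambda>x. R s x * (1 + w s x))) (at s)"
proof -
  have c: "cont (R s)" "cont (w s)" "cont (v s)" using cont_R cont_w cont_v assms by auto
  have "((\<lambda>s. 2 * pi + 2 * (sqrt (2 * pi) * fc (v s) 0) + ip (v s) (w s)) has_real_derivative
    2 * (sqrt (2 * pi) * fc (R s) 0) + 2 * ip (R s) (w s)) (at s)"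
    using fc_has_derivative[OF assms, of 0] ip_vw_deriv[OF assms] fc_R[of s 0] assms
    by (auto intro!: derivative_eq_intros)
  then have "((\<lambda>s. 2 * pi + 2 * circ (v s) + ip (v s) (w s)) has_real_derivative
    2 * circ (R s) + 2 * ip (R s) (w s)) (at s)" by (simp add: circ_eq_fc0[symmetric])
  moreover have "2 * circ (R s) + 2 * ip (R s) (w s) = 2 * circ (\<lambda>x. R s x * (1 + w s x))"
    using c by (simp add: ip_circ distrib_left circ_add continuous_on_mult)
  ultimately have d: "((\<lambda>s. 2 * pi + 2 * circ (v s) + ip (v s) (w s)) has_real_derivative 2 * circ (\<lambda>x. R s x * (1 + w s x))) (at s)" by simp
  show ?thesis
  proof (rule has_field_derivative_transform_within_open[OF d, of "{..<\<tau>0}"])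
    show "2 * pi + 2 * circ (v x) + ip (v x) (w x) = A x" if "x \<in> {..<\<tau>0}" for x using A_eq[of x] that by simp
  qed (use assms in auto)
qed

lemma R_eq: "R s x = (1 + v s x) - (1 + w s x) powr - \<alpha>"
  by (simp add: R_def E_def w_def algebra_simps)

text \<open>With W = 1 + w and f = W^(- \<alpha>) / u one has u W = f^(- p - 1) u^(- p). Against the
  weight u^(- p) the claim is Chebyshev's inequality for f and its decreasing function f^(- p - 1).
  The last expression has the sign of the time derivative of the entropy.\<close>

lemma chebyshev:
  assumes s: "s \<le> \<tau>0" and vs: "\<And>x. \<bar>v s x\<bar> \<le> 1 / 2"
  shows "0 < A s" "0 < B s" 
    "0 \<le> B s * circ (\<lambda>x. R s x * (1 + w s x)) - A s * circ (\<lambda>x. (1 + v s x) powr (- p - 1) * R s x)"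
proof -
  let ?u = "\<lambda>x. 1 + v s x" and ?W = "\<lambda>x. 1 + w s x"
  let ?g = "\<lambda>x. ?W x powr - \<alpha>"
  have ub: "1 / 2 \<le> ?u x" "?u x \<le> 3 / 2" for x using vs[of x] by (auto simp: abs_le_iff)
  have Wb: "1 / 2 \<le> ?W x" "?W x \<le> 3 / 2" for x using wh[OF s, of x] by (auto simp: abs_le_iff)
  have u0: "0 < ?u x" "0 < ?W x" for x using ub[of x] Wb[of x] by auto
  have c0: "cont (v s)" "cont (w s)" using cont_v cont_w s by auto
  have cW: "cont (\<lambda>x. ?W x powr a)" and cu: "cont (\<lambda>x. ?u x powr a)" for a
    using c0 u0 by (auto intro!: continuous_on_powr continuous_on_add simp: less_imp_neq[symmetric])
  note ci = continuous_on_mult continuous_on_add continuous_on_diff continuous_on_const c0 cW cu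
  have lo: "circ (\<lambda>x. c) \<le> circ f" if "cont f" "\<And>x. c \<le> f x" for c f
    by (rule circ_mono) (use that in auto)
  have "circ (\<lambda>x. 1 / 2 * (1 / 2)) \<le> A s"
    unfolding A_def
  proof (rule lo)
    show "1 / 2 * (1 / 2) \<le> ?u x * ?W x" for x using mult_mono[OF ub(1)[of x] Wb(1)[of x]] u0[of x] by simp
  qed (intro ci)
  then show A: "0 < A s" by (simp add: circ_const) (use pi_gt_zero in linarith)
  have "circ (\<lambda>x. (3 / 2) powr - p) \<le> B s"
    unfolding B_def by (rule lo) (use ub u0 p7 in \<open>auto intro!: ci powr_mono2' simp: less_imp_le\<close>)
  moreover have "0 < circ (\<lambda>x. (3 / 2 :: real) powr - p)" by (simp add: circ_const)
  ultimately show B: "0 < B s" by linarith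
  define J where "J = circ (\<lambda>x. ?u x powr (- p - 1) * ?g x)"
  define I where "I = circ (\<lambda>x. ?g x * ?W x)"
  have e1: "circ (\<lambda>x. R s x * ?W x) = A s - I"
    unfolding R_eq left_diff_distrib A_def I_def by (rule circ_diff) (intro ci)+
  have e2: "circ (\<lambda>x. ?u x powr (- p - 1) * R s x) = B s - J"
  proof -
    have "?u x powr (- p - 1) * R s x = ?u x powr - p - ?u x powr (- p - 1) * ?g x" for x
      using u0(1)[of x] by (simp add: R_eq right_diff_distrib powr_diff)
    then show ?thesis unfolding B_def J_def by (simp add: circ_diff ci)
  qed
  define gmin where "gmin = (3 / 2 :: real) powr (- p - 1) * (3 / 2) powr - \<alpha>"
  have "circ (\<lambda>x. gmin) \<le> J"
    unfolding J_def
  proof (rule lo)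
    fix x
    show "gmin \<le> ?u x powr (- p - 1) * ?g x"
      unfolding gmin_def using ub[of x] Wb[of x] u0[of x] p7 apos by (intro mult_mono powr_mono2') auto
  qed (intro ci)
  moreover have "0 < circ (\<lambda>x. gmin)" by (simp add: circ_const gmin_def)
  ultimately have J: "0 < J" by linarith
  \<comment> \<open>The weighted mean of f. Comparing f with this constant instead of a second copy
    of f avoids a double integral: (c - f) (f^(- p - 1) - c^(- p - 1)) >= 0 holds pointwise.\<close>
  define c where "c = J / B s"
  have c: "c > 0" using J B by (simp add: c_def)
  have pt: "c powr (- p - 1) * (c * ?u x powr - p - ?u x powr (- p - 1) * ?g x) \<le> c * (?u x * ?W x) - ?g x * ?W x" for x
  proof -
    let ?f = "?g x / ?u x"
    have f: "0 < ?f" using u0[of x] by simp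
    have Wg: "?W x = ?g x powr (- p - 1)"
    proof -
      have "- \<alpha> * (- p - 1) = 1" using alp by (simp add: algebra_simps)
      then show ?thesis using u0[of x] by (simp add: powr_powr)
    qed
    have fq: "?f powr (- p - 1) * ?u x powr - p = ?u x * ?W x"
    proof -
      have "?f powr (- p - 1) = ?g x powr (- p - 1) / ?u x powr (- p - 1)" using u0[of x] by (simp add: powr_divide)
      also have "\<dots> * ?u x powr - p = ?W x * (?u x powr - p / ?u x powr (- p - 1))" using Wg by simp
      also have "?u x powr - p / ?u x powr (- p - 1) = ?u x" using u0[of x] by (simp add: powr_diff[symmetric])
      finally show ?thesis by simp
    qed
    have uf: "?u x powr - p * ?f = ?u x powr (- p - 1) * ?g x" using u0[of x] by (simp add: powr_diff)
    have "c powr (- p - 1) * (c - ?f) \<le> ?f powr (- p - 1) * (c - ?f)"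
    proof (cases "?f \<le> c")
      case True
      then have "c powr (- p - 1) \<le> ?f powr (- p - 1)" using f p7 by (intro powr_mono2') auto
      then show ?thesis using True by (intro mult_right_mono) auto
    next
      case False
      then have "?f powr (- p - 1) \<le> c powr (- p - 1)" using c p7 by (intro powr_mono2') auto
      then show ?thesis using False by (intro mult_right_mono_neg) auto
    qed
    then have "c powr (- p - 1) * (c - ?f) * ?u x powr - p \<le> ?f powr (- p - 1) * (c - ?f) * ?u x powr - p"
      by (rule mult_right_mono) simp
    also have "?f powr (- p - 1) * (c - ?f) * ?u x powr - p = (c - ?f) * (?u x * ?W x)" unfolding fq[symmetric] by simp
    also have "\<dots> = c * (?u x * ?W x) - ?g x * ?W x" using u0[of x] by (simp add: field_simps)
    also have "c powr (- p - 1) * (c - ?f) * ?u x powr - p = c powr (- p - 1) * (c * ?u x powr - p - ?u x powr - p * ?f)"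
      by (simp add: algebra_simps)
    finally show ?thesis unfolding uf .
  qed
  have "circ (\<lambda>x. c powr (- p - 1) * (c * ?u x powr - p - ?u x powr (- p - 1) * ?g x)) \<le> circ (\<lambda>x. c * (?u x * ?W x) - ?g x * ?W x)"
    by (rule circ_mono[OF _ _ pt]) (intro ci)+
  moreover have "circ (\<lambda>x. c powr (- p - 1) * (c * ?u x powr - p - ?u x powr (- p - 1) * ?g x)) = c powr (- p - 1) * (c * B s - J)"
    by (simp add: circ_cmult circ_diff ci B_def J_def)
  moreover have "circ (\<lambda>x. c * (?u x * ?W x) - ?g x * ?W x) = c * A s - I"
    by (simp add: circ_cmult circ_diff ci A_def I_def)
  moreover have "c * B s - J = 0" using B by (simp add: c_def)
  ultimately have "I \<le> c * A s" by simp
  then have "B s * I \<le> J * A s" using B by (simp add: c_def field_simps)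
  then show "0 \<le> B s * circ (\<lambda>x. R s x * ?W x) - A s * circ (\<lambda>x. ?u x powr (- p - 1) * R s x)"
    unfolding e1 e2 by (simp add: algebra_simps)
qed

lemma B_deriv:
  assumes b: "b \<le> \<tau>0" "\<And>s x. s < b \<Longrightarrow> \<bar>v s x\<bar> \<le> 1 / 2" and s: "s < b"
  shows "(B has_real_derivative - p * circ (\<lambda>x. (1 + v s x) powr (- p - 1) * R s x)) (at s)"
proof -
  obtain D where D: "D > 0" "\<And>\<tau> x. \<tau> \<le> \<tau>0 \<Longrightarrow> \<bar>R \<tau> x\<bar> \<le> D" using bound_R by blast
  define K where "K = (1 / 2 :: real) powr (- p - 1) + (3 / 2) powr (- p - 1)"
  have ub: "1 / 2 \<le> 1 + v s x" "1 + v s x \<le> 3 / 2" if "s < b" for s x using b(2)[OF that, of x] by (auto simp: abs_le_iff)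
  have cu: "cont (\<lambda>x. (1 + v s x) powr a)" if "s < b" for s a
  proof -
    have "1 + v s x \<noteq> 0" for x using ub(1)[OF that, of x] by linarith
    then show ?thesis using cont_v[of s] that b(1) by (intro continuous_on_powr continuous_on_add) auto
  qed
  have "(B has_real_derivative circ (\<lambda>x. - p * ((1 + v s x) powr (- p - 1) * R s x))) (at s)"
    unfolding B_def[abs_def]
  proof (rule circ_has_derivative[where b = b and B = "p * (K * D)"])
    fix s x assume s: "s < b"
    have u: "0 < 1 + v s x" using ub(1)[OF s, of x] by linarith
    show "((\<lambda>s. (1 + v s x) powr - p) has_real_derivative - p * ((1 + v s x) powr (- p - 1) * R s x)) (at s)"
      using evolR[of s x] s b(1) u by (auto intro!: derivative_eq_intros simp: powr_diff)
    have "\<bar>(1 + v s x) powr (- p - 1)\<bar> \<le> K"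
      unfolding K_def by (rule powr_bound) (use ub[OF s, of x] in auto)
    then have "\<bar>(1 + v s x) powr (- p - 1) * R s x\<bar> \<le> K * D"
      unfolding abs_mult using D(2)[of s x] s b(1) by (intro mult_mono) (auto simp: K_def)
    then have "p * \<bar>(1 + v s x) powr (- p - 1) * R s x\<bar> \<le> p * (K * D)" using p7 by (intro mult_left_mono) auto
    then show "\<bar>- p * ((1 + v s x) powr (- p - 1) * R s x)\<bar> \<le> p * (K * D)" using p7 by (simp add: abs_mult)
  next
    fix s assume s: "s < b"
    show "cont (\<lambda>x. - p * ((1 + v s x) powr (- p - 1) * R s x))"
      using cu[OF s] cont_R[of s] s b(1) by (intro continuous_on_mult continuous_on_const) auto
  qed (use cu s in auto)
  then show ?thesis unfolding circ_cmult .
qed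

lemma A_lim: "(A \<longlongrightarrow> 2 * pi) at_bot"
proof -
  have "((\<lambda>s. nrm (v s) * (3 * (1 / 2))) \<longlongrightarrow> 0 * (3 * (1 / 2))) at_bot" by (intro tendsto_mult lim tendsto_const)
  then have m: "((\<lambda>s. nrm (v s) * (3 * (1 / 2))) \<longlongrightarrow> 0) at_bot" by simp
  have "((\<lambda>s. ip (v s) (w s)) \<longlongrightarrow> 0) at_bot"
  proof (rule Lim_null_comparison[OF _ m])
    show "\<forall>\<^sub>F s in at_bot. norm (ip (v s) (w s)) \<le> nrm (v s) * (3 * (1 / 2))"
      using eventually_le_at_bot[of \<tau>0]
    proof eventually_elim
      case (elim s)
      have "nrm (w s) \<le> 3 * (1 / 2)" by (rule nrm_bound[OF cont_w[OF elim] wh[OF elim]])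
      then have "nrm (v s) * nrm (w s) \<le> nrm (v s) * (3 * (1 / 2))" by (rule mult_left_mono) (rule nrm_nonneg[OF cont_v[OF elim]])
      then show ?case using ip_le_nrm[OF cont_v[OF elim] cont_w[OF elim]] by simp
    qed
  qed
  then have "((\<lambda>s. 2 * pi + 2 * (sqrt (2 * pi) * fc (v s) 0) + ip (v s) (w s)) \<longlongrightarrow> 2 * pi + 2 * (sqrt (2 * pi) * 0) + 0) at_bot"
    by (intro tendsto_intros fc_lim)
  then have 1: "((\<lambda>s. 2 * pi + 2 * (sqrt (2 * pi) * fc (v s) 0) + ip (v s) (w s)) \<longlongrightarrow> 2 * pi) at_bot" by simp
  show ?thesis
  proof (rule Lim_transform_eventually[OF 1])
    show "\<forall>\<^sub>F s in at_bot. 2 * pi + 2 * (sqrt (2 * pi) * fc (v s) 0) + ip (v s) (w s) = A s"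
      using eventually_le_at_bot[of \<tau>0] by eventually_elim (simp add: A_eq circ_eq_fc0)
  qed
qed

lemma B_lim: "(B \<longlongrightarrow> 2 * pi) at_bot"
proof -
  obtain C where C: "C > 0" "\<And>y. \<bar>y\<bar> \<le> 1 / 2 \<Longrightarrow> \<bar>(1 + y) powr - p - (\<Sum>m<1. (- p gchoose m) * y ^ m)\<bar> \<le> C * \<bar>y\<bar> ^ 1"
    using powr_taylor[of "- p" 1] by blast
  have "\<exists>t. \<forall>s\<le>t. dist (B s) (2 * pi) < e" if e: "e > 0" for e
  proof -
    define d where "d = min (1 / 2) (e / (4 * pi * C))"
    have d: "d > 0" "d \<le> 1 / 2" "2 * pi * (C * d) < e"
    proof -
      show "d > 0" using e C by (simp add: d_def)
      have "2 * pi * (C * d) \<le> 2 * pi * (C * (e / (4 * pi * C)))" using C by (intro mult_left_mono) (auto simp: d_def)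
      also have "\<dots> = e / 2" using C by (simp add: field_simps)
      finally show "2 * pi * (C * d) < e" using e by simp
    qed (simp add: d_def)
    obtain t where t: "t < \<tau>0" "\<And>\<tau> j x. \<tau> \<le> t \<Longrightarrow> j \<le> 2 \<Longrightarrow> \<bar>nth_deriv j (v \<tau>) x\<bar> \<le> d" using v_unif[OF d(1)] by blast
    have "dist (B s) (2 * pi) < e" if "s \<le> t" for s
    proof -
      have vd: "\<bar>v s x\<bar> \<le> d" "\<bar>v s x\<bar> \<le> 1 / 2" for x using t(2)[OF that, of 0 x] d(2) by auto
      have cu: "cont (\<lambda>x. (1 + v s x) powr - p)"
      proof -
        have "1 + v s x \<noteq> 0" for x using vd(2)[of x] by (auto simp: abs_le_iff)
        then show ?thesis using cont_v[of s] that t(1) by (intro continuous_on_powr continuous_on_add) auto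
      qed
      have "\<bar>circ (\<lambda>x. (1 + v s x) powr - p - 1)\<bar> \<le> 2 * pi * (C * d)"
      proof (rule circ_bound)
        fix x
        have "\<bar>(1 + v s x) powr - p - 1\<bar> \<le> C * \<bar>v s x\<bar>" using C(2)[OF vd(2)[of x]] by simp
        also have "\<dots> \<le> C * d" using C vd by simp
        finally show "\<bar>(1 + v s x) powr - p - 1\<bar> \<le> C * d" .
      qed (intro continuous_on_diff cu continuous_on_const)
      moreover have "circ (\<lambda>x. (1 + v s x) powr - p - 1) = B s - 2 * pi"
        unfolding B_def by (simp add: circ_diff cu circ_const)
      ultimately show ?thesis using d(3) by (simp add: dist_real_def)
    qed
    then show ?thesis by blast
  qed
  then show ?thesis unfolding tendsto_iff eventually_at_bot_linorder by blast
qed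

text \<open>The entropy is nondecreasing by \<open>chebyshev\<close> and tends at - infinity to its
  value at the circle, where both integrals are 2 pi.\<close>

lemma entropy_bound:
  obtains t where "t < \<tau>0" "\<And>s. s \<le> t \<Longrightarrow> 0 < A s \<and> 0 < B s \<and> 0 \<le> p * ln (A s / (2 * pi)) + 2 * ln (B s / (2 * pi))"
    "\<And>s x. s \<le> t \<Longrightarrow> \<bar>v s x\<bar> \<le> 1 / 2"
proof -
  have h2: "(1 / 2 :: real) > 0" by simp
  obtain t where t: "t < \<tau>0" "\<And>\<tau> j x. \<tau> \<le> t \<Longrightarrow> j \<le> 2 \<Longrightarrow> \<bar>nth_deriv j (v \<tau>) x\<bar> \<le> 1 / 2" using v_unif[OF h2] by blast
  have vh: "\<bar>v s x\<bar> \<le> 1 / 2" if "s \<le> t" for s x using t(2)[OF that, of 0 x] by simp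
  define L' where "L' s = p * (2 * circ (\<lambda>x. R s x * (1 + w s x)) / A s) + 2 * (- p * circ (\<lambda>x. (1 + v s x) powr (- p - 1) * R s x) / B s)" for s
  have ch: "0 < A s" "0 < B s" "0 \<le> B s * circ (\<lambda>x. R s x * (1 + w s x)) - A s * circ (\<lambda>x. (1 + v s x) powr (- p - 1) * R s x)"
    if "s \<le> t" for s
    using chebyshev[of s] vh[OF that] that t(1) by auto
  have L: "p * ln (2 * pi) + 2 * ln (2 * pi) \<le> p * ln (A s) + 2 * ln (B s)" if s: "s < t" for s
  proof (rule nonneg_of_nondecreasing[where b = t and y = "\<lambda>s. p * ln (A s) + 2 * ln (B s)" and y' = L'])
    fix r assume r: "r < t"
    then have r': "r \<le> t" "r < \<tau>0" using t(1) by auto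
    show "((\<lambda>s. p * ln (A s) + 2 * ln (B s)) has_real_derivative L' r) (at r)"
      unfolding L'_def using A_deriv[OF r'(2)] B_deriv[of t r] t(1) vh r ch[OF r'(1)]
      by (auto intro!: derivative_eq_intros simp: mult_ac)
    have "L' r = 2 * p / (A r * B r) * (B r * circ (\<lambda>x. R r x * (1 + w r x)) - A r * circ (\<lambda>x. (1 + v r x) powr (- p - 1) * R r x))"
      unfolding L'_def using ch(1,2)[OF r'(1)] by (simp add: field_simps)
    also have "0 \<le> \<dots>" using ch[OF r'(1)] p7 by (intro mult_nonneg_nonneg divide_nonneg_nonneg) auto
    finally show "0 \<le> L' r" .
  next
    show "((\<lambda>s. p * ln (A s) + 2 * ln (B s)) \<longlongrightarrow> p * ln (2 * pi) + 2 * ln (2 * pi)) at_bot"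
      by (intro tendsto_intros A_lim B_lim) auto
  qed (rule s)
  show ?thesis
  proof (rule that[of "t - 1"])
    show "t - 1 < \<tau>0" using t by simp
    fix s assume "s \<le> t - 1"
    then have s: "s < t" "s \<le> t" by auto
    show "0 < A s \<and> 0 < B s \<and> 0 \<le> p * ln (A s / (2 * pi)) + 2 * ln (B s / (2 * pi))"
      using L[OF s(1)] ch(1,2)[OF s(2)] by (simp add: ln_div algebra_simps)
    show "\<bar>v s x\<bar> \<le> 1 / 2" for x using vh[OF s(2)] .
  qed
qed

end

section \<open>Neutral modes\<close>

lemma fam_eb: "fam n I (\<lambda>i. eb k)"
proof (induction n arbitrary: k)
  case 0
  show ?case using cont_eb eb_abs by (auto intro!: exI[of _ 1])
next
  case (Suc n)
  show ?case
    by (rule fam_SucI[OF Suc.IH fam_cmult[OF Suc.IH, of "- of_int k" "- k"]]) (use eb_deriv[of k] in simp)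
qed

context neutral begin

text \<open>The unstable modes without the mean, which normalisation removes. \<open>xp\<close>,
  \<open>y2\<close> and \<open>z2\<close> are the squared norms of the other unstable modes, of the
  neutral part and of the stable part.\<close>

definition PP :: "int set" where "PP = {k. 0 < \<bar>k\<bar> \<and> \<bar>k\<bar> < l}"
definition y2 :: "real \<Rightarrow> real" where "y2 s = (fc (v s) l)\<^sup>2 + (fc (v s) (- l))\<^sup>2"
definition xp :: "real \<Rightarrow> real" where "xp s = (\<Sum>k\<in>PP. (fc (v s) k)\<^sup>2)"
definition z2 :: "real \<Rightarrow> real" where "z2 s = ip (v s) (v s) - (fc (v s) 0)\<^sup>2 - y2 s - xp s"

lemma lam_l: "lam \<alpha> l = 0" "lam \<alpha> (- l) = 0"
proof -
  have "(of_int l)\<^sup>2 - 1 \<noteq> (0::real)" using p7 by (simp add: p_def)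
  then show "lam \<alpha> l = 0" by (simp add: lam_def al)
  then show "lam \<alpha> (- l) = 0" by (simp add: lam_uminus)
qed

lemma P_eq: "P = insert 0 PP" "0 \<notin> PP" "finite PP"
proof -
  show "P = insert 0 PP"
  proof (intro subset_antisym subsetI)
    fix k assume "k \<in> P"
    then have "\<not> \<bar>l\<bar> < \<bar>k\<bar>" "\<bar>k\<bar> \<noteq> l"
      using lam_less[OF apos, of l k] lam_l by (auto simp: P_def abs_if split: if_splits)
    then show "k \<in> insert 0 PP" using l3 by (auto simp: PP_def)
  next
    fix k assume "k \<in> insert 0 PP"
    then have "\<bar>k\<bar> < \<bar>l\<bar>" using l3 by (auto simp: PP_def)
    then show "k \<in> P" using lam_less[OF apos, of k l] lam_l by (simp add: P_def)
  qed
  have "PP \<subseteq> {- l..l}" by (auto simp: PP_def)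
  then show "finite PP" by (rule finite_subset) simp
  show "0 \<notin> PP" by (simp add: PP_def)
qed

lemma x2_eq: "x2 s = (fc (v s) 0)\<^sup>2 + xp s"
  unfolding x2_def xp_def P_eq(1) using P_eq by simp

lemma xp_nonneg: "0 \<le> xp s"
  unfolding xp_def by (intro sum_nonneg) auto

text \<open>Normalising \<open>1 + v\<close> by its mean changes the scale-invariant entropy by nothing and
  removes the zeroth mode, whose contribution has the wrong sign.\<close>

lemma neutral_static:
  obtains t C where "t < \<tau>0" "C > 0" "\<And>s. s \<le> t \<Longrightarrow> (y2 s)\<^sup>2 + z2 s \<le> C * xp s"
proof -
  obtain \<epsilon> C where C: "\<epsilon> > 0" "C > 0"
    "\<And>f. CP 2 f \<Longrightarrow> fc f 0 = 0 \<Longrightarrow> (\<And>x. \<bar>f x\<bar> \<le> \<epsilon>) \<Longrightarrow> (\<And>x. \<bar>nth_deriv 1 f x\<bar> \<le> \<epsilon>) \<Longrightarrow>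
       0 \<le> p * ln (1 + (ip f f - ip (nth_deriv 1 f) (nth_deriv 1 f)) / (2 * pi)) + 2 * ln (av (\<lambda>x. (1 + f x) powr - p)) \<Longrightarrow>
       ((fc f l)\<^sup>2 + (fc f (- l))\<^sup>2)\<^sup>2 + (ip f f - ((fc f l)\<^sup>2 + (fc f (- l))\<^sup>2) - (\<Sum>k\<in>{k. 0 < \<bar>k\<bar> \<and> \<bar>k\<bar> < l}. (fc f k)\<^sup>2))
         \<le> C * (\<Sum>k\<in>{k. 0 < \<bar>k\<bar> \<and> \<bar>k\<bar> < l}. (fc f k)\<^sup>2)"
    using static_neutral[OF l3 p_def] by blast
  obtain t1 where t1: "t1 < \<tau>0" "\<And>s. s \<le> t1 \<Longrightarrow> 0 < A s \<and> 0 < B s \<and> 0 \<le> p * ln (A s / (2 * pi)) + 2 * ln (B s / (2 * pi))"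
    "\<And>s x. s \<le> t1 \<Longrightarrow> \<bar>v s x\<bar> \<le> 1 / 2" using entropy_bound by blast
  define e where "e = min (1 / 2) (\<epsilon> / 4)"
  have e: "e > 0" "e \<le> 1 / 2" "4 * e \<le> \<epsilon>" using C by (auto simp: e_def)
  obtain t2 where t2: "t2 < \<tau>0" "\<And>\<tau> j x. \<tau> \<le> t2 \<Longrightarrow> j \<le> 2 \<Longrightarrow> \<bar>nth_deriv j (v \<tau>) x\<bar> \<le> e" using v_unif[OF e(1)] by blast
  have "(y2 s)\<^sup>2 + z2 s \<le> 4 * C * xp s" if s: "s \<le> min t1 t2" for s
  proof -
    have s0: "s \<le> \<tau>0" "s \<le> t1" "s \<le> t2" using s t1 by auto
    have ve: "\<bar>v s x\<bar> \<le> e" "\<bar>nth_deriv 1 (v s) x\<bar> \<le> e" for x using t2(2)[OF s0(3), of 0 x] t2(2)[OF s0(3), of 1 x] by auto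
    have CP2: "CP 2 (v s)" using CPv' s0 by simp
    have c: "cont (v s)" "cont (nth_deriv 1 (v s))" using cont_v cont_vj s0 by auto
    \<comment> \<open>\<open>a\<close> is the mean of v and \<open>m\<close> that of 1 + v; f below
      is 1 + v divided by its mean, minus 1.\<close>
    define a where "a = circ (v s) / (2 * pi)"
    define m where "m = 1 + a"
    have "\<bar>circ (v s)\<bar> \<le> 2 * pi * e" by (rule circ_bound[OF c(1) ve(1)])
    then have a: "\<bar>a\<bar> \<le> e" by (simp add: a_def abs_divide field_simps)
    then have m: "1 / 2 \<le> m" "m \<le> 3 / 2" "m > 0" using e(2) by (auto simp: m_def abs_le_iff)
    have ca: "circ (v s) = 2 * pi * a" by (simp add: a_def)
    define f where "f = (\<lambda>x. (1 / m) * (v s x - a))"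
    have cva: "cont (\<lambda>x. v s x - a)" using c by (intro continuous_on_diff continuous_on_const)
    have CPf: "CP 2 f" unfolding f_def by (intro CP_cmult CP_diff CP2 CP_const)
    have f': "nth_deriv 1 f = (\<lambda>x. (1 / m) * nth_deriv 1 (v s) x)"
    proof -
      have "(f has_real_derivative (1 / m) * nth_deriv 1 (v s) x) (at x)" for x
        unfolding f_def using CP_D0[OF CP2, of x] m(3) by (auto intro!: derivative_eq_intros)
      from nth_deriv_eqI[OF this, of 0] show ?thesis by simp
    qed
    have uf: "1 + v s x = m * (1 + f x)" for x using m by (simp add: f_def m_def field_simps)
    have fcf: "fc f k = fc (v s) k / m" if "k \<noteq> 0" for k
    proof -
      have "fc (\<lambda>x. a) k = 0"
      proof -
        have "(\<lambda>x. a) = (\<lambda>x. (a * sqrt (2 * pi)) * eb 0 x)" by (simp add: eb_def fun_eq_iff)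
        then have "fc (\<lambda>x. a) k = (a * sqrt (2 * pi)) * ip (eb 0) (eb k)" unfolding fc_def by (simp only: ip_cmult)
        then show ?thesis using that by (simp add: ip_eb)
      qed
      then show ?thesis unfolding f_def fc_cmult using fc_diff[OF c(1), of "\<lambda>x. a" k] by simp
    qed
    have "circ f = 0" unfolding f_def circ_cmult using c ca by (simp add: circ_diff circ_const)
    then have fcf0: "fc f 0 = 0" using circ_eq_fc0[of f] by simp
    have ff: "m\<^sup>2 * ip f f = ip (v s) (v s) - (fc (v s) 0)\<^sup>2"
    proof -
      have "m\<^sup>2 * ip f f = ip (\<lambda>x. v s x - a) (\<lambda>x. v s x - a)"
        unfolding f_def ip_cmult ip_cmult2 using m by (simp add: power2_eq_square)
      also have "\<dots> = ip (v s) (v s) - 2 * (a * circ (v s)) + 2 * pi * a\<^sup>2"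
      proof -
        have "ip (v s) (\<lambda>x. a) = a * circ (v s)" by (simp add: ip_def circ_def)
        moreover have "ip (\<lambda>x. a) (\<lambda>x. a) = 2 * pi * a\<^sup>2" by (simp add: ip_circ circ_const power2_eq_square)
        ultimately show ?thesis using ip_square_diff[OF c(1), of "\<lambda>x. a"] by simp
      qed
      also have "\<dots> = ip (v s) (v s) - 2 * pi * a\<^sup>2" unfolding ca by (simp add: power2_eq_square)
      also have "2 * pi * a\<^sup>2 = (fc (v s) 0)\<^sup>2"
      proof -
        have "fc (v s) 0 = circ (v s) / sqrt (2 * pi)" by (simp add: circ_eq_fc0)
        then show ?thesis unfolding ca by (simp add: power_divide power2_eq_square)
      qed
      finally show ?thesis .
    qed
    have f'f': "m\<^sup>2 * ip (nth_deriv 1 f) (nth_deriv 1 f) = ip (nth_deriv 1 (v s)) (nth_deriv 1 (v s))"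
      unfolding f' ip_cmult ip_cmult2 using m by (simp add: power2_eq_square)
    have As: "A s = 2 * pi * m\<^sup>2 * (1 + (ip f f - ip (nth_deriv 1 f) (nth_deriv 1 f)) / (2 * pi))"
    proof -
      have "ip (v s) (w s) = ip (v s) (v s) - ip (nth_deriv 1 (v s)) (nth_deriv 1 (v s))"
      proof -
        have "ip (nth_deriv 1 (v s)) (nth_deriv 1 (v s)) = - ip (v s) (nth_deriv 2 (v s))"
          using ip_parts[OF CPv'[OF s0(1)] CP_nth'[OF CPv[OF s0(1)], of 1 1]]
          by (simp add: nth_deriv_add[of 1 1 "v s", simplified] numeral_2_eq_2)
        then show ?thesis unfolding w_def[abs_def] using c(1) cont_vj[OF s0(1), of 2] by (simp add: ip_add2)
      qed
      then have "A s = 2 * pi + 2 * (2 * pi * a) + ip (v s) (v s) - m\<^sup>2 * ip (nth_deriv 1 f) (nth_deriv 1 f)"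
        using A_eq[OF s0(1)] unfolding ca f'f' by simp
      moreover have "ip (v s) (v s) = m\<^sup>2 * ip f f + 2 * pi * a\<^sup>2"
      proof -
        have "fc (v s) 0 = circ (v s) / sqrt (2 * pi)" by (simp add: circ_eq_fc0)
        then have "(fc (v s) 0)\<^sup>2 = 2 * pi * a\<^sup>2" unfolding ca by (simp add: power_divide power2_eq_square)
        then show ?thesis using ff by simp
      qed
      ultimately have "A s = m\<^sup>2 * (2 * pi + ip f f - ip (nth_deriv 1 f) (nth_deriv 1 f))"
        by (simp add: m_def power2_eq_square algebra_simps)
      also have "\<dots> = 2 * pi * m\<^sup>2 * (1 + (ip f f - ip (nth_deriv 1 f) (nth_deriv 1 f)) / (2 * pi))"
        by (simp add: field_simps)
      finally show ?thesis .
    qed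
    have f1: "0 < 1 + f x" for x
    proof -
      have "0 < 1 + v s x" using ve(1)[of x] e(2) by (auto simp: abs_le_iff)
      then show ?thesis unfolding uf using m(3) by (simp add: zero_less_mult_iff)
    qed
    have Bs: "B s = 2 * pi * m powr - p * av (\<lambda>x. (1 + f x) powr - p)"
    proof -
      have "(1 + v s x) powr - p = m powr - p * (1 + f x) powr - p" for x
        unfolding uf using m(3) f1[of x] by (simp add: powr_mult)
      then show ?thesis unfolding B_def by (simp add: circ_cmult av_def)
    qed
    have ent: "0 \<le> p * ln (1 + (ip f f - ip (nth_deriv 1 f) (nth_deriv 1 f)) / (2 * pi)) + 2 * ln (av (\<lambda>x. (1 + f x) powr - p))"
    proof -
      define a1 where "a1 = 1 + (ip f f - ip (nth_deriv 1 f) (nth_deriv 1 f)) / (2 * pi)"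
      define b1 where "b1 = av (\<lambda>x. (1 + f x) powr - p)"
      have AB: "A s = 2 * pi * m\<^sup>2 * a1" "B s = 2 * pi * m powr - p * b1" using As Bs by (simp_all add: a1_def b1_def)
      have h: "0 < A s" "0 < B s" "0 \<le> p * ln (A s / (2 * pi)) + 2 * ln (B s / (2 * pi))" using t1(2)[OF s0(2)] by auto
      have ab: "a1 > 0" "b1 > 0"
        using zero_less_mult_pos[OF h(1)[unfolded AB(1)]] zero_less_mult_pos[OF h(2)[unfolded AB(2)]] m(3) by simp_all
      \<comment> \<open>The factors m^2 and m^(- p) contribute 2 p ln m and - 2 p ln m to the
        entropy and cancel.\<close>
      have "ln (A s / (2 * pi)) = 2 * ln m + ln a1"
        unfolding AB using m(3) ab by (simp add: ln_mult ln_realpow)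
      moreover have "ln (B s / (2 * pi)) = - p * ln m + ln b1"
        unfolding AB using m(3) ab by (simp add: ln_mult ln_powr)
      ultimately have "p * ln (A s / (2 * pi)) + 2 * ln (B s / (2 * pi)) = p * ln a1 + 2 * ln b1" by (simp add: algebra_simps)
      then show ?thesis using h(3) by (simp add: a1_def b1_def)
    qed
    have fb: "\<bar>f x\<bar> \<le> \<epsilon>" "\<bar>nth_deriv 1 f x\<bar> \<le> \<epsilon>" for x
    proof -
      have "\<bar>v s x - a\<bar> \<le> 2 * e" using ve(1)[of x] a by linarith
      moreover have im: "1 / m \<le> 2" "0 \<le> 1 / m" using m by (auto simp: field_simps)
      ultimately have "1 / m * \<bar>v s x - a\<bar> \<le> 2 * (2 * e)" by (intro mult_mono) auto
      then show "\<bar>f x\<bar> \<le> \<epsilon>" using e(3) m(3) by (simp add: f_def abs_mult)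
      have "1 / m * \<bar>nth_deriv 1 (v s) x\<bar> \<le> 2 * e" using im ve(2)[of x] by (intro mult_mono) auto
      moreover have "\<bar>nth_deriv 1 f x\<bar> = 1 / m * \<bar>nth_deriv 1 (v s) x\<bar>" unfolding f' abs_mult using m(3) by simp
      ultimately show "\<bar>nth_deriv 1 f x\<bar> \<le> \<epsilon>" using e(1,3) by linarith
    qed
    have sy: "(fc f l)\<^sup>2 + (fc f (- l))\<^sup>2 = y2 s / m\<^sup>2"
      using fcf[of l] fcf[of "- l"] l3 by (simp add: y2_def power_divide add_divide_distrib)
    have sx: "(\<Sum>k\<in>PP. (fc f k)\<^sup>2) = xp s / m\<^sup>2"
      unfolding xp_def sum_divide_distrib by (intro sum.cong) (auto simp: fcf power_divide PP_def)
    have sf: "ip f f = (ip (v s) (v s) - (fc (v s) 0)\<^sup>2) / m\<^sup>2" using ff m(3) by (simp add: field_simps)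
    have "(y2 s / m\<^sup>2)\<^sup>2 + (ip f f - y2 s / m\<^sup>2 - xp s / m\<^sup>2) \<le> C * (xp s / m\<^sup>2)"
      using C(3)[OF CPf fcf0 fb ent] unfolding PP_def[symmetric] sy sx .
    then have "(y2 s / m\<^sup>2)\<^sup>2 + z2 s / m\<^sup>2 \<le> C * (xp s / m\<^sup>2)"
      unfolding sf z2_def by (simp add: diff_divide_distrib)
    then have "((y2 s / m\<^sup>2)\<^sup>2 + z2 s / m\<^sup>2) * m\<^sup>2 \<le> C * (xp s / m\<^sup>2) * m\<^sup>2" by (rule mult_right_mono) simp
    moreover have "(y2 s / m\<^sup>2)\<^sup>2 * m\<^sup>2 = (y2 s)\<^sup>2 / m\<^sup>2" "z2 s / m\<^sup>2 * m\<^sup>2 = z2 s" "C * (xp s / m\<^sup>2) * m\<^sup>2 = C * xp s"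
      using m(3) by (simp_all add: power2_eq_square)
    ultimately have h: "(y2 s)\<^sup>2 / m\<^sup>2 + z2 s \<le> C * xp s" by (simp only: distrib_right)
    have m2: "1 / 4 \<le> m\<^sup>2" "m\<^sup>2 \<le> 9 / 4" using power_mono[OF m(1), of 2] power_mono[OF m(2), of 2] m(3) by (auto simp: power_divide)
    have z: "0 \<le> z2 s"
    proof -
      have "(\<Sum>k\<in>{0, l, - l} \<union> PP. (fc (v s) k)\<^sup>2) \<le> ip (v s) (v s)" using bessel[OF _ c(1)] P_eq(3) by simp
      moreover have "(\<Sum>k\<in>{0, l, - l} \<union> PP. (fc (v s) k)\<^sup>2) = (\<Sum>k\<in>{0, l, - l}. (fc (v s) k)\<^sup>2) + xp s"
        unfolding xp_def using P_eq(3) by (intro sum.union_disjoint) (auto simp: PP_def)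
      ultimately show ?thesis using l3 by (simp add: z2_def y2_def)
    qed
    have y: "(y2 s)\<^sup>2 \<le> 9 / 4 * ((y2 s)\<^sup>2 / m\<^sup>2)"
    proof -
      have "m\<^sup>2 * ((y2 s)\<^sup>2 / m\<^sup>2) \<le> 9 / 4 * ((y2 s)\<^sup>2 / m\<^sup>2)" using m2 by (intro mult_right_mono) auto
      then show ?thesis using m(3) by simp
    qed
    have "z2 s \<le> 9 / 4 * z2 s" using z by simp
    with y have "(y2 s)\<^sup>2 + z2 s \<le> 9 / 4 * ((y2 s)\<^sup>2 / m\<^sup>2 + z2 s)" unfolding distrib_left by (rule add_mono)
    also have "\<dots> \<le> 9 / 4 * (C * xp s)" using h by simp
    also have "\<dots> \<le> 4 * C * xp s" using mult_nonneg_nonneg[of C "xp s"] C(2) xp_nonneg[of s] by simp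
    finally show ?thesis .
  qed
  then show ?thesis using that[of "min t1 t2" "4 * C"] t1(1) C(2) by simp
qed


lemma z2_nonneg: "s \<le> \<tau>0 \<Longrightarrow> 0 \<le> z2 s"
proof -
  assume s: "s \<le> \<tau>0"
  have "(\<Sum>k\<in>{0, l, - l} \<union> PP. (fc (v s) k)\<^sup>2) \<le> ip (v s) (v s)" using bessel[OF _ cont_v[OF s]] P_eq(3) by simp
  moreover have "(\<Sum>k\<in>{0, l, - l} \<union> PP. (fc (v s) k)\<^sup>2) = (\<Sum>k\<in>{0, l, - l}. (fc (v s) k)\<^sup>2) + xp s"
    unfolding xp_def using P_eq(3) by (intro sum.union_disjoint) (auto simp: PP_def)
  ultimately show ?thesis using l3 by (simp add: z2_def y2_def)
qed

text \<open>The neutral part, the remainder and the share of the remainder in \<open>w\<close>. As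
  the neutral part is an eigenfunction, w = (1 - l^2) nn + wr; the squared norm of \<open>rr\<close>
  is X^2 + Z^2, which \<open>neutral_static\<close> bounds by a multiple of X^2.\<close>

definition nn :: "real \<Rightarrow> real \<Rightarrow> real" where "nn s x = fc (v s) l * eb l x + fc (v s) (- l) * eb (- l) x"
definition rr :: "real \<Rightarrow> real \<Rightarrow> real" where "rr s x = v s x - nn s x"
definition wr :: "real \<Rightarrow> real \<Rightarrow> real" where "wr s x = rr s x + nth_deriv 2 (rr s) x"

lemma mode_l: "mode l"
  using l3 by unfold_locales simp

lemma nn_mode: "nn s = mode.n l (fc (v s) l) (fc (v s) (- l))"
  by (simp add: nn_def[abs_def] mode.n_def[OF mode_l, abs_def])

lemma fam_rr: "fam 26 {..\<tau>0} rr"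
proof -
  obtain B where B: "B > 0" "\<And>\<tau> j x. \<tau> \<le> \<tau>0 \<Longrightarrow> j \<le> 26 \<Longrightarrow> \<bar>nth_deriv j (v \<tau>) x\<bar> \<le> B" using bound_v by blast
  have "\<bar>fc (v i) k\<bar> \<le> 3 * B" if "i \<in> {..\<tau>0}" for i k
  proof -
    have "nrm (v i) \<le> 3 * B" by (rule nrm_bound[OF cont_v]) (use that B(2)[of i 0] in auto)
    then show ?thesis using fc_le_nrm[OF cont_v, of i k] that by simp
  qed
  then show ?thesis
    unfolding rr_def[abs_def] nn_def[abs_def]
    by (intro fam_diff fam_v fam_add fam_mult fam_eb fam_const[of _ _ "3 * B"])
qed

lemma CP_nn: "CP j (nn s)"
  unfolding nn_mode by (rule mode.CP_n[OF mode_l])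

lemma CP_rr: "s \<le> \<tau>0 \<Longrightarrow> CP 26 (rr s)"
  unfolding rr_def[abs_def] by (intro CP_diff CPv CP_nn)

lemma cont_nn: "cont (nn s)" using CP_cont[OF CP_nn[of 0]] .
lemma cont_rr: "s \<le> \<tau>0 \<Longrightarrow> cont (rr s)" using CP_cont[OF CP_rr] .
lemma cont_wr: "s \<le> \<tau>0 \<Longrightarrow> cont (wr s)"
  unfolding wr_def[abs_def] by (intro continuous_on_add cont_rr CP_contj[OF CP_rr]) auto

lemma w_split: assumes "s \<le> \<tau>0" shows "w s x = (1 - (of_int l)\<^sup>2) * nn s x + wr s x"
proof -
  have n2: "nth_deriv 2 (nn s) = (\<lambda>x. - (of_int l)\<^sup>2 * nn s x)"
    using nth_deriv_eqI[OF mode.n_deriv[OF mode_l], of 1] nth_deriv_eqI[OF mode.n1_deriv[OF mode_l], of 0]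
    unfolding nn_mode by (simp add: numeral_2_eq_2)
  have "nth_deriv 2 (rr s) = (\<lambda>x. nth_deriv 2 (v s) x - nth_deriv 2 (nn s) x)"
    unfolding rr_def[abs_def] by (rule nth_deriv_diff[OF CPv'[OF assms, of 2] CP_nn]) auto
  then show ?thesis unfolding wr_def w_def n2 by (simp add: rr_def algebra_simps)
qed

lemma rr_norm: assumes "s \<le> \<tau>0" shows "ip (rr s) (rr s) = x2 s + z2 s"
proof -
  have f: "finite {l, - l}" by simp
  have "four {l, - l} (v s) = nn s" using l3 by (auto simp: four_def nn_def fun_eq_iff)
  then have "ip (rr s) (rr s) = ip (v s) (v s) - (\<Sum>k\<in>{l, - l}. (fc (v s) k)\<^sup>2)"
    using ip_minus_four[OF f cont_v[OF assms]] by (simp add: rr_def[abs_def])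
  then show ?thesis using l3 by (simp add: x2_eq z2_def y2_def)
qed

lemma nn_sq_le: "(nn s x)\<^sup>2 \<le> y2 s"
proof -
  have "(nn s x)\<^sup>2 \<le> 2 * mode.N (fc (v s) l) (fc (v s) (- l))" unfolding nn_mode by (rule mode.n_sq_le[OF mode_l])
  also have "\<dots> = y2 s / pi" by (simp add: mode.N_def[OF mode_l] y2_def field_simps)
  also have "\<dots> \<le> y2 s / 1" using pi_gt3 by (intro divide_left_mono) (auto simp: y2_def)
  finally show ?thesis by simp
qed

text \<open>The square of a mode of frequency l has frequencies 0 and 2 l only: at second order the
  neutral part forces neither itself nor the unstable modes 0 < |k| < l.\<close>

lemma fc_nn_sq: "\<bar>k\<bar> \<le> l \<Longrightarrow> fc (\<lambda>x. (nn s x)\<^sup>2) k = (if k = 0 then y2 s / sqrt (2 * pi) else 0)"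
proof -
  assume k: "\<bar>k\<bar> \<le> l"
  interpret m: mode l "fc (v s) l" "fc (v s) (- l)" by (rule mode_l)
  have "(\<lambda>x. (nn s x)\<^sup>2) = (\<lambda>x. m.m2 x + (m.N * sqrt (2 * pi)) * eb 0 x)"
    by (simp add: m.m2_def nn_mode eb_def fun_eq_iff)
  then have "fc (\<lambda>x. (nn s x)\<^sup>2) k = fc m.m2 k + (m.N * sqrt (2 * pi)) * fc (eb 0) k"
    using fc_add[OF m.cont_m2, of "\<lambda>x. (m.N * sqrt (2 * pi)) * eb 0 x" k] fc_cmult[of "m.N * sqrt (2 * pi)" "eb 0" k]
    by (simp add: continuous_on_mult cont_eb)
  moreover have "fc m.m2 k = 0" by (rule m.fc_m2) (use k l3 in auto)
  moreover have "fc (eb 0) k = (if k = 0 then 1 else 0)" by (simp add: fc_def ip_eb)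
  moreover have "m.N * sqrt (2 * pi) = y2 s / sqrt (2 * pi)"
  proof -
    define q where "q = sqrt (2 * pi)"
    have q: "2 * pi = q * q" "q \<noteq> 0" by (simp_all add: q_def)
    have "m.N = y2 s / (q * q)" unfolding m.N_def y2_def q(1) ..
    then show ?thesis unfolding q_def[symmetric] using q(2) by simp
  qed
  ultimately show ?thesis by simp
qed

text \<open>\<open>neutral_static\<close> lets the neutral amplitude be of order x2^(1/4), with a
  square as large as X. By \<open>fc_nn_sq\<close> that square reaches, among |k| <= l, the mean
  alone, where the weighted energy \<open>D2\<close> absorbs it. The other forcing of these modes is
  of order x2^(5/8); hence the unstable part grows exponentially, and Duhamel's formula gives Y <= C
  X.\<close>

lemma neutral_unstable_dominance:
  obtains C0 \<tau>1 where "C0 > 0" "\<tau>1 < \<tau>0" "\<And>\<tau>. \<tau> \<le> \<tau>1 \<Longrightarrow> nrm (v \<tau>) \<le> C0 * sqrt (x2 \<tau>)"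
proof -
  obtain ts C where ts: "ts < \<tau>0" "C > 0" "\<And>s. s \<le> ts \<Longrightarrow> (y2 s)\<^sup>2 + z2 s \<le> C * xp s" using neutral_static by blast
  obtain Br where Br: "Br > 0" "\<And>i j x. i \<in> {..\<tau>0} \<Longrightarrow> j \<le> 26 \<Longrightarrow> \<bar>nth_deriv j (rr i) x\<bar> \<le> Br"
    using fam_nth_bound[OF fam_rr] by blast
  obtain Cr where Cr: "Cr > 0" "\<And>f j x. CP 12 f \<Longrightarrow> (\<And>j x. j \<le> 12 \<Longrightarrow> \<bar>nth_deriv j f x\<bar> \<le> Br) \<Longrightarrow> j \<le> 2 \<Longrightarrow>
       \<bar>nth_deriv j f x\<bar> \<le> Cr * nrm f powr (3 / 4)" using sup_interp[OF Br(1)] by blast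
  obtain CE where CE: "CE > 0"
    "\<And>\<tau> x. \<tau> \<le> \<tau>0 \<Longrightarrow> \<bar>E \<tau> x + \<alpha> * (\<alpha> + 1) / 2 * (w \<tau> x)\<^sup>2\<bar> \<le> CE * \<bar>w \<tau> x\<bar> ^ 3" using E_cubic by blast
  have "\<forall>\<^sub>F s in at_bot. x2 s < 1" using order_tendstoD(2)[OF x2_lim] by simp
  then obtain t1 where t1: "\<And>s. s \<le> t1 \<Longrightarrow> x2 s < 1" by (auto simp: eventually_at_bot_linorder)
  define T where "T = min ts t1"
  have T: "s \<le> \<tau>0" "s < \<tau>0" "s \<le> ts" "x2 s \<le> 1" if "s \<le> T" for s using that ts(1) t1[of s] by (auto simp: T_def)
  define L where "L = (of_int l)\<^sup>2 - (1::real)"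
  have L: "L > 0" using p7 by (simp add: L_def p_def)
  define \<beta> where "\<beta> = \<alpha> * (\<alpha> + 1) / 2"
  have \<beta>: "\<beta> > 0" using apos by (simp add: \<beta>_def)
  have xx: "xp s \<le> x2 s" for s by (simp add: x2_eq)
  have y2b: "y2 s \<le> sqrt C * sqrt (xp s)" if s: "s \<le> T" for s
  proof -
    have "(y2 s)\<^sup>2 \<le> C * xp s" using ts(3)[OF T(3)[OF s]] z2_nonneg[OF T(1)[OF s]] by linarith
    then show ?thesis unfolding real_sqrt_mult[symmetric] by (rule real_le_rsqrt)
  qed
  have z2b: "z2 s \<le> C * x2 s" if s: "s \<le> T" for s
  proof -
    have "C * xp s \<le> C * x2 s" using xx[of s] ts(2) by simp
    then show ?thesis using ts(3)[OF T(3)[OF s]] zero_le_power2[of "y2 s"] by linarith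
  qed
  define K1 where "K1 = sqrt (sqrt C)"
  have K1: "K1 > 0" using ts(2) by (simp add: K1_def)
  have q14: "sqrt (sqrt (x2 s)) = x2 s powr (1 / 4)" for s
    using x2_nonneg[of s] by (simp add: powr_half_sqrt[symmetric] powr_powr)
  have nb: "\<bar>nn s x\<bar> \<le> K1 * x2 s powr (1 / 4)" if s: "s \<le> T" for s x
  proof -
    have "(nn s x)\<^sup>2 \<le> sqrt C * sqrt (x2 s)"
    proof -
      have "sqrt C * sqrt (xp s) \<le> sqrt C * sqrt (x2 s)" using xx[of s] ts(2) by (intro mult_left_mono) auto
      then show ?thesis using nn_sq_le[of s x] y2b[OF s] by linarith
    qed
    then have "\<bar>nn s x\<bar> \<le> sqrt (sqrt C * sqrt (x2 s))" by (intro real_le_rsqrt) simp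
    then show ?thesis by (simp add: K1_def real_sqrt_mult q14)
  qed
  define K2 where "K2 = 2 * Cr * (1 + C) powr (3 / 8)"
  have K2: "K2 > 0" using Cr ts(2) by (simp add: K2_def)
  \<comment> \<open>The remainder has norm at most a multiple of X, so interpolation gives X^(3/4) =
    x2^(3/8).\<close>
  have wb: "\<bar>wr s x\<bar> \<le> K2 * x2 s powr (3 / 8)" if s: "s \<le> T" for s x
  proof -
    have c: "CP 12 (rr s)" using CP_mono[OF CP_rr[OF T(1)[OF s]]] by simp
    have d: "\<bar>nth_deriv j (rr s) x\<bar> \<le> Cr * nrm (rr s) powr (3 / 4)" if "j \<le> 2" for j
      by (rule Cr(2)[OF c]) (use Br(2) T(1)[OF s] that in auto)
    have "nrm (rr s) powr (3 / 4) = (ip (rr s) (rr s)) powr (3 / 8)"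
      using ip_pos[OF cont_rr[OF T(1)[OF s]]] by (simp add: nrm_def powr_half_sqrt[symmetric] powr_powr)
    also have "\<dots> \<le> ((1 + C) * x2 s) powr (3 / 8)"
      using rr_norm[OF T(1)[OF s]] z2b[OF s] ip_pos[OF cont_rr[OF T(1)[OF s]]] by (intro powr_mono2) (auto simp: distrib_right)
    also have "\<dots> = (1 + C) powr (3 / 8) * x2 s powr (3 / 8)" using ts(2) x2_nonneg by (simp add: powr_mult)
    finally have "Cr * nrm (rr s) powr (3 / 4) \<le> Cr * ((1 + C) powr (3 / 8) * x2 s powr (3 / 8))" using Cr(1) by simp
    moreover have "\<bar>wr s x\<bar> \<le> 2 * (Cr * nrm (rr s) powr (3 / 4))" using d[of 0] d[of 2] by (simp add: wr_def)
    ultimately show ?thesis by (simp add: K2_def)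
  qed
  have pm: "x2 s powr c \<le> x2 s powr d" if "s \<le> T" "d \<le> c" "0 < d" for s c d
    using powr_mono'[OF that(2) x2_nonneg T(4)[OF that(1)]] .
  define K3 where "K3 = L * K1 + K2"
  have K3: "K3 > 0" using L K1 K2 by (simp add: K3_def add_pos_pos)
  have w3: "\<bar>w s x\<bar> \<le> K3 * x2 s powr (1 / 4)" if s: "s \<le> T" for s x
  proof -
    have "\<bar>w s x\<bar> \<le> L * \<bar>nn s x\<bar> + \<bar>wr s x\<bar>"
      unfolding w_split[OF T(1)[OF s]] using abs_triangle_ineq[of "(1 - (of_int l)\<^sup>2) * nn s x" "wr s x"] L
      by (simp add: abs_mult L_def abs_minus_commute[of 1])
    also have "\<dots> \<le> L * (K1 * x2 s powr (1 / 4)) + K2 * x2 s powr (1 / 4)"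
    proof (rule add_mono)
      show "L * \<bar>nn s x\<bar> \<le> L * (K1 * x2 s powr (1 / 4))" using nb[OF s] L by (intro mult_left_mono) auto
      show "\<bar>wr s x\<bar> \<le> K2 * x2 s powr (1 / 4)"
        by (rule order_trans[OF wb[OF s] mult_left_mono[OF pm[OF s]]]) (use K2 in auto)
    qed
    finally show ?thesis by (simp add: K3_def algebra_simps)
  qed
  \<comment> \<open>\<open>E\<close> without the contribution of nn^2, see \<open>Eg\<close>. What
    is left is at worst of order w^3 or wr nn, that is x2^(3/4) or x2^(3/8 + 1/4).\<close>
  define g where "g s x = E s x + \<beta> * (w s x)\<^sup>2 - \<beta> * (wr s x * (2 * (1 - (of_int l)\<^sup>2) * nn s x + wr s x))" for s x
  define K4 where "K4 = CE * K3 ^ 3 + \<beta> * (K2 * (2 * L * K1 + K2))"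
  have K4: "K4 > 0" using CE K3 K2 K1 L \<beta> by (simp add: K4_def add_pos_pos)
  have gb: "\<bar>g s x\<bar> \<le> K4 * x2 s powr (5 / 8)" if s: "s \<le> T" for s x
  proof -
    have "CE * \<bar>w s x\<bar> ^ 3 \<le> CE * (K3 * x2 s powr (1 / 4)) ^ 3"
      using w3[OF s] CE by (intro mult_left_mono power_mono) auto
    also have "\<dots> = CE * K3 ^ 3 * x2 s powr (3 / 4)"
      by (cases "x2 s = 0") (auto simp: power_mult_distrib powr_power)
    also have "\<dots> \<le> CE * K3 ^ 3 * x2 s powr (5 / 8)" using pm[OF s] CE K3 by (intro mult_left_mono) auto
    finally have 1: "\<bar>E s x + \<beta> * (w s x)\<^sup>2\<bar> \<le> CE * K3 ^ 3 * x2 s powr (5 / 8)"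
      using CE(2)[OF T(1)[OF s], of x] unfolding \<beta>_def by linarith
    have "\<bar>2 * (1 - (of_int l)\<^sup>2) * nn s x + wr s x\<bar> \<le> 2 * L * \<bar>nn s x\<bar> + \<bar>wr s x\<bar>"
      using abs_triangle_ineq[of "2 * (1 - (of_int l)\<^sup>2) * nn s x" "wr s x"] L
      by (simp add: abs_mult L_def abs_minus_commute[of 1])
    also have "\<dots> \<le> 2 * L * (K1 * x2 s powr (1 / 4)) + K2 * x2 s powr (1 / 4)"
    proof (rule add_mono)
      show "2 * L * \<bar>nn s x\<bar> \<le> 2 * L * (K1 * x2 s powr (1 / 4))" using nb[OF s] L by (intro mult_left_mono) auto
      show "\<bar>wr s x\<bar> \<le> K2 * x2 s powr (1 / 4)"
        by (rule order_trans[OF wb[OF s] mult_left_mono[OF pm[OF s]]]) (use K2 in auto)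
    qed
    also have "\<dots> = (2 * L * K1 + K2) * x2 s powr (1 / 4)" by (simp add: algebra_simps)
    finally have "\<bar>wr s x * (2 * (1 - (of_int l)\<^sup>2) * nn s x + wr s x)\<bar> \<le> (K2 * x2 s powr (3 / 8)) * ((2 * L * K1 + K2) * x2 s powr (1 / 4))"
      unfolding abs_mult[of "wr s x"] using wb[OF s, of x] K2 by (intro mult_mono) auto
    also have "\<dots> = K2 * (2 * L * K1 + K2) * (x2 s powr (3 / 8) * x2 s powr (1 / 4))" by simp
    also have "x2 s powr (3 / 8) * x2 s powr (1 / 4) = x2 s powr (5 / 8)" by (simp flip: powr_add)
    finally have "\<beta> * \<bar>wr s x * (2 * (1 - (of_int l)\<^sup>2) * nn s x + wr s x)\<bar> \<le> \<beta> * (K2 * (2 * L * K1 + K2) * x2 s powr (5 / 8))"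
      using \<beta> by (intro mult_left_mono) auto
    then have 2: "\<bar>\<beta> * (wr s x * (2 * (1 - (of_int l)\<^sup>2) * nn s x + wr s x))\<bar> \<le> \<beta> * (K2 * (2 * L * K1 + K2)) * x2 s powr (5 / 8)"
      using \<beta> by (simp add: abs_mult[of \<beta>] mult.assoc)
    show ?thesis unfolding g_def K4_def distrib_right using 1 2 abs_triangle_ineq4 by (smt (verit))
  qed
  have cg: "cont (g s)" if s: "s \<le> T" for s
    unfolding g_def[abs_def] using cont_E cont_w cont_wr cont_nn T(1)[OF s]
    by (intro continuous_on_diff continuous_on_add continuous_on_mult continuous_on_const continuous_on_power) auto
  have Eg: "E s = (\<lambda>x. g s x - (\<beta> * L\<^sup>2) * (nn s x)\<^sup>2)" if s: "s \<le> T" for s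
  proof
    fix x
    have wsq: "(w s x)\<^sup>2 = L\<^sup>2 * (nn s x)\<^sup>2 + wr s x * (2 * (1 - (of_int l)\<^sup>2) * nn s x + wr s x)"
      unfolding w_split[OF T(1)[OF s]] L_def by (simp add: power2_eq_square algebra_simps)
    show "E s x = g s x - (\<beta> * L\<^sup>2) * (nn s x)\<^sup>2" unfolding g_def wsq by (simp add: algebra_simps)
  qed
  define K5 where "K5 = 3 * K4"
  have K5: "K5 > 0" using K4 by (simp add: K5_def)
  have fg: "\<bar>fc (g s) k\<bar> \<le> K5 * x2 s powr (5 / 8)" if s: "s \<le> T" for s k
    using fc_le_nrm[OF cg[OF s], of k] nrm_bound[OF cg[OF s] gb[OF s]] by (simp add: K5_def)
  have fE: "fc (E s) k = fc (g s) k - (\<beta> * L\<^sup>2) * fc (\<lambda>x. (nn s x)\<^sup>2) k" if s: "s \<le> T" for s k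
    unfolding Eg[OF s] using cg[OF s] cont_nn by (simp add: fc_diff fc_cmult continuous_on_mult continuous_on_power)
  have E1: "\<bar>fc (E s) k\<bar> \<le> K5 * x2 s powr (5 / 8)" if "s \<le> T" "\<bar>k\<bar> \<le> l" "k \<noteq> 0" for s k
    using fg[OF that(1), of k] fc_nn_sq[OF that(2), of s] that(3) unfolding fE[OF that(1)] by simp
  define K6 where "K6 = \<beta> * L\<^sup>2 * sqrt C"
  have K6: "K6 > 0" using \<beta> L ts(2) by (simp add: K6_def)
  have E0: "\<bar>fc (E s) 0\<bar> \<le> K6 * sqrt (xp s) + K5 * x2 s powr (5 / 8)" if s: "s \<le> T" for s
  proof -
    have y: "0 \<le> y2 s" by (simp add: y2_def)
    have "1 \<le> sqrt (2 * pi)" using pi_gt3 by simp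
    then have "y2 s / sqrt (2 * pi) \<le> y2 s / 1" using y by (intro divide_left_mono) auto
    then have "(\<beta> * L\<^sup>2) * (y2 s / sqrt (2 * pi)) \<le> (\<beta> * L\<^sup>2) * (sqrt C * sqrt (xp s))"
      using y2b[OF s] \<beta> by (intro mult_left_mono) auto
    moreover have "0 \<le> (\<beta> * L\<^sup>2) * (y2 s / sqrt (2 * pi))" using \<beta> y by simp
    moreover have "fc (E s) 0 = fc (g s) 0 - (\<beta> * L\<^sup>2) * (y2 s / sqrt (2 * pi))"
      using fE[OF s, of 0] fc_nn_sq[of 0 s] l3 by simp
    ultimately show ?thesis using fg[OF s, of 0] unfolding K6_def by (auto simp: abs_le_iff)
  qed
  \<comment> \<open>The forcing K6 sqrt (xp) of the mean produces, by Young's inequality, the term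
    K6^2 / (1 + \<alpha>) xp; the weight a on \<open>xp\<close> is large enough for a \<mu> xp to
    cover it.\<close>
  define a where "a = 1 + K6\<^sup>2 / ((1 + \<alpha>) * \<mu>)"
  have "a * \<mu> = \<mu> + K6\<^sup>2 / (1 + \<alpha>)"
    unfolding a_def distrib_right[of 1 "K6\<^sup>2 / ((1 + \<alpha>) * \<mu>)"]
    using mu_pos nonzero_mult_divide_mult_cancel_right[of \<mu> "K6\<^sup>2" "1 + \<alpha>"] by simp
  then have a: "1 \<le> a" "K6\<^sup>2 / (1 + \<alpha>) \<le> a * \<mu>" using apos mu_pos by (simp_all add: a_def)
  define D2 where "D2 s = a * xp s + (fc (v s) 0)\<^sup>2" for s
  define D2' where "D2' s = a * (\<Sum>k\<in>PP. 2 * fc (v s) k * (- lam \<alpha> k * fc (v s) k + fc (E s) k)) + 2 * fc (v s) 0 * (- lam \<alpha> 0 * fc (v s) 0 + fc (E s) 0)" for s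
  define K8 where "K8 = a * (2 * of_nat (card PP) * K5) + 2 * K5"
  have K8: "K8 > 0" unfolding K8_def using K5 a by (intro add_nonneg_pos) auto
  have xD: "x2 s \<le> D2 s" "D2 s \<le> a * x2 s" for s
  proof -
    have "1 * xp s \<le> a * xp s" using a(1) xp_nonneg[of s] by (rule mult_right_mono)
    then show "x2 s \<le> D2 s" by (simp add: x2_eq D2_def)
    have "1 * (fc (v s) 0)\<^sup>2 \<le> a * (fc (v s) 0)\<^sup>2" using a(1) by (rule mult_right_mono) simp
    then show "D2 s \<le> a * x2 s" by (simp add: x2_eq D2_def distrib_left)
  qed
  have dD: "(D2 has_real_derivative D2' s) (at s)" if "s < \<tau>0" for s
    unfolding D2_def[abs_def] D2'_def xp_def power2_eq_square
    by (rule DERIV_cong[OF DERIV_add[OF DERIV_cmult[OF DERIV_sum[OF DERIV_mult[OF fc_has_derivative fc_has_derivative]]]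
            DERIV_mult[OF fc_has_derivative fc_has_derivative]]])
      (use that in \<open>auto simp: algebra_simps intro!: sum.cong\<close>)
  \<comment> \<open>The error power 9 / 8 = 1 / 2 + 5 / 8 exceeds 1, so for small \<open>x2\<close>
    half of the rate \<mu> survives.\<close>
  have low: "\<mu> * D2 s - K8 * x2 s powr (9 / 8) \<le> D2' s" if s: "s \<le> T" for s
  proof -
    let ?X = "sqrt (x2 s)" and ?c0 = "fc (v s) 0"
    have X98: "?X * x2 s powr (5 / 8) = x2 s powr (9 / 8)"
      using x2_nonneg[of s] by (simp add: powr_half_sqrt[symmetric] flip: powr_add)
    have c: "\<bar>fc (v s) k\<bar> \<le> ?X" if "k \<in> P" for k using abs_fc_P[OF that] .
    have "2 * \<mu> * xp s - 2 * of_nat (card PP) * K5 * x2 s powr (9 / 8) = (\<Sum>k\<in>PP. 2 * \<mu> * (fc (v s) k)\<^sup>2 - 2 * (?X * (K5 * x2 s powr (5 / 8))))"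
      unfolding xp_def sum_subtractf sum_distrib_left[symmetric] X98[symmetric] by simp
    also have "\<dots> \<le> (\<Sum>k\<in>PP. 2 * fc (v s) k * (- lam \<alpha> k * fc (v s) k + fc (E s) k))"
    proof (rule sum_mono)
      fix k assume k: "k \<in> PP"
      then have kP: "k \<in> P" and kl: "\<bar>k\<bar> \<le> l" "k \<noteq> 0" by (auto simp: P_eq(1) PP_def)
      have "\<mu> * (fc (v s) k)\<^sup>2 \<le> - lam \<alpha> k * (fc (v s) k)\<^sup>2" using mu_le[OF kP] by (rule mult_right_mono) simp
      moreover have "\<bar>fc (v s) k * fc (E s) k\<bar> \<le> ?X * (K5 * x2 s powr (5 / 8))"
        unfolding abs_mult using c[OF kP] E1[OF s kl] x2_nonneg by (intro mult_mono) auto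
      moreover have "2 * fc (v s) k * (- lam \<alpha> k * fc (v s) k + fc (E s) k) = 2 * (- lam \<alpha> k * (fc (v s) k)\<^sup>2) + 2 * (fc (v s) k * fc (E s) k)"
        by (simp add: power2_eq_square algebra_simps)
      ultimately show "2 * \<mu> * (fc (v s) k)\<^sup>2 - 2 * (?X * (K5 * x2 s powr (5 / 8))) \<le> 2 * fc (v s) k * (- lam \<alpha> k * fc (v s) k + fc (E s) k)"
        by (auto simp: abs_le_iff)
    qed
    finally have "a * (2 * \<mu> * xp s - 2 * of_nat (card PP) * K5 * x2 s powr (9 / 8)) \<le> a * (\<Sum>k\<in>PP. 2 * fc (v s) k * (- lam \<alpha> k * fc (v s) k + fc (E s) k))"
      using a(1) by (intro mult_left_mono) auto
    moreover have "2 * ?c0 * (- lam \<alpha> 0 * ?c0 + fc (E s) 0) \<ge> (1 + \<alpha>) * ?c0\<^sup>2 - K6\<^sup>2 / (1 + \<alpha>) * xp s - 2 * K5 * x2 s powr (9 / 8)"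
    proof -
      have "\<bar>?c0 * fc (E s) 0\<bar> \<le> \<bar>?c0\<bar> * (K6 * sqrt (xp s)) + \<bar>?c0\<bar> * (K5 * x2 s powr (5 / 8))"
        unfolding abs_mult distrib_left[symmetric] using E0[OF s] by (intro mult_left_mono) auto
      moreover have "\<bar>?c0\<bar> * (K5 * x2 s powr (5 / 8)) \<le> ?X * (K5 * x2 s powr (5 / 8))"
        using c[OF zero_in_P] K5 by (intro mult_right_mono) auto
      moreover have "?X * (K5 * x2 s powr (5 / 8)) = K5 * x2 s powr (9 / 8)" unfolding X98[symmetric] by simp
      moreover have "2 * (\<bar>?c0\<bar> * (K6 * sqrt (xp s))) \<le> (1 + \<alpha>) * ?c0\<^sup>2 + K6\<^sup>2 / (1 + \<alpha>) * xp s"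
      proof -
        have s1: "sqrt (1 + \<alpha>) > 0" using apos by simp
        have "0 \<le> (sqrt (1 + \<alpha>) * \<bar>?c0\<bar> - K6 / sqrt (1 + \<alpha>) * sqrt (xp s))\<^sup>2" by simp
        also have "\<dots> = (1 + \<alpha>) * ?c0\<^sup>2 - 2 * (\<bar>?c0\<bar> * (K6 * sqrt (xp s))) + K6\<^sup>2 / (1 + \<alpha>) * xp s"
          using apos xp_nonneg[of s] s1 by (simp add: power2_diff power_mult_distrib power_divide)
        finally show ?thesis by simp
      qed
      moreover have "2 * ?c0 * (- lam \<alpha> 0 * ?c0 + fc (E s) 0) = 2 * ((1 + \<alpha>) * ?c0\<^sup>2) + 2 * (?c0 * fc (E s) 0)"
        by (simp add: lam_0 power2_eq_square algebra_simps)
      ultimately show ?thesis by (auto simp: abs_le_iff)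
    qed
    moreover have "K6\<^sup>2 / (1 + \<alpha>) * xp s \<le> a * \<mu> * xp s" using a(2) xp_nonneg by (rule mult_right_mono)
    moreover have "\<mu> * ?c0\<^sup>2 \<le> (1 + \<alpha>) * ?c0\<^sup>2" using mu_le[OF zero_in_P] by (intro mult_right_mono) (auto simp: lam_0)
    ultimately show ?thesis unfolding D2'_def D2_def K8_def by (simp add: algebra_simps)
  qed
  have "\<forall>\<^sub>F s in at_bot. x2 s < (\<mu> / (2 * K8)) ^ 8"
    using order_tendstoD(2)[OF x2_lim] mu_pos K8 by simp
  then obtain t2 where t2: "\<And>s. s \<le> t2 \<Longrightarrow> x2 s < (\<mu> / (2 * K8)) ^ 8" by (auto simp: eventually_at_bot_linorder)
  define b where "b = min T t2"
  have b: "s \<le> T" "s < \<tau>0" "s \<le> t2" if "s < b" for s using that T(2)[of s] by (auto simp: b_def)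
  have low2: "\<mu> / 2 * D2 s \<le> D2' s" if s: "s < b" for s
  proof -
    have "x2 s powr (1 / 8) \<le> ((\<mu> / (2 * K8)) ^ 8) powr (1 / 8)"
      using t2[OF b(3)[OF s]] x2_nonneg by (intro powr_mono2) auto
    also have "\<dots> = \<mu> / (2 * K8)"
      using mu_pos K8 powr_powr[of "\<mu> / (2 * K8)" 8 "1 / 8"] by (simp add: powr_numeral)
    finally have k: "K8 * x2 s powr (1 / 8) \<le> \<mu> / 2" using K8 by (simp add: field_simps)
    have "K8 * x2 s powr (9 / 8) = K8 * x2 s powr (1 / 8) * x2 s"
      using x2_nonneg[of s] powr_add[of "x2 s" "1 / 8" 1] by (cases "x2 s = 0") auto
    also have "\<dots> \<le> \<mu> / 2 * D2 s" using k xD(1)[of s] x2_nonneg mu_pos by (intro mult_mono) auto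
    finally show ?thesis using low[OF b(1)[OF s]] by simp
  qed
  have gr: "D2 s \<le> D2 t * exp (\<mu> / 2 * (s - t))" if "s \<le> t" "t < b" for s t
    by (rule growth[where y' = D2' and b = b]) (use dD b low2 that in auto)
  have D2n: "0 \<le> D2 s" for s using xD(1)[of s] x2_nonneg[of s] by linarith
  define K9 where "K9 = K5 * a powr (5 / 8) / (5 / 16 * \<mu>)"
  have K9: "K9 > 0" using K5 a mu_pos by (simp add: K9_def)
  \<comment> \<open>The linear rate of a neutral mode is 0, so the bound rests on the exponential
    growth of the forcing bound: D2^(5/8) grows at rate 5 / 8 * \<mu> / 2 = 5 / 16 \<mu>.\<close>
  have yb: "\<bar>fc (v t) k\<bar> \<le> K9 * sqrt (x2 t)" if t: "t < b" and k: "k = l \<or> k = - l" for t k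
  proof -
    have lk: "lam \<alpha> k = 0" "\<bar>k\<bar> \<le> l" "k \<noteq> 0" using k lam_l l3 by auto
    have "\<bar>fc (v t) k\<bar> \<le> K5 * D2 t powr (5 / 8) / (0 + 5 / 16 * \<mu>)"
    proof (rule ode_decay[where c = "\<lambda>s. fc (v s) k" and f = "\<lambda>s. fc (E s) k" and b = b])
      show "((\<lambda>s. fc (v s) k) has_real_derivative - 0 * fc (v s) k + fc (E s) k) (at s)" if "s < b" for s
        using fc_has_derivative[OF b(2)[OF that], of k] by (simp add: lk)
      fix s assume s: "s \<le> t"
      have "\<bar>fc (E s) k\<bar> \<le> K5 * x2 s powr (5 / 8)" using E1[OF b(1) lk(2,3), of s] s t by simp
      also have "\<dots> \<le> K5 * (D2 t * exp (\<mu> / 2 * (s - t))) powr (5 / 8)"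
        using K5 order_trans[OF xD(1) gr[OF s t]] x2_nonneg by (intro mult_left_mono powr_mono2) auto
      also have "\<dots> = K5 * D2 t powr (5 / 8) * exp (5 / 16 * \<mu> * (s - t))"
        using D2n by (simp add: powr_mult powr_def[of "exp _"])
      finally show "\<bar>fc (E s) k\<bar> \<le> K5 * D2 t powr (5 / 8) * exp (5 / 16 * \<mu> * (s - t))" .
    qed (use fc_lim mu_pos t in auto)
    also have "\<dots> \<le> K5 * (a powr (5 / 8) * sqrt (x2 t)) / (0 + 5 / 16 * \<mu>)"
    proof -
      have "D2 t powr (5 / 8) \<le> (a * x2 t) powr (5 / 8)" using xD(2) D2n by (intro powr_mono2) auto
      also have "\<dots> = a powr (5 / 8) * x2 t powr (5 / 8)" using a x2_nonneg by (simp add: powr_mult)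
      also have "\<dots> \<le> a powr (5 / 8) * sqrt (x2 t)"
        using pm[OF b(1)[OF t], of "1 / 2" "5 / 8"] x2_nonneg[of t] by (intro mult_left_mono) (auto simp: powr_half_sqrt)
      finally show ?thesis using K5 mu_pos by (intro divide_right_mono mult_left_mono) auto
    qed
    finally show ?thesis by (simp add: K9_def)
  qed
  show ?thesis
  proof (rule that[of "sqrt (1 + 2 * K9\<^sup>2 + C)" "b - 1"])
    show "sqrt (1 + 2 * K9\<^sup>2 + C) > 0" using ts(2) by (simp add: add_pos_nonneg add_nonneg_pos)
    show "b - 1 < \<tau>0" using T(2)[of T] by (auto simp: b_def)
    fix \<tau> assume "\<tau> \<le> b - 1"
    then have t: "\<tau> < b" by simp
    have y: "(fc (v \<tau>) k)\<^sup>2 \<le> K9\<^sup>2 * x2 \<tau>" if "k = l \<or> k = - l" for k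
    proof -
      have "(fc (v \<tau>) k)\<^sup>2 \<le> (K9 * sqrt (x2 \<tau>))\<^sup>2" using yb[OF t that] by (metis abs_ge_zero power2_abs power_mono)
      then show ?thesis using x2_nonneg by (simp add: power_mult_distrib)
    qed
    have "ip (v \<tau>) (v \<tau>) = x2 \<tau> + y2 \<tau> + z2 \<tau>" by (simp add: z2_def x2_eq)
    also have "\<dots> \<le> (1 + 2 * K9\<^sup>2 + C) * x2 \<tau>"
      using y[of l] y[of "- l"] z2b[OF b(1)[OF t]] by (simp add: y2_def algebra_simps)
    finally show "nrm (v \<tau>) \<le> sqrt (1 + 2 * K9\<^sup>2 + C) * sqrt (x2 \<tau>)"
      unfolding nrm_def real_sqrt_mult[symmetric] by simp
  qed
qed

end

section \<open>Spectral projections\<close>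

lemma frechet_vector:
  fixes f :: "real \<Rightarrow> 'a::real_normed_vector"
  assumes "f differentiable (at x)"
  shows "(f has_vector_derivative frechet_derivative f (at x) 1) (at x)"
proof -
  have d: "(f has_derivative frechet_derivative f (at x)) (at x)" using assms frechet_derivative_works by blast
  then have "linear (frechet_derivative f (at x))" using has_derivative_linear by blast
  then have "frechet_derivative f (at x) = (\<lambda>h. h *\<^sub>R frechet_derivative f (at x) 1)"
    by (metis linear_scale real_scaleR_def mult.right_neutral)
  then show ?thesis using d unfolding has_vector_derivative_def by simp
qed

text \<open>On the line the direction 1 determines the Frechet derivative, which links
  \<open>Ck_on\<close> to \<open>nth_deriv\<close>.\<close>

lemma Ck_on_Suc_real:
  fixes f :: "real \<Rightarrow> 'a::real_normed_vector"
  assumes "Ck_on (Suc k) UNIV f"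
  shows "(f has_vector_derivative nth_deriv 1 f x) (at x)" "Ck_on k UNIV (nth_deriv 1 f)"
proof -
  have d: "(f has_vector_derivative frechet_derivative f (at x) 1) (at x)" for x
    using assms frechet_vector by auto
  have e: "nth_deriv 1 f = (\<lambda>x. frechet_derivative f (at x) 1)"
    using vector_derivative_at[OF d] by (simp add: nth_deriv_Suc_at[of 0, simplified] fun_eq_iff)
  show "(f has_vector_derivative nth_deriv 1 f x) (at x)" using d unfolding e .
  show "Ck_on k UNIV (nth_deriv 1 f)" unfolding e using assms by simp
qed

lemma Ck_on_CP: "Ck_on n UNIV f \<Longrightarrow> periodic_2pi f \<Longrightarrow> CP n f"
proof (induction n arbitrary: f)
  case 0 then show ?case by (simp add: CP_0I)
next
  case (Suc n)
  note d = Ck_on_Suc_real[OF Suc.prems(1)]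
  have d1: "(f has_real_derivative nth_deriv 1 f x) (at x)" for x
    using d(1) by (simp only: has_real_derivative_iff_has_vector_derivative)
  show ?case
    by (rule CP_SucI[OF Suc.prems(2) d1 Suc.IH[OF d(2) periodic_deriv[OF Suc.prems(2) d1]]])
qed

lemma smooth_eb: "smooth_on UNIV (eb k)"
proof -
  \<comment> \<open>The factor c is carried along because the derivative of a basis function is a
    multiple of its partner.\<close>
  have "Ck_on j UNIV (\<lambda>x. c * eb k x)" for j c k
  proof (induction j arbitrary: c k)
    case 0 then show ?case by (simp add: continuous_on_mult cont_eb)
  next
    case (Suc j)
    have d: "((\<lambda>x. c * eb k x) has_derivative (\<lambda>w. (w * - of_int k * c) * eb (- k) x)) (at x)" for x
      by (rule has_derivative_eq_rhs[OF DERIV_cmult[OF eb_deriv[of k x], of c, unfolded has_field_derivative_def]])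
        (simp add: fun_eq_iff mult_ac)
    have "Ck_on j UNIV (\<lambda>x. frechet_derivative (\<lambda>x. c * eb k x) (at x) w)" for w
      unfolding frechet_derivative_at[OF d, symmetric] by (rule Suc.IH)
    then show ?case using d by (auto simp: differentiable_def)
  qed
  from this[of _ 1] show ?thesis by (simp add: smooth_on_def)
qed

lemma eigenfunction_eb: "eigenfunction \<alpha> (lam \<alpha> k) (eb k)"
  unfolding eigenfunction_def
proof (intro conjI allI)
  show "\<exists>\<theta>. eb k \<theta> \<noteq> 0"
  proof (rule ccontr)
    assume "\<not> (\<exists>\<theta>. eb k \<theta> \<noteq> 0)"
    then have "eb k = (\<lambda>x. 0)" by auto
    then have "ip (eb k) (eb k) = 0" by (simp add: ip_def)
    then show False by (simp add: ip_eb_same)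
  qed
  show "lin_op \<alpha> (eb k) \<theta> + lam \<alpha> k * eb k \<theta> = 0" for \<theta>
    unfolding lin_op_def eb_2 by (simp add: lam_def algebra_simps)
qed (rule smooth_eb eb_periodic)+

lemma eigenfunction_CP: "eigenfunction \<alpha> \<mu> \<phi> \<Longrightarrow> CP n \<phi>"
  unfolding eigenfunction_def smooth_on_def using Ck_on_CP by blast

lemma eigenfunction_fc:
  assumes "eigenfunction \<alpha> \<mu> \<phi>" "fc \<phi> k \<noteq> 0" shows "lam \<alpha> k = \<mu>"
proof -
  have c: "cont \<phi>" "cont (nth_deriv 2 \<phi>)"
    using CP_cont[OF eigenfunction_CP[OF assms(1), of 0]] CP_contj[OF eigenfunction_CP[OF assms(1), of 2], of 2] by auto
  have "(\<lambda>x. \<alpha> * nth_deriv 2 \<phi> x + (\<alpha> + 1 + \<mu>) * \<phi> x) = (\<lambda>x. 0)"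
    using assms(1) unfolding eigenfunction_def lin_op_def by (auto simp: algebra_simps)
  then have "fc (\<lambda>x. \<alpha> * nth_deriv 2 \<phi> x + (\<alpha> + 1 + \<mu>) * \<phi> x) k = 0" by (simp add: fc_def ip_def)
  then have "\<alpha> * fc (nth_deriv 2 \<phi>) k + (\<alpha> + 1 + \<mu>) * fc \<phi> k = 0"
    using c by (simp add: fc_add fc_cmult continuous_on_mult)
  then have "(\<mu> - lam \<alpha> k) * fc \<phi> k = 0"
    unfolding fc_deriv2[OF eigenfunction_CP[OF assms(1)]] by (simp add: lam_def algebra_simps)
  then show ?thesis using assms(2) by simp
qed

text \<open>Parseval makes the L2 norms of f and f' vanish, and \<open>sobolev\<close> turns this
  into pointwise vanishing.\<close>

lemma fc_zero_imp_zero: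
  assumes "CP 1 f" "\<And>k. fc f k = 0" shows "f x = 0"
proof -
  have c: "cont f" "cont (nth_deriv 1 f)" using CP_cont[OF assms(1)] CP_contj[OF assms(1), of 1] by auto
  have "ip f f \<le> 0" using parseval_le[OF CP_periodic[OF assms(1)] c(1), of 0] assms(2) by simp
  moreover have "ip (nth_deriv 1 f) (nth_deriv 1 f) \<le> 0"
    by (rule nth_parseval_le[OF assms(1)]) (simp add: assms(2))
  moreover have "(f x)\<^sup>2 \<le> 2 * ip f f + ip (nth_deriv 1 f) (nth_deriv 1 f)"
    using sobolev[OF assms(1), of x] by (simp add: nrm_sq c del: One_nat_def)
  ultimately have "(f x)\<^sup>2 \<le> 0" by linarith
  then show ?thesis by simp
qed

lemma eigenvalue_iff: "eigenvalue \<alpha> \<mu> \<longleftrightarrow> (\<exists>k. \<mu> = lam \<alpha> k)"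
proof
  assume "eigenvalue \<alpha> \<mu>"
  then obtain \<phi> where \<phi>: "eigenfunction \<alpha> \<mu> \<phi>" by (auto simp: eigenvalue_def)
  then obtain x where "\<phi> x \<noteq> 0" by (auto simp: eigenfunction_def)
  then obtain k where "fc \<phi> k \<noteq> 0" using fc_zero_imp_zero[OF eigenfunction_CP[OF \<phi>]] by blast
  then show "\<exists>k. \<mu> = lam \<alpha> k" using eigenfunction_fc[OF \<phi>] by metis
qed (auto simp: eigenvalue_def intro: eigenfunction_eb)

section \<open>Lebesgue L2 on the circle and orthogonal projections\<close>

lemma cont_set_integrable: "cont (f :: real \<Rightarrow> real) \<Longrightarrow> set_integrable lborel {0..2 * pi} f"
  by (rule borel_integrable_atLeastAtMost') (rule continuous_on_subset, auto)

lemma cont_L2: "cont f \<Longrightarrow> f \<in> L2_circle"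
  using borel_measurable_integrable[OF cont_set_integrable[of f, unfolded set_integrable_def]]
  by (simp add: L2_circle_def set_borel_measurable_def cont_set_integrable continuous_on_power)

lemma L2_inner_ip: "cont f \<Longrightarrow> cont g \<Longrightarrow> L2_inner f g = ip f g"
  unfolding L2_inner_def ip_def
  by (rule set_borel_integral_eq_integral(2)[OF cont_set_integrable]) (rule continuous_on_mult)

lemma L2_norm_nrm: "cont f \<Longrightarrow> L2_norm f = nrm f"
  by (simp add: L2_norm_def nrm_def L2_inner_ip)

lemma L2_mult: 
  assumes "f \<in> L2_circle" "g \<in> L2_circle"
  shows "set_integrable lborel {0..2 * pi} (\<lambda>x. f x * g x)"
proof -
  have m: "set_borel_measurable lborel {0..2 * pi} f" "set_borel_measurable lborel {0..2 * pi} g"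
    and i: "set_integrable lborel {0..2 * pi} (\<lambda>x. (f x)\<^sup>2)" "set_integrable lborel {0..2 * pi} (\<lambda>x. (g x)\<^sup>2)"
    using assms by (auto simp: L2_circle_def)
  have s: "integrable lborel (\<lambda>x. indicator {0..2 * pi} x *\<^sub>R (f x)\<^sup>2 + indicator {0..2 * pi} x *\<^sub>R (g x)\<^sup>2)"
    using i unfolding set_integrable_def by (rule Bochner_Integration.integrable_add)
  have "(\<lambda>x. (indicator {0..2 * pi} x *\<^sub>R f x) * (indicator {0..2 * pi} x *\<^sub>R g x)) \<in> borel_measurable lborel"
    using m unfolding set_borel_measurable_def by (rule borel_measurable_times)
  then have fg: "(\<lambda>x. indicator {0..2 * pi} x *\<^sub>R (f x * g x)) \<in> borel_measurable lborel"
    by (rule back_subst[where P = "\<lambda>h. h \<in> borel_measurable lborel"]) (auto simp: fun_eq_iff indicator_def)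
  show ?thesis unfolding set_integrable_def
  proof (rule Bochner_Integration.integrable_bound[OF s fg], rule AE_I2)
    fix x
    have "\<bar>f x * g x\<bar> \<le> (f x)\<^sup>2 + (g x)\<^sup>2"
      using zero_le_power2[of "f x - g x"] zero_le_power2[of "f x + g x"] 
        zero_le_power2[of "f x"] zero_le_power2[of "g x"]
      unfolding power2_sum power2_diff abs_le_iff by linarith
    then show "norm (indicator {0..2 * pi} x *\<^sub>R (f x * g x)) \<le> norm (indicator {0..2 * pi} x *\<^sub>R (f x)\<^sup>2 + indicator {0..2 * pi} x *\<^sub>R (g x)\<^sup>2)"
      by (auto simp: indicator_def)
  qed
qed

lemma L2_inner_commute: "L2_inner f g = L2_inner g f"
  by (simp add: L2_inner_def mult.commute)

lemma L2_lin:
  assumes "f \<in> L2_circle" "g \<in> L2_circle" shows "(\<lambda>x. f x + c * g x) \<in> L2_circle"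
proof -
  have "set_borel_measurable lborel {0..2 * pi} (\<lambda>x. f x + c * g x)"
  proof -
    have "(\<lambda>x. indicator {0..2 * pi} x *\<^sub>R f x + c * (indicator {0..2 * pi} x *\<^sub>R g x)) \<in> borel_measurable lborel"
      using assms by (intro borel_measurable_add borel_measurable_times borel_measurable_const) (auto simp: L2_circle_def set_borel_measurable_def)
    then show ?thesis unfolding set_borel_measurable_def
      by (rule back_subst[where P = "\<lambda>h. h \<in> borel_measurable lborel"]) (auto simp: fun_eq_iff algebra_simps)
  qed
  moreover have "set_integrable lborel {0..2 * pi} (\<lambda>x. (f x)\<^sup>2 + (2 * c) * (f x * g x) + c\<^sup>2 * (g x)\<^sup>2)"
    using assms L2_mult[OF assms] by (intro set_integral_add set_integrable_mult_right) (auto simp: L2_circle_def)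
  then have "set_integrable lborel {0..2 * pi} (\<lambda>x. (f x + c * g x)\<^sup>2)"
    by (rule back_subst[where P = "set_integrable lborel {0..2 * pi}"]) (auto simp: fun_eq_iff power2_eq_square algebra_simps)
  ultimately show ?thesis by (simp add: L2_circle_def)
qed

lemma L2_inner_lin:
  assumes "f \<in> L2_circle" "g \<in> L2_circle" "h \<in> L2_circle"
  shows "L2_inner (\<lambda>x. f x + c * g x) h = L2_inner f h + c * L2_inner g h"
proof -
  have "L2_inner (\<lambda>x. f x + c * g x) h = (LINT x:{0..2 * pi}|lborel. f x * h x + c * (g x * h x))"
    unfolding L2_inner_def by (simp add: algebra_simps)
  also have "\<dots> = L2_inner f h + c * L2_inner g h"
    unfolding L2_inner_def using L2_mult assms by (subst set_integral_add) (auto intro: set_integrable_mult_right)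
  finally show ?thesis .
qed

lemma L2_diff: "f \<in> L2_circle \<Longrightarrow> g \<in> L2_circle \<Longrightarrow> (\<lambda>x. f x - g x) \<in> L2_circle"
  using L2_lin[of f g "-1"] by simp

lemma L2_inner_diff: "f \<in> L2_circle \<Longrightarrow> g \<in> L2_circle \<Longrightarrow> h \<in> L2_circle \<Longrightarrow>
   L2_inner (\<lambda>x. f x - g x) h = L2_inner f h - L2_inner g h"
  using L2_inner_lin[of f g h "-1"] by simp

lemma L2_inner_nonneg: "0 \<le> L2_inner f f"
  unfolding L2_inner_def set_lebesgue_integral_def by (intro Bochner_Integration.integral_nonneg) (auto simp: indicator_def)

text \<open>A counterpart of \<open>ip_cauchy\<close> for elements of a closed span, which may be
  discontinuous.\<close>

lemma L2_cauchy:
  assumes f: "f \<in> L2_circle" and g: "g \<in> L2_circle"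
  shows "\<bar>L2_inner f g\<bar> \<le> L2_norm f * L2_norm g"
proof -
  let ?F = "L2_inner f f" and ?G = "L2_inner g g" and ?I = "L2_inner f g"
  have q: "0 \<le> ?F + 2 * c * ?I + c\<^sup>2 * ?G" for c
  proof -
    have "L2_inner (\<lambda>x. f x + c * g x) (\<lambda>x. f x + c * g x) = L2_inner f (\<lambda>x. f x + c * g x) + c * L2_inner g (\<lambda>x. f x + c * g x)"
      by (rule L2_inner_lin[OF f g L2_lin[OF f g]])
    also have "\<dots> = ?F + 2 * c * ?I + c\<^sup>2 * ?G"
      using L2_inner_lin[OF f g f, of c] L2_inner_lin[OF f g g, of c]
      by (simp add: L2_inner_commute[of _ "\<lambda>x. f x + c * g x"] L2_inner_commute[of g f] power2_eq_square algebra_simps)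
    finally show ?thesis using L2_inner_nonneg by metis
  qed
  have "?I\<^sup>2 \<le> ?F * ?G"
  proof (cases "?G = 0")
    case True
    have "?I = 0"
    proof (rule ccontr)
      assume a: "?I \<noteq> 0"
      show False using q[of "- (?F + 1) / (2 * ?I)"] a True by (simp add: field_simps)
    qed
    then show ?thesis using True by simp
  next
    case False
    then have p: "?G > 0" using L2_inner_nonneg[of g] by simp
    have "0 \<le> (?F + 2 * (- ?I / ?G) * ?I + (- ?I / ?G)\<^sup>2 * ?G) * ?G"
      using q[of "- ?I / ?G"] p by (intro mult_nonneg_nonneg) auto
    also have "\<dots> = ?F * ?G - ?I\<^sup>2" using False by (simp add: field_simps power2_eq_square)
    finally show ?thesis by simp
  qed
  then show ?thesis unfolding L2_norm_def by (metis real_sqrt_abs real_sqrt_le_mono real_sqrt_mult)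
qed

text \<open>\<open>L2_proj\<close> chooses some function with the projection property. Testing both
  orthogonality conditions against both candidates makes all pairings equal, so an explicit
  candidate has the norm of the chosen one.\<close>

lemma L2_norm_proj:
  assumes f: "f \<in> L2_circle" and g: "g \<in> L2_closed_span E" "\<And>h. h \<in> L2_closed_span E \<Longrightarrow> L2_inner (\<lambda>x. f x - g x) h = 0"
  shows "L2_norm (L2_proj E f) = L2_norm g"
proof -
  define k where "k = L2_proj E f"
  have k: "k \<in> L2_closed_span E" "\<And>h. h \<in> L2_closed_span E \<Longrightarrow> L2_inner (\<lambda>x. f x - k x) h = 0"
    using someI[of "\<lambda>g. g \<in> L2_closed_span E \<and> (\<forall>h\<in>L2_closed_span E. L2_inner (\<lambda>\<theta>. f \<theta> - g \<theta>) h = 0)" g] g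
    unfolding k_def L2_proj_def by auto
  have L: "g \<in> L2_circle" "k \<in> L2_circle" using g(1) k(1) by (auto simp: L2_closed_span_def)
  have "L2_inner f g = L2_inner k g" "L2_inner f k = L2_inner k k" "L2_inner f g = L2_inner g g" "L2_inner f k = L2_inner g k"
    using k(2)[OF g(1)] k(2)[OF k(1)] g(2)[OF g(1)] g(2)[OF k(1)] L2_inner_diff[OF f L(2)] L2_inner_diff[OF f L(1)] L by auto
  then show ?thesis unfolding k_def[symmetric] L2_norm_def using L2_inner_commute[of g k] by simp
qed

lemma inj_eb: "inj eb"
proof (rule injI)
  fix j k assume "eb j = eb k"
  then have "ip (eb j) (eb k) = 1" by (simp add: ip_eb_same)
  then show "j = k" by (simp add: ip_eb split: if_splits)
qed

lemma ip_zero_of_fc: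
  assumes "periodic_2pi \<phi>" "cont \<phi>" "cont F" "\<And>k. fc F k * fc \<phi> k = 0"
  shows "ip F \<phi> = 0"
proof (rule ccontr)
  assume a: "ip F \<phi> \<noteq> 0"
  define e where "e = \<bar>ip F \<phi>\<bar> / (nrm F + 1)"
  have nF: "0 \<le> nrm F" using nrm_nonneg[OF assms(3)] .
  have e: "e > 0" using a nF by (simp add: e_def)
  obtain N where N: "\<And>n. n \<ge> N \<Longrightarrow> nrm (\<lambda>x. \<phi> x - four {-n..n} \<phi> x) < e" using four_complete[OF assms(1,2) e] by blast
  let ?S = "four {-N..N} \<phi>"
  have cS: "cont ?S" by (rule cont_four) simp
  have "ip F ?S = (\<Sum>k\<in>{-N..N}. fc \<phi> k * fc F k)" using ip_four[of "{-N..N}" F \<phi>] assms(3) by (simp add: ip_commute)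
  also have "\<dots> = 0" using assms(4) by (intro sum.neutral) (auto simp: mult.commute)
  finally have "ip F \<phi> = ip F (\<lambda>x. \<phi> x - ?S x)" using ip_diff2[OF assms(2) cS assms(3)] by simp
  then have "\<bar>ip F \<phi>\<bar> \<le> nrm F * nrm (\<lambda>x. \<phi> x - ?S x)"
    using ip_le_nrm[OF assms(3), of "\<lambda>x. \<phi> x - ?S x"] assms(2) cS by (simp add: continuous_on_diff)
  also have "\<dots> \<le> nrm F * e" using N[of N] nF by (intro mult_left_mono) auto
  also have "\<dots> < (nrm F + 1) * e" using e by simp
  also have "\<dots> = \<bar>ip F \<phi>\<bar>" using nF by (simp add: e_def)
  finally show False by simp
qed

text \<open>The continuous function g with the selected Fourier coefficients is an explicit
  candidate: its partial sums lie in the span, and f - g is orthogonal to the selected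
  eigenfunctions because their Fourier supports are disjoint. The predicate Q covers the three signs
  of the eigenvalue at once.\<close>

lemma L2_norm_spectral_proj:
  fixes Q :: "real \<Rightarrow> bool"
  assumes f: "cont f" and g: "periodic_2pi g" "cont g" "\<And>k. fc g k = (if Q (lam \<alpha> k) then fc f k else 0)"
  shows "L2_norm (L2_proj {\<phi>. \<exists>\<mu>. Q \<mu> \<and> eigenfunction \<alpha> \<mu> \<phi>} f) = nrm g"
proof -
  let ?E = "{\<phi>. \<exists>\<mu>. Q \<mu> \<and> eigenfunction \<alpha> \<mu> \<phi>}"
  let ?F = "\<lambda>x. f x - g x"
  have cF: "cont ?F" using f g(2) by (rule continuous_on_diff)
  have FL: "?F \<in> L2_circle" by (rule cont_L2[OF cF])
  have gS: "g \<in> L2_closed_span ?E"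
    unfolding L2_closed_span_def
  proof (intro CollectI conjI allI impI cont_L2[OF g(2)])
    fix e :: real assume "e > 0"
    then obtain N where N: "\<And>n. n \<ge> N \<Longrightarrow> nrm (\<lambda>x. g x - four {-n..n} g x) < e" using four_complete[OF g(1,2)] by blast
    let ?K = "{k\<in>{-N..N}. Q (lam \<alpha> k)}"
    have "four {-N..N} g = (\<lambda>x. \<Sum>k\<in>?K. fc g k * eb k x)"
      unfolding four_def by (rule ext, rule sum.mono_neutral_right) (auto simp: g(3))
    also have "\<dots> = (\<lambda>x. \<Sum>\<phi>\<in>eb ` ?K. ip g \<phi> * \<phi> x)"
      by (rule ext, subst sum.reindex) (auto simp: fc_def intro: inj_on_subset[OF inj_eb])
    finally have "four {-N..N} g \<in> fun_span ?E"
    proof -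
      assume e: "four {-N..N} g = (\<lambda>x. \<Sum>\<phi>\<in>eb ` ?K. ip g \<phi> * \<phi> x)"
      have "finite (eb ` ?K)" by (intro finite_imageI finite_subset[of ?K "{-N..N}"]) auto
      moreover have "eb ` ?K \<subseteq> ?E" using eigenfunction_eb by blast
      ultimately show ?thesis unfolding fun_span_def e by blast
    qed
    moreover have "L2_norm (\<lambda>x. g x - four {-N..N} g x) < e"
      using N[of N] g(2) cont_four[of "{-N..N}" g] by (simp add: L2_norm_nrm continuous_on_diff)
    ultimately show "\<exists>h\<in>fun_span ?E. L2_norm (\<lambda>\<theta>. g \<theta> - h \<theta>) < e" by blast
  qed
  have span: "cont h \<and> ip ?F h = 0" if hE: "h \<in> fun_span ?E" for h
  proof -
    obtain H c where h: "h = (\<lambda>\<theta>. \<Sum>\<phi>\<in>H. c \<phi> * \<phi> \<theta>)" "finite H" "H \<subseteq> ?E" using hE unfolding fun_span_def by blast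
    have e: "cont \<phi> \<and> ip ?F \<phi> = 0" if \<phi>H: "\<phi> \<in> H" for \<phi>
    proof -
      obtain \<mu> where \<mu>: "Q \<mu>" "eigenfunction \<alpha> \<mu> \<phi>" using \<phi>H h(3) by blast
      have c: "cont \<phi>" "periodic_2pi \<phi>" using CP_cont[OF eigenfunction_CP[OF \<mu>(2), of 0]] CP_periodic[OF eigenfunction_CP[OF \<mu>(2), of 0]] by auto
      have "fc ?F k * fc \<phi> k = 0" for k
        using eigenfunction_fc[OF \<mu>(2), of k] \<mu>(1) fc_diff[OF f g(2), of k] g(3)[of k] by (cases "fc \<phi> k = 0") auto
      then show ?thesis using ip_zero_of_fc[OF c(2,1) cF] c by blast
    qed
    have "cont h" unfolding h(1) using e by (intro continuous_on_sum continuous_on_mult continuous_on_const) auto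
    moreover have "ip ?F h = 0"
      unfolding h(1) using e h(2) cF by (subst ip_sum2) (auto simp: ip_cmult2 continuous_on_mult)
    ultimately show ?thesis by blast
  qed
  \<comment> \<open>Orthogonality passes to the closure: replacing h by an element of the span
    within distance e changes the pairing by less than its supposedly nonzero value.\<close>
  have "L2_inner ?F h = 0" if h: "h \<in> L2_closed_span ?E" for h
  proof (rule ccontr)
    assume a: "L2_inner ?F h \<noteq> 0"
    have nF: "0 \<le> L2_norm ?F" by (simp add: L2_norm_def L2_inner_nonneg)
    define e where "e = \<bar>L2_inner ?F h\<bar> / (L2_norm ?F + 1)"
    have e: "e > 0" using a nF by (simp add: e_def)
    have hL: "h \<in> L2_circle" using h by (simp add: L2_closed_span_def)
    obtain k where k: "k \<in> fun_span ?E" "L2_norm (\<lambda>x. h x - k x) < e" using h e by (auto simp: L2_closed_span_def)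
    have kL: "k \<in> L2_circle" using cont_L2 span[OF k(1)] by blast
    have "L2_inner ?F k = 0" using span[OF k(1)] L2_inner_ip[OF cF] by metis
    then have "L2_inner ?F h = L2_inner ?F (\<lambda>x. h x - k x)"
      using L2_inner_diff[OF hL kL FL] by (simp add: L2_inner_commute[of ?F])
    then have "\<bar>L2_inner ?F h\<bar> \<le> L2_norm ?F * L2_norm (\<lambda>x. h x - k x)" using L2_cauchy[OF FL L2_diff[OF hL kL]] by simp
    also have "\<dots> \<le> L2_norm ?F * e" using k(2) nF by (intro mult_left_mono) auto
    also have "\<dots> < (L2_norm ?F + 1) * e" using e by simp
    also have "\<dots> = \<bar>L2_inner ?F h\<bar>" using nF by (simp add: e_def)
    finally show False by simp
  qed
  then have "L2_norm (L2_proj ?E f) = L2_norm g" by (rule L2_norm_proj[OF cont_L2[OF f] gS])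
  then show ?thesis by (simp add: L2_norm_nrm g(2))
qed

context pde begin

lemma lambda_I_eq: "lambda_I \<alpha> = - \<mu>"
  unfolding lambda_I_def
proof (rule Greatest_equality)
  have "\<mu> \<in> (\<lambda>k. - lam \<alpha> k) ` P" unfolding \<mu>_def using finite_P zero_in_P by (intro Min_in) auto
  then show "eigenvalue \<alpha> (- \<mu>) \<and> - \<mu> < 0" using mu_pos by (auto simp: eigenvalue_iff)
  show "y \<le> - \<mu>" if "eigenvalue \<alpha> y \<and> y < 0" for y
    using that mu_le by (fastforce simp: eigenvalue_iff P_def)
qed

lemma projections_and_decay_of_unstable_dominance:
  assumes C0: "C0 > 0" "\<tau>1 < \<tau>0" "\<And>\<tau>. \<tau> \<le> \<tau>1 \<Longrightarrow> nrm (v \<tau>) \<le> C0 * sqrt (x2 \<tau>)"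
  shows "\<exists>C>0. \<exists>t < -1. \<forall>\<tau>\<le>t.
           L2_norm (P_minus \<alpha> (v \<tau>)) + L2_norm (P_star \<alpha> (v \<tau>)) \<le> C * Ck_norm 4 (v \<tau>) * L2_norm (P_plus \<alpha> (v \<tau>)) \<and>
           Ck_norm 4 (v \<tau>) \<le> C * exp (- lambda_I \<alpha> * \<tau>)"
proof -
  obtain C \<tau>2 where C: "C > 0" "\<tau>2 < \<tau>0"
    "\<And>\<tau> j x. \<tau> \<le> \<tau>2 \<Longrightarrow> j \<le> 4 \<Longrightarrow> \<bar>nth_deriv j (v \<tau>) x\<bar> \<le> C * sqrt (x2 \<tau>)"
    "\<And>\<tau> k. \<tau> \<le> \<tau>2 \<Longrightarrow> k \<notin> P \<Longrightarrow> of_int \<bar>k\<bar> * \<bar>fc (v \<tau>) k\<bar> \<le> C * x2 \<tau>"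
    "\<And>\<tau>. \<tau> \<le> \<tau>2 \<Longrightarrow> sqrt (x2 \<tau>) \<le> C * exp (\<mu> * \<tau>)" using mode_bounds_of_unstable_dominance[OF C0] by blast
  define Z where "Z = {k. lam \<alpha> k = 0}"
  define U where "U = {k. lam \<alpha> k \<le> 0}"
  have fin: "finite Z" "finite U" using finite_lam[OF apos, of 0] by (auto simp: Z_def U_def intro: finite_subset[rotated])
  \<comment> \<open>12 = (2 + 2) * 3: each of the two projections is at most 2 C X^2, and X is at
    most 3 times the C^4 norm. 5 counts the orders of differentiation in
    \<open>Ck_norm 4\<close>.\<close>
  define K where "K = 12 * C + 5 * C\<^sup>2"
  have K: "K > 0" "12 * C \<le> K" "5 * C\<^sup>2 \<le> K" using C(1) by (auto simp: K_def add_pos_pos)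
  have main: "L2_norm (P_minus \<alpha> (v \<tau>)) + L2_norm (P_star \<alpha> (v \<tau>)) \<le> K * Ck_norm 4 (v \<tau>) * L2_norm (P_plus \<alpha> (v \<tau>)) \<and>
           Ck_norm 4 (v \<tau>) \<le> K * exp (- lambda_I \<alpha> * \<tau>)" if t: "\<tau> \<le> \<tau>2" for \<tau>
  proof -
    have t0: "\<tau> \<le> \<tau>0" using t C(2) by simp
    note cv = cont_v[OF t0]
    have decay: "(fc (v \<tau>) k)\<^sup>2 \<le> (C * x2 \<tau>)\<^sup>2 * (1 / (of_int k)\<^sup>2)" if "k \<notin> P" for k
    proof -
      have "k \<noteq> 0" using zero_in_P that by blast
      have "(of_int \<bar>k\<bar> * \<bar>fc (v \<tau>) k\<bar>)\<^sup>2 \<le> (C * x2 \<tau>)\<^sup>2" using C(4)[OF t that] by (intro power_mono) auto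
      then show ?thesis using \<open>k \<noteq> 0\<close> by (simp add: power_mult_distrib field_simps)
    qed
    \<comment> \<open>Coefficients of size C x2 / |k| have squares summing to at most 4 (C x2)^2,
      uniformly in the index set.\<close>
    have tail: "(\<Sum>k\<in>S. (fc (v \<tau>) k)\<^sup>2) \<le> (2 * (C * x2 \<tau>))\<^sup>2" if "S \<subseteq> {-n..n}" "S \<inter> P = {}" for S n
    proof -
      have "(\<Sum>k\<in>S. (fc (v \<tau>) k)\<^sup>2) \<le> (\<Sum>k\<in>S. (C * x2 \<tau>)\<^sup>2 * (1 / (of_int k)\<^sup>2))"
        using decay that(2) by (intro sum_mono) blast
      also have "\<dots> \<le> (\<Sum>k\<in>{-n..n} - {0}. (C * x2 \<tau>)\<^sup>2 * (1 / (of_int k)\<^sup>2))"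
        using that zero_in_P by (intro sum_mono2) auto
      also have "\<dots> \<le> (C * x2 \<tau>)\<^sup>2 * 4"
        unfolding sum_distrib_left[symmetric] by (intro mult_left_mono sum_inverse_squares) auto
      finally show ?thesis by (simp add: power_mult_distrib)
    qed
    have plus: "L2_norm (P_plus \<alpha> (v \<tau>)) = sqrt (x2 \<tau>)"
    proof -
      have "L2_norm (P_plus \<alpha> (v \<tau>)) = nrm (four P (v \<tau>))"
        unfolding P_plus_def using L2_norm_spectral_proj[OF cv, of "four P (v \<tau>)" "\<lambda>\<mu>. \<mu> < 0" \<alpha>]
          CP_periodic[OF CP_four[OF finite_P, of 0]] cont_four[OF finite_P] fc_four[OF finite_P] by (simp add: P_def)
      also have "ip (four P (v \<tau>)) (four P (v \<tau>)) = x2 \<tau>"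
        unfolding ip_four[OF finite_P cont_four[OF finite_P]] x2_def using fc_four[OF finite_P]
        by (intro sum.cong) (auto simp: power2_eq_square)
      then have "nrm (four P (v \<tau>)) = sqrt (x2 \<tau>)" by (simp add: nrm_def)
      finally show ?thesis .
    qed
    have ZP: "Z \<inter> P = {}" by (auto simp: Z_def P_def)
    have star: "L2_norm (P_star \<alpha> (v \<tau>)) \<le> 2 * (C * x2 \<tau>)"
    proof -
      have "L2_norm (P_star \<alpha> (v \<tau>)) = nrm (four Z (v \<tau>))"
        unfolding P_star_def using L2_norm_spectral_proj[OF cv, of "four Z (v \<tau>)" "\<lambda>\<mu>. \<mu> = 0" \<alpha>]
          CP_periodic[OF CP_four[OF fin(1), of 0]] cont_four[OF fin(1)] fc_four[OF fin(1)] by (simp add: Z_def)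
      moreover have "ip (four Z (v \<tau>)) (four Z (v \<tau>)) = (\<Sum>k\<in>Z. (fc (v \<tau>) k)\<^sup>2)"
        unfolding ip_four[OF fin(1) cont_four[OF fin(1)]] using fc_four[OF fin(1)]
        by (intro sum.cong) (auto simp: power2_eq_square)
      moreover obtain n where "Z \<subseteq> {-n..n}"
      proof -
        have "Z \<subseteq> {- Max (abs ` Z)..Max (abs ` Z)}"
        proof
          fix k assume "k \<in> Z"
          then have "\<bar>k\<bar> \<le> Max (abs ` Z)" using fin(1) by (intro Max_ge) auto
          then show "k \<in> {- Max (abs ` Z)..Max (abs ` Z)}" by auto
        qed
        then show ?thesis using that by blast
      qed
      ultimately show ?thesis
        using tail[of Z n] ZP C(1) x2_nonneg[of \<tau>] unfolding nrm_def by (auto intro!: real_le_lsqrt)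
    qed
    have minus: "L2_norm (P_minus \<alpha> (v \<tau>)) \<le> 2 * (C * x2 \<tau>)"
    proof -
      \<comment> \<open>Infinitely many modes are stable, so their projection is taken as v minus
        the finitely many others.\<close>
      define g where "g = (\<lambda>x. v \<tau> x - four U (v \<tau>) x)"
      have CPg: "CP 0 g" unfolding g_def using CPv'[OF t0] CP_four[OF fin(2)] by (intro CP_diff) auto
      have fcg: "fc g k = (if lam \<alpha> k > 0 then fc (v \<tau>) k else 0)" for k
        unfolding g_def using fc_diff[OF cv cont_four[OF fin(2)]] fc_four[OF fin(2)] by (simp add: U_def)
      have "L2_norm (P_minus \<alpha> (v \<tau>)) = nrm g"
        unfolding P_minus_def
        using L2_norm_spectral_proj[OF cv CP_periodic[OF CPg] CP_cont[OF CPg], of "\<lambda>\<mu>. \<mu> > 0" \<alpha>] fcg by simp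
      moreover have "ip g g \<le> (2 * (C * x2 \<tau>))\<^sup>2"
      proof (rule parseval_le[OF CP_periodic[OF CPg] CP_cont[OF CPg]])
        fix n
        have "(\<Sum>k\<in>{-n..n}. (fc g k)\<^sup>2) = (\<Sum>k\<in>{k\<in>{-n..n}. lam \<alpha> k > 0}. (fc (v \<tau>) k)\<^sup>2)"
          by (rule sum.mono_neutral_cong_right) (auto simp: fcg)
        also have "\<dots> \<le> (2 * (C * x2 \<tau>))\<^sup>2" by (rule tail[of _ n]) (auto simp: P_def)
        finally show "(\<Sum>k\<in>{-n..n}. (fc g k)\<^sup>2) \<le> (2 * (C * x2 \<tau>))\<^sup>2" .
      qed
      ultimately show ?thesis using C(1) x2_nonneg[of \<tau>] unfolding nrm_def by (auto intro!: real_le_lsqrt)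
    qed
    have bdd: "bdd_above (range (\<lambda>s. norm (nth_deriv j (v \<tau>) s)))" if "j \<le> 4" for j
      using C(3)[OF t that] by (auto intro!: bdd_aboveI)
    have sup0: "0 \<le> (SUP s. norm (nth_deriv j (v \<tau>) s))" if "j \<le> 4" for j
      using cSUP_upper[OF UNIV_I bdd[OF that], of 0] norm_ge_zero order_trans by blast
    have vb: "\<bar>v \<tau> x\<bar> \<le> Ck_norm 4 (v \<tau>)" for x
    proof -
      have "\<bar>v \<tau> x\<bar> \<le> (SUP s. norm (nth_deriv 0 (v \<tau>) s))" using cSUP_upper[OF UNIV_I bdd[of 0], of x] by simp
      also have "\<dots> \<le> Ck_norm 4 (v \<tau>)" unfolding Ck_norm_def using sup0 by (intro member_le_sum[of 0 "{..4}"]) auto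
      finally show ?thesis .
    qed
    have C4: "Ck_norm 4 (v \<tau>) \<le> 5 * (C * sqrt (x2 \<tau>))"
    proof -
      have "Ck_norm 4 (v \<tau>) \<le> (\<Sum>j\<le>(4::nat). C * sqrt (x2 \<tau>))"
        unfolding Ck_norm_def using C(3)[OF t] by (intro sum_mono cSUP_least) auto
      then show ?thesis by simp
    qed
    \<comment> \<open>This exchanges one factor of X^2 for the C^4 norm in the first
      estimate.\<close>
    have X: "sqrt (x2 \<tau>) \<le> 3 * Ck_norm 4 (v \<tau>)"
    proof -
      have "sqrt (x2 \<tau>) \<le> nrm (v \<tau>)" using x2_le[OF t0] nrm_nonneg[OF cv] x2_nonneg by (intro real_le_lsqrt) auto
      also have "\<dots> \<le> 3 * Ck_norm 4 (v \<tau>)" by (rule nrm_bound[OF cv vb])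
      finally show ?thesis .
    qed
    have Cn: "0 \<le> Ck_norm 4 (v \<tau>)" using order_trans[OF abs_ge_zero vb[of 0]] .
    have "L2_norm (P_minus \<alpha> (v \<tau>)) + L2_norm (P_star \<alpha> (v \<tau>)) \<le> 4 * C * (sqrt (x2 \<tau>) * sqrt (x2 \<tau>))"
      using minus star x2_nonneg[of \<tau>] by simp
    also have "\<dots> \<le> 4 * C * (3 * Ck_norm 4 (v \<tau>) * sqrt (x2 \<tau>))"
      using C(1) X x2_nonneg[of \<tau>] by (intro mult_left_mono mult_right_mono) auto
    also have "\<dots> = 12 * C * (Ck_norm 4 (v \<tau>) * sqrt (x2 \<tau>))" by simp
    also have "\<dots> \<le> K * (Ck_norm 4 (v \<tau>) * sqrt (x2 \<tau>))"
      using K(2) Cn x2_nonneg[of \<tau>] by (intro mult_right_mono) auto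
    finally have 1: "L2_norm (P_minus \<alpha> (v \<tau>)) + L2_norm (P_star \<alpha> (v \<tau>)) \<le> K * Ck_norm 4 (v \<tau>) * L2_norm (P_plus \<alpha> (v \<tau>))"
      unfolding plus by simp
    have "Ck_norm 4 (v \<tau>) \<le> 5 * (C * (C * exp (\<mu> * \<tau>)))"
      by (rule order_trans[OF C4]) (intro mult_left_mono C(5)[OF t], use C(1) in auto)
    also have "\<dots> = 5 * C\<^sup>2 * exp (\<mu> * \<tau>)" by (simp add: power2_eq_square)
    also have "\<dots> \<le> K * exp (\<mu> * \<tau>)" using K(3) by (rule mult_right_mono) simp
    finally show ?thesis using 1 unfolding lambda_I_eq by simp
  qed
  show ?thesis
    by (rule exI[of _ K], intro conjI K(1) exI[of _ "min \<tau>2 (- 2)"]) (use main in auto)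
qed

theorem projections_and_decay:
  assumes "\<alpha> \<noteq> 1 / 3"
  shows "\<exists>C>0. \<exists>t < -1. \<forall>\<tau>\<le>t.
           L2_norm (P_minus \<alpha> (v \<tau>)) + L2_norm (P_star \<alpha> (v \<tau>)) \<le> C * Ck_norm 4 (v \<tau>) * L2_norm (P_plus \<alpha> (v \<tau>)) \<and>
           Ck_norm 4 (v \<tau>) \<le> C * exp (- lambda_I \<alpha> * \<tau>)"
proof (cases "\<exists>k. lam \<alpha> k = 0")
  case False
  then obtain \<tau>1 where t: "\<tau>1 < \<tau>0" "\<And>\<tau>. \<tau> \<le> \<tau>1 \<Longrightarrow> (nrm (v \<tau>))\<^sup>2 \<le> 2 * x2 \<tau>" using nonneutral_unstable_dominance by metis
  have "nrm (v \<tau>) \<le> sqrt 2 * sqrt (x2 \<tau>)" if "\<tau> \<le> \<tau>1" for \<tau>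
    unfolding real_sqrt_mult[symmetric] using t(2)[OF that] by (rule real_le_rsqrt)
  then show ?thesis using projections_and_decay_of_unstable_dominance[of "sqrt 2" \<tau>1] t(1) by simp
next
  case True
  then obtain k where k: "\<alpha> * ((of_int k)\<^sup>2 - 1) = 1" by (auto simp: lam_def)
  define l where "l = \<bar>k\<bar>"
  have kl: "\<alpha> * ((of_int l)\<^sup>2 - 1) = 1" using k by (simp add: l_def)
  then have "(of_int l)\<^sup>2 - 1 \<noteq> (0::real)" by auto
  then have al: "\<alpha> = 1 / ((of_int l)\<^sup>2 - 1)" using kl by (simp add: field_simps)
  \<comment> \<open>l = 0 would make \<alpha> negative, l = 1 contradicts \<open>kl\<close>, and l =
    2 is the excluded value 1 / 3.\<close>
  have "l \<noteq> 0" "l \<noteq> 1" "l \<noteq> 2"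
    using kl apos assms al by auto
  then have l3: "l \<ge> 3" using l_def by linarith
  interpret neutral \<alpha> v \<tau>0 l by unfold_locales (rule l3, rule al)
  obtain C0 \<tau>1 where "C0 > 0" "\<tau>1 < \<tau>0" "\<And>\<tau>. \<tau> \<le> \<tau>1 \<Longrightarrow> nrm (v \<tau>) \<le> C0 * sqrt (x2 \<tau>)" using neutral_unstable_dominance by blast
  then show ?thesis by (rule projections_and_decay_of_unstable_dominance)
qed

end

section \<open>Curves near the circle\<close>

lemma cont_deriv: "(\<And>x. (f has_real_derivative f' x) (at x)) \<Longrightarrow> cont f"
  by (meson DERIV_isCont continuous_at_imp_continuous_on)

text \<open>Change of frame for the tangent (- s + p, c + q): its components in the frame of
  direction (C, S) are expressed by those in the moving frame of the unit circle, which become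
  \<open>Tn\<close> and \<open>Nn\<close>, and by the sine and cosine of the angle between the
  frames.\<close>

lemma frame_rotate:
  fixes s c S C p q :: real
  assumes "s\<^sup>2 + c\<^sup>2 = 1"
  shows "C * (- s + p) + S * (c + q) = (1 - p * s + q * c) * (S * c - C * s) + (p * c + q * s) * (C * c + S * s)"
    "- S * (- s + p) + C * (c + q) = (1 - p * s + q * c) * (C * c + S * s) - (p * c + q * s) * (S * c - C * s)"
  using assms by algebra+

text \<open>A curve near the unit circle; \<open>\<psi>\<close> is the angle of its outward normal, so that its inverse
  \<open>\<sigma>\<close> parametrises the curve by the normal angle.\<close>

locale near_circle =
  fixes a b :: "real \<Rightarrow> real"
  assumes CPa: "CP 3 a" and CPb: "CP 3 b"
    and ab: "\<And>j s. j \<le> 2 \<Longrightarrow> \<bar>nth_deriv j a s\<bar> \<le> 1 / 20" "\<And>j s. j \<le> 2 \<Longrightarrow> \<bar>nth_deriv j b s\<bar> \<le> 1 / 20"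
begin

abbreviation "a1 \<equiv> nth_deriv 1 a"
abbreviation "a2 \<equiv> nth_deriv 2 a"
abbreviation "b1 \<equiv> nth_deriv 1 b"
abbreviation "b2 \<equiv> nth_deriv 2 b"

definition Y :: "real \<Rightarrow> complex" where "Y s = Complex (cos s + a s) (sin s + b s)"
text \<open>\<open>Tn\<close> and \<open>Nn\<close> are the components of the velocity along tangent
  and normal of the unit circle, \<open>\<rho>\<close> is its length and \<open>\<beta>\<close> its
  tilt. \<open>\<Psi>\<close> is the derivative of \<open>\<psi>\<close>, with a real power in place
  of a quotient so that \<open>fam_powr\<close> applies.\<close>

definition Tn :: "real \<Rightarrow> real" where "Tn s = 1 - a1 s * sin s + b1 s * cos s"
definition Nn :: "real \<Rightarrow> real" where "Nn s = a1 s * cos s + b1 s * sin s"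
definition Tn' :: "real \<Rightarrow> real" where "Tn' s = - a2 s * sin s - a1 s * cos s + b2 s * cos s - b1 s * sin s"
definition Nn' :: "real \<Rightarrow> real" where "Nn' s = a2 s * cos s - a1 s * sin s + b2 s * sin s + b1 s * cos s"
definition \<beta> :: "real \<Rightarrow> real" where "\<beta> s = arctan (Nn s / Tn s)"
definition \<psi> :: "real \<Rightarrow> real" where "\<psi> s = s - \<beta> s"
definition \<Psi> :: "real \<Rightarrow> real" where "\<Psi> s = 1 - (Nn' s * Tn s - Nn s * Tn' s) * ((Nn s)\<^sup>2 + (Tn s)\<^sup>2) powr - 1"
definition \<rho> :: "real \<Rightarrow> real" where "\<rho> s = sqrt ((Nn s)\<^sup>2 + (Tn s)\<^sup>2)"

lemma da: "(a has_real_derivative a1 s) (at s)" "(a1 has_real_derivative a2 s) (at s)"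
  and db: "(b has_real_derivative b1 s) (at s)" "(b1 has_real_derivative b2 s) (at s)"
  using CP_D[OF CPa, of 0 s] CP_D[OF CPa, of 1 s] CP_D[OF CPb, of 0 s] CP_D[OF CPb, of 1 s]
  by (simp_all add: numeral_2_eq_2)

lemma bd: "\<bar>a s\<bar> \<le> 1 / 20" "\<bar>a1 s\<bar> \<le> 1 / 20" "\<bar>a2 s\<bar> \<le> 1 / 20" "\<bar>b s\<bar> \<le> 1 / 20" "\<bar>b1 s\<bar> \<le> 1 / 20" "\<bar>b2 s\<bar> \<le> 1 / 20"
  using ab(1)[of 0 s] ab(1)[of 1 s] ab(1)[of 2 s] ab(2)[of 0 s] ab(2)[of 1 s] ab(2)[of 2 s] by simp_all

lemma trig_prod: "\<bar>c\<bar> \<le> 1 / 20 \<Longrightarrow> \<bar>c * sin s\<bar> \<le> 1 / 20" "\<bar>c\<bar> \<le> 1 / 20 \<Longrightarrow> \<bar>c * cos s\<bar> \<le> (1 / 20 :: real)"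
  using mult_mono[of "\<bar>c\<bar>" "1 / 20" "\<bar>sin s\<bar>" 1] mult_mono[of "\<bar>c\<bar>" "1 / 20" "\<bar>cos s\<bar>" 1] by (auto simp: abs_mult)

lemma Tn_bd: "9 / 10 \<le> Tn s" "Tn s \<le> 11 / 10"
  using trig_prod(1)[OF bd(2), of s s] trig_prod(2)[OF bd(5), of s s] unfolding Tn_def abs_le_iff by linarith+

lemma Nn_bd: "\<bar>Nn s\<bar> \<le> 1 / 10"
  using trig_prod(2)[OF bd(2), of s s] trig_prod(1)[OF bd(5), of s s] unfolding Nn_def abs_le_iff by linarith

lemma Tn'_bd: "\<bar>Tn' s\<bar> \<le> 1 / 5"
  using trig_prod(1)[OF bd(3), of s s] trig_prod(2)[OF bd(2), of s s] trig_prod(2)[OF bd(6), of s s] trig_prod(1)[OF bd(5), of s s]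
  unfolding Tn'_def abs_le_iff by (simp; linarith)

lemma Nn'_bd: "\<bar>Nn' s\<bar> \<le> 1 / 5"
  using trig_prod(2)[OF bd(3), of s s] trig_prod(1)[OF bd(2), of s s] trig_prod(1)[OF bd(6), of s s] trig_prod(2)[OF bd(5), of s s]
  unfolding Nn'_def abs_le_iff by (simp; linarith)

lemma Tn_deriv: "(Tn has_real_derivative Tn' s) (at s)" and Nn_deriv: "(Nn has_real_derivative Nn' s) (at s)"
  unfolding Tn_def[abs_def] Tn'_def Nn_def[abs_def] Nn'_def using da db
  by (auto intro!: derivative_eq_intros simp: algebra_simps)

lemma NT_lower: "81 / 100 \<le> (Nn s)\<^sup>2 + (Tn s)\<^sup>2"
proof -
  have "(9 / 10)\<^sup>2 \<le> (Tn s)\<^sup>2" using Tn_bd[of s] by (intro power_mono) auto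
  moreover have "(9 / 10)\<^sup>2 = (81 / 100 :: real)" by (simp add: power2_eq_square)
  ultimately show ?thesis using zero_le_power2[of "Nn s"] by linarith
qed

text \<open>The bound 1 / 20 on the perturbation gives a numerator of at most 6 / 25 over a
  denominator of at least 81 / 100, a quotient below 1 / 2.\<close>

lemma \<Psi>_bd: "1 / 2 \<le> \<Psi> s" "\<Psi> s \<le> 3 / 2"
proof -
  let ?D = "(Nn s)\<^sup>2 + (Tn s)\<^sup>2" and ?n = "Nn' s * Tn s - Nn s * Tn' s"
  have "\<bar>Nn' s * Tn s\<bar> \<le> 1 / 5 * (11 / 10)" unfolding abs_mult using Nn'_bd[of s] Tn_bd[of s] by (intro mult_mono) auto
  moreover have "\<bar>Nn s * Tn' s\<bar> \<le> 1 / 10 * (1 / 5)" unfolding abs_mult using Nn_bd[of s] Tn'_bd[of s] by (intro mult_mono) auto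
  ultimately have n: "\<bar>?n\<bar> \<le> 6 / 25" unfolding abs_le_iff by linarith
  have D: "81 / 100 \<le> ?D" by (rule NT_lower)
  have "\<bar>?n / ?D\<bar> = \<bar>?n\<bar> / ?D" using D by (simp add: abs_divide)
  also have "\<dots> \<le> (6 / 25) / (81 / 100)" using n D by (intro frac_le) auto
  finally have "\<bar>?n / ?D\<bar> \<le> 1 / 2" by simp
  then have "?n / ?D \<le> 1 / 2" "- (?n / ?D) \<le> 1 / 2" by (rule abs_le_D1, rule abs_le_D2)
  moreover have "\<Psi> s = 1 - ?n / ?D" using D by (simp add: \<Psi>_def powr_minus_divide)
  ultimately show "1 / 2 \<le> \<Psi> s" "\<Psi> s \<le> 3 / 2" by linarith+
qed

lemma \<psi>_deriv: "(\<psi> has_real_derivative \<Psi> s) (at s)"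
proof -
  let ?D = "(Nn s)\<^sup>2 + (Tn s)\<^sup>2"
  have T0: "Tn s \<noteq> 0" using Tn_bd[of s] by auto
  have D0: "?D > 0" using NT_lower[of s] by linarith
  have "((\<lambda>s. Nn s / Tn s) has_real_derivative (Nn' s * Tn s - Nn s * Tn' s) / (Tn s * Tn s)) (at s)"
    by (rule DERIV_divide[OF Nn_deriv Tn_deriv T0])
  from DERIV_chain2[OF DERIV_arctan this]
  have d: "(\<beta> has_real_derivative inverse (1 + (Nn s / Tn s)\<^sup>2) * ((Nn' s * Tn s - Nn s * Tn' s) / (Tn s * Tn s))) (at s)"
    unfolding \<beta>_def[abs_def] .
  have e: "1 + (Nn s / Tn s)\<^sup>2 = ?D / (Tn s * Tn s)" using T0 by (simp add: field_simps power2_eq_square)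
  have g: "inverse (D / (t * t)) * (n / (t * t)) = n * D powr - 1" if "t \<noteq> 0" "D > 0" for n D t :: real
    using that by (simp add: powr_minus divide_simps)
  show ?thesis
    unfolding \<psi>_def[abs_def] \<Psi>_def
    using DERIV_diff[OF DERIV_ident d] unfolding e g[OF T0 D0] .
qed

lemma \<psi>_mono: "s < t \<Longrightarrow> (t - s) / 2 \<le> \<psi> t - \<psi> s"
proof -
  assume st: "s < t"
  obtain z where "s < z" "\<psi> t - \<psi> s = (t - s) * \<Psi> z" using MVT2[OF st, of \<psi> \<Psi>] \<psi>_deriv by blast
  then show ?thesis using \<Psi>_bd(1)[of z] st mult_left_mono[of "1 / 2" "\<Psi> z" "t - s"] by simp
qed

lemma \<psi>_less_iff: "\<psi> s < \<psi> t \<longleftrightarrow> s < t"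
  using \<psi>_mono[of s t] \<psi>_mono[of t s] by (cases s t rule: linorder_cases) auto

lemma bij_\<psi>: "bij \<psi>"
proof (rule bijI)
  show "inj \<psi>" by (rule injI) (metis \<psi>_less_iff less_irrefl linorder_neqE)
  have c: "isCont \<psi> s" for s using \<psi>_deriv DERIV_isCont by blast
  have b: "\<bar>\<psi> s - s\<bar> \<le> pi" for s
    using arctan_lbound[of "Nn s / Tn s"] arctan_ubound[of "Nn s / Tn s"] by (auto simp: \<psi>_def \<beta>_def abs_le_iff)
  show "surj \<psi>"
    unfolding surj_def
  proof
    fix y
    have "\<psi> (y - pi) \<le> y" "y \<le> \<psi> (y + pi)" using b[of "y - pi"] b[of "y + pi"] by (auto simp: abs_le_iff)
    then obtain x where "\<psi> x = y" using IVT[of \<psi> "y - pi" y "y + pi"] c pi_gt_zero by fastforce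
    then show "\<exists>x. y = \<psi> x" by blast
  qed
qed

definition \<sigma> :: "real \<Rightarrow> real" where "\<sigma> = inv \<psi>"

lemma \<psi>\<sigma>: "\<psi> (\<sigma> \<theta>) = \<theta>" and \<sigma>\<psi>: "\<sigma> (\<psi> s) = s"
  using bij_\<psi> by (auto simp: \<sigma>_def bij_is_surj bij_is_inj surj_f_inv_f)

lemma per_ab: "a (s + 2 * pi) = a s" "b (s + 2 * pi) = b s" "a1 (s + 2 * pi) = a1 s" "b1 (s + 2 * pi) = b1 s"
  using CP_periodic[OF CPa] CP_periodic[OF CPb] CP_periodic[OF CP_nth'[OF CPa, of 1 0]] CP_periodic[OF CP_nth'[OF CPb, of 1 0]]
  by (auto simp: periodic_2pi_def simp del: One_nat_def)

lemma \<psi>_shift: "\<psi> (s + 2 * pi * of_int k) = \<psi> s + 2 * pi * of_int k"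
proof -
  have "periodic_2pi \<beta>" by (simp add: periodic_2pi_def \<beta>_def Nn_def Tn_def per_ab del: One_nat_def)
  then show ?thesis using periodic_int[of \<beta> s k] by (simp add: \<psi>_def)
qed

lemma Y_shift: "Y (s + 2 * pi * of_int k) = Y s"
  by (rule periodic_int) (simp add: periodic_2pi_def Y_def per_ab)

lemma \<sigma>_shift: "\<sigma> (\<theta> + 2 * pi) = \<sigma> \<theta> + 2 * pi"
  using \<psi>_shift[of "\<sigma> \<theta>" 1] \<psi>\<sigma>[of \<theta>] \<sigma>\<psi>[of "\<sigma> \<theta> + 2 * pi"] by simp

text \<open>An autonomous equation for \<open>\<sigma>\<close>, the form that
  \<open>fam_compose\<close> asks for.\<close>

lemma \<sigma>_deriv: "(\<sigma> has_real_derivative \<Psi> (\<sigma> \<theta>) powr - 1) (at \<theta>)"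
proof -
  have lip: "\<bar>\<sigma> x - \<sigma> y\<bar> \<le> 2 * \<bar>x - y\<bar>" for x y
    using \<psi>_mono[of "\<sigma> x" "\<sigma> y"] \<psi>_mono[of "\<sigma> y" "\<sigma> x"] unfolding \<psi>\<sigma>
    by (cases "\<sigma> x" "\<sigma> y" rule: linorder_cases) auto
  have "isCont \<sigma> \<theta>"
    unfolding isCont_def
  proof (rule LIM_I)
    fix r :: real assume "0 < r"
    then show "\<exists>s>0. \<forall>x. x \<noteq> \<theta> \<and> norm (x - \<theta>) < s \<longrightarrow> norm (\<sigma> x - \<sigma> \<theta>) < r"
      using lip by (intro exI[of _ "r / 2"]) (fastforce intro: le_less_trans)
  qed
  moreover have "\<Psi> (\<sigma> \<theta>) \<noteq> 0" using \<Psi>_bd(1)[of "\<sigma> \<theta>"] by auto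
  ultimately have "(\<sigma> has_real_derivative inverse (\<Psi> (\<sigma> \<theta>))) (at \<theta>)"
    by (intro DERIV_inverse_function[where f = \<psi> and a = "\<theta> - 1" and b = "\<theta> + 1"]) (auto simp: \<psi>\<sigma> intro: \<psi>_deriv)
  then show ?thesis using \<Psi>_bd(1)[of "\<sigma> \<theta>"] by (simp add: powr_minus)
qed

text \<open>Height of the curve in direction \<theta>; its maximum over s is the support
  function.\<close>

definition fe :: "real \<Rightarrow> real \<Rightarrow> real" where "fe \<theta> s = cos \<theta> * (cos s + a s) + sin \<theta> * (sin s + b s)"

lemma fe_inner: "fe \<theta> s = Complex (cos \<theta>) (sin \<theta>) \<bullet> Y s"
  by (simp add: fe_def Y_def inner_complex_def)

lemma \<rho>_pos: "0 < \<rho> s"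
  using NT_lower[of s] by (simp add: \<rho>_def) 

lemma NT_polar: "Tn s = \<rho> s * cos (\<beta> s)" "Nn s = \<rho> s * sin (\<beta> s)"
proof -
  have T: "Tn s > 0" using Tn_bd[of s] by auto
  have r: "sqrt (1 + (Nn s / Tn s)\<^sup>2) = \<rho> s / Tn s"
  proof -
    have "1 + (Nn s / Tn s)\<^sup>2 = ((Nn s)\<^sup>2 + (Tn s)\<^sup>2) / (Tn s)\<^sup>2" using T by (simp add: field_simps power2_eq_square)
    then show ?thesis using T by (simp add: \<rho>_def real_sqrt_divide)
  qed
  show "Tn s = \<rho> s * cos (\<beta> s)" unfolding \<beta>_def cos_arctan r using \<rho>_pos[of s] T by simp
  show "Nn s = \<rho> s * sin (\<beta> s)" unfolding \<beta>_def sin_arctan r using \<rho>_pos[of s] T by simp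
qed

lemma fe_deriv: "(fe \<theta> has_real_derivative \<rho> s * sin (\<theta> - \<psi> s)) (at s)"
proof -
  have "(fe \<theta> has_real_derivative cos \<theta> * (- sin s + a1 s) + sin \<theta> * (cos s + b1 s)) (at s)"
    unfolding fe_def[abs_def] using da(1)[of s] db(1)[of s] by (auto intro!: derivative_eq_intros)
  moreover have "cos \<theta> * (- sin s + a1 s) + sin \<theta> * (cos s + b1 s) = Tn s * sin (\<theta> - s) + Nn s * cos (\<theta> - s)"
    unfolding Tn_def Nn_def sin_diff cos_diff by (rule frame_rotate(1)) simp
  moreover have "\<dots> = \<rho> s * sin (\<theta> - s + \<beta> s)" unfolding sin_add NT_polar[of s] by (simp add: algebra_simps)
  ultimately show ?thesis by (simp add: \<psi>_def algebra_simps)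
qed

text \<open>By \<open>fe_deriv\<close> the height increases while the normal angle rises to \<theta>
  and decreases for the next half turn. Strictness makes the point of contact unique, which later
  identifies it on the flow.\<close>

lemma fe_max_strict: "\<theta> - pi \<le> \<psi> s \<Longrightarrow> \<psi> s \<le> \<theta> + pi \<Longrightarrow> s \<noteq> \<sigma> \<theta> \<Longrightarrow> fe \<theta> s < fe \<theta> (\<sigma> \<theta>)"
proof -
  assume r: "\<theta> - pi \<le> \<psi> s" "\<psi> s \<le> \<theta> + pi" and n: "s \<noteq> \<sigma> \<theta>"
  show ?thesis
  proof (cases "s < \<sigma> \<theta>")
    case True
    obtain z where z: "s < z" "z < \<sigma> \<theta>" "fe \<theta> (\<sigma> \<theta>) - fe \<theta> s = (\<sigma> \<theta> - s) * (\<rho> z * sin (\<theta> - \<psi> z))"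
      using MVT2[OF True, of "fe \<theta>" "\<lambda>s. \<rho> s * sin (\<theta> - \<psi> s)"] fe_deriv by blast
    have "\<psi> s < \<psi> z" "\<psi> z < \<theta>" using z \<psi>_less_iff[of s z] \<psi>_less_iff[of z "\<sigma> \<theta>"] by (auto simp: \<psi>\<sigma>)
    then have "0 < sin (\<theta> - \<psi> z)" using r by (intro sin_gt_zero) auto
    then have "0 < (\<sigma> \<theta> - s) * (\<rho> z * sin (\<theta> - \<psi> z))" using True \<rho>_pos[of z] by simp
    then show ?thesis using z(3) by simp
  next
    case False
    then have l: "\<sigma> \<theta> < s" using n by simp
    obtain z where z: "\<sigma> \<theta> < z" "z < s" "fe \<theta> s - fe \<theta> (\<sigma> \<theta>) = (s - \<sigma> \<theta>) * (\<rho> z * sin (\<theta> - \<psi> z))"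
      using MVT2[OF l, of "fe \<theta>" "\<lambda>s. \<rho> s * sin (\<theta> - \<psi> s)"] fe_deriv by blast
    have "\<psi> z < \<psi> s" "\<theta> < \<psi> z" using z \<psi>_less_iff[of z s] \<psi>_less_iff[of "\<sigma> \<theta>" z] by (auto simp: \<psi>\<sigma>)
    then have "0 < sin (\<psi> z - \<theta>)" using r by (intro sin_gt_zero) auto
    then have "sin (\<theta> - \<psi> z) < 0" using sin_minus[of "\<psi> z - \<theta>"] by simp
    then have "(s - \<sigma> \<theta>) * (\<rho> z * sin (\<theta> - \<psi> z)) < 0" using l \<rho>_pos[of z] by (simp add: mult_less_0_iff zero_less_mult_iff)
    then show ?thesis using z(3) by simp
  qed
qed

text \<open>\<open>Z \<theta>\<close> is the point with outward normal angle \<theta>,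
  \<open>h\<close> the support function, \<open>h1\<close> its derivative and \<open>W\<close> the
  radius of curvature, arc length per unit of normal angle.\<close>

definition Z :: "real \<Rightarrow> complex" where "Z \<theta> = Y (\<sigma> \<theta>)"
definition h :: "real \<Rightarrow> real" where "h \<theta> = cos \<theta> * (cos (\<sigma> \<theta>) + a (\<sigma> \<theta>)) + sin \<theta> * (sin (\<sigma> \<theta>) + b (\<sigma> \<theta>))"
definition h1 :: "real \<Rightarrow> real" where "h1 \<theta> = - sin \<theta> * (cos (\<sigma> \<theta>) + a (\<sigma> \<theta>)) + cos \<theta> * (sin (\<sigma> \<theta>) + b (\<sigma> \<theta>))"
definition W :: "real \<Rightarrow> real" where "W \<theta> = \<rho> (\<sigma> \<theta>) * \<Psi> (\<sigma> \<theta>) powr - 1"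

lemma h_fe: "h \<theta> = fe \<theta> (\<sigma> \<theta>)"
  by (simp add: h_def fe_def)

lemma h_inner: "h \<theta> = Complex (cos \<theta>) (sin \<theta>) \<bullet> Z \<theta>"
  unfolding h_fe Z_def by (rule fe_inner)

lemma max_point: "Complex (cos \<theta>) (sin \<theta>) \<bullet> Y s \<le> h \<theta>" 
  "Complex (cos \<theta>) (sin \<theta>) \<bullet> Y s = h \<theta> \<Longrightarrow> Y s = Z \<theta>"
proof -
  \<comment> \<open>The number of turns that brings the normal angle within pi of \<theta>.\<close>
  define k where "k = \<lfloor>(\<psi> s - \<theta> + pi) / (2 * pi)\<rfloor>"
  define s' where "s' = s + 2 * pi * of_int (- k)"
  have "of_int k \<le> (\<psi> s - \<theta> + pi) / (2 * pi)" "(\<psi> s - \<theta> + pi) / (2 * pi) < of_int k + 1" by (auto simp: k_def)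
  then have "of_int k * (2 * pi) \<le> \<psi> s - \<theta> + pi" "\<psi> s - \<theta> + pi < (of_int k + 1) * (2 * pi)"
    by (simp_all add: le_divide_eq divide_less_eq)
  then have r: "\<theta> - pi \<le> \<psi> s'" "\<psi> s' \<le> \<theta> + pi"
    unfolding s'_def \<psi>_shift by (auto simp: algebra_simps)
  have Ys: "Y s' = Y s" unfolding s'_def by (rule Y_shift)
  have e: "Complex (cos \<theta>) (sin \<theta>) \<bullet> Y s = fe \<theta> s'" unfolding fe_inner Ys ..
  show "Complex (cos \<theta>) (sin \<theta>) \<bullet> Y s \<le> h \<theta>"
    unfolding e h_fe using fe_max_strict[OF r] by (cases "s' = \<sigma> \<theta>") auto
  show "Complex (cos \<theta>) (sin \<theta>) \<bullet> Y s = h \<theta> \<Longrightarrow> Y s = Z \<theta>"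
    unfolding e h_fe Z_def using fe_max_strict[OF r] Ys by (cases "s' = \<sigma> \<theta>") auto
qed

lemma normal_eqs:
  fixes \<theta>
  defines "s \<equiv> \<sigma> \<theta>"
  shows "cos \<theta> * (- sin s + a1 s) + sin \<theta> * (cos s + b1 s) = 0"
    "- sin \<theta> * (- sin s + a1 s) + cos \<theta> * (cos s + b1 s) = \<rho> s"
proof -
  have th: "\<theta> = s - \<beta> s" using \<psi>\<sigma>[of \<theta>] by (simp add: s_def \<psi>_def)
  have "cos \<theta> * (- sin s + a1 s) + sin \<theta> * (cos s + b1 s) = Tn s * sin (\<theta> - s) + Nn s * cos (\<theta> - s)"
    unfolding Tn_def Nn_def sin_diff cos_diff by (rule frame_rotate(1)) simp
  also have "\<theta> - s = - \<beta> s" using th by simp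
  finally show "cos \<theta> * (- sin s + a1 s) + sin \<theta> * (cos s + b1 s) = 0"
    unfolding NT_polar[of s] by simp
  have "- sin \<theta> * (- sin s + a1 s) + cos \<theta> * (cos s + b1 s) = Tn s * cos (\<theta> - s) - Nn s * sin (\<theta> - s)"
    unfolding Tn_def Nn_def sin_diff cos_diff by (rule frame_rotate(2)) simp
  also have "\<theta> - s = - \<beta> s" using th by simp
  finally have "- sin \<theta> * (- sin s + a1 s) + cos \<theta> * (cos s + b1 s) = \<rho> s * ((sin (\<beta> s))\<^sup>2 + (cos (\<beta> s))\<^sup>2)"
    unfolding NT_polar[of s] distrib_left by (simp add: power2_eq_square mult.assoc)
  then show "- sin \<theta> * (- sin s + a1 s) + cos \<theta> * (cos s + b1 s) = \<rho> s" by simp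
qed

lemma \<sigma>_chain:
  shows "((\<lambda>\<theta>. cos (\<sigma> \<theta>) + a (\<sigma> \<theta>)) has_real_derivative (- sin (\<sigma> \<theta>) + a1 (\<sigma> \<theta>)) * \<Psi> (\<sigma> \<theta>) powr - 1) (at \<theta>)"
    "((\<lambda>\<theta>. sin (\<sigma> \<theta>) + b (\<sigma> \<theta>)) has_real_derivative (cos (\<sigma> \<theta>) + b1 (\<sigma> \<theta>)) * \<Psi> (\<sigma> \<theta>) powr - 1) (at \<theta>)"
  using \<sigma>_deriv[of \<theta>] DERIV_chain2[OF da(1) \<sigma>_deriv] DERIV_chain2[OF db(1) \<sigma>_deriv]
  by (auto intro!: derivative_eq_intros simp: algebra_simps)

text \<open>Envelope argument: moving the point of contact contributes the component of the tangent
  in direction \<theta>, which vanishes by \<open>normal_eqs\<close>.\<close>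

lemma h_deriv: "(h has_real_derivative h1 \<theta>) (at \<theta>)"
proof -
  let ?p = "\<Psi> (\<sigma> \<theta>) powr - 1"
  have "(h has_real_derivative h1 \<theta> + (cos \<theta> * (- sin (\<sigma> \<theta>) + a1 (\<sigma> \<theta>)) + sin \<theta> * (cos (\<sigma> \<theta>) + b1 (\<sigma> \<theta>))) * ?p) (at \<theta>)"
    unfolding h_def[abs_def] h1_def
    by (rule DERIV_cong[OF DERIV_add[OF DERIV_mult[OF DERIV_cos \<sigma>_chain(1)] DERIV_mult[OF DERIV_sin \<sigma>_chain(2)]]])
      (simp add: algebra_simps)
  then show ?thesis unfolding normal_eqs(1) by simp
qed

text \<open>The classical relation that h + h'' is the radius of curvature.\<close>

lemma h1_deriv: "(h1 has_real_derivative W \<theta> - h \<theta>) (at \<theta>)"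
proof -
  let ?p = "\<Psi> (\<sigma> \<theta>) powr - 1"
  have "(h1 has_real_derivative - h \<theta> + (- sin \<theta> * (- sin (\<sigma> \<theta>) + a1 (\<sigma> \<theta>)) + cos \<theta> * (cos (\<sigma> \<theta>) + b1 (\<sigma> \<theta>))) * ?p) (at \<theta>)"
    unfolding h1_def[abs_def] h_def
    by (rule DERIV_cong[OF DERIV_add[OF DERIV_mult[OF DERIV_minus[OF DERIV_sin] \<sigma>_chain(1)] DERIV_mult[OF DERIV_cos \<sigma>_chain(2)]]])
      (simp add: algebra_simps)
  then show ?thesis unfolding normal_eqs(2) by (simp add: W_def)
qed

lemma W_pos: "0 < W \<theta>"
  using \<rho>_pos[of "\<sigma> \<theta>"] \<Psi>_bd(1)[of "\<sigma> \<theta>"] by (simp add: W_def)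

lemma Z_eq: "Z \<theta> = Complex (h \<theta> * cos \<theta> - h1 \<theta> * sin \<theta>) (h \<theta> * sin \<theta> + h1 \<theta> * cos \<theta>)"
proof -
  have id: "u = (c * u + s * v) * c - (- s * u + c * v) * s" "v = (c * u + s * v) * s + (- s * u + c * v) * c"
    if "s\<^sup>2 + c\<^sup>2 = 1" for u v c s :: real
  proof -
    have "(c * u + s * v) * c - (- s * u + c * v) * s = u * (s\<^sup>2 + c\<^sup>2)" by (simp add: power2_eq_square algebra_simps)
    then show "u = (c * u + s * v) * c - (- s * u + c * v) * s" using that by simp
    have "(c * u + s * v) * s + (- s * u + c * v) * c = v * (s\<^sup>2 + c\<^sup>2)" by (simp add: power2_eq_square algebra_simps)
    then show "v = (c * u + s * v) * s + (- s * u + c * v) * c" using that by simp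
  qed
  show ?thesis unfolding Z_def Y_def h_def h1_def complex.inject
    using id[of "sin \<theta>" "cos \<theta>"] by simp
qed

lemma Z_deriv: "(Z has_vector_derivative W \<theta> *\<^sub>R Complex (- sin \<theta>) (cos \<theta>)) (at \<theta>)"
proof -
  have r: "((\<lambda>\<theta>. h \<theta> * cos \<theta> - h1 \<theta> * sin \<theta>) has_real_derivative W \<theta> * - sin \<theta>) (at \<theta>)"
    using h_deriv[of \<theta>] h1_deriv[of \<theta>] by (auto intro!: derivative_eq_intros simp: algebra_simps)
  have i: "((\<lambda>\<theta>. h \<theta> * sin \<theta> + h1 \<theta> * cos \<theta>) has_real_derivative W \<theta> * cos \<theta>) (at \<theta>)"
    using h_deriv[of \<theta>] h1_deriv[of \<theta>] by (auto intro!: derivative_eq_intros simp: algebra_simps)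
  show ?thesis
    unfolding has_vector_derivative_complex_iff using r i by (simp add: Z_eq[abs_def])
qed

lemma h_periodic: "periodic_2pi h"
  using \<sigma>_shift per_ab by (simp add: periodic_2pi_def h_def)

lemma h_nth: "nth_deriv 1 h = h1" "nth_deriv 2 h = (\<lambda>\<theta>. W \<theta> - h \<theta>)"
  using nth_deriv_eqI[OF h_deriv, of 0] nth_deriv_eqI[OF h_deriv, of 1] nth_deriv_eqI[OF h1_deriv, of 0]
  by (simp_all add: numeral_2_eq_2)

lemma h_near: assumes "\<And>s. \<bar>a s\<bar> \<le> d" "\<And>s. \<bar>b s\<bar> \<le> d" shows "\<bar>h \<theta> - 1\<bar> \<le> 2 * d"
proof -
  have p: "\<bar>cos \<theta> * a s + sin \<theta> * b s\<bar> \<le> 2 * d" for s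
  proof -
    have "\<bar>cos \<theta> * a s\<bar> \<le> 1 * d" "\<bar>sin \<theta> * b s\<bar> \<le> 1 * d"
      unfolding abs_mult using assms[of s] by (intro mult_mono; simp)+
    then show ?thesis by linarith
  qed
  have fe: "fe \<theta> s = cos (\<theta> - s) + (cos \<theta> * a s + sin \<theta> * b s)" for s by (simp add: fe_def cos_diff algebra_simps)
  have "h \<theta> \<le> 1 + 2 * d" unfolding h_fe fe using abs_le_D1[OF p[of "\<sigma> \<theta>"]] cos_le_one[of "\<theta> - \<sigma> \<theta>"] by linarith
  moreover have "fe \<theta> \<theta> \<le> h \<theta>" unfolding fe_inner by (rule max_point)
  then have "1 - 2 * d \<le> h \<theta>" unfolding fe using abs_le_D2[OF p[of \<theta>]] by simp
  ultimately show ?thesis by (simp add: abs_le_iff)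
qed

end

section \<open>Smooth convergence\<close>

lemma Ck_on_diff: "Ck_on n UNIV f \<Longrightarrow> Ck_on n UNIV g \<Longrightarrow> Ck_on n UNIV (\<lambda>x. f x - g x)"
proof (induction n arbitrary: f g)
  case 0 then show ?case by (simp add: continuous_on_diff)
next
  case (Suc n)
  have d: "((\<lambda>x. f x - g x) has_derivative (\<lambda>w. frechet_derivative f (at x) w - frechet_derivative g (at x) w)) (at x)" for x
    using Suc.prems by (intro has_derivative_diff) (auto simp: frechet_derivative_works[symmetric])
  have "Ck_on n UNIV (\<lambda>x. frechet_derivative (\<lambda>x. f x - g x) (at x) w)" for w
    unfolding frechet_derivative_at[OF d, symmetric] using Suc by simp
  then show ?case using d by (auto simp: differentiable_def)
qed

lemma Ck_on_cis: "Ck_on n UNIV (\<lambda>s. c * cis s)"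
proof (induction n arbitrary: c)
  case 0 then show ?case by (auto intro!: continuous_intros)
next
  case (Suc n)
  have d: "((\<lambda>s. c * cis s) has_derivative (\<lambda>w. (w *\<^sub>R (c * \<i>)) * cis x)) (at x)" for x
  proof -
    have "(cis has_vector_derivative \<i> * cis x) (at x)"
      by (auto simp: has_vector_derivative_complex_iff intro!: derivative_eq_intros)
    then have "((\<lambda>s. c * cis s) has_vector_derivative c * (\<i> * cis x)) (at x)"
      by (rule has_vector_derivative_mult_right)
    then show ?thesis unfolding has_vector_derivative_def by (rule has_derivative_eq_rhs) (simp add: fun_eq_iff mult.assoc)
  qed
  have "Ck_on n UNIV (\<lambda>x. frechet_derivative (\<lambda>s. c * cis s) (at x) w)" for w
    unfolding frechet_derivative_at[OF d, symmetric] by (rule Suc)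
  then show ?case using d by (auto simp: differentiable_def)
qed

lemma Ck_on_linear_CP:
  fixes f :: "real \<Rightarrow> 'a::real_normed_vector"
  assumes "bounded_linear L" "Ck_on n UNIV f" "periodic_2pi (\<lambda>s. L (f s) :: real)"
  shows "CP n (\<lambda>s. L (f s)) \<and> (\<forall>j\<le>n. nth_deriv j (\<lambda>s. L (f s)) = (\<lambda>s. L (nth_deriv j f s)))"
  using assms(2,3)
proof (induction n arbitrary: f)
  case 0
  have "continuous_on UNIV (\<lambda>s. L (f s))" using bounded_linear.continuous_on[OF assms(1)] 0 by simp
  then show ?case using 0 by (auto intro: CP_0I)
next
  case (Suc n)
  note d = Ck_on_Suc_real[OF Suc.prems(1)]
  have d1: "((\<lambda>s. L (f s)) has_real_derivative L (nth_deriv 1 f x)) (at x)" for x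
    using bounded_linear.has_vector_derivative[OF assms(1) d(1)]
    by (simp only: has_real_derivative_iff_has_vector_derivative)
  note IH = Suc.IH[OF d(2) periodic_deriv[OF Suc.prems(2) d1]]
  have "nth_deriv j (\<lambda>s. L (f s)) = (\<lambda>s. L (nth_deriv j f s))" if "j \<le> Suc n" for j
  proof (cases j)
    case (Suc i)
    then show ?thesis using nth_deriv_eqI[OF d1, of i] IH that by (simp add: nth_deriv_Suc[of i] del: One_nat_def)
  qed simp
  then show ?case using CP_SucI[OF Suc.prems(2) d1] IH by blast
qed

lemma CP_0_bounded: assumes "CP 0 f" obtains B where "\<And>x. \<bar>f x\<bar> \<le> B"
proof -
  have "compact (f ` {0..2 * pi})"
    using CP_cont[OF assms] by (intro compact_continuous_image) (auto intro: continuous_on_subset)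
  then obtain B where B: "\<And>x. x \<in> {0..2 * pi} \<Longrightarrow> \<bar>f x\<bar> \<le> B"
    using compact_imp_bounded[of "f ` {0..2 * pi}"] unfolding bounded_iff by (metis image_eqI real_norm_def)
  have "\<bar>f x\<bar> \<le> B" for x
  proof -
    obtain y where "y \<in> {0..<2 * pi}" "f y = f x" using periodic_reduce[OF CP_periodic[OF assms], of x] by metis
    then show ?thesis using B[of y] by simp
  qed
  then show ?thesis using that by blast
qed

text \<open>Each supremum in \<open>Ck_norm\<close> dominates its values once they are bounded,
  which continuity and periodicity ensure.\<close>

lemma Ck_norm_ge:
  fixes f :: "real \<Rightarrow> complex"
  assumes "Ck_on n UNIV f" "periodic_2pi f" "j \<le> n"
  shows "norm (nth_deriv j f s) \<le> Ck_norm n f"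
proof -
  have p: "periodic_2pi (\<lambda>s. Re (f s))" "periodic_2pi (\<lambda>s. Im (f s))" using assms(2) by (auto simp: periodic_2pi_def)
  note R = Ck_on_linear_CP[OF bounded_linear_Re assms(1) p(1)] and I = Ck_on_linear_CP[OF bounded_linear_Im assms(1) p(2)]
  have b: "bdd_above (range (\<lambda>s. norm (nth_deriv i f s)))" if i: "i \<le> n" for i
  proof -
    have "CP 0 (\<lambda>s. Re (nth_deriv i f s))" "CP 0 (\<lambda>s. Im (nth_deriv i f s))"
      using CP_nth'[of n "\<lambda>s. Re (f s)" i 0] CP_nth'[of n "\<lambda>s. Im (f s)" i 0] R I i by auto
    then obtain B C where "\<And>s. \<bar>Re (nth_deriv i f s)\<bar> \<le> B" "\<And>s. \<bar>Im (nth_deriv i f s)\<bar> \<le> C"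
      using CP_0_bounded by metis
    then have "norm (nth_deriv i f s) \<le> B + C" for s using cmod_le by (meson add_mono order_trans)
    then show ?thesis by (auto intro!: bdd_aboveI)
  qed
  have "norm (nth_deriv j f s) \<le> (SUP s. norm (nth_deriv j f s))" by (rule cSUP_upper[OF UNIV_I b[OF assms(3)]])
  also have "\<dots> \<le> Ck_norm n f"
    unfolding Ck_norm_def
  proof (rule member_le_sum)
    fix i assume "i \<in> {..n} - {j}"
    then have "norm (nth_deriv i f s) \<le> (SUP s. norm (nth_deriv i f s))" by (intro cSUP_upper[OF UNIV_I b]) auto
    then show "0 \<le> (SUP s. norm (nth_deriv i f s))" using norm_ge_zero order_trans by blast
  qed (use assms(3) in auto)
  finally show ?thesis .
qed

lemma fam_CPI:
  assumes "\<And>i. i \<in> I \<Longrightarrow> CP n (f i)" "\<And>i j x. i \<in> I \<Longrightarrow> j \<le> n \<Longrightarrow> \<bar>nth_deriv j (f i) x\<bar> \<le> B"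
  shows "fam n I f"
  using assms
proof (induction n arbitrary: f)
  case 0
  then show ?case using CP_cont by fastforce
next
  case (Suc n)
  have f': "fam n I (\<lambda>i. nth_deriv 1 (f i))"
  proof (rule Suc.IH)
    show "CP n (nth_deriv 1 (f i))" if "i \<in> I" for i using Suc.prems(1)[OF that] by (rule CP_deriv)
    show "\<bar>nth_deriv j (nth_deriv 1 (f i)) x\<bar> \<le> B" if "i \<in> I" "j \<le> n" for i j x
      using Suc.prems(2)[OF that(1), of "Suc j" x] that(2) unfolding nth_deriv_Suc[of j] by simp
  qed
  have "\<forall>i\<in>I. \<forall>x. \<bar>f i x\<bar> \<le> B" using Suc.prems(2)[of _ 0] by simp
  moreover have "\<forall>i\<in>I. \<forall>x. (f i has_real_derivative nth_deriv 1 (f i) x) (at x)"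
    using CP_D0[OF Suc.prems(1)] by blast
  ultimately show ?case using f' by auto
qed

text \<open>Two derivatives are lost because \<open>\<Psi>\<close> contains second derivatives of
  the perturbation. The inverse \<open>\<sigma>\<close> enters through \<open>fam_compose\<close>,
  the rest through the closure rules.\<close>

lemma fam_near_circle:
  assumes nc: "\<And>i. i \<in> I \<Longrightarrow> near_circle (a i) (b i)" and a: "fam (n + 2) I a" and b: "fam (n + 2) I b"
  shows "fam n I (\<lambda>i. near_circle.h (a i) (b i))"
proof -
  have d: "fam n I a" "fam n I b" "fam n I (\<lambda>i. nth_deriv 1 (a i))" "fam n I (\<lambda>i. nth_deriv 1 (b i))"
    "fam n I (\<lambda>i. nth_deriv 2 (a i))" "fam n I (\<lambda>i. nth_deriv 2 (b i))"
    using fam_mono[OF a] fam_mono[OF b] fam_nth'[OF a] fam_nth'[OF b] by auto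
  have T: "fam n I (\<lambda>i. near_circle.Tn (a i) (b i))"
    by (rule fam_cong[OF fam_add[OF fam_diff[OF fam_const'[of n I 1] fam_mult[OF d(3) fam_sin]] fam_mult[OF d(4) fam_cos]]])
      (simp add: near_circle.Tn_def[OF nc] fun_eq_iff)
  have N: "fam n I (\<lambda>i. near_circle.Nn (a i) (b i))"
    by (rule fam_cong[OF fam_add[OF fam_mult[OF d(3) fam_cos] fam_mult[OF d(4) fam_sin]]])
      (simp add: near_circle.Nn_def[OF nc] fun_eq_iff)
  have T': "fam n I (\<lambda>i. near_circle.Tn' (a i) (b i))"
    by (rule fam_cong[OF fam_diff[OF fam_add[OF fam_diff[OF fam_mult[OF fam_minus[OF d(5)] fam_sin] fam_mult[OF d(3) fam_cos]]
        fam_mult[OF d(6) fam_cos]] fam_mult[OF d(4) fam_sin]]])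
      (simp add: near_circle.Tn'_def[OF nc] fun_eq_iff)
  have N': "fam n I (\<lambda>i. near_circle.Nn' (a i) (b i))"
    by (rule fam_cong[OF fam_add[OF fam_add[OF fam_diff[OF fam_mult[OF d(5) fam_cos] fam_mult[OF d(3) fam_sin]]
        fam_mult[OF d(6) fam_sin]] fam_mult[OF d(4) fam_cos]]])
      (simp add: near_circle.Nn'_def[OF nc] fun_eq_iff)
  have D: "fam n I (\<lambda>i s. ((near_circle.Nn (a i) (b i) s)\<^sup>2 + (near_circle.Tn (a i) (b i) s)\<^sup>2) powr - 1)"
    by (rule fam_powr[of _ _ _ "81 / 100"])
      (use fam_add[OF fam_mult[OF N N] fam_mult[OF T T]] near_circle.NT_lower[OF nc] in \<open>auto simp: power2_eq_square\<close>)
  have P: "fam n I (\<lambda>i. near_circle.\<Psi> (a i) (b i))"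
    by (rule fam_cong[OF fam_diff[OF fam_const'[of n I 1] fam_mult[OF fam_diff[OF fam_mult[OF N' T] fam_mult[OF N T']] D]]])
      (simp add: near_circle.\<Psi>_def[OF nc] fun_eq_iff)
  have P1: "fam n I (\<lambda>i s. near_circle.\<Psi> (a i) (b i) s powr - 1)"
    by (rule fam_powr[OF P, of "1 / 2"]) (use near_circle.\<Psi>_bd(1)[OF nc] in auto)
  note c = fam_compose[OF _ P1 near_circle.\<sigma>_deriv[OF nc]]
  have A: "fam n I (\<lambda>i \<theta>. cos (near_circle.\<sigma> (a i) (b i) \<theta>) + a i (near_circle.\<sigma> (a i) (b i) \<theta>))"
    by (rule c[OF fam_add[OF fam_cos d(1)]])
  have B: "fam n I (\<lambda>i \<theta>. sin (near_circle.\<sigma> (a i) (b i) \<theta>) + b i (near_circle.\<sigma> (a i) (b i) \<theta>))"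
    by (rule c[OF fam_add[OF fam_sin d(2)]])
  show ?thesis
    by (rule fam_cong[OF fam_add[OF fam_mult[OF fam_cos A] fam_mult[OF fam_sin B]]])
      (simp add: near_circle.h_def[OF nc] fun_eq_iff)
qed

lemma converging_parametrisation:
  assumes "converges_smoothly_to_unit_circle G"
  obtains a b d \<tau>\<^sub>1 where "\<And>\<tau>. \<tau> \<le> \<tau>\<^sub>1 \<Longrightarrow> near_circle (a \<tau>) (b \<tau>)"
    "\<And>\<tau>. \<tau> \<le> \<tau>\<^sub>1 \<Longrightarrow> range (near_circle.Y (a \<tau>) (b \<tau>)) = G \<tau>"
    "fam n {..\<tau>\<^sub>1} a" "fam n {..\<tau>\<^sub>1} b"
    "\<And>\<tau> s. \<tau> \<le> \<tau>\<^sub>1 \<Longrightarrow> \<bar>a \<tau> s\<bar> \<le> d \<tau>" "\<And>\<tau> s. \<tau> \<le> \<tau>\<^sub>1 \<Longrightarrow> \<bar>b \<tau> s\<bar> \<le> d \<tau>" "(d \<longlongrightarrow> (0::real)) at_bot"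
proof -
  obtain Y where Y: "\<forall>\<^sub>F \<tau> in at_bot. smooth_on UNIV (Y \<tau>) \<and> periodic_2pi (Y \<tau>) \<and> range (Y \<tau>) = G \<tau>"
    "\<And>k. ((\<lambda>\<tau>. Ck_norm k (\<lambda>s. Y \<tau> s - cis s)) \<longlongrightarrow> 0) at_bot"
    using assms unfolding converges_smoothly_to_unit_circle_def by blast
  define D where "D \<tau> s = Y \<tau> s - cis s" for \<tau> s
  \<comment> \<open>\<open>near_circle\<close> asks for three derivatives even if n is
    smaller.\<close>
  define m where "m = max n 3"
  define d where "d \<tau> = Ck_norm m (D \<tau>)" for \<tau>
  define a where "a \<tau> s = Re (D \<tau> s)" for \<tau> s
  define b where "b \<tau> s = Im (D \<tau> s)" for \<tau> s
  have d0: "(d \<longlongrightarrow> 0) at_bot" using Y(2)[of m] unfolding d_def D_def[abs_def] .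
  have "\<forall>\<^sub>F \<tau> in at_bot. d \<tau> < 1 / 20" using order_tendstoD(2)[OF d0, of "1 / 20"] by simp
  with Y(1) have "\<forall>\<^sub>F \<tau> in at_bot. (smooth_on UNIV (Y \<tau>) \<and> periodic_2pi (Y \<tau>) \<and> range (Y \<tau>) = G \<tau>) \<and> d \<tau> < 1 / 20"
    by (rule eventually_conj)
  then obtain \<tau>\<^sub>1 where 1: "\<And>\<tau>. \<tau> \<le> \<tau>\<^sub>1 \<Longrightarrow> smooth_on UNIV (Y \<tau>)" "\<And>\<tau>. \<tau> \<le> \<tau>\<^sub>1 \<Longrightarrow> periodic_2pi (Y \<tau>)"
    "\<And>\<tau>. \<tau> \<le> \<tau>\<^sub>1 \<Longrightarrow> range (Y \<tau>) = G \<tau>" "\<And>\<tau>. \<tau> \<le> \<tau>\<^sub>1 \<Longrightarrow> d \<tau> < 1 / 20"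
    unfolding eventually_at_bot_linorder by auto
  have C: "Ck_on m UNIV (D \<tau>)" if "\<tau> \<le> \<tau>\<^sub>1" for \<tau>
    using Ck_on_diff[of m "Y \<tau>" cis] Ck_on_cis[of m 1] 1(1)[OF that] by (simp add: D_def[abs_def] smooth_on_def)
  have p: "periodic_2pi (D \<tau>)" if "\<tau> \<le> \<tau>\<^sub>1" for \<tau>
    using 1(2)[OF that] by (simp add: periodic_2pi_def D_def cis_def complex_eq_iff)
  have pa: "periodic_2pi (\<lambda>s. Re (D \<tau> s))" "periodic_2pi (\<lambda>s. Im (D \<tau> s))" if "\<tau> \<le> \<tau>\<^sub>1" for \<tau>
    using p[OF that] by (simp_all add: periodic_2pi_def)
  have A: "CP m (a \<tau>)" "CP m (b \<tau>)" "\<And>j. j \<le> m \<Longrightarrow> nth_deriv j (a \<tau>) = (\<lambda>s. Re (nth_deriv j (D \<tau>) s))"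
    "\<And>j. j \<le> m \<Longrightarrow> nth_deriv j (b \<tau>) = (\<lambda>s. Im (nth_deriv j (D \<tau>) s))" if "\<tau> \<le> \<tau>\<^sub>1" for \<tau>
    using Ck_on_linear_CP[OF bounded_linear_Re C[OF that] pa(1)[OF that]] Ck_on_linear_CP[OF bounded_linear_Im C[OF that] pa(2)[OF that]]
    unfolding a_def[abs_def] b_def[abs_def] by blast+
  have ba: "\<bar>nth_deriv j (a \<tau>) s\<bar> \<le> d \<tau>" "\<bar>nth_deriv j (b \<tau>) s\<bar> \<le> d \<tau>" if "\<tau> \<le> \<tau>\<^sub>1" "j \<le> m" for \<tau> j s
    unfolding A(3,4)[OF that] d_def
    using Ck_norm_ge[OF C[OF that(1)] p[OF that(1)] that(2), of s] abs_Re_le_cmod abs_Im_le_cmod order_trans by blast+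
  have bb: "\<bar>nth_deriv j (a \<tau>) s\<bar> \<le> 1 / 20" "\<bar>nth_deriv j (b \<tau>) s\<bar> \<le> 1 / 20" if "\<tau> \<le> \<tau>\<^sub>1" "j \<le> m" for \<tau> j s
    using ba[OF that, of s] 1(4)[OF that(1)] by linarith+
  have nm: "n \<le> m" "3 \<le> m" by (auto simp: m_def)
  have nc: "near_circle (a \<tau>) (b \<tau>)" if t: "\<tau> \<le> \<tau>\<^sub>1" for \<tau>
    by unfold_locales (use CP_mono[OF A(1)[OF t] nm(2)] CP_mono[OF A(2)[OF t] nm(2)] bb[OF t] nm(2) in auto)
  show ?thesis
  proof (rule that[OF nc])
    fix \<tau> assume t: "\<tau> \<le> \<tau>\<^sub>1"
    have "near_circle.Y (a \<tau>) (b \<tau>) = Y \<tau>"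
      by (simp add: fun_eq_iff near_circle.Y_def[OF nc[OF t]] a_def b_def D_def complex_eq_iff)
    then show "range (near_circle.Y (a \<tau>) (b \<tau>)) = G \<tau>" using 1(3)[OF t] by simp
    fix s
    show "\<bar>a \<tau> s\<bar> \<le> d \<tau>" "\<bar>b \<tau> s\<bar> \<le> d \<tau>" using ba[OF t, of 0 s] by simp_all
  next
    show "fam n {..\<tau>\<^sub>1} a" "fam n {..\<tau>\<^sub>1} b"
      using fam_CPI[of "{..\<tau>\<^sub>1}" m a] A(1) bb(1) fam_CPI[of "{..\<tau>\<^sub>1}" m b] A(2) bb(2) fam_mono nm(1) by (metis atMost_iff)+
  qed (use d0 in auto)
qed

section \<open>Support functions and curvature\<close>

text \<open>A half-plane is convex, so if it contains the curve it contains its inside; and the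
  curve is the boundary of its inside, so the maximum is attained in the closure. The bound on
  interior points later excludes the outward normal.\<close>

lemma support_function_eq:
  fixes c :: "real \<Rightarrow> complex"
  assumes c: "simple_path c" "pathfinish c = pathstart c"
    and m: "\<And>z. z \<in> path_image c \<Longrightarrow> Complex (cos \<theta>) (sin \<theta>) \<bullet> z \<le> m"
    and z0: "z0 \<in> path_image c" "Complex (cos \<theta>) (sin \<theta>) \<bullet> z0 = m"
  shows "support_function (path_image c) \<theta> = m"
    and "\<And>z. z \<in> inside (path_image c) \<Longrightarrow> Complex (cos \<theta>) (sin \<theta>) \<bullet> z \<le> m"
proof -
  let ?e = "Complex (cos \<theta>) (sin \<theta>)" and ?S = "path_image c"
  note J = Jordan_inside_outside[OF c]
  have "- {z. ?e \<bullet> z \<le> m} \<subseteq> outside ?S"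
    by (rule outside_subset_convex[OF convex_halfspace_le]) (use m in auto)
  then have i: "inside ?S \<subseteq> {z. ?e \<bullet> z \<le> m}" using J by blast
  then show "\<And>z. z \<in> inside ?S \<Longrightarrow> ?e \<bullet> z \<le> m" by blast
  have cl: "closure (inside ?S) \<subseteq> {z. ?e \<bullet> z \<le> m}" by (rule closure_minimal[OF i closed_halfspace_le])
  have "frontier (inside ?S) = ?S" using J by blast
  then have "z0 \<in> closure (inside ?S)" using z0(1) by (auto simp: frontier_def)
  then show "support_function ?S \<theta> = m"
    unfolding support_function_def using cl z0(2) by (intro cSup_eq_maximum) auto
qed

text \<open>Twice the height over the squared tangential displacement tends to the curvature;
  l'Hopital's rule computes this limit in a given parametrisation.\<close>

lemma quadratic_ratio:
  fixes p q p' :: "real \<Rightarrow> real"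
  assumes p: "\<And>s. (p has_real_derivative p' s) (at s)" "(p' has_real_derivative A) (at s0)" "p s0 = 0" "p' s0 = 0"
    and q: "(q has_real_derivative B) (at s0)" "q s0 = 0" "B \<noteq> 0"
  shows "((\<lambda>s. 2 * p s / (q s)\<^sup>2) \<longlongrightarrow> A / B\<^sup>2) (at s0)"
proof -
  have ev: "\<forall>\<^sub>F s in at s0. s \<noteq> s0" by (simp add: eventually_at_filter)
  have P: "((\<lambda>s. p s / (s - s0)\<^sup>2) \<longlongrightarrow> A / 2) (at s0)"
  proof (rule lhopital[where f' = p' and g' = "\<lambda>s. 2 * (s - s0)"])
    show "(p \<longlongrightarrow> 0) (at s0)" using DERIV_isCont[OF p(1)] p(3) by (metis isContD)
    show "((\<lambda>s. (s - s0)\<^sup>2) \<longlongrightarrow> 0) (at s0)" by (auto intro!: tendsto_eq_intros)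
    show "\<forall>\<^sub>F s in at s0. (s - s0)\<^sup>2 \<noteq> 0" "\<forall>\<^sub>F s in at s0. 2 * (s - s0) \<noteq> 0"
      using ev by (auto elim: eventually_mono)
    show "\<forall>\<^sub>F s in at s0. (p has_real_derivative p' s) (at s)" using p(1) by simp
    show "\<forall>\<^sub>F s in at s0. ((\<lambda>s. (s - s0)\<^sup>2) has_real_derivative 2 * (s - s0)) (at s)"
      by (auto intro!: derivative_eq_intros always_eventually)
    have "((\<lambda>s. (p' s - p' s0) / (s - s0)) \<longlongrightarrow> A) (at s0)" using p(2) unfolding has_field_derivative_iff .
    from tendsto_mult_left[OF this, of "1 / 2"]
    show "((\<lambda>s. p' s / (2 * (s - s0))) \<longlongrightarrow> A / 2) (at s0)" using p(4) by (simp add: field_simps)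
  qed
  have Q: "((\<lambda>s. q s / (s - s0)) \<longlongrightarrow> B) (at s0)" using q(1) unfolding has_field_derivative_iff q(2) by simp
  have "((\<lambda>s. 2 * (p s / (s - s0)\<^sup>2) / (q s / (s - s0))\<^sup>2) \<longlongrightarrow> 2 * (A / 2) / B\<^sup>2) (at s0)"
    by (intro tendsto_intros P Q) (use q(3) in simp)
  moreover have "\<forall>\<^sub>F s in at s0. 2 * (p s / (s - s0)\<^sup>2) / (q s / (s - s0))\<^sup>2 = 2 * p s / (q s)\<^sup>2"
    using ev by (rule eventually_mono) (simp add: power_divide)
  ultimately have "((\<lambda>s. 2 * p s / (q s)\<^sup>2) \<longlongrightarrow> 2 * (A / 2) / B\<^sup>2) (at s0)" by (rule Lim_transform_eventually)
  then show ?thesis by simp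
qed

text \<open>Both parametrisations pass through the same points near \<open>Z \<theta>\<^sub>0 = x s\<^sub>0\<close>, and the ratio of normal
  to squared tangential displacement of a point determines the curvature in either of them.\<close>

lemma curvature_match:
  fixes x x1 x2 Z :: "real \<Rightarrow> complex"
  assumes x: "periodic_2pi x" "inj_on x {0..<2 * pi}" 
    "\<And>s. (x has_vector_derivative x1 s) (at s)" "\<And>s. (x1 has_vector_derivative x2 s) (at s)"
    and Z: "\<And>\<theta>. Z \<theta> \<in> range x" "\<And>\<theta>. (Z has_vector_derivative W \<theta> *\<^sub>R Complex (- sin \<theta>) (cos \<theta>)) (at \<theta>)"
    and W: "cont W" "W \<theta>\<^sub>0 > 0"
    and 0: "Z \<theta>\<^sub>0 = x s\<^sub>0" "Complex (cos \<theta>\<^sub>0) (sin \<theta>\<^sub>0) \<bullet> x1 s\<^sub>0 = 0" "x1 s\<^sub>0 \<noteq> 0"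
  shows "- (Complex (cos \<theta>\<^sub>0) (sin \<theta>\<^sub>0) \<bullet> x2 s\<^sub>0) / (norm (x1 s\<^sub>0))\<^sup>2 = 1 / W \<theta>\<^sub>0"
proof -
  define e where "e = Complex (cos \<theta>\<^sub>0) (sin \<theta>\<^sub>0)"
  define f where "f = Complex (- sin \<theta>\<^sub>0) (cos \<theta>\<^sub>0)"
  define R where "R z = 2 * (e \<bullet> (x s\<^sub>0 - z)) / (f \<bullet> (z - x s\<^sub>0))\<^sup>2" for z
  have nf: "(e \<bullet> z)\<^sup>2 + (f \<bullet> z)\<^sup>2 = (norm z)\<^sup>2" for z
  proof -
    have "(c * u + s * v)\<^sup>2 + (- s * u + c * v)\<^sup>2 = (s\<^sup>2 + c\<^sup>2) * (u\<^sup>2 + v\<^sup>2)" for c s u v :: real by algebra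
    then have "(e \<bullet> z)\<^sup>2 + (f \<bullet> z)\<^sup>2 = ((sin \<theta>\<^sub>0)\<^sup>2 + (cos \<theta>\<^sub>0)\<^sup>2) * ((Re z)\<^sup>2 + (Im z)\<^sup>2)"
      by (simp only: e_def f_def inner_complex_def complex.sel)
    then show ?thesis by (simp add: cmod_power2)
  qed
  have fx: "(f \<bullet> x1 s\<^sub>0)\<^sup>2 = (norm (x1 s\<^sub>0))\<^sup>2" using nf[of "x1 s\<^sub>0"] 0(2) by (simp add: e_def)
  have dinner: "((\<lambda>t. w \<bullet> (y t - c)) has_real_derivative w \<bullet> y') (at t)" "((\<lambda>t. w \<bullet> (c - y t)) has_real_derivative - (w \<bullet> y')) (at t)"
    if "(y has_vector_derivative y') (at t)" for w c y' :: complex and y t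
  proof -
    have "((\<lambda>t. w \<bullet> y t) has_vector_derivative w \<bullet> y') (at t)"
      by (rule bounded_linear.has_vector_derivative[OF bounded_linear_inner_right that])
    then have d: "((\<lambda>t. w \<bullet> y t) has_real_derivative w \<bullet> y') (at t)" by (simp add: has_real_derivative_iff_has_vector_derivative)
    show "((\<lambda>t. w \<bullet> (y t - c)) has_real_derivative w \<bullet> y') (at t)" "((\<lambda>t. w \<bullet> (c - y t)) has_real_derivative - (w \<bullet> y')) (at t)"
      unfolding inner_diff_right using DERIV_diff[OF d DERIV_const[of "w \<bullet> c"]] DERIV_diff[OF DERIV_const[of "w \<bullet> c"] d] by simp_all
  qed
  have Rx: "((\<lambda>s. R (x s)) \<longlongrightarrow> - (e \<bullet> x2 s\<^sub>0) / (f \<bullet> x1 s\<^sub>0)\<^sup>2) (at s\<^sub>0)"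
    unfolding R_def
  proof (rule quadratic_ratio)
    show "((\<lambda>s. e \<bullet> (x s\<^sub>0 - x s)) has_real_derivative e \<bullet> (0 - x1 s)) (at s)" for s using dinner(2)[OF x(3)] by simp
    show "((\<lambda>s. e \<bullet> (0 - x1 s)) has_real_derivative - (e \<bullet> x2 s\<^sub>0)) (at s\<^sub>0)" by (rule dinner(2)[OF x(4)])
    show "((\<lambda>s. f \<bullet> (x s - x s\<^sub>0)) has_real_derivative f \<bullet> x1 s\<^sub>0) (at s\<^sub>0)" by (rule dinner(1)[OF x(3)])
    show "f \<bullet> x1 s\<^sub>0 \<noteq> 0" using fx 0(3) by auto
  qed (use 0(2) in \<open>auto simp: e_def\<close>)
  have RZ: "((\<lambda>\<theta>. R (Z \<theta>)) \<longlongrightarrow> W \<theta>\<^sub>0 / (W \<theta>\<^sub>0)\<^sup>2) (at \<theta>\<^sub>0)"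
    unfolding R_def 0(1)[symmetric]
  proof (rule quadratic_ratio)
    show "((\<lambda>\<theta>. e \<bullet> (Z \<theta>\<^sub>0 - Z \<theta>)) has_real_derivative W \<theta> * sin (\<theta> - \<theta>\<^sub>0)) (at \<theta>)" for \<theta>
      by (rule DERIV_cong[OF dinner(2)[OF Z(2)]]) (simp add: e_def inner_complex_def sin_diff algebra_simps)
    have "((\<lambda>\<theta>. sin (\<theta> - \<theta>\<^sub>0)) has_real_derivative 1) (at \<theta>\<^sub>0)" by (auto intro!: derivative_eq_intros)
    then have "((\<lambda>\<theta>. sin (\<theta> - \<theta>\<^sub>0) / (\<theta> - \<theta>\<^sub>0)) \<longlongrightarrow> 1) (at \<theta>\<^sub>0)" unfolding has_field_derivative_iff by simp
    moreover have "(W \<longlongrightarrow> W \<theta>\<^sub>0) (at \<theta>\<^sub>0)" using W(1) by (auto simp: continuous_on_eq_continuous_at isCont_def)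
    ultimately have "((\<lambda>\<theta>. W \<theta> * (sin (\<theta> - \<theta>\<^sub>0) / (\<theta> - \<theta>\<^sub>0))) \<longlongrightarrow> W \<theta>\<^sub>0 * 1) (at \<theta>\<^sub>0)" by (intro tendsto_mult)
    then show "((\<lambda>\<theta>. W \<theta> * sin (\<theta> - \<theta>\<^sub>0)) has_real_derivative W \<theta>\<^sub>0) (at \<theta>\<^sub>0)" unfolding has_field_derivative_iff by simp
    have "- s * (w * - s) + c * (w * c) = w * (s\<^sup>2 + c\<^sup>2)" for s c w :: real by algebra
    then have "f \<bullet> (W \<theta>\<^sub>0 *\<^sub>R Complex (- sin \<theta>\<^sub>0) (cos \<theta>\<^sub>0)) = W \<theta>\<^sub>0 * ((sin \<theta>\<^sub>0)\<^sup>2 + (cos \<theta>\<^sub>0)\<^sup>2)"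
      by (simp only: f_def inner_complex_def complex.sel scaleR_complex.sel)
    then have "f \<bullet> (W \<theta>\<^sub>0 *\<^sub>R Complex (- sin \<theta>\<^sub>0) (cos \<theta>\<^sub>0)) = W \<theta>\<^sub>0" by simp
    then show "((\<lambda>\<theta>. f \<bullet> (Z \<theta> - Z \<theta>\<^sub>0)) has_real_derivative W \<theta>\<^sub>0) (at \<theta>\<^sub>0)" using dinner(1)[OF Z(2)[of \<theta>\<^sub>0], of f] by metis
  qed (use W(2) in auto)
  have Zc: "isCont Z \<theta>\<^sub>0" using Z(2) has_vector_derivative_continuous by blast
  have xc: "isCont x s" for s using x(3) has_vector_derivative_continuous by blast
  \<comment> \<open>The points \<open>Z (\<theta> n)\<close> approach the common point. Their
    preimages under x are taken in a window of half-width pi around \<open>s\<^sub>0\<close>, so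
    injectivity on a period leaves \<open>s\<^sub>0\<close> as the only possible limit.\<close>
  define \<theta> where "\<theta> n = \<theta>\<^sub>0 + 1 / real (Suc n)" for n
  have th: "\<theta> \<longlonglongrightarrow> \<theta>\<^sub>0" "\<And>n. \<theta> n \<noteq> \<theta>\<^sub>0" 
    unfolding \<theta>_def using tendsto_add[OF tendsto_const LIMSEQ_inverse_real_of_nat, of \<theta>\<^sub>0] by (auto simp: inverse_eq_divide)
  have per: "periodic_2pi (\<lambda>s. x (s + (s\<^sub>0 - pi)))" 
    unfolding periodic_2pi_def
  proof
    fix t
    have "x ((t + (s\<^sub>0 - pi)) + 2 * pi) = x (t + (s\<^sub>0 - pi))" using x(1) unfolding periodic_2pi_def by blast
    then show "x (t + 2 * pi + (s\<^sub>0 - pi)) = x (t + (s\<^sub>0 - pi))" by (simp only: add_ac)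
  qed
  have "\<exists>s\<in>{s\<^sub>0 - pi..s\<^sub>0 + pi}. x s = Z (\<theta> n)" for n
  proof -
    obtain s where s: "Z (\<theta> n) = x s" using Z(1) by blast
    obtain y where "y \<in> {0..<2 * pi}" "x (y + (s\<^sub>0 - pi)) = x (s - (s\<^sub>0 - pi) + (s\<^sub>0 - pi))"
      using periodic_reduce[OF per, of "s - (s\<^sub>0 - pi)"] by metis
    then show ?thesis using s by (intro bexI[of _ "y + (s\<^sub>0 - pi)"]) auto
  qed
  then obtain s where s: "\<And>n. s n \<in> {s\<^sub>0 - pi..s\<^sub>0 + pi}" "\<And>n. x (s n) = Z (\<theta> n)" by metis
  obtain l r where r: "l \<in> {s\<^sub>0 - pi..s\<^sub>0 + pi}" "strict_mono (r :: nat \<Rightarrow> nat)" "(s \<circ> r) \<longlonglongrightarrow> l"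
    using compact_Icc[of "s\<^sub>0 - pi" "s\<^sub>0 + pi"] s(1) unfolding compact_def by metis
  have thr: "(\<lambda>n. \<theta> (r n)) \<longlonglongrightarrow> \<theta>\<^sub>0" using LIMSEQ_subseq_LIMSEQ[OF th(1) r(2)] by (simp add: o_def)
  have "(\<lambda>n. x (s (r n))) \<longlonglongrightarrow> x l" using isCont_tendsto_compose[OF xc r(3)] by (simp add: o_def)
  moreover have "(\<lambda>n. x (s (r n))) \<longlonglongrightarrow> Z \<theta>\<^sub>0" unfolding s(2) by (rule isCont_tendsto_compose[OF Zc thr])
  ultimately have "x l = x s\<^sub>0" using LIMSEQ_unique 0(1) by metis
  obtain u k where u: "u \<in> {0..<2 * pi}" "x u = x l" "u = l + 2 * pi * of_int k" using periodic_reduce[OF x(1), of l] by metis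
  obtain w j where w: "w \<in> {0..<2 * pi}" "x w = x s\<^sub>0" "w = s\<^sub>0 + 2 * pi * of_int j" using periodic_reduce[OF x(1), of s\<^sub>0] by metis
  have "u = w" using inj_onD[OF x(2)] u w \<open>x l = x s\<^sub>0\<close> by metis
  then have ls: "l - s\<^sub>0 = 2 * pi * of_int (j - k)" using u(3) w(3) by (simp add: algebra_simps)
  have "\<bar>2 * pi * of_int (j - k)\<bar> \<le> pi" unfolding ls[symmetric] using r(1) by auto
  then have "2 * pi * \<bar>of_int (j - k)\<bar> \<le> pi * 1" by (simp add: abs_mult del: of_int_diff)
  then have "\<bar>real_of_int (j - k)\<bar> \<le> 1 / 2" using pi_gt_zero by simp
  then have "j - k = 0" by linarith
  then have l: "l = s\<^sub>0" using ls by simp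
  have sr: "(\<lambda>n. s (r n)) \<longlonglongrightarrow> s\<^sub>0" using r(3) l by (simp add: o_def)
  have z: "filterlim (\<lambda>n. \<theta> (r n)) (at \<theta>\<^sub>0) sequentially" using thr th(2) by (simp add: filterlim_at)
  from filterlim_compose[OF RZ z] have R1: "(\<lambda>n. R (Z (\<theta> (r n)))) \<longlonglongrightarrow> W \<theta>\<^sub>0 / (W \<theta>\<^sub>0)\<^sup>2" .
  have "\<forall>\<^sub>F n in sequentially. R (Z (\<theta> (r n))) \<noteq> 0"
    by (rule tendsto_imp_eventually_ne[OF R1]) (use W(2) in simp)
  then have "\<forall>\<^sub>F n in sequentially. s (r n) \<noteq> s\<^sub>0"
    \<comment> \<open>\<open>R (x s\<^sub>0)\<close> is 0 / 0 = 0, so a nonzero ratio shows that the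
      parameter differs from \<open>s\<^sub>0\<close>.\<close>
    by (rule eventually_mono) (auto simp: s(2)[symmetric] R_def)
  then have y: "filterlim (\<lambda>n. s (r n)) (at s\<^sub>0) sequentially" using sr by (simp add: filterlim_at)
  from filterlim_compose[OF Rx y] have "(\<lambda>n. R (Z (\<theta> (r n)))) \<longlonglongrightarrow> - (e \<bullet> x2 s\<^sub>0) / (f \<bullet> x1 s\<^sub>0)\<^sup>2" unfolding s(2) .
  from LIMSEQ_unique[OF this R1] have "- (e \<bullet> x2 s\<^sub>0) / (norm (x1 s\<^sub>0))\<^sup>2 = W \<theta>\<^sub>0 / (W \<theta>\<^sub>0)\<^sup>2" unfolding fx .
  then show ?thesis unfolding e_def using W(2) by (simp add: power2_eq_square)
qed

lemma LIMSEQ_of_subseq: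
  fixes f :: "nat \<Rightarrow> 'a::metric_space"
  assumes "\<And>r. strict_mono r \<Longrightarrow> \<exists>r'. strict_mono (r' :: nat \<Rightarrow> nat) \<and> (\<lambda>n. f (r (r' n))) \<longlonglongrightarrow> l"
  shows "f \<longlonglongrightarrow> l"
proof (rule ccontr)
  assume "\<not> f \<longlonglongrightarrow> l"
  then obtain e where e: "e > 0" "\<And>N. \<exists>n\<ge>N. e \<le> dist (f n) l" unfolding lim_sequentially by (meson not_less)
  then have "infinite {n. e \<le> dist (f n) l}" unfolding infinite_nat_iff_unbounded_le by blast
  then obtain r :: "nat \<Rightarrow> nat" where r: "strict_mono r" "\<And>n. e \<le> dist (f (r n)) l"
    using infinite_enumerate[of "{n. e \<le> dist (f n) l}"] by (metis mem_Collect_eq)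
  obtain r' where "(\<lambda>n. f (r (r' n))) \<longlonglongrightarrow> l" using assms[OF r(1)] by blast
  then obtain N where "dist (f (r (r' N))) l < e" using e(1) unfolding lim_sequentially by blast
  then show False using r(2)[of "r' N"] by simp
qed

text \<open>The difference quotient of m lies between the one along a fixed maximiser at
  \<open>t\<^sub>0\<close> and the one along a maximiser at the nearby time. By compactness the
  latter accumulate at maximisers for \<open>t\<^sub>0\<close>, where the time derivative is
  D.\<close>

lemma deriv_max:
  fixes F Ft :: "real \<Rightarrow> real \<Rightarrow> real"
  assumes m: "\<And>s t. t < b \<Longrightarrow> F s t \<le> m t" "\<And>t. t < b \<Longrightarrow> \<exists>s\<in>{0..2 * pi}. F s t = m t"
    and d: "\<And>s t. t < b \<Longrightarrow> (F s has_real_derivative Ft s t) (at t)"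
    and c: "continuous_on (UNIV \<times> {..<b}) (\<lambda>(s, t). F s t)" "continuous_on (UNIV \<times> {..<b}) (\<lambda>(s, t). Ft s t)"
    and D: "\<And>s. F s t\<^sub>0 = m t\<^sub>0 \<Longrightarrow> Ft s t\<^sub>0 = D" and t0: "t\<^sub>0 < b"
  shows "(m has_real_derivative D) (at t\<^sub>0)"
proof -
  obtain s\<^sub>0 where s0: "F s\<^sub>0 t\<^sub>0 = m t\<^sub>0" using m(2)[OF t0] by blast
  have lim: "(\<lambda>n. G (s n) (t n)) \<longlonglongrightarrow> G l t\<^sub>0"
    if G: "continuous_on (UNIV \<times> {..<b}) (\<lambda>(s, t). G s t)" and st: "s \<longlonglongrightarrow> l" "t \<longlonglongrightarrow> t\<^sub>0" "\<And>n. t n < b"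
    for G :: "real \<Rightarrow> real \<Rightarrow> real" and s t :: "nat \<Rightarrow> real" and l
    using continuous_on_tendsto_compose[OF G tendsto_Pair[OF st(1,2)]] st(3) t0 by simp
  have key: "(\<lambda>n. (m (t n) - m t\<^sub>0) / (t n - t\<^sub>0)) \<longlonglongrightarrow> D" if t: "t \<longlonglongrightarrow> t\<^sub>0" "\<And>n. t n < b" "\<And>n. t n \<noteq> t\<^sub>0" for t :: "nat \<Rightarrow> real"
  proof -
    obtain s where s: "\<And>n. s n \<in> {0..2 * pi}" "\<And>n. F (s n) (t n) = m (t n)" using m(2)[OF t(2)] by metis
    have "\<exists>z. (F (s n) (t n) - F (s n) t\<^sub>0) / (t n - t\<^sub>0) = Ft (s n) z \<and> z < b \<and> \<bar>z - t\<^sub>0\<bar> \<le> \<bar>t n - t\<^sub>0\<bar>" for n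
    proof (cases "t n < t\<^sub>0")
      case True
      obtain z where "t n < z" "z < t\<^sub>0" "F (s n) t\<^sub>0 - F (s n) (t n) = (t\<^sub>0 - t n) * Ft (s n) z"
        using MVT2[OF True, of "F (s n)" "Ft (s n)"] d t0 by force
      then show ?thesis using t0 t(2)[of n] by (intro exI[of _ z]) (auto simp: field_simps)
    next
      case False
      then have l: "t\<^sub>0 < t n" using t(3)[of n] by simp
      obtain z where "t\<^sub>0 < z" "z < t n" "F (s n) (t n) - F (s n) t\<^sub>0 = (t n - t\<^sub>0) * Ft (s n) z"
        using MVT2[OF l, of "F (s n)" "Ft (s n)"] d t(2)[of n] by force
      then show ?thesis using t0 t(2)[of n] by (intro exI[of _ z]) (auto simp: field_simps)
    qed
    then obtain z where z: "\<And>n. (F (s n) (t n) - F (s n) t\<^sub>0) / (t n - t\<^sub>0) = Ft (s n) (z n)" "\<And>n. z n < b" "\<And>n. \<bar>z n - t\<^sub>0\<bar> \<le> \<bar>t n - t\<^sub>0\<bar>"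
      by metis
    have z0: "z \<longlonglongrightarrow> t\<^sub>0"
    proof (rule LIM_zero_cancel, rule tendsto_0_le)
        show "(\<lambda>n. t n - t\<^sub>0) \<longlonglongrightarrow> 0" using t(1) by (rule LIM_zero)
        show "\<forall>\<^sub>F n in sequentially. norm (z n - t\<^sub>0) \<le> norm (t n - t\<^sub>0) * 1" using z(3) by simp
      qed
    have "(\<lambda>n. Ft (s n) (z n)) \<longlonglongrightarrow> D"
    proof (rule LIMSEQ_of_subseq)
      fix r :: "nat \<Rightarrow> nat" assume r: "strict_mono r"
      obtain l r' where l: "strict_mono (r' :: nat \<Rightarrow> nat)" "((\<lambda>n. s (r n)) \<circ> r') \<longlonglongrightarrow> l"
        using compact_Icc[of 0 "2 * pi"] s(1) unfolding compact_def by metis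
      let ?q = "r \<circ> r'"
      have q: "strict_mono ?q" using r l(1) by (simp add: strict_mono_o)
      have sl: "(\<lambda>n. s (?q n)) \<longlonglongrightarrow> l" using l(2) by (simp add: o_def)
      have tl: "(\<lambda>n. t (?q n)) \<longlonglongrightarrow> t\<^sub>0" and zl: "(\<lambda>n. z (?q n)) \<longlonglongrightarrow> t\<^sub>0"
        using LIMSEQ_subseq_LIMSEQ[OF t(1) q] LIMSEQ_subseq_LIMSEQ[OF z0 q] by (simp_all add: o_def)
      have "F s\<^sub>0 (t (?q n)) \<le> F (s (?q n)) (t (?q n))" for n using m(1)[OF t(2), of s\<^sub>0 "?q n"] s(2) by simp
      then have "F s\<^sub>0 t\<^sub>0 \<le> F l t\<^sub>0"
        by (intro LIMSEQ_le[OF lim[OF c(1) tendsto_const tl t(2)] lim[OF c(1) sl tl t(2)]]) auto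
      then have "Ft l t\<^sub>0 = D" using D m(1)[OF t0, of l] s0 by simp
      then show "\<exists>r'. strict_mono r' \<and> (\<lambda>n. Ft (s (r (r' n))) (z (r (r' n)))) \<longlonglongrightarrow> D"
        using lim[OF c(2) sl zl z(2)] l(1) by auto
    qed
    moreover have "(\<lambda>n. (F s\<^sub>0 (t n) - F s\<^sub>0 t\<^sub>0) / (t n - t\<^sub>0)) \<longlonglongrightarrow> D"
    proof -
      have "((\<lambda>u. (F s\<^sub>0 u - F s\<^sub>0 t\<^sub>0) / (u - t\<^sub>0)) \<longlongrightarrow> D) (at t\<^sub>0)"
        using d[OF t0, of s\<^sub>0] unfolding has_field_derivative_iff D[OF s0] .
      moreover have "filterlim t (at t\<^sub>0) sequentially" using t by (simp add: filterlim_at)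
      ultimately show ?thesis by (rule filterlim_compose)
    qed
    ultimately have "(\<lambda>n. \<bar>Ft (s n) (z n) - D\<bar> + \<bar>(F s\<^sub>0 (t n) - F s\<^sub>0 t\<^sub>0) / (t n - t\<^sub>0) - D\<bar>) \<longlonglongrightarrow> 0 + 0"
      by (intro tendsto_add tendsto_rabs_zero LIM_zero)
    then have L: "(\<lambda>n. \<bar>Ft (s n) (z n) - D\<bar> + \<bar>(F s\<^sub>0 (t n) - F s\<^sub>0 t\<^sub>0) / (t n - t\<^sub>0) - D\<bar>) \<longlonglongrightarrow> 0" by simp
    have "\<bar>(m (t n) - m t\<^sub>0) / (t n - t\<^sub>0) - D\<bar> \<le> \<bar>Ft (s n) (z n) - D\<bar> + \<bar>(F s\<^sub>0 (t n) - F s\<^sub>0 t\<^sub>0) / (t n - t\<^sub>0) - D\<bar>" for n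
    proof -
      let ?u = "t n - t\<^sub>0" and ?A = "F (s n) (t n) - F (s n) t\<^sub>0" and ?B = "F s\<^sub>0 (t n) - F s\<^sub>0 t\<^sub>0" and ?m = "m (t n) - m t\<^sub>0"
      have "?B \<le> ?m" "?m \<le> ?A" using m(1)[OF t(2), of s\<^sub>0 n] m(1)[OF t0, of "s n"] s(2)[of n] s0 by auto
      then have "(?B / ?u \<le> ?m / ?u \<and> ?m / ?u \<le> ?A / ?u) \<or> (?A / ?u \<le> ?m / ?u \<and> ?m / ?u \<le> ?B / ?u)"
        using t(3)[of n] by (cases "?u > 0") (auto intro: divide_right_mono divide_right_mono_neg)
      then show ?thesis unfolding z(1)[symmetric] by argo
    qed
    then have "(\<lambda>n. (m (t n) - m t\<^sub>0) / (t n - t\<^sub>0) - D) \<longlonglongrightarrow> 0"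
      by (intro Lim_null_comparison[OF always_eventually L]) simp
    then show ?thesis by (rule LIM_zero_cancel)
  qed
  have T: "((\<lambda>t. (m t - m t\<^sub>0) / (t - t\<^sub>0)) \<longlongrightarrow> D) (at t\<^sub>0 within {..<b})"
    unfolding tendsto_at_iff_sequentially using key by (auto simp: o_def)
  then show ?thesis
    unfolding has_field_derivative_iff using at_within_open[of t\<^sub>0 "{..<b}"] t0 by simp
qed

section \<open>Evolution of the support function under the flow\<close>

lemma Ck_on_continuous: "Ck_on n S f \<Longrightarrow> continuous_on S f"
  by (cases n) (auto intro!: differentiable_imp_continuous_on simp: differentiable_on_def differentiable_at_withinI)

lemma Ck_on_subset: "Ck_on n S f \<Longrightarrow> S' \<subseteq> S \<Longrightarrow> Ck_on n S' f"
  by (induction n arbitrary: f) (auto intro: continuous_on_subset)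

lemma partial_derivatives:
  fixes F :: "real \<times> real \<Rightarrow> 'a::real_normed_vector"
  assumes "F differentiable (at (s, t))"
  shows "((\<lambda>s. F (s, t)) has_vector_derivative frechet_derivative F (at (s, t)) (1, 0)) (at s)"
    "((\<lambda>t. F (s, t)) has_vector_derivative frechet_derivative F (at (s, t)) (0, 1)) (at t)"
proof -
  let ?D = "frechet_derivative F (at (s, t))"
  have d: "(F has_derivative ?D) (at (s, t))" using assms frechet_derivative_works by blast
  then have l: "linear ?D" using has_derivative_linear by blast
  have "((\<lambda>s. (s, t)) has_derivative (\<lambda>h. (h, 0))) (at s)" by (auto intro!: derivative_eq_intros)
  from has_derivative_compose[OF this d]
  have c: "((\<lambda>s. F (s, t)) has_derivative (\<lambda>h. ?D (h, 0))) (at s)" .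
  have e: "(\<lambda>h. ?D (h, 0)) = (\<lambda>h. h *\<^sub>R ?D (1, 0))" 
    by (rule ext) (rule linear_scale[OF l, of _ "(1, 0)", unfolded scaleR_Pair real_scaleR_def mult_zero_right mult.right_neutral])
  show "((\<lambda>s. F (s, t)) has_vector_derivative ?D (1, 0)) (at s)" using c unfolding e has_vector_derivative_def .
  have "((\<lambda>t. (s, t)) has_derivative (\<lambda>h. (0, h))) (at t)" by (auto intro!: derivative_eq_intros)
  from has_derivative_compose[OF this d]
  have c: "((\<lambda>t. F (s, t)) has_derivative (\<lambda>h. ?D (0, h))) (at t)" .
  have e: "(\<lambda>h. ?D (0, h)) = (\<lambda>h. h *\<^sub>R ?D (0, 1))" 
    by (rule ext) (rule linear_scale[OF l, of _ "(0, 1)", unfolded scaleR_Pair real_scaleR_def mult_zero_right mult.right_neutral])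
  show "((\<lambda>t. F (s, t)) has_vector_derivative ?D (0, 1)) (at t)" using c unfolding e has_vector_derivative_def .
qed

lemma simple_loop:
  fixes x :: "real \<Rightarrow> complex"
  assumes "periodic_2pi x" "inj_on x {0..<2 * pi}" "continuous_on UNIV x"
  shows "simple_path (\<lambda>r. x (2 * pi * r))" "pathfinish (\<lambda>r. x (2 * pi * r)) = pathstart (\<lambda>r. x (2 * pi * r))"
    "path_image (\<lambda>r. x (2 * pi * r)) = range x"
proof -
  have x0: "x (2 * pi) = x 0" using assms(1) unfolding periodic_2pi_def by (metis add_0)
  show "simple_path (\<lambda>r. x (2 * pi * r))"
    unfolding simple_path_def path_def loop_free_def
  proof (intro conjI ballI impI)
    show "continuous_on {0..1} (\<lambda>r. x (2 * pi * r))"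
      by (rule continuous_on_compose2[OF assms(3)]) (auto intro!: continuous_intros)
    fix u w :: real assume u: "u \<in> {0..1}" and w: "w \<in> {0..1}" and e: "x (2 * pi * u) = x (2 * pi * w)"
    have r: "r \<in> {0..1} \<Longrightarrow> r \<noteq> 1 \<Longrightarrow> 2 * pi * r \<in> {0..<2 * pi}" for r :: real by auto
    have z: "0 \<in> {0..<2 * pi}" by simp
    have z: "w' = 0" if "w' \<in> {0..1}" "x (2 * pi * w') = x 0" "w' \<noteq> 1" for w'
      using inj_onD[OF assms(2) that(2) r[OF that(1,3)]] by simp
    consider "u = 1" "w = 1" | "u = 1" "w \<noteq> 1" | "u \<noteq> 1" "w = 1" | "u \<noteq> 1" "w \<noteq> 1" by blast
    then show "u = w \<or> u = 0 \<and> w = 1 \<or> u = 1 \<and> w = 0"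
    proof cases
      case 2 then show ?thesis using z[OF w] e x0 by simp
    next
      case 3 then show ?thesis using z[OF u] e x0 by simp
    next
      case 4 then show ?thesis using inj_onD[OF assms(2) e r[OF u] r[OF w]] by simp
    qed simp
  qed
  show "pathfinish (\<lambda>r. x (2 * pi * r)) = pathstart (\<lambda>r. x (2 * pi * r))"
    by (simp add: pathfinish_def pathstart_def x0)
  show "path_image (\<lambda>r. x (2 * pi * r)) = range x"
  proof
    show "range x \<subseteq> path_image (\<lambda>r. x (2 * pi * r))"
    proof clarify
      fix s
      obtain y where y: "y \<in> {0..<2 * pi}" "x y = x s" using periodic_reduce[OF assms(1), of s] by metis
      then show "x s \<in> path_image (\<lambda>r. x (2 * pi * r))"
        unfolding path_image_def by (intro image_eqI[of _ _ "y / (2 * pi)"]) auto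
    qed
  qed (auto simp: path_image_def)
qed

lemma (in near_circle) W_cont: "cont W"
proof -
  have c: "cont a1" "cont a2" "cont b1" "cont b2" "cont Tn" "cont Nn" "cont \<sigma>"
    using CP_contj[OF CPa, of 1] CP_contj[OF CPa, of 2] CP_contj[OF CPb, of 1] CP_contj[OF CPb, of 2]
      cont_deriv[OF Tn_deriv] cont_deriv[OF Nn_deriv] cont_deriv[OF \<sigma>_deriv] by auto
  have c': "cont Tn'" "cont Nn'"
    unfolding Tn'_def[abs_def] Nn'_def[abs_def] by (intro continuous_intros c)+
  have "cont \<rho>" unfolding \<rho>_def[abs_def] by (intro continuous_intros c)
  moreover have "cont (\<lambda>s. \<Psi> s powr - 1)"
  proof -
    have nz: "(Nn s)\<^sup>2 + (Tn s)\<^sup>2 \<noteq> 0" "\<Psi> s \<noteq> 0" for s using NT_lower[of s] \<Psi>_bd(1)[of s] by linarith+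
    have "cont (\<lambda>s. ((Nn s)\<^sup>2 + (Tn s)\<^sup>2) powr - 1)"
      by (intro continuous_on_powr continuous_intros c) (use nz in blast)
    then have "cont \<Psi>" unfolding \<Psi>_def[abs_def]
      by (intro continuous_on_diff continuous_on_mult continuous_on_const c c')
    then show ?thesis by (intro continuous_on_powr continuous_on_const) (use nz in blast)+
  qed
  ultimately show ?thesis
    unfolding W_def[abs_def] by (intro continuous_on_mult continuous_on_compose2[OF _ c(7)]) auto
qed

lemma (in near_circle) support_h:
  fixes x :: "real \<Rightarrow> complex"
  assumes "periodic_2pi x" "inj_on x {0..<2 * pi}" "continuous_on UNIV x" "range x = range Y"
  shows "support_function (range x) \<theta> = h \<theta>"
    and "\<And>z. z \<in> inside (range x) \<Longrightarrow> Complex (cos \<theta>) (sin \<theta>) \<bullet> z \<le> h \<theta>"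
proof -
  note L = simple_loop[OF assms(1-3)]
  have m: "Complex (cos \<theta>) (sin \<theta>) \<bullet> z \<le> h \<theta>" if "z \<in> range x" for z
    using that max_point(1) unfolding assms(4) by blast
  have "Z \<theta> \<in> range x" unfolding assms(4) Z_def by blast
  from support_function_eq[OF L(1,2), unfolded L(3), OF m this h_inner[symmetric]]
  show "support_function (range x) \<theta> = h \<theta>"
    "\<And>z. z \<in> inside (range x) \<Longrightarrow> Complex (cos \<theta>) (sin \<theta>) \<bullet> z \<le> h \<theta>" by blast+
qed

section \<open>Rescaling and the equation of the support function\<close>

definition scaling :: "real \<Rightarrow> real \<Rightarrow> real" where
  "scaling \<alpha> \<tau> = (1 + \<alpha>) powr (- 1 / (1 + \<alpha>)) * (- unscaled_time \<alpha> \<tau>) powr (- 1 / (1 + \<alpha>))"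

lemma scaling_eq: "\<alpha> > 0 \<Longrightarrow> scaling \<alpha> \<tau> = (1 + \<alpha>) powr (- 1 / (1 + \<alpha>)) * exp \<tau>"
proof -
  assume a: "\<alpha> > 0"
  then have "- 1 / (1 + \<alpha>) * (- (1 + \<alpha>) * \<tau>) = \<tau>" by (simp add: field_simps)
  then show ?thesis by (simp add: scaling_def unscaled_time_def powr_def)
qed

lemma scaling_pos: "\<alpha> > 0 \<Longrightarrow> scaling \<alpha> \<tau> > 0"
  by (simp add: scaling_eq)

text \<open>The time change has derivative (1 + \<alpha>) exp (- (1 + \<alpha>) \<tau>); it
  compensates the scaling of length and of curvature to the power \<alpha>, so the rescaled equation
  has coefficient 1.\<close>

lemma scaling_powr: "\<alpha> > 0 \<Longrightarrow> scaling \<alpha> \<tau> * scaling \<alpha> \<tau> powr \<alpha> * ((1 + \<alpha>) * exp (- (1 + \<alpha>) * \<tau>)) = 1"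
proof -
  assume a: "\<alpha> > 0"
  have "scaling \<alpha> \<tau> * scaling \<alpha> \<tau> powr \<alpha> = scaling \<alpha> \<tau> powr (1 + \<alpha>)"
    using scaling_pos[OF a, of \<tau>] by (simp add: powr_add)
  also have "\<dots> = ((1 + \<alpha>) powr (- 1 / (1 + \<alpha>))) powr (1 + \<alpha>) * exp \<tau> powr (1 + \<alpha>)"
    by (simp add: scaling_eq[OF a] powr_mult)
  also have "((1 + \<alpha>) powr (- 1 / (1 + \<alpha>))) powr (1 + \<alpha>) = inverse (1 + \<alpha>)"
  proof -
    have "- 1 / (1 + \<alpha>) * (1 + \<alpha>) = - 1" using a by simp
    then show ?thesis using a by (simp only: powr_powr) (simp add: powr_minus)
  qed
  also have "exp \<tau> powr (1 + \<alpha>) = exp ((1 + \<alpha>) * \<tau>)" by (simp add: powr_def)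
  finally have "scaling \<alpha> \<tau> * scaling \<alpha> \<tau> powr \<alpha> * ((1 + \<alpha>) * exp (- (1 + \<alpha>) * \<tau>)) =
      exp ((1 + \<alpha>) * \<tau> + - (1 + \<alpha>) * \<tau>)" using a by (simp add: exp_add)
  then show ?thesis by (simp add: algebra_simps)
qed

lemma unscaled_time_mono: "\<alpha> > 0 \<Longrightarrow> unscaled_time \<alpha> \<tau> < unscaled_time \<alpha> \<tau>' \<longleftrightarrow> \<tau> < \<tau>'"
  by (simp add: unscaled_time_def)

text \<open>Time bounds are strict, so the domain is open and two-sided derivatives make sense at
  each of its points. The flow keeps its own parametrisation, which is tied to
  \<open>near_circle.Y\<close> only as a set.\<close>

locale flow_near_circle =
  fixes \<alpha> \<tau>\<^sub>1 :: real and X :: "real \<Rightarrow> real \<Rightarrow> complex" and a b :: "real \<Rightarrow> real \<Rightarrow> real"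
  assumes apos: "\<alpha> > 0"
    and C2: "Ck_on 2 {p. snd p < unscaled_time \<alpha> \<tau>\<^sub>1} (\<lambda>p. X (fst p) (snd p))"
    and emb: "\<And>t. t < unscaled_time \<alpha> \<tau>\<^sub>1 \<Longrightarrow> closed_convex_embedding (\<lambda>s. X s t)"
    and flow: "\<And>s t. t < unscaled_time \<alpha> \<tau>\<^sub>1 \<Longrightarrow> \<exists>N. inward_unit_normal (\<lambda>s. X s t) s N \<and>
              ((\<lambda>t'. X s t') has_vector_derivative (curvature_wrt (\<lambda>s. X s t) s N powr \<alpha>) *\<^sub>R N) (at t)"
    and nc: "\<And>\<tau>. \<tau> < \<tau>\<^sub>1 \<Longrightarrow> near_circle (a \<tau>) (b \<tau>)"
    and rng: "\<And>\<tau>. \<tau> < \<tau>\<^sub>1 \<Longrightarrow> range (near_circle.Y (a \<tau>) (b \<tau>)) = range (\<lambda>s. scaling \<alpha> \<tau> *\<^sub>R X s (unscaled_time \<alpha> \<tau>))"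
begin

abbreviation "tb \<equiv> unscaled_time \<alpha> \<tau>\<^sub>1"

text \<open>Partial derivatives are taken as values of the Frechet derivative: \<open>Ck_on\<close>
  then supplies the joint continuity that \<open>deriv_max\<close> requires.\<close>

definition "F = (\<lambda>p. X (fst p) (snd p))"
definition "Fs = (\<lambda>p. frechet_derivative F (at p) (1, 0))"
definition "Ft = (\<lambda>p. frechet_derivative F (at p) (0, 1))"
definition "Fss = (\<lambda>p. frechet_derivative Fs (at p) (1, 0))"

lemma diffs: "t < tb \<Longrightarrow> F differentiable (at (s, t))" "t < tb \<Longrightarrow> Fs differentiable (at (s, t))"
  "continuous_on {p. snd p < tb} F" "continuous_on {p. snd p < tb} Ft"
proof -
  have c: "Ck_on (Suc (Suc 0)) {p. snd p < tb} F" using C2 by (simp only: F_def numeral_2_eq_2)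
  then have 1: "Ck_on (Suc 0) {p. snd p < tb} Fs" "Ck_on (Suc 0) {p. snd p < tb} Ft"
    unfolding Ck_on.simps(2)[of "Suc 0"] Fs_def Ft_def by blast+
  show "t < tb \<Longrightarrow> F differentiable (at (s, t))" using c unfolding Ck_on.simps(2)[of "Suc 0"] by auto
  show "t < tb \<Longrightarrow> Fs differentiable (at (s, t))" using 1 by auto
  show "continuous_on {p. snd p < tb} F" "continuous_on {p. snd p < tb} Ft"
    using Ck_on_continuous c 1 by blast+
qed

lemma X_derivs:
  assumes "t < tb"
  shows "((\<lambda>s. X s t) has_vector_derivative Fs (s, t)) (at s)" "((\<lambda>s. Fs (s, t)) has_vector_derivative Fss (s, t)) (at s)"
    "((\<lambda>t. X s t) has_vector_derivative Ft (s, t)) (at t)"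
  using partial_derivatives[OF diffs(1)[OF assms], of s] partial_derivatives(1)[OF diffs(2)[OF assms], of s]
  by (simp_all add: Fs_def Ft_def Fss_def F_def)

lemma X_nth: assumes "t < tb" shows "nth_deriv 1 (\<lambda>s. X s t) = (\<lambda>s. Fs (s, t))" "nth_deriv 2 (\<lambda>s. X s t) = (\<lambda>s. Fss (s, t))"
proof -
  show 1: "nth_deriv 1 (\<lambda>s. X s t) = (\<lambda>s. Fs (s, t))"
    using vector_derivative_at[OF X_derivs(1)[OF assms]] by (simp add: nth_deriv_Suc_at[of 0, simplified] fun_eq_iff)
  show "nth_deriv 2 (\<lambda>s. X s t) = (\<lambda>s. Fss (s, t))"
  proof
    fix s
    have "nth_deriv (Suc 1) (\<lambda>s. X s t) s = Fss (s, t)"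
      unfolding nth_deriv_Suc_at 1 by (rule vector_derivative_at[OF X_derivs(2)[OF assms]])
    then show "nth_deriv 2 (\<lambda>s. X s t) s = Fss (s, t)" by (simp add: numeral_2_eq_2)
  qed
qed

lemma X_cont: "t < tb \<Longrightarrow> continuous_on UNIV (\<lambda>s. X s t)"
  by (intro continuous_at_imp_continuous_on ballI has_vector_derivative_continuous[OF X_derivs(1)])

lemma scaled_curve:
  assumes "\<tau> < \<tau>\<^sub>1"
  defines "x \<equiv> \<lambda>s. scaling \<alpha> \<tau> *\<^sub>R X s (unscaled_time \<alpha> \<tau>)"
  shows "periodic_2pi x" "inj_on x {0..<2 * pi}" "continuous_on UNIV x"
proof -
  have t: "unscaled_time \<alpha> \<tau> < tb" using assms(1) unscaled_time_mono[OF apos] by blast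
  show "periodic_2pi x" "inj_on x {0..<2 * pi}"
    using emb[OF t] scaling_pos[OF apos, of \<tau>] by (auto simp: closed_convex_embedding_def periodic_2pi_def inj_on_def x_def)
  show "continuous_on UNIV x" unfolding x_def by (intro continuous_intros X_cont[OF t])
qed

abbreviation "H \<tau> \<equiv> near_circle.h (a \<tau>) (b \<tau>)"
abbreviation "V \<tau> \<equiv> near_circle.W (a \<tau>) (b \<tau>)"

lemma support_H:
  assumes "\<tau> < \<tau>\<^sub>1"
  shows "support_function (range (\<lambda>s. scaling \<alpha> \<tau> *\<^sub>R X s (unscaled_time \<alpha> \<tau>))) \<theta> = H \<tau> \<theta>"
  by (rule near_circle.support_h(1)[OF nc[OF assms] scaled_curve[OF assms] rng[OF assms, symmetric]])

lemma inside_bound: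
  assumes "\<tau> < \<tau>\<^sub>1" "z \<in> inside (range (\<lambda>s. X s (unscaled_time \<alpha> \<tau>)))"
  shows "Complex (cos \<theta>) (sin \<theta>) \<bullet> z \<le> H \<tau> \<theta> / scaling \<alpha> \<tau>"
proof -
  let ?x = "\<lambda>s. X s (unscaled_time \<alpha> \<tau>)" and ?k = "scaling \<alpha> \<tau>"
  have t: "unscaled_time \<alpha> \<tau> < tb" using assms(1) unscaled_time_mono[OF apos] by blast
  have k: "?k > 0" using scaling_pos[OF apos] .
  have p: "periodic_2pi ?x" "inj_on ?x {0..<2 * pi}" "continuous_on UNIV ?x"
    using emb[OF t] X_cont[OF t] by (auto simp: closed_convex_embedding_def)
  interpret N: near_circle "a \<tau>" "b \<tau>" by (rule nc[OF assms(1)])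
  have sc: "?k *\<^sub>R ?x s \<in> range N.Y" for s using rng[OF assms(1)] by auto
  have le: "Complex (cos \<theta>) (sin \<theta>) \<bullet> ?x s \<le> H \<tau> \<theta> / ?k" for s
  proof -
    obtain r where "?k *\<^sub>R ?x s = N.Y r" using sc by blast
    then have "?k * (Complex (cos \<theta>) (sin \<theta>) \<bullet> ?x s) \<le> H \<tau> \<theta>" using N.max_point(1)[of \<theta> r] by (metis inner_scaleR_right)
    then show ?thesis using k by (simp add: field_simps)
  qed
  have "N.Z \<theta> \<in> range (\<lambda>s. ?k *\<^sub>R ?x s)" using rng[OF assms(1)] by (auto simp: N.Z_def)
  then obtain s where s: "N.Z \<theta> = ?k *\<^sub>R ?x s" by blast
  have "Complex (cos \<theta>) (sin \<theta>) \<bullet> ?x s = H \<tau> \<theta> / ?k"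
    using N.h_inner[of \<theta>] k unfolding s by simp
  with le show ?thesis
    using support_function_eq(2)[OF simple_loop(1,2)[OF p], of \<theta> "H \<tau> \<theta> / ?k" "?x s" z] assms(2)
    unfolding simple_loop(3)[OF p] by auto
qed

text \<open>At a highest point in direction e the tangent is orthogonal to e, so the normal is e or
  - e; with e, interior points would lie beyond the support line, against
  \<open>inside_bound\<close>. The curvature comes from the normal angle parametrisation through
  \<open>curvature_match\<close>.\<close>

lemma speed_at_max:
  assumes "\<tau> < \<tau>\<^sub>1" and m: "Complex (cos \<theta>) (sin \<theta>) \<bullet> X s (unscaled_time \<alpha> \<tau>) = H \<tau> \<theta> / scaling \<alpha> \<tau>"
  shows "Complex (cos \<theta>) (sin \<theta>) \<bullet> Ft (s, unscaled_time \<alpha> \<tau>) = - ((scaling \<alpha> \<tau> / V \<tau> \<theta>) powr \<alpha>)"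
proof -
  define e where "e = Complex (cos \<theta>) (sin \<theta>)"
  define k where "k = scaling \<alpha> \<tau>"
  define t where "t = unscaled_time \<alpha> \<tau>"
  interpret N: near_circle "a \<tau>" "b \<tau>" by (rule nc[OF assms(1)])
  have t: "t < tb" using assms(1) unscaled_time_mono[OF apos] unfolding t_def by blast
  have k: "k > 0" using scaling_pos[OF apos] unfolding k_def .
  have e1: "e \<bullet> e = 1" by (simp add: e_def inner_complex_def power2_eq_square[symmetric])
  have rng': "range N.Y = range (\<lambda>s. k *\<^sub>R X s t)" using rng[OF assms(1)] by (simp add: k_def t_def)
  have max: "e \<bullet> X r t \<le> e \<bullet> X s t" for r
  proof -
    have "k *\<^sub>R X r t \<in> range N.Y" unfolding rng' by blast
    then obtain r' where "k *\<^sub>R X r t = N.Y r'" by blast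
    then have "k * (e \<bullet> X r t) \<le> H \<tau> \<theta>" using N.max_point(1)[of \<theta> r'] unfolding e_def by (metis inner_scaleR_right)
    then have "e \<bullet> X r t \<le> H \<tau> \<theta> / k" using k by (simp add: field_simps)
    then show ?thesis using m by (simp add: e_def t_def k_def)
  qed
  have es: "e \<bullet> Fs (s, t) = 0"
  proof -
    have "((\<lambda>r. e \<bullet> X r t) has_real_derivative e \<bullet> Fs (s, t)) (at s)"
      unfolding has_real_derivative_iff_has_vector_derivative
      by (rule bounded_linear.has_vector_derivative[OF bounded_linear_inner_right X_derivs(1)[OF t]])
    then show ?thesis by (rule DERIV_local_max[of _ _ _ 1]) (use max in auto)
  qed
  have F0: "Fs (s, t) \<noteq> 0" using emb[OF t] X_nth(1)[OF t] by (auto simp: closed_convex_embedding_def)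
  obtain N where N: "inward_unit_normal (\<lambda>s. X s t) s N"
    "((\<lambda>t'. X s t') has_vector_derivative (curvature_wrt (\<lambda>s. X s t) s N powr \<alpha>) *\<^sub>R N) (at t)"
    using flow[OF t] by blast
  have FtN: "Ft (s, t) = (curvature_wrt (\<lambda>s. X s t) s N powr \<alpha>) *\<^sub>R N"
    using vector_derivative_at[OF N(2)] vector_derivative_at[OF X_derivs(3)[OF t]] by metis
  have N1: "norm N = 1" "N \<bullet> Fs (s, t) = 0" "\<forall>\<^sub>F \<epsilon> in at_right 0. X s t + \<epsilon> *\<^sub>R N \<in> inside (range (\<lambda>s. X s t))"
    using N(1) X_nth(1)[OF t] unfolding inward_unit_normal_def by auto
  \<comment> \<open>In the plane, two vectors orthogonal to the same nonzero vector are
    parallel.\<close>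
  have par: "N = (e \<bullet> N) *\<^sub>R e"
  proof -
    have g: "n1 = (c * n1 + s * n2) * c \<and> n2 = (c * n1 + s * n2) * s"
      if "c * x + s * y = 0" "n1 * x + n2 * y = 0" "x \<noteq> 0 \<or> y \<noteq> 0" "s\<^sup>2 + c\<^sup>2 = 1" for c s x y n1 n2 :: real
    proof -
      have "(n1 * s - n2 * c) * x = 0" "(n1 * s - n2 * c) * y = 0" using that by algebra+
      then have "n1 * s = n2 * c" using that(3) by auto
      then show ?thesis using that(4) by algebra
    qed
    have "Re (Fs (s, t)) \<noteq> 0 \<or> Im (Fs (s, t)) \<noteq> 0" using F0 by (auto simp: complex_eq_iff)
    from g[OF _ _ this, of "cos \<theta>" "sin \<theta>" "Re N" "Im N"] es N1(2)
    show ?thesis by (simp add: complex_eq_iff e_def inner_complex_def)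
  qed
  have "(e \<bullet> N)\<^sup>2 = 1"
  proof -
    have "N \<bullet> N = 1" using N1(1) by (simp add: dot_square_norm)
    moreover have "N \<bullet> N = (e \<bullet> N) * (e \<bullet> N)" by (subst par) simp
    ultimately show ?thesis by (simp add: power2_eq_square)
  qed
  then have "e \<bullet> N = 1 \<or> e \<bullet> N = - 1" by (simp add: power2_eq_1_iff)
  moreover have "e \<bullet> N \<noteq> 1"
  proof
    assume 1: "e \<bullet> N = 1"
    obtain \<epsilon> where ep: "\<epsilon> > 0" "X s t + \<epsilon> *\<^sub>R N \<in> inside (range (\<lambda>s. X s t))"
      using N1(3) eventually_happens'[OF _ eventually_conj[OF N1(3) eventually_at_right_less[of 0]]] by auto
    have "e \<bullet> (X s t + \<epsilon> *\<^sub>R N) \<le> H \<tau> \<theta> / k" using inside_bound[OF assms(1)] ep(2) by (simp add: e_def k_def t_def)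
    then show False using m 1 ep(1) by (simp add: inner_add_right e_def k_def t_def)
  qed
  ultimately have Ne: "N = - e" using par by auto
  have kZ: "k *\<^sub>R X s t = N.Z \<theta>"
  proof -
    have "k *\<^sub>R X s t \<in> range N.Y" unfolding rng' by blast
    then obtain r where r: "k *\<^sub>R X s t = N.Y r" by blast
    have "e \<bullet> (k *\<^sub>R X s t) = H \<tau> \<theta>" using m k by (simp add: e_def t_def k_def)
    then show ?thesis using N.max_point(2)[of \<theta> r] unfolding r e_def by simp
  qed
  have dk: "((\<lambda>s. k *\<^sub>R f s) has_vector_derivative k *\<^sub>R f') (at r)" if "(f has_vector_derivative f') (at r)" for f :: "real \<Rightarrow> complex" and f' r
    by (rule bounded_linear.has_vector_derivative[OF bounded_linear_scaleR_right that])
  have "- (Complex (cos \<theta>) (sin \<theta>) \<bullet> (k *\<^sub>R Fss (s, t))) / (norm (k *\<^sub>R Fs (s, t)))\<^sup>2 = 1 / V \<tau> \<theta>"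
  proof (rule curvature_match[where x = "\<lambda>s. k *\<^sub>R X s t" and Z = N.Z and ?x1.0 = "\<lambda>s. k *\<^sub>R Fs (s, t)"])
    show "periodic_2pi (\<lambda>s. k *\<^sub>R X s t)" "inj_on (\<lambda>s. k *\<^sub>R X s t) {0..<2 * pi}"
      using scaled_curve[OF assms(1)] by (simp_all add: k_def t_def)
    show "N.Z \<theta> \<in> range (\<lambda>s. k *\<^sub>R X s t)" for \<theta> unfolding rng'[symmetric] N.Z_def by simp
    show "Complex (cos \<theta>) (sin \<theta>) \<bullet> k *\<^sub>R Fs (s, t) = 0" using es by (simp add: e_def)
    show "((\<lambda>s. k *\<^sub>R X s t) has_vector_derivative k *\<^sub>R Fs (r, t)) (at r)" for r by (rule dk[OF X_derivs(1)[OF t]])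
    show "((\<lambda>s. k *\<^sub>R Fs (s, t)) has_vector_derivative k *\<^sub>R Fss (r, t)) (at r)" for r by (rule dk[OF X_derivs(2)[OF t]])
    show "(N.Z has_vector_derivative V \<tau> \<theta> *\<^sub>R Complex (- sin \<theta>) (cos \<theta>)) (at \<theta>)" for \<theta> by (rule N.Z_deriv)
    show "cont (V \<tau>)" "0 < V \<tau> \<theta>" "N.Z \<theta> = k *\<^sub>R X s t" "k *\<^sub>R Fs (s, t) \<noteq> 0"
      using N.W_cont N.W_pos kZ F0 k by auto
  qed
  \<comment> \<open>Curvature scales inversely to length, so the factor k reappears on the
    right.\<close>
  then have "- (e \<bullet> Fss (s, t)) / (norm (Fs (s, t)))\<^sup>2 = k / V \<tau> \<theta>"
    using k N.W_pos[of \<theta>] F0 by (simp add: e_def[symmetric] field_simps power2_eq_square)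
  then have "curvature_wrt (\<lambda>s. X s t) s N = k / V \<tau> \<theta>"
    by (simp add: curvature_wrt_def X_nth[OF t] Ne inner_commute del: One_nat_def)
  then show ?thesis using FtN e1 by (simp add: Ne e_def[symmetric] k_def[symmetric] t_def[symmetric])
qed

text \<open>Before rescaling, the support function in a fixed direction is a maximum over the curve,
  so \<open>deriv_max\<close> applies with the speed from \<open>speed_at_max\<close>. The term H
  stems from the scaling factor, which is its own derivative in \<tau>.\<close>

lemma H_evolution:
  assumes "\<tau> < \<tau>\<^sub>1"
  shows "((\<lambda>\<tau>. H \<tau> \<theta>) has_real_derivative H \<tau> \<theta> - V \<tau> \<theta> powr - \<alpha>) (at \<tau>)"
proof -
  define e where "e = Complex (cos \<theta>) (sin \<theta>)"
  \<comment> \<open>\<open>rt\<close> inverts \<open>unscaled_time\<close>, and \<open>m\<close> is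
    the unscaled support function in the original time.\<close>
  define rt where "rt t = - ln (- t) / (1 + \<alpha>)" for t
  define m where "m t = H (rt t) \<theta> / scaling \<alpha> (rt t)" for t
  have rt: "rt (unscaled_time \<alpha> \<tau>) = \<tau>" for \<tau>
  proof -
    have "- (- (1 + \<alpha>) * \<tau>) / (1 + \<alpha>) = \<tau>" using apos by (simp only: mult_minus_left minus_minus) simp
    then show ?thesis by (simp only: rt_def unscaled_time_def minus_minus ln_exp)
  qed
  have rt': "unscaled_time \<alpha> (rt t) = t" if "t < 0" for t
  proof -
    have "- (1 + \<alpha>) * (- ln (- t) / (1 + \<alpha>)) = ln (- t)" using apos by (simp only: mult_minus_left minus_divide_left[symmetric] mult_minus_right minus_minus) simp
    then show ?thesis using that by (simp only: rt_def unscaled_time_def) simp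
  qed
  have tb0: "tb < 0" by (simp add: unscaled_time_def)
  have rtb: "rt t < \<tau>\<^sub>1" if "t < tb" for t using rt'[of t] unscaled_time_mono[OF apos, of "rt t" \<tau>\<^sub>1] that tb0 by simp
  have t: "unscaled_time \<alpha> \<tau> < tb" using assms unscaled_time_mono[OF apos] by blast
  let ?D = "- ((scaling \<alpha> \<tau> / V \<tau> \<theta>) powr \<alpha>)"
  have co: "continuous_on (UNIV \<times> {..<tb}) (\<lambda>(s, t). e \<bullet> G (s, t))" if "continuous_on {p. snd p < tb} G" for G :: "real \<times> real \<Rightarrow> complex"
  proof -
    have "UNIV \<times> {..<tb} = {p::real \<times> real. snd p < tb}" by auto
    moreover have "(\<lambda>(s, t). e \<bullet> G (s, t)) = (\<lambda>p. e \<bullet> G p)" by auto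
    ultimately show ?thesis using that by (simp only:) (intro continuous_intros)
  qed
  have "(m has_real_derivative ?D) (at (unscaled_time \<alpha> \<tau>))"
  proof (rule deriv_max[where F = "\<lambda>s t. e \<bullet> X s t" and Ft = "\<lambda>s t. e \<bullet> Ft (s, t)" and b = tb])
    fix s u assume u: "u < tb"
    interpret N: near_circle "a (rt u)" "b (rt u)" by (rule nc[OF rtb[OF u]])
    have k: "scaling \<alpha> (rt u) > 0" using scaling_pos[OF apos] .
    have ru: "range N.Y = range (\<lambda>s. scaling \<alpha> (rt u) *\<^sub>R X s u)" using rng[OF rtb[OF u]] rt'[of u] u tb0 by simp
    obtain r where "scaling \<alpha> (rt u) *\<^sub>R X s u = N.Y r" using ru by (metis rangeE rangeI)
    then have "scaling \<alpha> (rt u) * (e \<bullet> X s u) \<le> N.h \<theta>" using N.max_point(1)[of \<theta> r] unfolding e_def by (metis inner_scaleR_right)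
    then show "e \<bullet> X s u \<le> m u" unfolding m_def using k by (simp add: field_simps)
    have "N.Z \<theta> \<in> range (\<lambda>s. scaling \<alpha> (rt u) *\<^sub>R X s u)" unfolding ru[symmetric] N.Z_def by simp
    then obtain q where q: "N.Z \<theta> = scaling \<alpha> (rt u) *\<^sub>R X q u" by blast
    have "periodic_2pi (\<lambda>s. X s u)" using emb[OF u] by (simp add: closed_convex_embedding_def)
    then obtain y where y: "y \<in> {0..<2 * pi}" "X y u = X q u" using periodic_reduce[of "\<lambda>s. X s u" q] by metis
    have "e \<bullet> X y u = m u" using N.h_inner[of \<theta>] k unfolding q y(2) m_def e_def by simp
    then show "\<exists>s\<in>{0..2 * pi}. e \<bullet> X s u = m u" using y(1) by (intro bexI[of _ y]) auto
    show "((\<lambda>t. e \<bullet> X s t) has_real_derivative e \<bullet> Ft (s, u)) (at u)"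
      unfolding has_real_derivative_iff_has_vector_derivative
      by (rule bounded_linear.has_vector_derivative[OF bounded_linear_inner_right X_derivs(3)[OF u]])
  next
    show "continuous_on (UNIV \<times> {..<tb}) (\<lambda>(s, t). e \<bullet> X s t)" using co[OF diffs(3)] by (simp add: F_def)
    show "continuous_on (UNIV \<times> {..<tb}) (\<lambda>(s, t). e \<bullet> Ft (s, t))" by (rule co[OF diffs(4)])
    show "unscaled_time \<alpha> \<tau> < tb" by (rule t)
    fix s assume "e \<bullet> X s (unscaled_time \<alpha> \<tau>) = m (unscaled_time \<alpha> \<tau>)"
    then show "e \<bullet> Ft (s, unscaled_time \<alpha> \<tau>) = ?D"
      unfolding m_def rt e_def by (rule speed_at_max[OF assms])
  qed
  moreover have "(unscaled_time \<alpha> has_real_derivative (1 + \<alpha>) * exp (- (1 + \<alpha>) * \<tau>)) (at \<tau>)"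
    unfolding unscaled_time_def[abs_def] by (auto intro!: derivative_eq_intros simp: algebra_simps)
  ultimately have "((\<lambda>\<tau>. m (unscaled_time \<alpha> \<tau>)) has_real_derivative ?D * ((1 + \<alpha>) * exp (- (1 + \<alpha>) * \<tau>))) (at \<tau>)"
    by (rule DERIV_chain2)
  moreover have "(scaling \<alpha> has_real_derivative scaling \<alpha> \<tau>) (at \<tau>)"
    unfolding scaling_eq[OF apos, abs_def] by (auto intro!: derivative_eq_intros)
  ultimately have "((\<lambda>\<tau>. scaling \<alpha> \<tau> * m (unscaled_time \<alpha> \<tau>)) has_real_derivative
      scaling \<alpha> \<tau> * m (unscaled_time \<alpha> \<tau>) + ?D * ((1 + \<alpha>) * exp (- (1 + \<alpha>) * \<tau>)) * scaling \<alpha> \<tau>) (at \<tau>)"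
    by (rule DERIV_mult[rotated])
  moreover have km: "scaling \<alpha> \<tau> * m (unscaled_time \<alpha> \<tau>) = H \<tau> \<theta>" for \<tau>
    using scaling_pos[OF apos, of \<tau>] by (simp add: m_def rt)
  moreover have "?D * ((1 + \<alpha>) * exp (- (1 + \<alpha>) * \<tau>)) * scaling \<alpha> \<tau> = - (V \<tau> \<theta> powr - \<alpha>)"
  proof -
    have e: "(scaling \<alpha> \<tau> / V \<tau> \<theta>) powr \<alpha> = scaling \<alpha> \<tau> powr \<alpha> * V \<tau> \<theta> powr - \<alpha>"
      using near_circle.W_pos[OF nc[OF assms], of \<theta>] scaling_pos[OF apos, of \<tau>]
      by (simp add: powr_divide powr_minus_divide)
    have g: "- (p * w) * q * k = - w" if "k * p * q = 1" for p w q k :: real using that by algebra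
    show ?thesis unfolding e by (rule g[OF scaling_powr[OF apos]])
  qed
  ultimately show ?thesis by simp
qed

end

lemma eventually_before:
  assumes "\<alpha> > 0" "T \<noteq> -\<infinity>"
  obtains \<tau>\<^sub>2 where "\<And>\<tau>. \<tau> \<le> \<tau>\<^sub>2 \<Longrightarrow> ereal (unscaled_time \<alpha> \<tau>) < T"
proof (cases T)
  case (real r)
  have lt: "unscaled_time \<alpha> \<tau> < r" if "\<tau> \<le> - (\<bar>r\<bar> + 1) / (1 + \<alpha>)" for \<tau>
  proof -
    have "(1 + \<alpha>) * \<tau> \<le> - (\<bar>r\<bar> + 1)" using that assms(1) by (simp add: pos_le_divide_eq mult.commute)
    then have "\<bar>r\<bar> + 1 < exp (- (1 + \<alpha>) * \<tau>)"
      using exp_ge_add_one_self[of "- (1 + \<alpha>) * \<tau>"] by (simp only: mult_minus_left)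
    then show ?thesis unfolding unscaled_time_def by linarith
  qed
  show ?thesis by (rule that[of "- (\<bar>r\<bar> + 1) / (1 + \<alpha>)"]) (use lt real in simp)
qed (use assms that in auto)

theorem theorem4p1:
  fixes \<alpha> :: real and T :: ereal and \<Gamma> :: "real \<Rightarrow> complex set" and v :: "real \<Rightarrow> real \<Rightarrow> real"
  assumes "\<alpha> > 0" and "\<alpha> \<noteq> 1 / 3"
    and "closed_ancient_alpha_csf \<alpha> T \<Gamma>"
    and "converges_smoothly_to_unit_circle (rescaled_flow \<alpha> \<Gamma>)"
    and "\<And>\<tau> \<theta>. ereal (unscaled_time \<alpha> \<tau>) < T \<Longrightarrow>
           support_function (rescaled_flow \<alpha> \<Gamma> \<tau>) \<theta> = 1 + v \<tau> \<theta>"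
  shows "\<exists>C>0. \<exists>\<tau>\<^sub>0 < -1. \<forall>\<tau>\<le>\<tau>\<^sub>0.
           L2_norm (P_minus \<alpha> (v \<tau>)) + L2_norm (P_star \<alpha> (v \<tau>))
             \<le> C * Ck_norm 4 (v \<tau>) * L2_norm (P_plus \<alpha> (v \<tau>)) \<and>
           Ck_norm 4 (v \<tau>) \<le> C * exp (- lambda_I \<alpha> * \<tau>)"
proof -
  obtain X where T: "T \<noteq> -\<infinity>" and X: "smooth_on {p. ereal (snd p) < T} (\<lambda>p. X (fst p) (snd p))"
    "\<And>t. ereal t < T \<Longrightarrow> closed_convex_embedding (\<lambda>s. X s t) \<and> \<Gamma> t = range (\<lambda>s. X s t)"
    "\<And>t s. ereal t < T \<Longrightarrow> \<exists>N. inward_unit_normal (\<lambda>s. X s t) s N \<and>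
       ((\<lambda>t'. X s t') has_vector_derivative (curvature_wrt (\<lambda>s. X s t) s N powr \<alpha>) *\<^sub>R N) (at t)"
    using assms(3) unfolding closed_ancient_alpha_csf_def by blast
  obtain \<tau>\<^sub>2 where t2: "\<And>\<tau>. \<tau> \<le> \<tau>\<^sub>2 \<Longrightarrow> ereal (unscaled_time \<alpha> \<tau>) < T" using eventually_before[OF assms(1) T] by blast
  \<comment> \<open>28 derivatives of the parametrisation leave, by \<open>fam_near_circle\<close>,
    the 26 of \<open>pde\<close>.\<close>
  obtain a b d \<tau>\<^sub>3 where ab: "\<And>\<tau>. \<tau> \<le> \<tau>\<^sub>3 \<Longrightarrow> near_circle (a \<tau>) (b \<tau>)"
    "\<And>\<tau>. \<tau> \<le> \<tau>\<^sub>3 \<Longrightarrow> range (near_circle.Y (a \<tau>) (b \<tau>)) = rescaled_flow \<alpha> \<Gamma> \<tau>"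
    "fam 28 {..\<tau>\<^sub>3} a" "fam 28 {..\<tau>\<^sub>3} b"
    "\<And>\<tau> s. \<tau> \<le> \<tau>\<^sub>3 \<Longrightarrow> \<bar>a \<tau> s\<bar> \<le> d \<tau>" "\<And>\<tau> s. \<tau> \<le> \<tau>\<^sub>3 \<Longrightarrow> \<bar>b \<tau> s\<bar> \<le> d \<tau>" "(d \<longlongrightarrow> 0) at_bot"
    using converging_parametrisation[OF assms(4), of 28] by metis
  define \<tau>\<^sub>1 where "\<tau>\<^sub>1 = min \<tau>\<^sub>2 \<tau>\<^sub>3"
  have t1: "\<tau> \<le> \<tau>\<^sub>2" "\<tau> \<le> \<tau>\<^sub>3" if "\<tau> \<le> \<tau>\<^sub>1" for \<tau> using that by (auto simp: \<tau>\<^sub>1_def)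
  have tT: "ereal t < T" if "t < unscaled_time \<alpha> \<tau>\<^sub>1" for t
    using less_trans[of "ereal t" "ereal (unscaled_time \<alpha> \<tau>\<^sub>1)" T] t2[OF t1(1)[OF order_refl]] that by simp
  have resc: "rescaled_flow \<alpha> \<Gamma> \<tau> = range (\<lambda>s. scaling \<alpha> \<tau> *\<^sub>R X s (unscaled_time \<alpha> \<tau>))" if "\<tau> \<le> \<tau>\<^sub>1" for \<tau>
    using X(2)[OF t2[OF t1(1)[OF that]]] by (simp add: rescaled_flow_def scaling_def image_image Let_def)
  interpret flow_near_circle \<alpha> \<tau>\<^sub>1 X a b
  proof (rule flow_near_circle.intro)
    show "Ck_on 2 {p. snd p < unscaled_time \<alpha> \<tau>\<^sub>1} (\<lambda>p. X (fst p) (snd p))"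
      using X(1) tT unfolding smooth_on_def by (blast intro: Ck_on_subset)
    show "range (near_circle.Y (a \<tau>) (b \<tau>)) = range (\<lambda>s. scaling \<alpha> \<tau> *\<^sub>R X s (unscaled_time \<alpha> \<tau>))" if "\<tau> < \<tau>\<^sub>1" for \<tau>
      using ab(2)[of \<tau>] t1[of \<tau>] resc[of \<tau>] that by simp
  qed (use assms(1) X tT ab(1) t1 in auto)
  \<comment> \<open>\<open>f\<close> agrees with \<open>v\<close> before
    \<open>\<tau>\<^sub>1\<close>, which suffices for a statement about early times, and its
    regularity is inherited from the parametrisation.\<close>
  define f where "f \<tau> \<theta> = H \<tau> \<theta> - 1" for \<tau> \<theta>
  have vf: "v \<tau> = f \<tau>" if "\<tau> < \<tau>\<^sub>1" for \<tau>
  proof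
    fix \<theta>
    have "1 + v \<tau> \<theta> = H \<tau> \<theta>"
      using assms(5)[OF t2[OF t1(1)], of \<tau> \<theta>] support_H[OF that, of \<theta>] resc[of \<tau>] that by simp
    then show "v \<tau> \<theta> = f \<tau> \<theta>" by (simp add: f_def)
  qed
  have famH: "fam 26 {..\<tau>\<^sub>3} H"
    by (rule fam_near_circle) (use ab(1,3,4) in auto)
  then have famf: "fam 26 {..\<tau>\<^sub>3} f" unfolding f_def[abs_def] by (intro fam_diff fam_const')
  have per: "periodic_2pi (f \<tau>)" if "\<tau> \<le> \<tau>\<^sub>3" for \<tau>
    using near_circle.h_periodic[OF ab(1)[OF that]] by (simp add: periodic_2pi_def f_def)
  have CP: "CP 26 (f \<tau>)" if "\<tau> \<le> \<tau>\<^sub>3" for \<tau> by (rule fam_CP[OF famf _ per[OF that]]) (use that in auto)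
  \<comment> \<open>As h + h'' is the radius of curvature, the quantity w of \<open>pde\<close> is V
    - 1.\<close>
  have f2: "f \<tau> \<theta> + nth_deriv 2 (f \<tau>) \<theta> = V \<tau> \<theta> - 1" if t: "\<tau> \<le> \<tau>\<^sub>3" for \<tau> \<theta>
  proof -
    have "CP 26 (H \<tau>)" by (rule fam_CP[OF famH _ near_circle.h_periodic[OF ab(1)[OF t]]]) (use t in auto)
    from nth_deriv_diff[OF this CP_const, of 2 1] have "nth_deriv 2 (f \<tau>) \<theta> = nth_deriv 2 (H \<tau>) \<theta> - nth_deriv 2 (\<lambda>x. 1) \<theta>"
      by (simp add: f_def[abs_def])
    moreover have "nth_deriv 2 (\<lambda>x. 1 :: real) \<theta> = 0"
      using nth_deriv_cmult[OF CP_const, of 2 2 0 1] nth_deriv_eqI[OF DERIV_const, of 1 1] nth_deriv_eqI[OF DERIV_const, of 0 0] by (simp add: numeral_2_eq_2)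
    ultimately show ?thesis using near_circle.h_nth(2)[OF ab(1)[OF t]] by (simp add: f_def)
  qed
  have n0: "0 \<le> nrm (f \<tau>)" "nrm (f \<tau>) \<le> 6 * d \<tau>" if t: "\<tau> \<le> \<tau>\<^sub>3" for \<tau>
  proof -
    have "\<bar>f \<tau> \<theta>\<bar> \<le> 2 * d \<tau>" for \<theta> unfolding f_def by (rule near_circle.h_near[OF ab(1)[OF t] ab(5,6)[OF t]])
    from nrm_bound[OF CP_cont[OF CP[OF t]] this] show "nrm (f \<tau>) \<le> 6 * d \<tau>" by simp
    show "0 \<le> nrm (f \<tau>)" by (rule nrm_nonneg[OF CP_cont[OF CP[OF t]]])
  qed
  have lim: "((\<lambda>\<tau>. nrm (f \<tau>)) \<longlongrightarrow> 0) at_bot"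
  proof (rule tendsto_sandwich)
    show "\<forall>\<^sub>F \<tau> in at_bot. 0 \<le> nrm (f \<tau>)" "\<forall>\<^sub>F \<tau> in at_bot. nrm (f \<tau>) \<le> 6 * d \<tau>"
      using n0 by (auto simp: eventually_at_bot_linorder)
    show "((\<lambda>\<tau>. 6 * d \<tau>) \<longlongrightarrow> 0) at_bot" using tendsto_mult_left[OF ab(7), of 6] by simp
  qed simp
  obtain B where B: "B > 0" "\<And>\<tau> j x. \<tau> \<in> {..\<tau>\<^sub>3} \<Longrightarrow> j \<le> 26 \<Longrightarrow> \<bar>nth_deriv j (f \<tau>) x\<bar> \<le> B" using fam_nth_bound[OF famf] by metis
  obtain C where C: "C > 0" "\<And>f j x. CP 12 f \<Longrightarrow> (\<And>j x. j \<le> 12 \<Longrightarrow> \<bar>nth_deriv j f x\<bar> \<le> B) \<Longrightarrow> j \<le> 2 \<Longrightarrow>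
       \<bar>nth_deriv j f x\<bar> \<le> C * nrm f powr (3 / 4)" using sup_interp[OF B(1)] by metis
  \<comment> \<open>Interpolation makes f and f'' smaller than 1 / 4 each at early times, hence
    their sum at most 1 / 2, as \<open>pde\<close> demands.\<close>
  have small: "\<bar>nth_deriv j (f \<tau>) x\<bar> \<le> C * nrm (f \<tau>) powr (3 / 4)" if "\<tau> \<le> \<tau>\<^sub>3" "j \<le> 2" for \<tau> j x
    by (rule C(2)[OF CP_mono[OF CP[OF that(1)]] B(2) that(2)]) (use that in auto)
  have "((\<lambda>\<tau>. C * nrm (f \<tau>) powr (3 / 4)) \<longlongrightarrow> C * 0 powr (3 / 4)) at_bot"
    by (intro tendsto_mult tendsto_const tendsto_powr' lim) (use n0(1) in \<open>auto simp: eventually_at_bot_linorder\<close>)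
  then have "((\<lambda>\<tau>. C * nrm (f \<tau>) powr (3 / 4)) \<longlongrightarrow> 0) at_bot" by simp
  from order_tendstoD(2)[OF this, of "1 / 4"] obtain \<tau>\<^sub>4 where t4: "\<And>\<tau>. \<tau> \<le> \<tau>\<^sub>4 \<Longrightarrow> C * nrm (f \<tau>) powr (3 / 4) < 1 / 4"
    by (auto simp: eventually_at_bot_linorder)
  define \<tau>\<^sub>0 where "\<tau>\<^sub>0 = min (\<tau>\<^sub>1 - 1) \<tau>\<^sub>4"
  have t0: "\<tau> < \<tau>\<^sub>1" "\<tau> \<le> \<tau>\<^sub>3" "\<tau> \<le> \<tau>\<^sub>4" if "\<tau> \<le> \<tau>\<^sub>0" for \<tau> using that by (auto simp: \<tau>\<^sub>0_def \<tau>\<^sub>1_def)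
  interpret P: pde \<alpha> f \<tau>\<^sub>0
  proof
    show "fam 26 {..\<tau>\<^sub>0} f" by (rule fam_subset[OF famf]) (use t0(2) in auto)
    fix \<tau> x
    {
      assume t: "\<tau> \<le> \<tau>\<^sub>0"
      show "periodic_2pi (f \<tau>)" by (rule per[OF t0(2)[OF t]])
      have "\<bar>f \<tau> x\<bar> \<le> 1 / 4" "\<bar>nth_deriv 2 (f \<tau>) x\<bar> \<le> 1 / 4"
        using small[OF t0(2)[OF t], of 0 x] small[OF t0(2)[OF t], of 2 x] t4[OF t0(3)[OF t]] by simp_all
      then show "\<bar>f \<tau> x + nth_deriv 2 (f \<tau>) x\<bar> \<le> 1 / 2" by linarith
    }
    assume t: "\<tau> < \<tau>\<^sub>0"
    have "((\<lambda>s. H s x - 1) has_real_derivative H \<tau> x - V \<tau> x powr - \<alpha> - 0) (at \<tau>)"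
      by (rule DERIV_diff[OF H_evolution DERIV_const]) (use t0(1) t in auto)
    then show "((\<lambda>s. f s x) has_real_derivative 1 + f \<tau> x - (1 + (f \<tau> x + nth_deriv 2 (f \<tau>) x)) powr - \<alpha>) (at \<tau>)"
      using f2[OF t0(2)] t by (simp add: f_def)
  qed (use assms(1) lim in auto)
  obtain K t where K: "K > 0" "t < -1" "\<And>\<tau>. \<tau> \<le> t \<Longrightarrow>
           L2_norm (P_minus \<alpha> (f \<tau>)) + L2_norm (P_star \<alpha> (f \<tau>)) \<le> K * Ck_norm 4 (f \<tau>) * L2_norm (P_plus \<alpha> (f \<tau>)) \<and>
           Ck_norm 4 (f \<tau>) \<le> K * exp (- lambda_I \<alpha> * \<tau>)"
    using P.projections_and_decay[OF assms(2)] by blast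
  show ?thesis
  proof (intro exI conjI)
    show "0 < K" "min t \<tau>\<^sub>0 < -1" using K by auto
    show "\<forall>\<tau>\<le>min t \<tau>\<^sub>0. L2_norm (P_minus \<alpha> (v \<tau>)) + L2_norm (P_star \<alpha> (v \<tau>))
             \<le> K * Ck_norm 4 (v \<tau>) * L2_norm (P_plus \<alpha> (v \<tau>)) \<and> Ck_norm 4 (v \<tau>) \<le> K * exp (- lambda_I \<alpha> * \<tau>)"
      using K(3) vf t0(1) by simp
  qed
qed

end
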